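(* Let $(\mathbb{K},\partial)$ be a differential field with subfield of constants $\Bbbk$, and let $U=\mathbb{K}[Y;\partial]$. The $\Bbbk$-algebra $\mathcal{D}lin_{\mathbb{K}}$ of differentially recursive sequences (with the Hurwitz product) enjoys a structure of commutative Hopf algebroid with base $\Bbbk$-algebra $\mathbb{K}$. The structure maps are explicitly given by the source $s:\mathbb{K}\to\mathcal{D}lin_{\mathbb{K}}$, $x\mapsto(x,0,0,\ldots)$, the target $t:\mathbb{K}\to\mathcal{D}lin_{\mathbb{K}}$, $x\mapsto(\partial^n(x))_{n\ge0}$, the counit $\varepsilon:\mathcal{D}lin_{\mathbb{K}}\to\mathbb{K}$, $\alpha\mapsto\alpha(0)$, the comultiplication $$\Delta:\mathcal{D}lin_{\mathbb{K}}\to\mathcal{D}lin_{\mathbb{K}}\otimes_{\mathbb{K}}\mathcal{D}lin_{\mathbb{K}},\qquad \alpha\mapsto\sum_{i=0}^{d-1}\mathcal{N}^i(\alpha)\otimes_{\mathbb{K}}\big(y_i^*(y_n)\big)_{n\ge0},$$ where $d$ is the order of $\alpha$, $P_\alpha(Y)$ is the monic generator of the right ideal $\{Q\in U\mid \alpha\triangleleft Q=0\}$, $y_n:=Y^n+P_\alpha(Y)U$ for $n\geq 0$, and $\{y_i,y_i^*\}_{0\le i\le d-1}$ is the dual basis of the right $\mathbb{K}$-vector space $M_\alpha=U/P_\alpha(Y)U$; and the antipode $$\mathscr{S}:\mathcal{D}lin_{\mathbb{K}}\to\mathcal{D}lin_{\mathbb{K}},\qquad \alpha\mapsto\Big(\sum_{k=0}^n\binom{n}{k}(-1)^{n-k}\partial^k\big(\alpha(n-k)\big)\Big)_{n\ge0}.$$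 With this structure there is a chain of isomorphisms of commutative Hopf algebroids $$U^{\circ}\;\cong\;\mathcal{D}lin_{\mathbb{K}}\;\cong\;U^{\bullet}.$$ Furthermore, for a non-zero operator $\mathcal{L}=\sum_{i=0}^d t(c_i)\mathcal{N}^i$ let $M_{\mathcal{L}}^*=(U/P_{\mathcal{L}}(Y)U)^*$ be the space of formal solutions of $\mathcal{L}(y)=0$, where $P_{\mathcal L}(Y)=\sum_{i=0}^dY^ic_i$. Then the family $\{M_{\mathcal{L}}^*\}_{\mathcal{L}}$ forms a directed system of left $\mathcal{D}lin_{\mathbb{K}}$-comodules such that there is an isomorphism of left $\mathcal{D}lin_{\mathbb{K}}$-comodules $$\varinjlim_{\mathcal{L}}M_{\mathcal{L}}^*\;\cong\;\mathcal{D}lin_{\mathbb{K}}.$$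
   Context: A differential field $(\mathbb{K},\partial)$ is a field with an additive map $\partial$ satisfying the Leibniz rule; $\Bbbk=\{c\in\mathbb{K}\mid\partial(c)=0\}$. Unadorned $\otimes$ is over $\Bbbk$. Sequences. $\mathcal{H}(\mathbb{K})=\mathbb{K}^{\mathbb{N}}$ with componentwise sum and Hurwitz product $(\alpha\beta)(n)=\sum_{k=0}^n\binom nk\alpha(k)\beta(n-k)$; $\mathcal{N}(\alpha)(n)=\alpha(n+1)$. It is a commutative $(\mathbb{K}\otimes\mathbb{K})$-algebra via $x\otimes y\mapsto s(x)t(y)$, where $s(x)=(x,0,0,\ldots)$ and $t(x)=(\partial^n(x))_{n\ge0}$; left $\mathbb{K}$-action via $s$, right $\mathbb{K}$-action via $t$ (so in $-\otimes_{\mathbb{K}}-$ the left factor is a $\mathbb{K}$-space via $t$ and the right factor via $s$). $\mathcal{D}lin_{\mathbb{K}}$ is the set of $\alpha\in\mathcal{H}(\mathbb{K})$ for which there are $d\ge0$ and $c_0,\ldots,c_d\in\mathbb{K}$ with $c_d\ne0$ and $\sum_{i=0}^dt(c_i)\mathcal{N}^i(\alpha)=0$; the order of $\alpha$ is the minimal such $d$. Differential operators. $U=\mathbb{K}[Y;\partial]$ is the $\Bbbk$-algebra generated by $\mathbb{K}$ and $Y$ with $xY=Yx+\partial(x)$, $x\in\mathbb{K}$; as a right $\mathbb{K}$-space it has basis $\{Y^i\}_{i\ge0}$. Let $\tau:\mathbb{K}\to U$ be the inclusion. $\mathcal{H}(\mathbb{K})$ is a right $U$-module via $\alpha\triangleleft\sum_iY^ic_i=\sum_it(c_i)\mathcal{N}^i(\alpha)$.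 $(-)^*$ denotes right $\mathbb{K}$-linear maps to $\mathbb{K}$, with left action $(xf)(m)=xf(m)$. $U^*$ is a commutative ring under the convolution product $(f*g)(Y^n)=\sum_{k=0}^n\binom nkf(Y^k)g(Y^{n-k})$, and a $(\mathbb{K}\otimes\mathbb{K})$-algebra via $x\otimes y\mapsto (x\varepsilon_U)*\mu(y)$, where $\varepsilon_U(Y^n)=\delta_{0,n}$ and $\mu(y)(Y^n)=\partial^n(y)$. Commutative Hopf algebroid over $\mathbb{K}$ (equivalently, an affine groupoid $\Bbbk$-scheme): a commutative $\Bbbk$-algebra $H$ with $\Bbbk$-algebra maps $s,t:\mathbb{K}\to H$, $\varepsilon:H\to\mathbb{K}$, $\Delta:H\to H\otimes_{\mathbb{K}}H$ ($t$ on the left factor, $s$ on the right factor), $S:H\to H$ such that $(H,\Delta,\varepsilon)$ is a $\mathbb{K}$-coring (coassociative and counital coalgebra in $\mathbb{K}$-bimodules), $\varepsilon s=\varepsilon t=\mathrm{id}$, $\Delta s=s\otimes1$, $\Delta t=1\otimes t$, $Ss=t$, $St=s$, $\sum h_{(1)}S(h_{(2)})=s\varepsilon(h)$, $\sum S(h_{(1)})h_{(2)}=t\varepsilon(h)$. The finite dual $U^\circ$. A finite-dimensional differential $\mathbb{K}$-vector space is a finite-dimensional right $\mathbb{K}$-space $M$ with a $\Bbbk$-linear $\partial_M$ satisfying $\partial_M(mx)=\partial_M(m)x+m\partial(x)$ (equivalently a right $U$-module, $m\triangleleft Y=\partial_M(m)$). $T_{MN}$ is the space of $\mathbb{K}$-linear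 maps $M\to N$ commuting with the differentials and $T_M=T_{MM}$. $M\otimes_{\mathbb{K}}N$ has differential $\partial_M\otimes N+M\otimes\partial_N$, and $M^*$ has differential $f\mapsto[m\mapsto\partial(f(m))-f(\partial_M(m))]$. Then $$U^\circ=\Big(\bigoplus_{(M,\partial_M)}M^*\otimes_{T_M}M\Big)\Big/\langle\psi\otimes_{T_N}fx-\psi f\otimes_{T_M}x\mid\psi\in N^*,x\in M,f\in T_{MN}\rangle,$$ the class of $\varphi\otimes m$ being denoted $\overline{\varphi\otimes_{T_M}m}$. It is a commutative Hopf algebroid over $\mathbb{K}$ with product $\overline{\varphi\otimes p}\cdot\overline{\psi\otimes q}=\overline{(\psi\diamond\varphi)\otimes(q\otimes_{\mathbb{K}}p)}$, $(\psi\diamond\varphi)(q\otimes p)=\varphi(\psi(q)p)$, source $k\mapsto\overline{k\otimes1}$, target $k\mapsto\overline{1\otimes k}$ (both in the component of $M=\mathbb{K}$), comultiplication $\overline{\varphi\otimes m}\mapsto\sum_i\overline{\varphi\otimes e_i}\otimes_{\mathbb{K}}\overline{e_i^*\otimes m}$ ($\{e_i,e_i^*\}$ a dual basis of $M$), counit $\overline{\varphi\otimes m}\mapsto\varphi(m)$, antipode $\overline{\varphi\otimes m}\mapsto\overline{\mathsf{ev}_m\otimes\varphi}$, where $\mathsf{ev}_m\in(M^* )^*$ is evaluation at $m$. The dual $U^\bullet$. $(U^\bullet,\xi)$ is a $\mathbb{K}$-coring $U^\bullet$ with a $\Bbbk$-linear map $\xi:U^\bullet\to U^*$ satisfying, for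 all $z\in U^\bullet$, $u,v\in U$, $x,y\in\mathbb{K}$: $\xi(z)(uv)=\sum\xi(z_{(1)})\big(\tau(\xi(z_{(2)})(u))v\big)$, $\xi(z)(1_U)=\varepsilon(z)$, $\xi(x\cdot z\cdot y)(u)=x\,\xi(z)(\tau(y)u)$; and universal: for every $\mathbb{K}$-coring $C$ with a $\Bbbk$-linear $f:C\to U^*$ satisfying the same three identities there is a unique coring morphism $\widehat f:C\to U^\bullet$ with $\xi\widehat f=f$. It carries the commutative Hopf algebroid structure over $\mathbb{K}$ extending its coring structure, for which $\xi$ is a morphism of $(\mathbb{K}\otimes\mathbb{K})$-algebras (its product and unit being those induced by the universal property). Comodules. For $\mathcal{L}$ non-zero, put $M_{\mathcal{L}}=U/P_{\mathcal{L}}(Y)U$, $y_n=Y^n+P_{\mathcal{L}}(Y)U$, with dual basis $\{y_i,y_i^*\}_{0\le i\le\deg P_{\mathcal L}-1}$. $M_{\mathcal{L}}^*$ is a left $\mathcal{D}lin_{\mathbb{K}}$-comodule via $f\mapsto\sum_{i}\big(f(y_{n+i})\big)_{n\ge0}\otimes_{\mathbb{K}}y_i^*$. The directed system has transition maps $M_{\mathcal{L}}^*\to M_{\mathcal{L}'}^*$, for $P_{\mathcal{L}'}\in P_{\mathcal{L}}U$, dual to the canonical projections $U/P_{\mathcal{L}'}U\to U/P_{\mathcal{L}}U$. $\mathcal{D}lin_{\mathbb{K}}$ is a left comodule over itself via $\Delta$. *)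

theory Defs
  imports
    "HOL-Algebra.Algebraic_Closure_Type"
    "HOL-Algebra.Free_Abelian_Groups"
    "HOL-Algebra.Module"
    "HOL-Computational_Algebra.Polynomial"
begin

hide_const (open) UnivPoly.coeff UnivPoly.monom Polynomial.smult
no_notation var (\<open>X\<index>\<close>)

section \<open>Differential fields\<close>

class differential_field = field +
  fixes derivation :: "'a \<Rightarrow> 'a" (\<open>\<partial>\<close>)
  assumes derivation_add: "\<partial> (x + y) = \<partial> x + \<partial> y"
    and derivation_mult: "\<partial> (x * y) = \<partial> x * y + x * \<partial> y"

definition constants :: "'k::differential_field set" where
  "constants = {c. \<partial> c = 0}"

abbreviation base_ring :: "'k::differential_field ring" (\<open>\<bbbK>\<close>) where
  "\<bbbK> \<equiv> ring_of_type_algebra"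

section \<open>Abelian groups given by generators and relations\<close>

definition relation_subgroup :: "'g set \<Rightarrow> ('g \<Rightarrow>\<^sub>0 int) set \<Rightarrow> ('g \<Rightarrow>\<^sub>0 int) set" where
  "relation_subgroup S R = generate (free_Abelian_group S) R"

definition presented_group :: "'g set \<Rightarrow> ('g \<Rightarrow>\<^sub>0 int) set \<Rightarrow> ('g \<Rightarrow>\<^sub>0 int) set monoid" where
  "presented_group S R = free_Abelian_group S Mod relation_subgroup S R"

definition presented_class ::
    "'g set \<Rightarrow> ('g \<Rightarrow>\<^sub>0 int) set \<Rightarrow> ('g \<Rightarrow>\<^sub>0 int) \<Rightarrow> ('g \<Rightarrow>\<^sub>0 int) set" where
  "presented_class S R u = relation_subgroup S R #>\<^bsub>free_Abelian_group S\<^esub> u"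

text \<open>
  Maps out of a quotient are given by a formula on representatives; \<open>rep\<close> picks one.
\<close>

definition rep :: "'a set \<Rightarrow> 'a" where
  "rep X = (SOME u. u \<in> X)"

text \<open>
  The additive map into an abelian group \<open>A\<close> (the additive group of a ring record) determined by
  its values \<open>g\<close> on generators.
\<close>

definition additive_extension ::
    "('a, 'r) ring_scheme \<Rightarrow> ('g \<Rightarrow> 'a) \<Rightarrow> ('g \<Rightarrow>\<^sub>0 int) set \<Rightarrow> 'a" where
  "additive_extension A g X =
     (\<Oplus>\<^bsub>A\<^esub>p\<in>Poly_Mapping.keys (rep X). [Poly_Mapping.lookup (rep X) p] \<cdot>\<^bsub>A\<^esub> g p)"

section \<open>Bimodules, linear maps, duals and tensor products\<close>

text \<open>
  Since the base field is commutative, right vector spaces are represented by the library's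
  \<open>module\<close> records, with \<open>x \<odot> m\<close> standing for \<open>m x\<close>.  The multiplicative fields of a record that
  only serves as a module are irrelevant.
\<close>

record ('k, 'a) bimodule = "('k, 'a) module" +
  rsmult :: "'a \<Rightarrow> 'k \<Rightarrow> 'a"

definition is_bimodule :: "('k::differential_field, 'a, 'z) bimodule_scheme \<Rightarrow> bool" where
  "is_bimodule M \<longleftrightarrow>
     module \<bbbK> M \<and> module \<bbbK> (M\<lparr>smult := \<lambda>x m. rsmult M m x\<rparr>) \<and>
     (\<forall>x y. \<forall>m\<in>carrier M. rsmult M (x \<odot>\<^bsub>M\<^esub> m) y = x \<odot>\<^bsub>M\<^esub> rsmult M m y) \<and>
     (\<forall>c\<in>constants. \<forall>m\<in>carrier M. c \<odot>\<^bsub>M\<^esub> m = rsmult M m c)"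

definition linear_maps ::
    "('k, 'a, 'z) module_scheme \<Rightarrow> ('k, 'b, 'w) module_scheme \<Rightarrow> ('a \<Rightarrow> 'b) set" where
  "linear_maps M N = {f \<in> hom (add_monoid M) (add_monoid N).
     \<forall>x. \<forall>m\<in>carrier M. f (x \<odot>\<^bsub>M\<^esub> m) = x \<odot>\<^bsub>N\<^esub> f m}"

definition base_module :: "('k::differential_field, 'k) module" where
  "base_module = \<lparr>carrier = UNIV, monoid.mult = (*), one = 1, ring.zero = 0, add = (+),
     smult = (*)\<rparr>"

text \<open>Linear forms are made extensional so that they are determined by their values on \<open>M\<close>.\<close>

definition dual :: "('k::differential_field, 'a, 'z) module_scheme \<Rightarrow> ('k, 'a \<Rightarrow> 'k) module" where
  "dual M = \<lparr>carrier = linear_maps M base_module \<inter> extensional (carrier M),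
     monoid.mult = undefined, one = undefined,
     ring.zero = (\<lambda>m\<in>carrier M. 0),
     add = (\<lambda>f g. \<lambda>m\<in>carrier M. f m + g m),
     smult = (\<lambda>x f. \<lambda>m\<in>carrier M. x * f m)\<rparr>"

definition is_dual_basis ::
    "('k::differential_field, 'a, 'z) module_scheme \<Rightarrow> nat \<Rightarrow> (nat \<Rightarrow> 'a) \<Rightarrow> (nat \<Rightarrow> 'a \<Rightarrow> 'k) \<Rightarrow> bool"
  where
  "is_dual_basis M d e e' \<longleftrightarrow>
     (\<forall>i<d. e i \<in> carrier M \<and> e' i \<in> carrier (dual M)) \<and>
     (\<forall>i<d. \<forall>j<d. e' i (e j) = of_bool (i = j)) \<and>
     (\<forall>m\<in>carrier M. m = (\<Oplus>\<^bsub>M\<^esub>i\<in>{..<d}. e' i m \<odot>\<^bsub>M\<^esub> e i))"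

definition finite_dimensional :: "('k::differential_field, 'a, 'z) module_scheme \<Rightarrow> bool" where
  "finite_dimensional M \<longleftrightarrow>
     (\<exists>B. finite B \<and> B \<subseteq> carrier M \<and> (\<forall>m\<in>carrier M. \<exists>c. m = (\<Oplus>\<^bsub>M\<^esub>b\<in>B. c b \<odot>\<^bsub>M\<^esub> b)))"

definition tensor_relations ::
    "('k, 'a, 'z) bimodule_scheme \<Rightarrow> ('k, 'b, 'w) module_scheme \<Rightarrow> ('a \<times> 'b \<Rightarrow>\<^sub>0 int) set" where
  "tensor_relations M N =
     {frag_of (a \<oplus>\<^bsub>M\<^esub> a', b) - frag_of (a, b) - frag_of (a', b) | a a' b.
        a \<in> carrier M \<and> a' \<in> carrier M \<and> b \<in> carrier N} \<union>
     {frag_of (a, b \<oplus>\<^bsub>N\<^esub> b') - frag_of (a, b) - frag_of (a, b') | a b b'.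
        a \<in> carrier M \<and> b \<in> carrier N \<and> b' \<in> carrier N} \<union>
     {frag_of (rsmult M a x, b) - frag_of (a, x \<odot>\<^bsub>N\<^esub> b) | a x b.
        a \<in> carrier M \<and> b \<in> carrier N}"

definition tensor ::
    "('k, 'a, 'z) bimodule_scheme \<Rightarrow> ('k, 'b, 'w) module_scheme \<Rightarrow> ('a \<times> 'b \<Rightarrow>\<^sub>0 int) set monoid"
  where
  "tensor M N = presented_group (carrier M \<times> carrier N) (tensor_relations M N)"

definition tensor_class ::
    "('k, 'a, 'z) bimodule_scheme \<Rightarrow> ('k, 'b, 'w) module_scheme \<Rightarrow>
     ('a \<times> 'b \<Rightarrow>\<^sub>0 int) \<Rightarrow> ('a \<times> 'b \<Rightarrow>\<^sub>0 int) set" where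
  "tensor_class M N = presented_class (carrier M \<times> carrier N) (tensor_relations M N)"

definition pure_tensor ::
    "('k, 'a, 'z) bimodule_scheme \<Rightarrow> ('k, 'b, 'w) module_scheme \<Rightarrow> 'a \<Rightarrow> 'b \<Rightarrow> ('a \<times> 'b \<Rightarrow>\<^sub>0 int) set"
  where
  "pure_tensor M N a b = tensor_class M N (frag_of (a, b))"

text \<open>\<open>tensor_map M' N' f g\<close> is \<open>f \<otimes> g\<close> with values in \<open>M' \<otimes> N'\<close>.\<close>

definition tensor_map ::
    "('k, 'a, 'z) bimodule_scheme \<Rightarrow> ('k, 'b, 'w) module_scheme \<Rightarrow> ('c \<Rightarrow> 'a) \<Rightarrow> ('d \<Rightarrow> 'b) \<Rightarrow>
     ('c \<times> 'd \<Rightarrow>\<^sub>0 int) set \<Rightarrow> ('a \<times> 'b \<Rightarrow>\<^sub>0 int) set" where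
  "tensor_map M' N' f g X =
     tensor_class M' N' (frag_extend (\<lambda>(a, b). frag_of (f a, g b)) (rep X))"

text \<open>The threefold tensor product \<open>L \<otimes> M \<otimes> N\<close>, in which coassociativity is expressed.\<close>

definition tensor3_relations ::
    "('k, 'a, 'z) bimodule_scheme \<Rightarrow> ('k, 'b, 'w) bimodule_scheme \<Rightarrow> ('k, 'c, 'v) module_scheme \<Rightarrow>
     ('a \<times> 'b \<times> 'c \<Rightarrow>\<^sub>0 int) set" where
  "tensor3_relations L M N =
     {frag_of (a \<oplus>\<^bsub>L\<^esub> a', b, c) - frag_of (a, b, c) - frag_of (a', b, c) | a a' b c.
        a \<in> carrier L \<and> a' \<in> carrier L \<and> b \<in> carrier M \<and> c \<in> carrier N} \<union>
     {frag_of (a, b \<oplus>\<^bsub>M\<^esub> b', c) - frag_of (a, b, c) - frag_of (a, b', c) | a b b' c.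
        a \<in> carrier L \<and> b \<in> carrier M \<and> b' \<in> carrier M \<and> c \<in> carrier N} \<union>
     {frag_of (a, b, c \<oplus>\<^bsub>N\<^esub> c') - frag_of (a, b, c) - frag_of (a, b, c') | a b c c'.
        a \<in> carrier L \<and> b \<in> carrier M \<and> c \<in> carrier N \<and> c' \<in> carrier N} \<union>
     {frag_of (rsmult L a x, b, c) - frag_of (a, x \<odot>\<^bsub>M\<^esub> b, c) | a x b c.
        a \<in> carrier L \<and> b \<in> carrier M \<and> c \<in> carrier N} \<union>
     {frag_of (a, rsmult M b x, c) - frag_of (a, b, x \<odot>\<^bsub>N\<^esub> c) | a b x c.
        a \<in> carrier L \<and> b \<in> carrier M \<and> c \<in> carrier N}"

definition tensor3_class ::
    "('k, 'a, 'z) bimodule_scheme \<Rightarrow> ('k, 'b, 'w) bimodule_scheme \<Rightarrow> ('k, 'c, 'v) module_scheme \<Rightarrow>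
     ('a \<times> 'b \<times> 'c \<Rightarrow>\<^sub>0 int) \<Rightarrow> ('a \<times> 'b \<times> 'c \<Rightarrow>\<^sub>0 int) set" where
  "tensor3_class L M N =
     presented_class (carrier L \<times> carrier M \<times> carrier N) (tensor3_relations L M N)"

section \<open>Corings\<close>

record ('k, 'a) coring = "('k, 'a) bimodule" +
  comult :: "'a \<Rightarrow> ('a \<times> 'a \<Rightarrow>\<^sub>0 int) set"
  counit :: "'a \<Rightarrow> 'k"

text \<open>
  \<open>\<Delta> \<otimes> N\<close> and \<open>C \<otimes> \<rho>\<close> as maps from \<open>C \<otimes> N\<close> to \<open>C \<otimes> C \<otimes> N\<close>, for \<open>\<rho>\<close> from \<open>N\<close> to \<open>C \<otimes> N\<close>.
\<close>

definition comult_tensor ::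
    "('k, 'a, 'z) coring_scheme \<Rightarrow> ('k, 'b, 'w) module_scheme \<Rightarrow>
     ('a \<times> 'b \<Rightarrow>\<^sub>0 int) set \<Rightarrow> ('a \<times> 'a \<times> 'b \<Rightarrow>\<^sub>0 int) set" where
  "comult_tensor C N X = tensor3_class C C N
     (frag_extend (\<lambda>(c, n). frag_extend (\<lambda>(c', c''). frag_of (c', c'', n)) (rep (comult C c))) (rep X))"

definition tensor_coact ::
    "('k, 'a, 'z) coring_scheme \<Rightarrow> ('k, 'b, 'w) module_scheme \<Rightarrow> ('b \<Rightarrow> ('a \<times> 'b \<Rightarrow>\<^sub>0 int) set) \<Rightarrow>
     ('a \<times> 'b \<Rightarrow>\<^sub>0 int) set \<Rightarrow> ('a \<times> 'a \<times> 'b \<Rightarrow>\<^sub>0 int) set" where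
  "tensor_coact C N \<rho> X = tensor3_class C C N
     (frag_extend (\<lambda>(c, n). frag_extend (\<lambda>(c', n'). frag_of (c, c', n')) (rep (\<rho> n))) (rep X))"

definition is_coring :: "('k::differential_field, 'a, 'z) coring_scheme \<Rightarrow> bool" where
  "is_coring C \<longleftrightarrow>
     is_bimodule C \<and>
     comult C \<in> hom (add_monoid C) (tensor C C) \<and>
     (\<forall>x. \<forall>c\<in>carrier C. comult C (x \<odot>\<^bsub>C\<^esub> c) = tensor_map C C (\<lambda>a. x \<odot>\<^bsub>C\<^esub> a) id (comult C c)) \<and>
     (\<forall>x. \<forall>c\<in>carrier C. comult C (rsmult C c x) = tensor_map C C id (\<lambda>b. rsmult C b x) (comult C c)) \<and>
     counit C \<in> linear_maps C base_module \<and>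
     (\<forall>x. \<forall>c\<in>carrier C. counit C (rsmult C c x) = counit C c * x) \<and>
     (\<forall>c\<in>carrier C. comult_tensor C C (comult C c) = tensor_coact C C (comult C) (comult C c)) \<and>
     (\<forall>c\<in>carrier C. additive_extension C (\<lambda>(a, b). counit C a \<odot>\<^bsub>C\<^esub> b) (comult C c) = c) \<and>
     (\<forall>c\<in>carrier C. additive_extension C (\<lambda>(a, b). rsmult C a (counit C b)) (comult C c) = c)"

definition coring_homs ::
    "('k::differential_field, 'a, 'z) coring_scheme \<Rightarrow> ('k, 'b, 'w) coring_scheme \<Rightarrow> ('a \<Rightarrow> 'b) set"
  where
  "coring_homs C D = {f \<in> linear_maps C D.
     (\<forall>x. \<forall>c\<in>carrier C. f (rsmult C c x) = rsmult D (f c) x) \<and>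
     (\<forall>c\<in>carrier C. counit D (f c) = counit C c) \<and>
     (\<forall>c\<in>carrier C. comult D (f c) = tensor_map D D f f (comult C c))}"

section \<open>Commutative Hopf algebroids\<close>

record ('k, 'a) hopf_algebroid = "('k, 'a) coring" +
  source :: "'k \<Rightarrow> 'a"
  target :: "'k \<Rightarrow> 'a"
  antipode :: "'a \<Rightarrow> 'a"

text \<open>A ring with two maps from the base field; left action via \<open>s\<close>, right action via \<open>t\<close>.\<close>

definition algebra_bimodule ::
    "'a ring \<Rightarrow> ('k \<Rightarrow> 'a) \<Rightarrow> ('k \<Rightarrow> 'a) \<Rightarrow> ('k, 'a) bimodule" where
  "algebra_bimodule R s t =
     \<lparr>carrier = carrier R, monoid.mult = monoid.mult R, one = one R, ring.zero = ring.zero R,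
      add = add R, smult = (\<lambda>x a. s x \<otimes>\<^bsub>R\<^esub> a), rsmult = (\<lambda>a x. a \<otimes>\<^bsub>R\<^esub> t x)\<rparr>"

definition make_hopf_algebroid ::
    "'a ring \<Rightarrow> ('k \<Rightarrow> 'a) \<Rightarrow> ('k \<Rightarrow> 'a) \<Rightarrow> ('a \<Rightarrow> ('a \<times> 'a \<Rightarrow>\<^sub>0 int) set) \<Rightarrow> ('a \<Rightarrow> 'k) \<Rightarrow>
     ('a \<Rightarrow> 'a) \<Rightarrow> ('k, 'a) hopf_algebroid" where
  "make_hopf_algebroid R s t \<Delta> e S =
     \<lparr>carrier = carrier R, monoid.mult = monoid.mult R, one = one R, ring.zero = ring.zero R,
      add = add R, smult = smult (algebra_bimodule R s t), rsmult = rsmult (algebra_bimodule R s t),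
      comult = \<Delta>, counit = e, source = s, target = t, antipode = S\<rparr>"

definition tensor_mult ::
    "('k, 'a, 'z) bimodule_scheme \<Rightarrow> ('a \<times> 'a \<Rightarrow>\<^sub>0 int) set \<Rightarrow> ('a \<times> 'a \<Rightarrow>\<^sub>0 int) set \<Rightarrow>
     ('a \<times> 'a \<Rightarrow>\<^sub>0 int) set" where
  "tensor_mult H X Y = tensor_class H H
     (frag_extend (\<lambda>(a, b). frag_extend (\<lambda>(c, d). frag_of (a \<otimes>\<^bsub>H\<^esub> c, b \<otimes>\<^bsub>H\<^esub> d)) (rep Y)) (rep X))"

text \<open>
  The algebra structure over the constants is the restriction of the source map, which there agrees
  with the target map.
\<close>

definition commutative_hopf_algebroid ::
    "('k::differential_field, 'a, 'z) hopf_algebroid_scheme \<Rightarrow> bool" where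
  "commutative_hopf_algebroid H \<longleftrightarrow>
     cring H \<and>
     source H \<in> ring_hom \<bbbK> H \<and> target H \<in> ring_hom \<bbbK> H \<and>
     (\<forall>c\<in>constants. source H c = target H c) \<and>
     (\<forall>x. \<forall>h\<in>carrier H. x \<odot>\<^bsub>H\<^esub> h = source H x \<otimes>\<^bsub>H\<^esub> h \<and> rsmult H h x = h \<otimes>\<^bsub>H\<^esub> target H x) \<and>
     is_coring H \<and>
     counit H \<in> ring_hom H \<bbbK> \<and>
     (\<forall>x. counit H (source H x) = x \<and> counit H (target H x) = x) \<and>
     comult H \<one>\<^bsub>H\<^esub> = pure_tensor H H \<one>\<^bsub>H\<^esub> \<one>\<^bsub>H\<^esub> \<and>
     (\<forall>g\<in>carrier H. \<forall>h\<in>carrier H.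
        comult H (g \<otimes>\<^bsub>H\<^esub> h) = tensor_mult H (comult H g) (comult H h)) \<and>
     (\<forall>x. comult H (source H x) = pure_tensor H H (source H x) \<one>\<^bsub>H\<^esub>) \<and>
     (\<forall>x. comult H (target H x) = pure_tensor H H \<one>\<^bsub>H\<^esub> (target H x)) \<and>
     antipode H \<in> ring_hom H H \<and>
     (\<forall>x. antipode H (source H x) = target H x \<and> antipode H (target H x) = source H x) \<and>
     (\<forall>h\<in>carrier H. additive_extension H (\<lambda>(a, b). a \<otimes>\<^bsub>H\<^esub> antipode H b) (comult H h)
        = source H (counit H h)) \<and>
     (\<forall>h\<in>carrier H. additive_extension H (\<lambda>(a, b). antipode H a \<otimes>\<^bsub>H\<^esub> b) (comult H h)
        = target H (counit H h))"

definition hopf_algebroid_isos ::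
    "('k::differential_field, 'a, 'z) hopf_algebroid_scheme \<Rightarrow>
     ('k, 'b, 'w) hopf_algebroid_scheme \<Rightarrow> ('a \<Rightarrow> 'b) set" where
  "hopf_algebroid_isos H H' = {f \<in> ring_hom H H' \<inter> coring_homs H H'.
     bij_betw f (carrier H) (carrier H') \<and>
     (\<forall>x. f (source H x) = source H' x) \<and> (\<forall>x. f (target H x) = target H' x) \<and>
     (\<forall>h\<in>carrier H. f (antipode H h) = antipode H' (f h))}"

definition hopf_algebroid_isomorphic ::
    "('k::differential_field, 'a, 'z) hopf_algebroid_scheme \<Rightarrow>
     ('k, 'b, 'w) hopf_algebroid_scheme \<Rightarrow> bool" where
  "hopf_algebroid_isomorphic H H' \<longleftrightarrow>
     commutative_hopf_algebroid H \<and> commutative_hopf_algebroid H' \<and> hopf_algebroid_isos H H' \<noteq> {}"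

section \<open>Left comodules and direct limits\<close>

record ('k, 'c, 'a) comodule = "('k, 'a) module" +
  coact :: "'a \<Rightarrow> ('c \<times> 'a \<Rightarrow>\<^sub>0 int) set"

definition left_comodule ::
    "('k::differential_field, 'c, 'z) coring_scheme \<Rightarrow> ('k, 'c, 'a, 'w) comodule_scheme \<Rightarrow> bool" where
  "left_comodule C X \<longleftrightarrow>
     module \<bbbK> X \<and>
     coact X \<in> hom (add_monoid X) (tensor C X) \<and>
     (\<forall>x. \<forall>m\<in>carrier X. coact X (x \<odot>\<^bsub>X\<^esub> m) = tensor_map C X (\<lambda>c. x \<odot>\<^bsub>C\<^esub> c) id (coact X m)) \<and>
     (\<forall>m\<in>carrier X. comult_tensor C X (coact X m) = tensor_coact C X (coact X) (coact X m)) \<and>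
     (\<forall>m\<in>carrier X. additive_extension X (\<lambda>(c, n). counit C c \<odot>\<^bsub>X\<^esub> n) (coact X m) = m)"

definition comodule_homs ::
    "('k::differential_field, 'c, 'z) coring_scheme \<Rightarrow> ('k, 'c, 'a, 'w) comodule_scheme \<Rightarrow>
     ('k, 'c, 'b, 'v) comodule_scheme \<Rightarrow> ('a \<Rightarrow> 'b) set" where
  "comodule_homs C X Y = {f \<in> linear_maps X Y.
     \<forall>m\<in>carrier X. coact Y (f m) = tensor_map C Y id f (coact X m)}"

definition directed_system ::
    "('k::differential_field, 'c, 'z) coring_scheme \<Rightarrow> 'i set \<Rightarrow> ('i \<Rightarrow> 'i \<Rightarrow> bool) \<Rightarrow>
     ('i \<Rightarrow> ('k, 'c, 'a) comodule) \<Rightarrow> ('i \<Rightarrow> 'i \<Rightarrow> 'a \<Rightarrow> 'a) \<Rightarrow> bool" where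
  "directed_system C I below X \<tau> \<longleftrightarrow>
     I \<noteq> {} \<and>
     (\<forall>i\<in>I. below i i) \<and>
     (\<forall>i\<in>I. \<forall>j\<in>I. \<forall>k\<in>I. below i j \<longrightarrow> below j k \<longrightarrow> below i k) \<and>
     (\<forall>i\<in>I. \<forall>j\<in>I. \<exists>k\<in>I. below i k \<and> below j k) \<and>
     (\<forall>i\<in>I. left_comodule C (X i)) \<and>
     (\<forall>i\<in>I. \<forall>j\<in>I. below i j \<longrightarrow> \<tau> i j \<in> comodule_homs C (X i) (X j)) \<and>
     (\<forall>i\<in>I. \<forall>m\<in>carrier (X i). \<tau> i i m = m) \<and>
     (\<forall>i\<in>I. \<forall>j\<in>I. \<forall>k\<in>I. below i j \<longrightarrow> below j k \<longrightarrow>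
        (\<forall>m\<in>carrier (X i). \<tau> j k (\<tau> i j m) = \<tau> i k m))"

definition limit_class ::
    "'i set \<Rightarrow> ('i \<Rightarrow> 'i \<Rightarrow> bool) \<Rightarrow> ('i \<Rightarrow> ('k, 'c, 'a) comodule) \<Rightarrow> ('i \<Rightarrow> 'i \<Rightarrow> 'a \<Rightarrow> 'a) \<Rightarrow>
     'i \<Rightarrow> 'a \<Rightarrow> ('i \<times> 'a) set" where
  "limit_class I below X \<tau> i m =
     {(j, n). j \<in> I \<and> n \<in> carrier (X j) \<and> (\<exists>k\<in>I. below i k \<and> below j k \<and> \<tau> i k m = \<tau> j k n)}"

definition limit_module ::
    "'i set \<Rightarrow> ('i \<Rightarrow> 'i \<Rightarrow> bool) \<Rightarrow> ('i \<Rightarrow> ('k, 'c, 'a) comodule) \<Rightarrow> ('i \<Rightarrow> 'i \<Rightarrow> 'a \<Rightarrow> 'a) \<Rightarrow>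
     ('k, ('i \<times> 'a) set) module" where
  "limit_module I below X \<tau> =
     \<lparr>carrier = {limit_class I below X \<tau> i m | i m. i \<in> I \<and> m \<in> carrier (X i)},
      monoid.mult = undefined, one = undefined,
      ring.zero = (let i = rep I in limit_class I below X \<tau> i \<zero>\<^bsub>X i\<^esub>),
      add = (\<lambda>A B. let (i, m) = rep A; (j, n) = rep B; k = rep {k \<in> I. below i k \<and> below j k}
        in limit_class I below X \<tau> k (\<tau> i k m \<oplus>\<^bsub>X k\<^esub> \<tau> j k n)),
      smult = (\<lambda>x A. let (i, m) = rep A in limit_class I below X \<tau> i (x \<odot>\<^bsub>X i\<^esub> m))\<rparr>"

text \<open>
  The coaction on the limit is the one for which all canonical maps \<open>X i \<rightarrow> lim X\<close> are colinear.
\<close>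

definition limit_comodule ::
    "('k, 'c, 'z) coring_scheme \<Rightarrow> 'i set \<Rightarrow> ('i \<Rightarrow> 'i \<Rightarrow> bool) \<Rightarrow> ('i \<Rightarrow> ('k, 'c, 'a) comodule) \<Rightarrow>
     ('i \<Rightarrow> 'i \<Rightarrow> 'a \<Rightarrow> 'a) \<Rightarrow> ('k, 'c, ('i \<times> 'a) set) comodule" where
  "limit_comodule C I below X \<tau> = module.extend (limit_module I below X \<tau>)
     (comodule.fields (\<lambda>A. let (i, m) = rep A in
        tensor_map C (limit_module I below X \<tau>) id (limit_class I below X \<tau> i) (coact (X i) m)))"

section \<open>Differential operators\<close>

text \<open>
  The underlying set of \<open>\<bbbK>[Y; \<partial>]\<close> is that of polynomials: \<open>p\<close> stands for \<open>\<Sum>i. Y\<^sup>i (coeff p i)\<close>, with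
  coefficients on the right.  From \<open>x Y = Y x + \<partial> x\<close> one gets
  \<open>x Y\<^sup>j = \<Sum>k\<le>j. (j choose k) Y\<^bsup>j-k\<^esup> \<partial>\<^sup>k x\<close>, hence the product below.
\<close>

definition op_mult :: "'k::differential_field poly \<Rightarrow> 'k poly \<Rightarrow> 'k poly" where
  "op_mult p q = (\<Sum>i\<le>degree p. \<Sum>j\<le>degree q. \<Sum>k\<le>j.
     monom (of_nat (j choose k) * (\<partial> ^^ k) (coeff p i) * coeff q j) (i + (j - k)))"

definition op_ring :: "'k::differential_field poly ring" where
  "op_ring = \<lparr>carrier = UNIV, monoid.mult = op_mult, one = 1, ring.zero = 0, add = (+)\<rparr>"

lemma op_mult_commutation: "op_mult [:x:] (monom 1 1) = op_mult (monom 1 1) [:x:] + [:\<partial> x:]"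
  by (simp add: op_mult_def degree_monom_eq monom_0 add.commute)

definition right_ideal :: "'k::differential_field poly \<Rightarrow> 'k poly set" where
  "right_ideal P = range (op_mult P)"

definition quotient_class :: "'k::differential_field poly \<Rightarrow> 'k poly \<Rightarrow> 'k poly set" where
  "quotient_class P u = right_ideal P +>\<^bsub>op_ring\<^esub> u"

text \<open>The right vector space \<open>U / P U\<close>.\<close>

definition quotient_space :: "'k::differential_field poly \<Rightarrow> ('k, 'k poly set) module" where
  "quotient_space P = \<lparr>carrier = range (quotient_class P),
     monoid.mult = undefined, one = undefined, ring.zero = quotient_class P 0,
     add = (\<lambda>X Z. quotient_class P (rep X + rep Z)),
     smult = (\<lambda>x X. quotient_class P (op_mult (rep X) [:x:]))\<rparr>"

definition quotient_power :: "'k::differential_field poly \<Rightarrow> nat \<Rightarrow> 'k poly set" where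
  "quotient_power P n = quotient_class P (monom 1 n)"

definition dual_power :: "'k::differential_field poly \<Rightarrow> nat \<Rightarrow> 'k poly set \<Rightarrow> 'k" where
  "dual_power P i = (THE f. f \<in> carrier (dual (quotient_space P)) \<and>
     (\<forall>j<degree P. f (quotient_power P j) = of_bool (i = j)))"

section \<open>Differentially recursive sequences\<close>

definition hurwitz_mult :: "(nat \<Rightarrow> 'k::differential_field) \<Rightarrow> (nat \<Rightarrow> 'k) \<Rightarrow> nat \<Rightarrow> 'k" where
  "hurwitz_mult \<alpha> \<beta> = (\<lambda>n. \<Sum>k\<le>n. of_nat (n choose k) * \<alpha> k * \<beta> (n - k))"

definition seq_shift :: "(nat \<Rightarrow> 'k) \<Rightarrow> nat \<Rightarrow> 'k" where
  "seq_shift \<alpha> = (\<lambda>n. \<alpha> (n + 1))"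

definition seq_source :: "'k::differential_field \<Rightarrow> nat \<Rightarrow> 'k" where
  "seq_source x = (\<lambda>n. if n = 0 then x else 0)"

definition seq_target :: "'k::differential_field \<Rightarrow> nat \<Rightarrow> 'k" where
  "seq_target x = (\<lambda>n. (\<partial> ^^ n) x)"

definition annihilated_in_degree :: "(nat \<Rightarrow> 'k::differential_field) \<Rightarrow> nat \<Rightarrow> bool" where
  "annihilated_in_degree \<alpha> d \<longleftrightarrow> (\<exists>c :: nat \<Rightarrow> 'k. c d \<noteq> 0 \<and>
     (\<forall>n. (\<Sum>i\<le>d. hurwitz_mult (seq_target (c i)) ((seq_shift ^^ i) \<alpha>) n) = 0))"

definition dlin :: "(nat \<Rightarrow> 'k::differential_field) set" where
  "dlin = {\<alpha>. \<exists>d. annihilated_in_degree \<alpha> d}"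

definition seq_order :: "(nat \<Rightarrow> 'k::differential_field) \<Rightarrow> nat" where
  "seq_order \<alpha> = (LEAST d. annihilated_in_degree \<alpha> d)"

text \<open>The right \<open>U\<close>-action \<open>\<alpha> \<triangleleft> \<Sum>i. Y\<^sup>i c\<^sub>i = \<Sum>i. t(c\<^sub>i) N\<^sup>i(\<alpha>)\<close>.\<close>

definition seq_act :: "(nat \<Rightarrow> 'k::differential_field) \<Rightarrow> 'k poly \<Rightarrow> nat \<Rightarrow> 'k" where
  "seq_act \<alpha> P = (\<lambda>n. \<Sum>i\<le>degree P. hurwitz_mult (seq_target (coeff P i)) ((seq_shift ^^ i) \<alpha>) n)"

definition seq_annihilator :: "(nat \<Rightarrow> 'k::differential_field) \<Rightarrow> 'k poly set" where
  "seq_annihilator \<alpha> = {Q. seq_act \<alpha> Q = (\<lambda>_. 0)}"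

definition minimal_operator :: "(nat \<Rightarrow> 'k::differential_field) \<Rightarrow> 'k poly" where
  "minimal_operator \<alpha> = (THE P. lead_coeff P = 1 \<and> seq_annihilator \<alpha> = right_ideal P)"

definition dlin_ring :: "(nat \<Rightarrow> 'k::differential_field) ring" where
  "dlin_ring = \<lparr>carrier = dlin, monoid.mult = hurwitz_mult, one = seq_source 1,
     ring.zero = (\<lambda>_. 0), add = (\<lambda>\<alpha> \<beta> n. \<alpha> n + \<beta> n)\<rparr>"

definition dlin_bimodule :: "('k::differential_field, nat \<Rightarrow> 'k) bimodule" where
  "dlin_bimodule = algebra_bimodule dlin_ring seq_source seq_target"

definition dlin_comult ::
    "(nat \<Rightarrow> 'k::differential_field) \<Rightarrow> ((nat \<Rightarrow> 'k) \<times> (nat \<Rightarrow> 'k) \<Rightarrow>\<^sub>0 int) set" where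
  "dlin_comult \<alpha> = (let P = minimal_operator \<alpha> in
     tensor_class dlin_bimodule dlin_bimodule
       (\<Sum>i<seq_order \<alpha>. frag_of ((seq_shift ^^ i) \<alpha>, \<lambda>n. dual_power P i (quotient_power P n))))"

definition dlin_antipode :: "(nat \<Rightarrow> 'k::differential_field) \<Rightarrow> nat \<Rightarrow> 'k" where
  "dlin_antipode \<alpha> = (\<lambda>n. \<Sum>k\<le>n. of_nat (n choose k) * (- 1) ^ (n - k) * (\<partial> ^^ k) (\<alpha> (n - k)))"

definition Dlin :: "('k::differential_field, nat \<Rightarrow> 'k) hopf_algebroid" where
  "Dlin = make_hopf_algebroid dlin_ring seq_source seq_target dlin_comult (\<lambda>\<alpha>. \<alpha> 0) dlin_antipode"

section \<open>The comodules of formal solutions\<close>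

definition Dlin_comodule :: "('k::differential_field, nat \<Rightarrow> 'k, nat \<Rightarrow> 'k) comodule" where
  "Dlin_comodule = \<lparr>carrier = carrier Dlin, monoid.mult = monoid.mult Dlin, one = one Dlin,
     ring.zero = ring.zero Dlin, add = add Dlin, smult = smult Dlin, coact = comult Dlin\<rparr>"

text \<open>
  Non-zero operators \<open>\<L> = \<Sum>i. t(c\<^sub>i) N\<^sup>i\<close> are indexed by their polynomials
  \<open>P = \<Sum>i. Y\<^sup>i c\<^sub>i\<close>.
\<close>

definition operator_index :: "'k::differential_field poly set" where
  "operator_index = {P. P \<noteq> 0}"

definition operator_le :: "'k::differential_field poly \<Rightarrow> 'k poly \<Rightarrow> bool" where
  "operator_le P P' \<longleftrightarrow> P' \<in> right_ideal P"

definition solution_comodule ::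
    "'k::differential_field poly \<Rightarrow> ('k, nat \<Rightarrow> 'k, 'k poly set \<Rightarrow> 'k) comodule" where
  "solution_comodule P = module.extend (dual (quotient_space P))
     (comodule.fields (\<lambda>f. tensor_class Dlin (dual (quotient_space P))
        (\<Sum>i<degree P. frag_of (\<lambda>n. f (quotient_power P (n + i)), dual_power P i))))"

text \<open>The transpose of the canonical projection \<open>U / P' U \<rightarrow> U / P U\<close>.\<close>

definition solution_transition ::
    "'k::differential_field poly \<Rightarrow> 'k poly \<Rightarrow> ('k poly set \<Rightarrow> 'k) \<Rightarrow> 'k poly set \<Rightarrow> 'k" where
  "solution_transition P P' f = (\<lambda>X\<in>carrier (quotient_space P'). f (quotient_class P (rep X)))"

definition solution_limit ::
    "('k::differential_field, nat \<Rightarrow> 'k, ('k poly \<times> ('k poly set \<Rightarrow> 'k)) set) comodule" where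
  "solution_limit =
     limit_comodule Dlin operator_index operator_le solution_comodule solution_transition"

section \<open>Finite-dimensional differential vector spaces\<close>

record ('k, 'a) diff_space = "('k, 'a) module" +
  differential :: "'a \<Rightarrow> 'a"

definition fd_diff_space :: "('k::differential_field, 'a, 'z) diff_space_scheme \<Rightarrow> bool" where
  "fd_diff_space M \<longleftrightarrow>
     module \<bbbK> M \<and> finite_dimensional M \<and>
     differential M \<in> hom (add_monoid M) (add_monoid M) \<and>
     (\<forall>x. \<forall>m\<in>carrier M.
        differential M (x \<odot>\<^bsub>M\<^esub> m) = x \<odot>\<^bsub>M\<^esub> differential M m \<oplus>\<^bsub>M\<^esub> \<partial> x \<odot>\<^bsub>M\<^esub> m)"

definition diff_homs ::
    "('k, 'a, 'z) diff_space_scheme \<Rightarrow> ('k, 'b, 'w) diff_space_scheme \<Rightarrow> ('a \<Rightarrow> 'b) set" where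
  "diff_homs M N = {f \<in> linear_maps M N.
     \<forall>m\<in>carrier M. f (differential M m) = differential N (f m)}"

definition diff_isos ::
    "('k, 'a, 'z) diff_space_scheme \<Rightarrow> ('k, 'b, 'w) diff_space_scheme \<Rightarrow> ('a \<Rightarrow> 'b) set" where
  "diff_isos M N = {f \<in> diff_homs M N. bij_betw f (carrier M) (carrier N)}"

definition diff_unit :: "('k::differential_field, 'k) diff_space" where
  "diff_unit = module.extend base_module (diff_space.fields \<partial>)"

definition diff_dual ::
    "('k::differential_field, 'a) diff_space \<Rightarrow> ('k, 'a \<Rightarrow> 'k) diff_space" where
  "diff_dual M = module.extend (dual M)
     (diff_space.fields (\<lambda>f. \<lambda>m\<in>carrier M. \<partial> (f m) - f (differential M m)))"

text \<open>A vector space as a symmetric bimodule.\<close>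

definition symmetric_bimodule :: "('k, 'a, 'z) module_scheme \<Rightarrow> ('k, 'a) bimodule" where
  "symmetric_bimodule M =
     \<lparr>carrier = carrier M, monoid.mult = monoid.mult M, one = one M, ring.zero = ring.zero M,
      add = add M, smult = smult M, rsmult = (\<lambda>m x. x \<odot>\<^bsub>M\<^esub> m)\<rparr>"

definition diff_tensor ::
    "('k, 'a) diff_space \<Rightarrow> ('k, 'b) diff_space \<Rightarrow> ('k, ('a \<times> 'b \<Rightarrow>\<^sub>0 int) set) diff_space" where
  "diff_tensor M N = (let M' = symmetric_bimodule M in
     \<lparr>carrier = carrier (tensor M' N), monoid.mult = undefined, one = undefined,
      ring.zero = one (tensor M' N), add = monoid.mult (tensor M' N),
      smult = (\<lambda>x. tensor_map M' N (\<lambda>m. x \<odot>\<^bsub>M\<^esub> m) id),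
      differential = (\<lambda>X. tensor_class M' N
        (frag_extend (\<lambda>(m, n). frag_of (differential M m, n) + frag_of (m, differential N n)) (rep X)))\<rparr>)"

section \<open>The finite dual\<close>

text \<open>
  There is no set of all finite-dimensional differential spaces, so \<open>M\<close> is taken to range over those
  whose underlying set consists of sequences over the base field; every finite-dimensional
  differential space is isomorphic to one of these.
\<close>

definition diff_universe :: "('k::differential_field, nat \<Rightarrow> 'k) diff_space set" where
  "diff_universe = {M. fd_diff_space M}"

type_synonym 'k udeg_gen =
  "('k, nat \<Rightarrow> 'k) diff_space \<times> ((nat \<Rightarrow> 'k) \<Rightarrow> 'k) \<times> (nat \<Rightarrow> 'k)"

type_synonym 'k udeg = "('k udeg_gen \<Rightarrow>\<^sub>0 int) set"

text \<open>
  The direct sum of the \<open>M\<^sup>* \<otimes> M\<close> has generators \<open>(M, \<phi>, m)\<close>.  The tensor product over the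
  endomorphism ring of \<open>M\<close> is obtained from the last family of relations with \<open>N = M\<close>.
\<close>

definition udeg_gens :: "'k::differential_field udeg_gen set" where
  "udeg_gens = {(M, \<phi>, m). M \<in> diff_universe \<and> \<phi> \<in> carrier (dual M) \<and> m \<in> carrier M}"

definition udeg_relations :: "('k::differential_field udeg_gen \<Rightarrow>\<^sub>0 int) set" where
  "udeg_relations =
     {frag_of (M, \<phi> \<oplus>\<^bsub>dual M\<^esub> \<phi>', m) - frag_of (M, \<phi>, m) - frag_of (M, \<phi>', m) | M \<phi> \<phi>' m.
        M \<in> diff_universe \<and> \<phi> \<in> carrier (dual M) \<and> \<phi>' \<in> carrier (dual M) \<and> m \<in> carrier M} \<union>
     {frag_of (M, \<phi>, m \<oplus>\<^bsub>M\<^esub> m') - frag_of (M, \<phi>, m) - frag_of (M, \<phi>, m') | M \<phi> m m'.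
        M \<in> diff_universe \<and> \<phi> \<in> carrier (dual M) \<and> m \<in> carrier M \<and> m' \<in> carrier M} \<union>
     {frag_of (N, \<psi>, f m) - frag_of (M, compose (carrier M) \<psi> f, m) | M N \<psi> f m.
        M \<in> diff_universe \<and> N \<in> diff_universe \<and> \<psi> \<in> carrier (dual N) \<and> m \<in> carrier M \<and>
        f \<in> diff_homs M N}"

definition udeg_group :: "'k::differential_field udeg monoid" where
  "udeg_group = presented_group udeg_gens udeg_relations"

definition udeg_class :: "('k::differential_field udeg_gen \<Rightarrow>\<^sub>0 int) \<Rightarrow> 'k udeg" where
  "udeg_class = presented_class udeg_gens udeg_relations"

text \<open>
  \<open>udeg_gen M \<phi> m\<close> is a generator representing \<open>\<phi> \<otimes> m\<close> for a finite-dimensional differential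
  space \<open>M\<close> on an arbitrary type, obtained by transport along an isomorphism; by the last family of
  relations its class does not depend on the choice.
\<close>

definition udeg_gen ::
    "('k::differential_field, 'a) diff_space \<Rightarrow> ('a \<Rightarrow> 'k) \<Rightarrow> 'a \<Rightarrow> 'k udeg_gen" where
  "udeg_gen M \<phi> m = (SOME (N, \<psi>, n). N \<in> diff_universe \<and> n \<in> carrier N \<and>
     (\<exists>\<theta>\<in>diff_isos N M. \<psi> = compose (carrier N) \<phi> \<theta> \<and> \<theta> n = m))"

definition udeg_gen_mult ::
    "'k::differential_field udeg_gen \<Rightarrow> 'k udeg_gen \<Rightarrow> 'k udeg_gen" where
  "udeg_gen_mult = (\<lambda>(M, \<phi>, p) (N, \<psi>, q).
     udeg_gen (diff_tensor N M)
       (\<lambda>X\<in>carrier (diff_tensor N M). additive_extension \<bbbK> (\<lambda>(q, p). \<phi> (\<psi> q \<odot>\<^bsub>M\<^esub> p)) X)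
       (pure_tensor (symmetric_bimodule N) M q p))"

definition udeg_mult :: "'k::differential_field udeg \<Rightarrow> 'k udeg \<Rightarrow> 'k udeg" where
  "udeg_mult X Z = udeg_class
     (frag_extend (\<lambda>g. frag_extend (\<lambda>h. frag_of (udeg_gen_mult g h)) (rep Z)) (rep X))"

definition udeg_source :: "'k::differential_field \<Rightarrow> 'k udeg" where
  "udeg_source k = udeg_class (frag_of (udeg_gen diff_unit (\<lambda>x. k * x) 1))"

definition udeg_target :: "'k::differential_field \<Rightarrow> 'k udeg" where
  "udeg_target k = udeg_class (frag_of (udeg_gen diff_unit (\<lambda>x. x) k))"

definition udeg_ring :: "'k::differential_field udeg ring" where
  "udeg_ring = \<lparr>carrier = carrier udeg_group, monoid.mult = udeg_mult, one = udeg_source 1,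
     ring.zero = one udeg_group, add = monoid.mult udeg_group\<rparr>"

definition udeg_bimodule :: "('k::differential_field, 'k udeg) bimodule" where
  "udeg_bimodule = algebra_bimodule udeg_ring udeg_source udeg_target"

definition udeg_comult :: "'k::differential_field udeg \<Rightarrow> ('k udeg \<times> 'k udeg \<Rightarrow>\<^sub>0 int) set" where
  "udeg_comult X = tensor_class udeg_bimodule udeg_bimodule
     (frag_extend (\<lambda>(M, \<phi>, m).
        let (d, e, e') = (SOME (d, e, e'). is_dual_basis M d e e') in
        \<Sum>i<d. frag_of (udeg_class (frag_of (M, \<phi>, e i)), udeg_class (frag_of (M, e' i, m))))
      (rep X))"

definition udeg_counit :: "'k::differential_field udeg \<Rightarrow> 'k" where
  "udeg_counit = additive_extension \<bbbK> (\<lambda>(M, \<phi>, m). \<phi> m)"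

definition udeg_antipode :: "'k::differential_field udeg \<Rightarrow> 'k udeg" where
  "udeg_antipode X = udeg_class
     (frag_extend (\<lambda>(M, \<phi>, m).
        frag_of (udeg_gen (diff_dual M) (\<lambda>f\<in>carrier (dual M). f m) \<phi>)) (rep X))"

definition finite_dual :: "('k::differential_field, 'k udeg) hopf_algebroid" where
  "finite_dual = make_hopf_algebroid udeg_ring udeg_source udeg_target
     udeg_comult udeg_counit udeg_antipode"

section \<open>The dual defined by a universal property\<close>

definition op_functionals :: "('k::differential_field poly \<Rightarrow> 'k) set" where
  "op_functionals = {f. (\<forall>u v. f (u + v) = f u + f v) \<and> (\<forall>u x. f (op_mult u [:x:]) = f u * x)}"

text \<open>The right linear functional on \<open>U\<close> with prescribed values on the powers of \<open>Y\<close>.\<close>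

definition functional_of_seq :: "(nat \<Rightarrow> 'k::differential_field) \<Rightarrow> 'k poly \<Rightarrow> 'k" where
  "functional_of_seq \<alpha> u = (\<Sum>n\<le>degree u. \<alpha> n * coeff u n)"

definition convolution ::
    "('k::differential_field poly \<Rightarrow> 'k) \<Rightarrow> ('k poly \<Rightarrow> 'k) \<Rightarrow> 'k poly \<Rightarrow> 'k" where
  "convolution f g = functional_of_seq
     (\<lambda>n. \<Sum>k\<le>n. of_nat (n choose k) * f (monom 1 k) * g (monom 1 (n - k)))"

definition op_counit :: "'k::differential_field poly \<Rightarrow> 'k" where
  "op_counit = functional_of_seq (\<lambda>n. of_bool (n = 0))"

definition op_mu :: "'k::differential_field \<Rightarrow> 'k poly \<Rightarrow> 'k" where
  "op_mu y = functional_of_seq (\<lambda>n. (\<partial> ^^ n) y)"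

definition dual_pairing ::
    "('k::differential_field, 'c, 'z) coring_scheme \<Rightarrow> ('c \<Rightarrow> 'k poly \<Rightarrow> 'k) \<Rightarrow> bool" where
  "dual_pairing C \<xi> \<longleftrightarrow>
     (\<forall>z\<in>carrier C. \<xi> z \<in> op_functionals) \<and>
     (\<forall>z\<in>carrier C. \<forall>w\<in>carrier C. \<forall>u. \<xi> (z \<oplus>\<^bsub>C\<^esub> w) u = \<xi> z u + \<xi> w u) \<and>
     (\<forall>c\<in>constants. \<forall>z\<in>carrier C. \<forall>u. \<xi> (c \<odot>\<^bsub>C\<^esub> z) u = c * \<xi> z u) \<and>
     (\<forall>z\<in>carrier C. \<forall>u v. \<xi> z (op_mult u v) =
        additive_extension \<bbbK> (\<lambda>(a, b). \<xi> a (op_mult [:\<xi> b u:] v)) (comult C z)) \<and>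
     (\<forall>z\<in>carrier C. \<xi> z 1 = counit C z) \<and>
     (\<forall>x y. \<forall>z\<in>carrier C. \<forall>u. \<xi> (rsmult C (x \<odot>\<^bsub>C\<^esub> z) y) u = x * \<xi> z (op_mult [:y:] u))"

text \<open>
  The universal property for test corings whose underlying set is carried by the type \<open>'c\<close>.  Since a
  formula cannot quantify over types, \<open>'c\<close> is a parameter.
\<close>

definition universal_pairing ::
    "'c itself \<Rightarrow> ('k::differential_field, 'v, 'z) coring_scheme \<Rightarrow> ('v \<Rightarrow> 'k poly \<Rightarrow> 'k) \<Rightarrow> bool" where
  "universal_pairing T V \<xi> \<longleftrightarrow>
     (\<forall>(C :: ('k, 'c) coring) f. is_coring C \<longrightarrow> dual_pairing C f \<longrightarrow>
        (\<exists>g\<in>coring_homs C V. (\<forall>c\<in>carrier C. \<xi> (g c) = f c) \<and>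
           (\<forall>g'\<in>coring_homs C V. (\<forall>c\<in>carrier C. \<xi> (g' c) = f c) \<longrightarrow>
              (\<forall>c\<in>carrier C. g' c = g c))))"

definition is_universal_dual ::
    "'c itself \<Rightarrow> ('k::differential_field, 'v, 'z) hopf_algebroid_scheme \<Rightarrow>
     ('v \<Rightarrow> 'k poly \<Rightarrow> 'k) \<Rightarrow> bool" where
  "is_universal_dual T V \<xi> \<longleftrightarrow>
     commutative_hopf_algebroid V \<and> dual_pairing V \<xi> \<and> universal_pairing T V \<xi> \<and>
     \<xi> \<one>\<^bsub>V\<^esub> = op_counit \<and>
     (\<forall>z\<in>carrier V. \<forall>w\<in>carrier V. \<xi> (z \<otimes>\<^bsub>V\<^esub> w) = convolution (\<xi> z) (\<xi> w)) \<and>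
     (\<forall>x y. \<xi> (source V x \<otimes>\<^bsub>V\<^esub> target V y) = convolution (\<lambda>u. x * op_counit u) (op_mu y))"

end

(* Every space in sight embeds into the space of sequences over the base field K, compatibly with the
   left and right actions of K: a functional on U goes to its values on the powers of Y, a formal
   solution to its sequence of values, and the class of phi (x) m in the finite dual to
   (phi (d^n m))_n. A tensor sum_i a_i (x) b_i of such spaces is determined by the sequences
   sum_i a_i t(b_i(n)), n >= 0: choosing a basis of the finitely many right factors dual to
   evaluations at finitely many places separates tensors. Under this embedding Delta(alpha) is the
   tensor whose n-th sequence is the shift N^n(alpha), so all axioms of corings, comodules and Hopf
   algebroids, and the compatibility of all maps, become identities between sequences.

   A sequence is differentially recursive exactly if its shifts lie in a finite-dimensional K-space
   (K acting through t); this gives closure under all operations, and shows that every functional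
   coming from a coring is differentially recursive. In the finite dual, every element is the class
   of one pair (evaluation at 0, alpha) on a shift-stable finite-dimensional space of sequences, which
   makes the map to sequences injective. *)

theory Submission
  imports Defs "HOL-Library.Function_Algebras"
begin

section \<open>The ring of sequences under the Hurwitz product, with source and target\<close>

section \<open>Sequences\<close>

text \<open>The map a (x) b |-> a t(b(n)) is well defined because a right scalar x on a is the
  factor t(x), while a left scalar x on b multiplies the entry b(n), and t is multiplicative. The
  numbers y_i^*(y_n) are the coefficients of the remainder of Y^n modulo P, and P kills \<alpha>:
  this is why the comultiplication evaluates to shifts. What shapes the development is that every
  operation on a quotient is a formula on an arbitrarily chosen representative. Such a formula
  cannot be computed, but a map that kills the relators can be evaluated on it, and separation turns
  equal evaluations back into equal classes. Three points need a further idea. The limit is directed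
  because U satisfies the right Ore condition. The pairing of a universal dual V is not assumed
  injective and says nothing about the antipode: injectivity of V -> \<open>Dlin\<close> comes from
  uniqueness in the universal property, compatibility with antipodes from coassociativity. Finally,
  the differential spaces range over spaces carried by sequences only, so duals and tensor products
  are moved back there by coordinates, which leave the attached sequence unchanged.\<close>

lemma of_int_fun_apply: "(of_int c :: 'a \<Rightarrow> 'b::ring_1) x = of_int c"
  by (cases c) (simp_all add: of_nat_fun_apply)

lemmas fun_apply = plus_fun_apply zero_fun_apply times_fun_apply minus_apply uminus_apply
  of_nat_fun_apply of_int_fun_apply

text \<open>
  As simplification rules these would also rewrite unapplied sums of sequences given by abstractions,
  which should stay identities between sequences.
\<close>

declare fun_apply [simp del] one_fun_apply [simp del]

notation hurwitz_mult (infixl \<open>\<star>\<close> 70)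

lemma derivation_0 [simp]: "\<partial> (0::'k::differential_field) = 0"
  using derivation_add[of "0::'k" 0] by (metis add.right_neutral add_left_cancel)

lemma derivation_1 [simp]: "\<partial> (1::'k::differential_field) = 0"
  using derivation_mult[of "1::'k" 1] by (metis add_cancel_left_left mult.left_neutral mult.right_neutral)

lemma derivation_minus: "\<partial> (- x) = - \<partial> (x::'k::differential_field)"
  using derivation_add[of x "- x"] by (simp add: eq_neg_iff_add_eq_0 add.commute)

lemma derivation_diff: "\<partial> (x - y) = \<partial> x - \<partial> (y::'k::differential_field)"
  using derivation_add[of x "- y"] by (simp add: derivation_minus)

lemma derivation_sum: "\<partial> (sum f A) = (\<Sum>i\<in>A. \<partial> (f i :: 'k::differential_field))"
  by (induction A rule: infinite_finite_induct) (auto simp: derivation_add)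

lemma derivation_power_add: "(\<partial> ^^ n) (x + y) = (\<partial> ^^ n) x + (\<partial> ^^ n) (y::'k::differential_field)"
  by (induction n) (auto simp: derivation_add)

lemma derivation_power_0 [simp]: "(\<partial> ^^ n) (0::'k::differential_field) = 0"
  by (induction n) auto

lemma derivation_of_nat [simp]: "\<partial> (of_nat n :: 'k::differential_field) = 0"
  by (induction n) (auto simp: derivation_add)

text \<open>Pascal's rule for a sum over paths: \<open>f k j\<close> belongs to k steps of one kind
  and j of another, and one further step is of either kind. The product rule of the shift, its
  iterated form and the recursions for the antipode are instances.\<close>

lemma pascal_sum:
  fixes f :: "nat \<Rightarrow> nat \<Rightarrow> 'a::comm_ring_1"
  shows "(\<Sum>k\<le>Suc n. of_nat (Suc n choose k) * f k (Suc n - k)) =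
    (\<Sum>k\<le>n. of_nat (n choose k) * (f (Suc k) (n - k) + f k (Suc (n - k))))"
proof -
  have "(\<Sum>k\<le>Suc n. of_nat (Suc n choose k) * f k (Suc n - k)) =
      f 0 (Suc n) + (\<Sum>k\<le>n. of_nat (Suc n choose Suc k) * f (Suc k) (n - k))"
    by (subst sum.atMost_Suc_shift) simp
  also have "\<dots> = f 0 (Suc n) + (\<Sum>k\<le>n. of_nat (n choose Suc k) * f (Suc k) (n - k))
      + (\<Sum>k\<le>n. of_nat (n choose k) * f (Suc k) (n - k))"
    by (simp add: sum.distrib algebra_simps)
  also have "f 0 (Suc n) + (\<Sum>k\<le>n. of_nat (n choose Suc k) * f (Suc k) (n - k)) =
      (\<Sum>k\<le>Suc n. of_nat (n choose k) * f k (Suc n - k))"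
    by (subst sum.atMost_Suc_shift) simp
  also have "\<dots> = (\<Sum>k\<le>n. of_nat (n choose k) * f k (Suc (n - k)))"
    by (simp add: binomial_eq_0 Suc_diff_le)
  finally show ?thesis by (simp add: sum.distrib algebra_simps)
qed

lemma seq_shift_add [simp]: "seq_shift (\<alpha> + \<beta>) = seq_shift \<alpha> + seq_shift \<beta>"
  by (auto simp: fun_apply seq_shift_def)

lemma seq_shift_diff [simp]: "seq_shift (\<alpha> - \<beta>) = seq_shift \<alpha> - seq_shift \<beta>"
  by (auto simp: fun_apply seq_shift_def)

lemma seq_shift_0 [simp]: "seq_shift 0 = 0"
  by (auto simp: fun_apply seq_shift_def)

lemma sum_fun_apply: "(\<Sum>i\<in>A. f i) n = (\<Sum>i\<in>A. f i n)"
  by (induction A rule: infinite_finite_induct) (auto simp: fun_apply)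

lemma seq_shift_sum: "seq_shift (\<Sum>i\<in>A. f i) = (\<Sum>i\<in>A. seq_shift (f i))"
  by (auto simp: fun_apply seq_shift_def sum_fun_apply)

lemma seq_shift_funpow: "(seq_shift ^^ m) \<alpha> n = \<alpha> (m + n)"
  by (induction m arbitrary: n) (auto simp: seq_shift_def)

lemma hurwitz_0: "(\<alpha> \<star> \<beta>) 0 = \<alpha> 0 * \<beta> 0"
  by (simp add: hurwitz_mult_def)

text \<open>The shift is a derivation; this and the value at 0 determine the product. Commutativity
  and associativity follow by induction on the place with the sequences left arbitrary, since place
  n + 1 is place n of the shift.\<close>

lemma hurwitz_shift: "seq_shift (\<alpha> \<star> \<beta>) = seq_shift \<alpha> \<star> \<beta> + \<alpha> \<star> seq_shift \<beta>"
proof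
  fix n
  show "seq_shift (\<alpha> \<star> \<beta>) n = (seq_shift \<alpha> \<star> \<beta> + \<alpha> \<star> seq_shift \<beta>) n"
    using pascal_sum[of n "\<lambda>i j. \<alpha> i * \<beta> j"]
    by (simp add: fun_apply seq_shift_def hurwitz_mult_def mult.assoc sum.distrib distrib_left)
qed

lemma hurwitz_add_left: "(\<alpha> + \<beta>) \<star> \<gamma> = \<alpha> \<star> \<gamma> + \<beta> \<star> \<gamma>"
  by (auto simp: fun_apply hurwitz_mult_def algebra_simps sum.distrib)

lemma hurwitz_add_right: "\<gamma> \<star> (\<alpha> + \<beta>) = \<gamma> \<star> \<alpha> + \<gamma> \<star> \<beta>"
  by (auto simp: fun_apply hurwitz_mult_def algebra_simps sum.distrib)

lemma hurwitz_diff_left: "(\<alpha> - \<beta>) \<star> \<gamma> = \<alpha> \<star> \<gamma> - \<beta> \<star> \<gamma>"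
  by (auto simp: fun_apply hurwitz_mult_def algebra_simps sum_subtractf)

lemma hurwitz_diff_right: "\<gamma> \<star> (\<alpha> - \<beta>) = \<gamma> \<star> \<alpha> - \<gamma> \<star> \<beta>"
  by (auto simp: fun_apply hurwitz_mult_def algebra_simps sum_subtractf)

lemma hurwitz_zero_left [simp]: "0 \<star> \<alpha> = 0"
  by (auto simp: fun_apply hurwitz_mult_def)

lemma hurwitz_zero_right [simp]: "\<alpha> \<star> 0 = 0"
  by (auto simp: fun_apply hurwitz_mult_def)

lemma hurwitz_sum_left: "(\<Sum>i\<in>A. f i) \<star> \<gamma> = (\<Sum>i\<in>A. f i \<star> \<gamma>)"
  by (induction A rule: infinite_finite_induct) (simp_all add: hurwitz_add_left)

lemma hurwitz_sum_right: "\<gamma> \<star> (\<Sum>i\<in>A. f i) = (\<Sum>i\<in>A. \<gamma> \<star> f i)"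
  by (induction A rule: infinite_finite_induct) (simp_all add: hurwitz_add_right)

lemma hurwitz_commute: "\<alpha> \<star> \<beta> = \<beta> \<star> \<alpha>"
proof -
  have "(\<alpha> \<star> \<beta>) n = (\<beta> \<star> \<alpha>) n" for n
  proof (induction n arbitrary: \<alpha> \<beta>)
    case (Suc n)
    have "seq_shift (\<alpha> \<star> \<beta>) n = seq_shift (\<beta> \<star> \<alpha>) n"
      by (simp add: hurwitz_shift Suc.IH[of _ \<beta>] Suc.IH[of \<alpha>] fun_apply add.commute)
    then show ?case by (simp add: seq_shift_def)
  qed (simp add: hurwitz_0)
  then show ?thesis by blast
qed

lemma hurwitz_assoc: "(\<alpha> \<star> \<beta>) \<star> \<gamma> = \<alpha> \<star> (\<beta> \<star> \<gamma>)"
proof -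
  have "((\<alpha> \<star> \<beta>) \<star> \<gamma>) n = (\<alpha> \<star> (\<beta> \<star> \<gamma>)) n" for n
  proof (induction n arbitrary: \<alpha> \<beta> \<gamma>)
    case (Suc n)
    have "seq_shift ((\<alpha> \<star> \<beta>) \<star> \<gamma>) n = seq_shift (\<alpha> \<star> (\<beta> \<star> \<gamma>)) n"
      by (simp add: hurwitz_shift hurwitz_add_left hurwitz_add_right Suc.IH fun_apply)
    then show ?case by (simp add: seq_shift_def)
  qed (simp add: hurwitz_0)
  then show ?thesis by blast
qed

lemma hurwitz_left_commute: "\<alpha> \<star> (\<beta> \<star> \<gamma>) = \<beta> \<star> (\<alpha> \<star> \<gamma>)"
  by (metis hurwitz_assoc hurwitz_commute)

lemmas hurwitz_ac = hurwitz_assoc hurwitz_commute hurwitz_left_commute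

lemma seq_source_mult: "seq_source x \<star> \<alpha> = (\<lambda>n. x * \<alpha> n)"
proof
  fix n
  have "(seq_source x \<star> \<alpha>) n = (\<Sum>k\<le>n. if k = 0 then x * \<alpha> n else 0)"
    unfolding hurwitz_mult_def by (rule sum.cong) (auto simp: seq_source_def)
  then show "(seq_source x \<star> \<alpha>) n = x * \<alpha> n" by simp
qed

lemma seq_source_1_mult [simp]: "seq_source 1 \<star> \<alpha> = \<alpha>"
  by (simp add: seq_source_mult)

lemma seq_source_hom:
  "seq_source (x + y) = seq_source x + seq_source y"
  "seq_source (x * y) = seq_source x \<star> seq_source y"
  "seq_source 0 = 0"
  by (auto simp: seq_source_mult fun_apply) (auto simp: seq_source_def fun_apply)

lemma seq_source_shift: "seq_shift (seq_source x) = 0"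
  by (auto simp: fun_apply seq_source_def seq_shift_def)

lemma seq_target_shift: "seq_shift (seq_target x) = seq_target (\<partial> x)"
  by (auto simp: fun_apply seq_target_def seq_shift_def funpow_swap1)

lemma seq_target_at_0 [simp]: "seq_target x 0 = x"
  by (simp add: seq_target_def)

lemma seq_target_add: "seq_target (x + y) = seq_target x + seq_target y"
  by (auto simp: fun_apply seq_target_def derivation_power_add)

lemma seq_target_0 [simp]: "seq_target 0 = 0"
  by (auto simp: fun_apply seq_target_def)

lemma seq_target_minus: "seq_target (- x) = - seq_target x"
  using seq_target_add[of x "- x"] by (simp add: eq_neg_iff_add_eq_0 add.commute)

lemma seq_target_diff: "seq_target (x - y) = seq_target x - seq_target y"
  using seq_target_add[of x "- y"] by (simp add: seq_target_minus)

lemma seq_target_sum: "seq_target (\<Sum>i\<in>A. f i) = (\<Sum>i\<in>A. seq_target (f i))"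
  by (induction A rule: infinite_finite_induct) (auto simp: seq_target_add)

lemma seq_target_constant: assumes "\<partial> c = 0" shows "seq_target c = seq_source c"
proof
  fix n
  show "seq_target c n = seq_source c n"
    using assms by (cases n) (simp_all add: seq_target_def seq_source_def funpow_Suc_right del: funpow.simps)
qed

lemma seq_target_1 [simp]: "seq_target 1 = seq_source 1"
  by (rule seq_target_constant) simp

lemma seq_target_mult: "seq_target (x * y) = seq_target x \<star> seq_target y"
proof -
  have "seq_target (x * y) n = (seq_target x \<star> seq_target y) n" for n
  proof (induction n arbitrary: x y)
    case (Suc n)
    have "seq_shift (seq_target (x * y)) n = seq_shift (seq_target x \<star> seq_target y) n"
      by (simp add: hurwitz_shift seq_target_shift derivation_mult seq_target_add Suc.IH fun_apply)
    then show ?case by (simp add: seq_shift_def)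
  qed (simp add: hurwitz_0)
  then show ?thesis by blast
qed

text \<open>\<open>of_nat\<close> is a constant function here and \<open>*\<close> the pointwise
  product, so the binomial factor is repeated addition and \<open>pascal_sum\<close> applies to
  sequences as it does to numbers.\<close>

lemma shift_mult_pow:
  "(seq_shift ^^ m) (\<alpha> \<star> \<beta>) = (\<Sum>k\<le>m. of_nat (m choose k) * ((seq_shift ^^ k) \<alpha> \<star> (seq_shift ^^ (m - k)) \<beta>))"
proof (induction m arbitrary: \<alpha> \<beta>)
  case (Suc m)
  have "(seq_shift ^^ Suc m) (\<alpha> \<star> \<beta>) = (seq_shift ^^ m) (seq_shift \<alpha> \<star> \<beta> + \<alpha> \<star> seq_shift \<beta>)"
    by (simp add: funpow_swap1 hurwitz_shift)
  also have "\<dots> = (seq_shift ^^ m) (seq_shift \<alpha> \<star> \<beta>) + (seq_shift ^^ m) (\<alpha> \<star> seq_shift \<beta>)"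
    by (auto simp: fun_apply seq_shift_funpow)
  also have "\<dots> = (\<Sum>k\<le>m. of_nat (m choose k) *
      ((seq_shift ^^ Suc k) \<alpha> \<star> (seq_shift ^^ (m - k)) \<beta> + (seq_shift ^^ k) \<alpha> \<star> (seq_shift ^^ Suc (m - k)) \<beta>))"
    by (simp add: Suc.IH funpow_swap1 sum.distrib distrib_left)
  also have "\<dots> = (\<Sum>k\<le>Suc m. of_nat (Suc m choose k) * ((seq_shift ^^ k) \<alpha> \<star> (seq_shift ^^ (Suc m - k)) \<beta>))"
    by (rule pascal_sum[symmetric])
  finally show ?case .
qed simp

section \<open>The antipode as an involution exchanging two derivations\<close>

subsection \<open>The antipode of a sequence\<close>

definition seq_deriv :: "(nat \<Rightarrow> 'k::differential_field) \<Rightarrow> nat \<Rightarrow> 'k" where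
  "seq_deriv \<alpha> = (\<lambda>n. \<partial> (\<alpha> n))"

text \<open>The difference of two commuting derivations of the Hurwitz product, entrywise
  differentiation and the shift. Its constants are the target sequences, as those of the shift are
  the source sequences; the antipode exchanges \<open>seq_diff\<close> and the shift.\<close>

definition seq_diff :: "(nat \<Rightarrow> 'k::differential_field) \<Rightarrow> nat \<Rightarrow> 'k" where
  "seq_diff \<alpha> = seq_deriv \<alpha> - seq_shift \<alpha>"

lemma seq_deriv_diff: "seq_deriv (\<alpha> - \<beta>) = seq_deriv \<alpha> - seq_deriv \<beta>"
  by (auto simp: fun_apply seq_deriv_def derivation_diff)

lemma seq_deriv_shift: "seq_deriv (seq_shift \<alpha>) = seq_shift (seq_deriv \<alpha>)"
  by (auto simp: fun_apply seq_deriv_def seq_shift_def)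

lemma seq_deriv_mult: "seq_deriv (\<alpha> \<star> \<beta>) = seq_deriv \<alpha> \<star> \<beta> + \<alpha> \<star> seq_deriv \<beta>"
  by (auto simp: fun_apply seq_deriv_def hurwitz_mult_def derivation_sum derivation_mult algebra_simps sum.distrib)

lemma seq_deriv_target: "seq_deriv (seq_target x) = seq_target (\<partial> x)"
  by (auto simp: fun_apply seq_deriv_def seq_target_def funpow_swap1)

lemma seq_diff_mult: "seq_diff (\<alpha> \<star> \<beta>) = seq_diff \<alpha> \<star> \<beta> + \<alpha> \<star> seq_diff \<beta>"
  by (simp add: seq_diff_def seq_deriv_mult hurwitz_shift hurwitz_diff_left hurwitz_diff_right)

lemma seq_diff_target: "seq_diff (seq_target x) = 0"
  by (simp add: seq_diff_def seq_deriv_target seq_target_shift)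

lemma antipode_at_0 [simp]: "dlin_antipode \<alpha> 0 = \<alpha> 0"
  by (simp add: dlin_antipode_def)

text \<open>Pascal's rule for (-1)^j times the k-th derivative of entry j. With the value at 0 this
  is a recursion for the antipode; as \<open>seq_diff\<close> is a derivation, multiplicativity
  follows from it by induction on the place.\<close>

lemma antipode_shift: "seq_shift (dlin_antipode \<alpha>) = dlin_antipode (seq_diff \<alpha>)"
proof
  fix n
  have p: "(\<partial> ^^ k) (x - y) = (\<partial> ^^ k) x - (\<partial> ^^ k) (y::'a)" for k x y
    by (induction k) (auto simp: derivation_diff)
  have "seq_shift (dlin_antipode \<alpha>) n =
     (\<Sum>k\<le>Suc n. of_nat (Suc n choose k) * ((- 1) ^ (Suc n - k) * (\<partial> ^^ k) (\<alpha> (Suc n - k))))"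
    by (simp add: seq_shift_def dlin_antipode_def mult.assoc del: sum.atMost_Suc)
  also have "\<dots> = (\<Sum>k\<le>n. of_nat (n choose k) * ((- 1) ^ (n - k) * (\<partial> ^^ Suc k) (\<alpha> (n - k))
       + (- 1) ^ (Suc (n - k)) * (\<partial> ^^ k) (\<alpha> (Suc (n - k)))))"
    by (rule pascal_sum)
  also have "\<dots> = dlin_antipode (seq_diff \<alpha>) n"
    unfolding dlin_antipode_def
    by (rule sum.cong) (auto simp: seq_diff_def seq_deriv_def seq_shift_def p funpow_swap1 fun_apply algebra_simps)
  finally show "seq_shift (dlin_antipode \<alpha>) n = dlin_antipode (seq_diff \<alpha>) n" .
qed

lemma antipode_add: "dlin_antipode (\<alpha> + \<beta>) = dlin_antipode \<alpha> + dlin_antipode \<beta>"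
  by (auto simp: fun_apply dlin_antipode_def derivation_power_add sum.distrib algebra_simps)

lemma antipode_0 [simp]: "dlin_antipode 0 = 0"
  by (auto simp: fun_apply dlin_antipode_def)

lemma antipode_diff: "dlin_antipode (\<alpha> - \<beta>) = dlin_antipode \<alpha> - dlin_antipode \<beta>"
  using antipode_add[of "\<alpha> - \<beta>" \<beta>] by simp

lemma antipode_deriv: "seq_deriv (dlin_antipode \<alpha>) = dlin_antipode (seq_deriv \<alpha>)"
proof -
  have "seq_deriv (dlin_antipode \<alpha>) n = dlin_antipode (seq_deriv \<alpha>) n" for n
  proof (induction n arbitrary: \<alpha>)
    case (Suc n)
    have "seq_shift (seq_deriv (dlin_antipode \<alpha>)) n = seq_shift (dlin_antipode (seq_deriv \<alpha>)) n"
      by (simp add: seq_deriv_shift[symmetric] antipode_shift Suc.IH)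
        (simp add: seq_diff_def seq_deriv_diff seq_deriv_shift)
    then show ?case by (simp add: seq_shift_def)
  qed (simp add: seq_deriv_def)
  then show ?thesis by blast
qed

text \<open>The shift is \<open>seq_deriv\<close> minus \<open>seq_diff\<close>, and the antipode
  commutes with the former. Together with \<open>antipode_shift\<close> it makes the square of the
  antipode commute with the shift, so that the square is the identity.\<close>

lemma antipode_of_shift: "dlin_antipode (seq_shift \<alpha>) = seq_diff (dlin_antipode \<alpha>)"
proof -
  have "dlin_antipode (seq_shift \<alpha>) = dlin_antipode (seq_deriv \<alpha>) - dlin_antipode (seq_diff \<alpha>)"
    by (simp add: antipode_diff[symmetric] seq_diff_def)
  then show ?thesis by (simp add: antipode_deriv[symmetric] antipode_shift[symmetric] seq_diff_def[of "dlin_antipode \<alpha>"])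
qed

lemma antipode_antipode: "dlin_antipode (dlin_antipode \<alpha>) = \<alpha>"
proof -
  have "dlin_antipode (dlin_antipode \<alpha>) n = \<alpha> n" for n
  proof (induction n arbitrary: \<alpha>)
    case (Suc n)
    have "seq_shift (dlin_antipode (dlin_antipode \<alpha>)) n = seq_shift \<alpha> n"
      by (simp add: antipode_shift antipode_of_shift[symmetric] Suc.IH)
    then show ?case by (simp add: seq_shift_def)
  qed simp
  then show ?thesis by blast
qed

lemma antipode_mult: "dlin_antipode (\<alpha> \<star> \<beta>) = dlin_antipode \<alpha> \<star> dlin_antipode \<beta>"
proof -
  have "dlin_antipode (\<alpha> \<star> \<beta>) n = (dlin_antipode \<alpha> \<star> dlin_antipode \<beta>) n" for n
  proof (induction n arbitrary: \<alpha> \<beta>)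
    case (Suc n)
    have "seq_shift (dlin_antipode (\<alpha> \<star> \<beta>)) n = seq_shift (dlin_antipode \<alpha> \<star> dlin_antipode \<beta>) n"
      by (simp add: antipode_shift seq_diff_mult antipode_add hurwitz_shift Suc.IH fun_apply)
    then show ?case by (simp add: seq_shift_def)
  qed (simp add: hurwitz_0)
  then show ?thesis by blast
qed

lemma antipode_target: "dlin_antipode (seq_target x) = seq_source x"
proof
  fix n
  show "dlin_antipode (seq_target x) n = seq_source x n"
  proof (cases n)
    case (Suc m)
    have "seq_shift (dlin_antipode (seq_target x)) m = 0"
      by (simp add: antipode_shift seq_diff_target zero_fun_apply)
    then show ?thesis by (simp add: Suc seq_shift_def seq_source_def)
  qed (simp add: seq_source_def)
qed

lemma antipode_source: "dlin_antipode (seq_source x) = seq_target x"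
  using antipode_antipode[of "seq_target x"] by (simp add: antipode_target)

text \<open>Trades the antipode of the right factor for the sequences \<alpha> t(\<beta>(l)), which
  are the evaluations of the tensor \<alpha> (x) \<beta>; the antipode axioms rest on this.\<close>

lemma mult_antipode_expand:
  "(\<alpha> \<star> dlin_antipode \<beta>) n =
    (\<Sum>l\<le>n. of_nat (n choose l) * ((- 1) ^ l * (\<alpha> \<star> seq_target (\<beta> l)) (n - l)))"
proof (induction n arbitrary: \<alpha> \<beta>)
  case 0
  show ?case by (simp add: hurwitz_0)
next
  case (Suc n)
  have e: "(\<alpha> \<star> seq_target (\<beta> l)) (Suc j) = (seq_shift \<alpha> \<star> seq_target (\<beta> l)) j +
     (\<alpha> \<star> seq_target (seq_deriv \<beta> l)) j" for l j
    using fun_cong[OF hurwitz_shift[of \<alpha> "seq_target (\<beta> l)"], of j]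
    by (simp add: seq_shift_def[of "_ \<star> _"] seq_target_shift seq_deriv_def fun_apply)
  have "(\<alpha> \<star> dlin_antipode \<beta>) (Suc n) = seq_shift (\<alpha> \<star> dlin_antipode \<beta>) n"
    by (simp add: seq_shift_def)
  also have "\<dots> = (seq_shift \<alpha> \<star> dlin_antipode \<beta>) n + (\<alpha> \<star> dlin_antipode (seq_deriv \<beta>)) n
      - (\<alpha> \<star> dlin_antipode (seq_shift \<beta>)) n"
    by (simp add: hurwitz_shift antipode_shift seq_diff_def antipode_diff hurwitz_diff_right fun_apply)
  also have "\<dots> = (\<Sum>l\<le>n. of_nat (n choose l) * ((- 1) ^ Suc l * (\<alpha> \<star> seq_target (\<beta> (Suc l))) (n - l)
      + (- 1) ^ l * (\<alpha> \<star> seq_target (\<beta> l)) (Suc (n - l))))"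
    unfolding Suc.IH e
    by (simp add: sum.distrib[symmetric] sum_subtractf[symmetric] algebra_simps)
      (simp add: seq_shift_def)
  also have "\<dots> = (\<Sum>l\<le>Suc n. of_nat (Suc n choose l) * ((- 1) ^ l * (\<alpha> \<star> seq_target (\<beta> l)) (Suc n - l)))"
    by (rule pascal_sum[symmetric])
  finally show ?case .
qed

section \<open>Extension of maps on generators to free abelian groups\<close>

section \<open>Additive maps out of free abelian groups\<close>

text \<open>Integer multiples are products with \<open>of_int\<close>, which is why the values lie
  in a commutative ring; for sequences that ring is the pointwise one, not the Hurwitz ring.\<close>

definition fsum :: "('g \<Rightarrow> 'b::comm_ring_1) \<Rightarrow> ('g \<Rightarrow>\<^sub>0 int) \<Rightarrow> 'b" where
  "fsum f u = (\<Sum>p\<in>Poly_Mapping.keys u. of_int (Poly_Mapping.lookup u p) * f p)"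

lemma fsum_superset:
  assumes "finite A" "Poly_Mapping.keys u \<subseteq> A"
  shows "fsum f u = (\<Sum>p\<in>A. of_int (Poly_Mapping.lookup u p) * f p)"
  unfolding fsum_def using assms by (intro sum.mono_neutral_left) (auto simp: in_keys_iff)

lemma fsum_0 [simp]: "fsum f 0 = 0"
  by (simp add: fsum_def)

lemma fsum_of [simp]: "fsum f (frag_of p) = f p"
  by (simp add: fsum_def)

lemma fsum_diff: "fsum f (u - v) = fsum f u - fsum f v"
proof -
  let ?A = "Poly_Mapping.keys u \<union> Poly_Mapping.keys v"
  have "Poly_Mapping.keys (u - v) \<subseteq> ?A" by (rule keys_diff)
  then show ?thesis
    by (simp add: fsum_superset[of ?A] lookup_minus sum_subtractf left_diff_distrib)
qed

lemma fsum_add: "fsum f (u + v) = fsum f u + fsum f v"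
  using fsum_diff[of f "u + v" v] by simp

lemma fsum_sum: "fsum f (\<Sum>i\<in>I. u i) = (\<Sum>i\<in>I. fsum f (u i))"
  by (induction I rule: infinite_finite_induct) (auto simp: fsum_add)

lemma fsum_cong: "(\<And>p. p \<in> Poly_Mapping.keys u \<Longrightarrow> f p = g p) \<Longrightarrow> fsum f u = fsum g u"
  unfolding fsum_def by (rule sum.cong) auto

lemma fsum_frag_extend: "fsum f (frag_extend g u) = fsum (\<lambda>p. fsum f (g p)) u"
  by (rule frag_induction[of u UNIV]) (auto simp: frag_extend_diff fsum_diff)

lemma fsum_hom:
  assumes "\<And>x y. h (x - y) = h x - h y"
  shows "h (fsum f u) = fsum (\<lambda>p. h (f p)) u"
proof (rule frag_induction[of u UNIV])
  show "h (fsum f 0) = fsum (\<lambda>p. h (f p)) 0"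
    using assms[of 0 0] by simp
qed (auto simp: fsum_diff assms)

lemma fsum_add_fun: "fsum (\<lambda>p. f p + g p) u = fsum f u + fsum g u"
  by (rule frag_induction[of u UNIV]) (auto simp: fsum_diff)

lemma fsum_zero_fun [simp]: "fsum (\<lambda>p. 0) u = 0"
  by (simp add: fsum_def)

lemma fsum_sum_fun: "fsum (\<lambda>p. \<Sum>i\<in>I. f i p) u = (\<Sum>i\<in>I. fsum (f i) u)"
  by (induction I rule: infinite_finite_induct) (auto simp: fsum_add_fun)

lemma fsum_at: "fsum f u n = fsum (\<lambda>p. f p n) u"
  by (rule fsum_hom[of "\<lambda>\<alpha>. \<alpha> n"]) (simp add: fun_apply)

lemma keys_diff_subset: "Poly_Mapping.keys u \<subseteq> S \<Longrightarrow> Poly_Mapping.keys v \<subseteq> S \<Longrightarrow> Poly_Mapping.keys (u - v) \<subseteq> S"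
  using keys_diff[of u v] by blast

lemma keys_add_subset: "Poly_Mapping.keys u \<subseteq> S \<Longrightarrow> Poly_Mapping.keys v \<subseteq> S \<Longrightarrow> Poly_Mapping.keys (u + v) \<subseteq> S"
  using Poly_Mapping.keys_add[of u v] by blast

lemma keys_sum_subset: "(\<And>i. i \<in> I \<Longrightarrow> Poly_Mapping.keys (u i) \<subseteq> S) \<Longrightarrow> Poly_Mapping.keys (\<Sum>i\<in>I. u i) \<subseteq> S"
  using keys_sum[of u I] by blast

lemma keys_frag_of_subset: "p \<in> S \<Longrightarrow> Poly_Mapping.keys (frag_of p) \<subseteq> S"
  by simp

lemma keys_frag_extend_subset:
  "(\<And>p. p \<in> Poly_Mapping.keys u \<Longrightarrow> Poly_Mapping.keys (g p) \<subseteq> S) \<Longrightarrow> Poly_Mapping.keys (frag_extend g u) \<subseteq> S"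
  using keys_frag_extend[of g u] by blast

lemmas keys_subset_intros = keys_diff_subset keys_add_subset keys_sum_subset keys_frag_of_subset
  keys_frag_extend_subset

text \<open>Connects sums formed inside the record \<open>A\<close> with sums in a type: after an
  additive \<open>f\<close>, usually an embedding into sequences, the operations of the record
  disappear.\<close>

lemma additive_extension_fsum:
  fixes f :: "'a \<Rightarrow> 'b::comm_ring_1" and g :: "'p \<Rightarrow> 'a"
  assumes A: "abelian_group A"
    and f: "\<And>x y. x \<in> carrier A \<Longrightarrow> y \<in> carrier A \<Longrightarrow> f (x \<oplus>\<^bsub>A\<^esub> y) = f x + f y"
    and g: "\<And>p. p \<in> Poly_Mapping.keys (rep X) \<Longrightarrow> g p \<in> carrier A"
  shows "additive_extension A g X \<in> carrier A"
    and "f (additive_extension A g X) = fsum (\<lambda>p. f (g p)) (rep X)"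
proof -
  interpret abelian_group A by fact
  have f0: "f \<zero>\<^bsub>A\<^esub> = 0"
    using f[of "\<zero>\<^bsub>A\<^esub>" "\<zero>\<^bsub>A\<^esub>"] by simp
  have fneg: "f (\<ominus>\<^bsub>A\<^esub> x) = - f x" if "x \<in> carrier A" for x
    using f[of "\<ominus>\<^bsub>A\<^esub> x" x] that f0 by (simp add: l_neg eq_neg_iff_add_eq_0)
  have fnat: "f ([n] \<cdot>\<^bsub>A\<^esub> x) = of_nat n * f x" if "x \<in> carrier A" for x and n :: nat
    using that by (induction n) (auto simp: f0 f algebra_simps)
  have fint: "f ([c] \<cdot>\<^bsub>A\<^esub> x) = of_int c * f x" if x: "x \<in> carrier A" for x and c :: int
  proof (cases "c \<ge> 0")
    case True
    then obtain n where c: "c = int n" using nonneg_int_cases by blast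
    have "[int n] \<cdot>\<^bsub>A\<^esub> x = [n] \<cdot>\<^bsub>A\<^esub> x"
      by (simp add: add_pow_def int_pow_int)
    with fnat[OF x, of n] show ?thesis by (simp add: c)
  next
    case False
    then obtain n where c: "c = - int n" by (metis int_cases2 of_nat_0_le_iff)
    have "[(- int n)] \<cdot>\<^bsub>A\<^esub> x = \<ominus>\<^bsub>A\<^esub> ([n] \<cdot>\<^bsub>A\<^esub> x)"
      using x a_group by (simp add: add_pow_def group.int_pow_neg int_pow_int a_inv_def)
    with fnat[OF x, of n] fneg[of "[n] \<cdot>\<^bsub>A\<^esub> x"] x show ?thesis by (simp add: c)
  qed
  have closed: "[c] \<cdot>\<^bsub>A\<^esub> g p \<in> carrier A" if "p \<in> Poly_Mapping.keys (rep X)" for p and c :: int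
    using g[OF that] by (rule add.int_pow_closed[folded add_pow_def, simplified])
  have fin: "f (\<Oplus>\<^bsub>A\<^esub>p\<in>P. h p) = (\<Sum>p\<in>P. f (h p))" if "finite P" "h \<in> P \<rightarrow> carrier A" for P :: "'p set" and h
    using that by (induction P) (auto simp: f0 f Pi_def)
  then show "f (additive_extension A g X) = fsum (\<lambda>p. f (g p)) (rep X)"
    unfolding additive_extension_def fsum_def
    by (subst fin) (use g closed in \<open>auto simp: Pi_def fint intro!: sum.cong\<close>)
  show "additive_extension A g X \<in> carrier A"
    unfolding additive_extension_def by (rule finsum_closed) (use closed in auto)
qed

lemma base_ring_simps [simp]:
  "carrier \<bbbK> = UNIV" "monoid.mult \<bbbK> x y = x * y" "one \<bbbK> = 1" "ring.zero \<bbbK> = 0" "add \<bbbK> x y = x + y"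
  by (auto simp: ring_of_type_algebra_def)

lemma cring_base_ring: "cring \<bbbK>"
  by (rule cring_from_type_algebra)

lemma additive_extension_base_ring: "additive_extension \<bbbK> g X = fsum g (rep X)"
proof -
  have "abelian_group \<bbbK>"
    using cring_base_ring by (intro ring.is_abelian_group) (rule cring.axioms(1))
  from additive_extension_fsum(2)[OF this, of "\<lambda>x. x" X g] show ?thesis by simp
qed

section \<open>Abelian groups by generators and relations, computed on representatives\<close>

section \<open>Presented abelian groups\<close>

locale presentation =
  fixes S :: "'g set" and R :: "('g \<Rightarrow>\<^sub>0 int) set"
  assumes relators: "r \<in> R \<Longrightarrow> Poly_Mapping.keys r \<subseteq> S"
begin

abbreviation "Rel \<equiv> relation_subgroup S R"
abbreviation "cls \<equiv> presented_class S R"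
abbreviation "Grp \<equiv> presented_group S R"

lemma Rel_subgroup: "subgroup Rel (free_Abelian_group S)"
  unfolding relation_subgroup_def
  by (rule group.generate_is_subgroup) (use relators in auto)

lemma Rel_0 [simp]: "0 \<in> Rel"
  using subgroup.one_closed[OF Rel_subgroup] by simp

lemma Rel_keys: "r \<in> Rel \<Longrightarrow> Poly_Mapping.keys r \<subseteq> S"
  using subgroup.mem_carrier[OF Rel_subgroup] by simp

lemma Rel_add: "r \<in> Rel \<Longrightarrow> r' \<in> Rel \<Longrightarrow> r + r' \<in> Rel"
  using subgroup.m_closed[OF Rel_subgroup] by simp

lemma Rel_minus: "r \<in> Rel \<Longrightarrow> - r \<in> Rel"
  using subgroup.m_inv_closed[OF Rel_subgroup, of r] Rel_keys[of r] by simp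

lemma Rel_diff: "r \<in> Rel \<Longrightarrow> r' \<in> Rel \<Longrightarrow> r - r' \<in> Rel"
  using Rel_add[of r "- r'"] Rel_minus[of r'] by simp

lemma Rel_sum: "(\<And>i. i \<in> I \<Longrightarrow> r i \<in> Rel) \<Longrightarrow> (\<Sum>i\<in>I. r i) \<in> Rel"
  by (induction I rule: infinite_finite_induct) (auto simp: Rel_add)

lemma Rel_relator: "r \<in> R \<Longrightarrow> r \<in> Rel"
  by (simp add: relation_subgroup_def generate.incl)

text \<open>Closure under differences covers inverses, as 0 - v, and sums, as u - (0 - v). Later
  inductions thus only need maps compatible with subtraction.\<close>

lemma Rel_induct [consumes 1, case_names relator zero diff]:
  assumes "u \<in> Rel" "\<And>r. r \<in> R \<Longrightarrow> P r" "P 0" "\<And>u v. P u \<Longrightarrow> P v \<Longrightarrow> P (u - v)"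
  shows "P u"
  using assms(1)[unfolded relation_subgroup_def]
proof (induction rule: generate.induct)
  case one
  with assms(3) show ?case by simp
next
  case (incl h)
  with assms(2) show ?case by simp
next
  case (inv h)
  with assms(4)[OF assms(3) assms(2)[OF inv]] relators[OF inv] show ?case by simp
next
  case (eng h1 h2)
  with assms(4)[OF eng(3) assms(4)[OF assms(3) eng(4)]] show ?case by simp
qed

lemma fsum_Rel: "u \<in> Rel \<Longrightarrow> (\<And>r. r \<in> R \<Longrightarrow> fsum f r = 0) \<Longrightarrow> fsum f u = 0"
  by (induction rule: Rel_induct) (auto simp: fsum_diff)

lemma frag_extend_Rel:
  assumes "u \<in> Rel" "presentation S' R'" "\<And>r. r \<in> R \<Longrightarrow> frag_extend g r \<in> relation_subgroup S' R'"
  shows "frag_extend g u \<in> relation_subgroup S' R'"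
  using assms(1)
proof (induction rule: Rel_induct)
  case zero
  show ?case using presentation.Rel_0[OF assms(2)] by simp
qed (auto simp: frag_extend_diff assms(3) presentation.Rel_diff[OF assms(2)])

lemma cls_eq: "cls u = {r + u | r. r \<in> Rel}"
  by (auto simp: presented_class_def r_coset_def)

lemma cls_eq_iff: "cls u = cls v \<longleftrightarrow> u - v \<in> Rel"
proof
  assume "cls u = cls v"
  moreover have "u \<in> cls u" using Rel_0 by (auto simp: cls_eq intro!: exI[of _ 0])
  ultimately obtain r where "r \<in> Rel" "u = r + v" by (auto simp: cls_eq)
  then show "u - v \<in> Rel" by simp
next
  assume uv: "u - v \<in> Rel"
  have "r + u \<in> cls v" if "r \<in> Rel" for r
    using Rel_add[OF that uv] by (auto simp: cls_eq intro!: exI[of _ "r + (u - v)"])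
  moreover have "r + v \<in> cls u" if "r \<in> Rel" for r
    using Rel_diff[OF that uv] by (auto simp: cls_eq intro!: exI[of _ "r - (u - v)"])
  ultimately show "cls u = cls v" by (auto simp: cls_eq)
qed

lemma carrier_Grp: "X \<in> carrier Grp \<longleftrightarrow> (\<exists>u. Poly_Mapping.keys u \<subseteq> S \<and> X = cls u)"
  by (simp only: presented_group_def FactGroup_def RCOSETS_def presented_class_def
      partial_object.select_convs UN_iff singleton_iff carrier_free_Abelian_group_iff Bex_def)

lemma cls_in_carrier: "Poly_Mapping.keys u \<subseteq> S \<Longrightarrow> cls u \<in> carrier Grp"
  by (auto simp: carrier_Grp)

lemma rep_cls: "rep (cls u) - u \<in> Rel"
proof -
  have "u \<in> cls u" using Rel_0 by (auto simp: cls_eq intro!: exI[of _ 0])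
  then have "rep (cls u) \<in> cls u" unfolding rep_def by (rule someI)
  then show ?thesis by (auto simp: cls_eq)
qed

lemma rep_keys: "X \<in> carrier Grp \<Longrightarrow> Poly_Mapping.keys (rep X) \<subseteq> S"
  using Rel_keys[OF rep_cls] keys_add_subset[of "rep (cls u) - u" S u for u]
  by (auto simp only: carrier_Grp diff_add_cancel)

lemma cls_rep: "X \<in> carrier Grp \<Longrightarrow> cls (rep X) = X"
  by (elim carrier_Grp[THEN iffD1, elim_format] exE conjE) (simp only: cls_eq_iff rep_cls)

text \<open>The chosen representative differs from \<open>u\<close> by a relation. A map killing the
  relators therefore does not see the choice; this is how all formulas involving \<open>rep\<close>
  are evaluated.\<close>

lemma fsum_rep_cls: "(\<And>r. r \<in> R \<Longrightarrow> fsum f r = 0) \<Longrightarrow> fsum f (rep (cls u)) = fsum f u"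
  using fsum_Rel[OF rep_cls, of f u] by (simp add: fsum_diff)

lemma mult_Grp: "cls u \<otimes>\<^bsub>Grp\<^esub> cls v = cls (u + v)"
proof -
  have "r + u + (r' + v) \<in> cls (u + v)" if "r \<in> Rel" "r' \<in> Rel" for r r'
    using Rel_add[OF that] by (auto simp: cls_eq intro!: exI[of _ "r + r'"])
  moreover have "\<exists>r'\<in>Rel. \<exists>r''\<in>Rel. r + (u + v) = r' + u + (r'' + v)" if "r \<in> Rel" for r
    using that Rel_0 by (intro bexI[of _ r] bexI[of _ 0]) auto
  ultimately show ?thesis
    by (auto simp: presented_group_def FactGroup_def set_mult_def cls_eq)
qed

lemma one_Grp: "one Grp = cls 0"
  by (auto simp: presented_group_def FactGroup_def cls_eq)

end

section \<open>Separation of tensors by evaluation at places\<close>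

section \<open>Tensor products of spaces of sequences\<close>

text \<open>
  Every space and bimodule below is given together with an injective linear map to sequences; the
  base field acts on the left through \<open>seq_source\<close> and on the right through \<open>seq_target\<close>.
\<close>

locale seq_module =
  fixes N :: "('k::differential_field, 'b, 'z) module_scheme" and \<Psi> :: "'b \<Rightarrow> nat \<Rightarrow> 'k"
  assumes add_closed: "\<lbrakk>a \<in> carrier N; b \<in> carrier N\<rbrakk> \<Longrightarrow> a \<oplus>\<^bsub>N\<^esub> b \<in> carrier N"
    and zero_closed: "\<zero>\<^bsub>N\<^esub> \<in> carrier N"
    and smult_closed: "a \<in> carrier N \<Longrightarrow> x \<odot>\<^bsub>N\<^esub> a \<in> carrier N"
    and emb_add: "\<lbrakk>a \<in> carrier N; b \<in> carrier N\<rbrakk> \<Longrightarrow> \<Psi> (a \<oplus>\<^bsub>N\<^esub> b) = \<Psi> a + \<Psi> b"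
    and emb_zero: "\<Psi> \<zero>\<^bsub>N\<^esub> = 0"
    and emb_smult: "a \<in> carrier N \<Longrightarrow> \<Psi> (x \<odot>\<^bsub>N\<^esub> a) = seq_source x \<star> \<Psi> a"
    and emb_inj: "inj_on \<Psi> (carrier N)"
begin

lemma emb_eqI: "a \<in> carrier N \<Longrightarrow> b \<in> carrier N \<Longrightarrow> \<Psi> a = \<Psi> b \<Longrightarrow> a = b"
  using emb_inj by (auto dest: inj_onD)

text \<open>The axioms are identities and transfer back along the injective embedding; only inverses
  have to be supplied, and multiples by -1 serve.\<close>

lemma is_abelian_group: "abelian_group N"
proof (rule abelian_groupI)
  fix x assume x: "x \<in> carrier N"
  have "\<Psi> ((- 1) \<odot>\<^bsub>N\<^esub> x \<oplus>\<^bsub>N\<^esub> x) = \<Psi> \<zero>\<^bsub>N\<^esub>"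
    using x by (auto simp: emb_add emb_smult emb_zero smult_closed seq_source_mult fun_apply)
  then show "\<exists>y\<in>carrier N. y \<oplus>\<^bsub>N\<^esub> x = \<zero>\<^bsub>N\<^esub>"
    using x by (intro bexI[of _ "(- 1) \<odot>\<^bsub>N\<^esub> x"] emb_eqI) (auto simp: add_closed smult_closed zero_closed)
qed (auto intro!: emb_eqI simp: add_closed zero_closed emb_add emb_zero algebra_simps)

lemma is_module: "module \<bbbK> N"
  by (rule moduleI[OF cring_base_ring is_abelian_group])
    (auto intro!: emb_eqI simp: add_closed smult_closed emb_add emb_smult seq_source_hom
      hurwitz_add_left hurwitz_add_right hurwitz_assoc)

lemma neg_closed: "a \<in> carrier N \<Longrightarrow> \<ominus>\<^bsub>N\<^esub> a \<in> carrier N"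
  by (rule abelian_group.a_inv_closed[OF is_abelian_group])

lemma emb_neg: "a \<in> carrier N \<Longrightarrow> \<Psi> (\<ominus>\<^bsub>N\<^esub> a) = - \<Psi> a"
  using emb_add[of "\<ominus>\<^bsub>N\<^esub> a" a] neg_closed[of a] abelian_group.l_neg[OF is_abelian_group, of a]
  by (simp add: emb_zero eq_neg_iff_add_eq_0)

lemma emb_additive_extension:
  assumes "\<And>p. p \<in> Poly_Mapping.keys (rep X) \<Longrightarrow> g p \<in> carrier N"
  shows "additive_extension N g X \<in> carrier N"
    and "\<Psi> (additive_extension N g X) = fsum (\<lambda>p. \<Psi> (g p)) (rep X)"
  using additive_extension_fsum[OF is_abelian_group emb_add assms] by auto

lemma lincomb_exists:
  assumes "\<And>j. j < (d::nat) \<Longrightarrow> e j \<in> carrier N"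
  shows "\<exists>n\<in>carrier N. \<Psi> n = (\<Sum>j<d. seq_source (c j) \<star> \<Psi> (e j))"
  using assms
proof (induction d)
  case 0
  show ?case using zero_closed emb_zero by auto
next
  case (Suc d)
  then obtain n where n: "n \<in> carrier N" "\<Psi> n = (\<Sum>j<d. seq_source (c j) \<star> \<Psi> (e j))"
    by auto
  then show ?case
    using Suc.prems[of d]
    by (intro bexI[of _ "n \<oplus>\<^bsub>N\<^esub> c d \<odot>\<^bsub>N\<^esub> e d"]) (auto simp: emb_add emb_smult smult_closed add_closed)
qed

text \<open>Gaussian elimination with places as pivots. Subtracting from a new \<open>b\<close> its
  interpolant leaves a vector vanishing at all old places; if it is non-zero, a place
  \<open>q\<close> where it does not vanish becomes the next pivot.\<close>

lemma interpolation:
  assumes "finite F" "F \<subseteq> carrier N"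
  shows "\<exists>(d::nat) p e. (\<forall>j<d. e j \<in> carrier N) \<and> (\<forall>j<d. \<forall>k<d. \<Psi> (e j) (p k) = of_bool (j = k)) \<and>
     (\<forall>b\<in>F. \<Psi> b = (\<Sum>j<d. seq_source (\<Psi> b (p j)) \<star> \<Psi> (e j)))"
  using assms
proof (induction F)
  case empty
  show ?case by (intro exI[of _ 0]) auto
next
  case (insert b F)
  then obtain d :: nat and p e where e: "\<forall>j<d. e j \<in> carrier N"
    and dual: "\<forall>j<d. \<forall>k<d. \<Psi> (e j) (p k) = of_bool (j = k)"
    and F: "\<forall>b\<in>F. \<Psi> b = (\<Sum>j<d. seq_source (\<Psi> b (p j)) \<star> \<Psi> (e j))"
    using insert.IH insert.prems by blast
  have b: "b \<in> carrier N" using insert.prems by auto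
  obtain n where n: "n \<in> carrier N" "\<Psi> n = (\<Sum>j<d. seq_source (\<Psi> b (p j)) \<star> \<Psi> (e j))"
    using lincomb_exists[of d e "\<lambda>j. \<Psi> b (p j)"] e by auto
  define r where "r = b \<oplus>\<^bsub>N\<^esub> \<ominus>\<^bsub>N\<^esub> n"
  have r: "r \<in> carrier N" "\<Psi> r = \<Psi> b - \<Psi> n"
    using b n neg_closed by (auto simp: r_def add_closed emb_add emb_neg)
  show ?case
  proof (cases "\<Psi> r = 0")
    case True
    then have "\<Psi> b = \<Psi> n" using r by simp
    with n(2) e dual F show ?thesis by (intro exI[of _ d] exI[of _ p] exI[of _ e]) auto
  next
    case False
    then obtain q where q: "\<Psi> r q \<noteq> 0" by (auto simp: fun_eq_iff zero_fun_apply)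
    have rp: "\<Psi> r (p k) = 0" if "k < d" for k
    proof -
      have "(\<Sum>j<d. \<Psi> b (p j) * of_bool (j = k)) = (\<Sum>j<d. if j = k then \<Psi> b (p j) else 0)"
        by (rule sum.cong) auto
      then show ?thesis
        using that dual by (simp add: r n(2) fun_apply sum_fun_apply seq_source_mult)
    qed
    define f where "f = (1 / \<Psi> r q) \<odot>\<^bsub>N\<^esub> r"
    have f: "f \<in> carrier N" "\<Psi> f = seq_source (1 / \<Psi> r q) \<star> \<Psi> r"
      using r by (auto simp: f_def smult_closed emb_smult)
    have fq: "\<Psi> f q = 1" and fp: "\<And>k. k < d \<Longrightarrow> \<Psi> f (p k) = 0"
      using q rp by (auto simp: f(2) seq_source_mult)
    \<comment> \<open>The old vectors are corrected so as to vanish at \<open>q\<close>; their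
      entries at the old places stay the same because \<open>f\<close> vanishes there.\<close>
    define e' where "e' = (\<lambda>j. if j < d then e j \<oplus>\<^bsub>N\<^esub> (- \<Psi> (e j) q) \<odot>\<^bsub>N\<^esub> f else f)"
    define p' where "p' = (\<lambda>j. if j < d then p j else q)"
    have e'_emb: "\<Psi> (e' j) = \<Psi> (e j) + seq_source (- \<Psi> (e j) q) \<star> \<Psi> f" if "j < d" for j
      using that e f by (simp add: e'_def emb_add emb_smult smult_closed)
    have e'_d: "\<Psi> (e' d) = \<Psi> f" by (simp add: e'_def)
    have 1: "\<forall>j<Suc d. e' j \<in> carrier N"
      using e f by (auto simp: e'_def add_closed smult_closed)
    have 2: "\<forall>j<Suc d. \<forall>k<Suc d. \<Psi> (e' j) (p' k) = of_bool (j = k)"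
      using dual fq fp
      by (auto simp: less_Suc_eq e'_emb e'_d p'_def seq_source_mult fun_apply)
    \<comment> \<open>The entry at \<open>q\<close> of such an \<open>a\<close> is \<open>c\<close>
      plus contributions of the old vectors, and the corrections in \<open>e'\<close> cancel the
      latter. The case \<open>c = 0\<close> serves the old elements, the case
      \<open>c = \<Psi> r q\<close> the new one.\<close>
    have 3: "\<Psi> a = (\<Sum>j<Suc d. seq_source (\<Psi> a (p' j)) \<star> \<Psi> (e' j))"
      if a: "\<Psi> a = (\<Sum>j<d. seq_source (\<Psi> a (p j)) \<star> \<Psi> (e j)) + seq_source c \<star> \<Psi> f" for a c
    proof
      fix i
      have "\<Psi> a q = (\<Sum>j<d. \<Psi> a (p j) * \<Psi> (e j) q) + c"
        by (subst a) (simp add: fun_apply sum_fun_apply seq_source_mult fq)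
      moreover have "\<Psi> a i = (\<Sum>j<d. \<Psi> a (p j) * \<Psi> (e j) i) + c * \<Psi> f i"
        by (subst a) (simp add: fun_apply sum_fun_apply seq_source_mult)
      ultimately show "\<Psi> a i = (\<Sum>j<Suc d. seq_source (\<Psi> a (p' j)) \<star> \<Psi> (e' j)) i"
        by (simp add: fun_apply sum_fun_apply seq_source_mult e'_emb e'_d p'_def algebra_simps
            sum.distrib sum_distrib_left sum_subtractf)
    qed
    have "\<Psi> b = \<Psi> n + seq_source (\<Psi> r q) \<star> \<Psi> f"
      using q by (auto simp: f(2) hurwitz_assoc[symmetric] seq_source_hom(2)[symmetric] r)
    then have "\<forall>a\<in>insert b F. \<Psi> a = (\<Sum>j<Suc d. seq_source (\<Psi> a (p' j)) \<star> \<Psi> (e' j))"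
      using 3[of b] 3[of _ 0] F n(2) by (auto simp: seq_source_hom(3))
    with 1 2 show ?thesis by blast
  qed
qed

end

locale seq_bimodule = seq_module M \<Phi>
  for M :: "('k::differential_field, 'a, 'z) bimodule_scheme" and \<Phi> +
  assumes rsmult_closed: "a \<in> carrier M \<Longrightarrow> rsmult M a x \<in> carrier M"
    and emb_rsmult: "a \<in> carrier M \<Longrightarrow> \<Phi> (rsmult M a x) = \<Phi> a \<star> seq_target x"
begin

lemma is_bimodule: "is_bimodule M"
proof -
  interpret module \<bbbK> M by (rule is_module)
  have ag: "abelian_group (M\<lparr>smult := \<lambda>x m. rsmult M m x\<rparr>)"
    by (rule abelian_groupI) (auto intro: a_assoc a_comm l_neg)
  have "module \<bbbK> (M\<lparr>smult := \<lambda>x m. rsmult M m x\<rparr>)"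
    by (rule moduleI[OF cring_base_ring ag])
      (auto intro!: emb_eqI simp: rsmult_closed emb_rsmult add_closed emb_add seq_target_add
        seq_target_mult hurwitz_add_left hurwitz_add_right hurwitz_ac)
  moreover have "c \<odot>\<^bsub>M\<^esub> m = rsmult M m c" if "c \<in> constants" "m \<in> carrier M" for c m
    using that by (intro emb_eqI)
      (auto simp: smult_closed rsmult_closed emb_rsmult emb_smult constants_def seq_target_constant
        hurwitz_commute)
  ultimately show ?thesis
    unfolding is_bimodule_def
    by (auto simp: is_module smult_closed rsmult_closed emb_rsmult emb_smult hurwitz_ac intro!: emb_eqI)
qed

end

text \<open>The m-th coordinate of a tensor: the entry of the right factor at \<open>m\<close> is
  moved across as a right scalar of the left factor, where it acts through t.\<close>

definition tensor_eval ::
    "('a \<Rightarrow> nat \<Rightarrow> 'k::differential_field) \<Rightarrow> ('b \<Rightarrow> nat \<Rightarrow> 'k) \<Rightarrow> ('a \<times> 'b \<Rightarrow>\<^sub>0 int) \<Rightarrow> nat \<Rightarrow> nat \<Rightarrow> 'k" where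
  "tensor_eval \<Phi> \<Psi> u m = fsum (\<lambda>(a, b). \<Phi> a \<star> seq_target (\<Psi> b m)) u"

text \<open>Iterated evaluation: the last two factors are evaluated at \<open>m\<close>, and the
  entry at \<open>l\<close> of the resulting sequence becomes a right scalar of the first
  factor.\<close>

definition tensor3_eval ::
    "('a \<Rightarrow> nat \<Rightarrow> 'k::differential_field) \<Rightarrow> ('b \<Rightarrow> nat \<Rightarrow> 'k) \<Rightarrow> ('a \<times> 'a \<times> 'b \<Rightarrow>\<^sub>0 int) \<Rightarrow>
      nat \<Rightarrow> nat \<Rightarrow> nat \<Rightarrow> 'k" where
  "tensor3_eval \<Phi> \<Psi> u m l = fsum (\<lambda>(a, b, c). \<Phi> a \<star> seq_target ((\<Phi> b \<star> seq_target (\<Psi> c m)) l)) u"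

lemma tensor_eval_diff: "tensor_eval \<Phi> \<Psi> (u - v) m = tensor_eval \<Phi> \<Psi> u m - tensor_eval \<Phi> \<Psi> v m"
  by (simp add: tensor_eval_def fsum_diff)

lemma tensor_eval_of [simp]: "tensor_eval \<Phi> \<Psi> (frag_of (a, b)) m = \<Phi> a \<star> seq_target (\<Psi> b m)"
  by (simp add: tensor_eval_def)

lemma tensor3_eval_diff: "tensor3_eval \<Phi> \<Psi> (u - v) m l = tensor3_eval \<Phi> \<Psi> u m l - tensor3_eval \<Phi> \<Psi> v m l"
  by (simp add: tensor3_eval_def fsum_diff)

lemma tensor_relations_cases [consumes 1, case_names left right balanced]:
  assumes "r \<in> tensor_relations M N"
  obtains a a' b where "a \<in> carrier M" "a' \<in> carrier M" "b \<in> carrier N"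
      "r = frag_of (a \<oplus>\<^bsub>M\<^esub> a', b) - frag_of (a, b) - frag_of (a', b)"
  | a b b' where "a \<in> carrier M" "b \<in> carrier N" "b' \<in> carrier N"
      "r = frag_of (a, b \<oplus>\<^bsub>N\<^esub> b') - frag_of (a, b) - frag_of (a, b')"
  | a b x where "a \<in> carrier M" "b \<in> carrier N"
      "r = frag_of (rsmult M a x, b) - frag_of (a, x \<odot>\<^bsub>N\<^esub> b)"
  using assms unfolding tensor_relations_def by blast

lemma tensor3_relations_intros:
  "\<lbrakk>a \<in> carrier L; a' \<in> carrier L; b \<in> carrier M; c \<in> carrier N\<rbrakk> \<Longrightarrow>
    frag_of (a \<oplus>\<^bsub>L\<^esub> a', b, c) - frag_of (a, b, c) - frag_of (a', b, c) \<in> tensor3_relations L M N"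
  "\<lbrakk>a \<in> carrier L; b \<in> carrier M; b' \<in> carrier M; c \<in> carrier N\<rbrakk> \<Longrightarrow>
    frag_of (a, b \<oplus>\<^bsub>M\<^esub> b', c) - frag_of (a, b, c) - frag_of (a, b', c) \<in> tensor3_relations L M N"
  "\<lbrakk>a \<in> carrier L; b \<in> carrier M; c \<in> carrier N; c' \<in> carrier N\<rbrakk> \<Longrightarrow>
    frag_of (a, b, c \<oplus>\<^bsub>N\<^esub> c') - frag_of (a, b, c) - frag_of (a, b, c') \<in> tensor3_relations L M N"
  "\<lbrakk>a \<in> carrier L; b \<in> carrier M; c \<in> carrier N\<rbrakk> \<Longrightarrow>
    frag_of (rsmult L a x, b, c) - frag_of (a, x \<odot>\<^bsub>M\<^esub> b, c) \<in> tensor3_relations L M N"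
  "\<lbrakk>a \<in> carrier L; b \<in> carrier M; c \<in> carrier N\<rbrakk> \<Longrightarrow>
    frag_of (a, rsmult M b x, c) - frag_of (a, b, x \<odot>\<^bsub>N\<^esub> c) \<in> tensor3_relations L M N"
  unfolding tensor3_relations_def by blast+

locale seq_pair = M: seq_bimodule M \<Phi> + N: seq_module N \<Psi>
  for M :: "('k::differential_field, 'a, 'z) bimodule_scheme" and \<Phi>
    and N :: "('k, 'b, 'w) module_scheme" and \<Psi>
begin

sublocale T: presentation "carrier M \<times> carrier N" "tensor_relations M N"
proof
  fix r assume "r \<in> tensor_relations M N"
  then show "Poly_Mapping.keys r \<subseteq> carrier M \<times> carrier N"
    by (auto simp only: tensor_relations_def Un_iff mem_Collect_eq)
      (auto dest!: subsetD[OF keys_diff] simp: M.add_closed N.add_closed N.smult_closed M.rsmult_closed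
        split: if_splits)
qed

lemma class_eq: "tensor_class M N = T.cls"
  by (rule ext) (simp add: tensor_class_def)

lemma group_eq: "tensor M N = T.Grp"
  by (simp add: tensor_def)

lemma relator_eval: "r \<in> tensor_relations M N \<Longrightarrow> tensor_eval \<Phi> \<Psi> r m = 0"
  by (auto simp: tensor_relations_def tensor_eval_def fsum_diff M.emb_add M.emb_rsmult N.emb_add
      N.emb_smult hurwitz_add_left hurwitz_add_right seq_target_add fun_apply seq_source_mult
      seq_target_mult hurwitz_assoc)

lemma eval_rep: "tensor_eval \<Phi> \<Psi> (rep (tensor_class M N u)) m = tensor_eval \<Phi> \<Psi> u m"
  unfolding class_eq tensor_eval_def
  by (rule T.fsum_rep_cls) (use relator_eval in \<open>auto simp: tensor_eval_def\<close>)

lemma rel_left: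
  "\<lbrakk>a \<in> carrier M; a' \<in> carrier M; b \<in> carrier N\<rbrakk> \<Longrightarrow>
    frag_of (a \<oplus>\<^bsub>M\<^esub> a', b) - frag_of (a, b) - frag_of (a', b) \<in> T.Rel"
  by (rule T.Rel_relator, unfold tensor_relations_def, rule UnI1, rule UnI1) blast

lemma rel_right:
  "\<lbrakk>a \<in> carrier M; b \<in> carrier N; b' \<in> carrier N\<rbrakk> \<Longrightarrow>
    frag_of (a, b \<oplus>\<^bsub>N\<^esub> b') - frag_of (a, b) - frag_of (a, b') \<in> T.Rel"
  by (rule T.Rel_relator, unfold tensor_relations_def, rule UnI1, rule UnI2) blast

lemma rel_balanced:
  "\<lbrakk>a \<in> carrier M; b \<in> carrier N\<rbrakk> \<Longrightarrow>
    frag_of (rsmult M a x, b) - frag_of (a, x \<odot>\<^bsub>N\<^esub> b) \<in> T.Rel"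
  by (rule T.Rel_relator, unfold tensor_relations_def, rule UnI2) blast

lemma zero_left_Rel: "b \<in> carrier N \<Longrightarrow> frag_of (\<zero>\<^bsub>M\<^esub>, b) \<in> T.Rel"
proof -
  assume "b \<in> carrier N"
  then have "frag_of (\<zero>\<^bsub>M\<^esub> \<oplus>\<^bsub>M\<^esub> \<zero>\<^bsub>M\<^esub>, b) - frag_of (\<zero>\<^bsub>M\<^esub>, b) - frag_of (\<zero>\<^bsub>M\<^esub>, b) \<in> T.Rel"
    by (intro rel_left) (auto simp: M.zero_closed)
  moreover have "\<zero>\<^bsub>M\<^esub> \<oplus>\<^bsub>M\<^esub> \<zero>\<^bsub>M\<^esub> = \<zero>\<^bsub>M\<^esub>"
    by (intro M.emb_eqI) (auto simp: M.add_closed M.zero_closed M.emb_add M.emb_zero)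
  ultimately show ?thesis using T.Rel_minus by fastforce
qed

lemma zero_right_Rel: "a \<in> carrier M \<Longrightarrow> frag_of (a, \<zero>\<^bsub>N\<^esub>) \<in> T.Rel"
proof -
  assume "a \<in> carrier M"
  then have "frag_of (a, \<zero>\<^bsub>N\<^esub> \<oplus>\<^bsub>N\<^esub> \<zero>\<^bsub>N\<^esub>) - frag_of (a, \<zero>\<^bsub>N\<^esub>) - frag_of (a, \<zero>\<^bsub>N\<^esub>) \<in> T.Rel"
    by (intro rel_right) (auto simp: N.zero_closed)
  moreover have "\<zero>\<^bsub>N\<^esub> \<oplus>\<^bsub>N\<^esub> \<zero>\<^bsub>N\<^esub> = \<zero>\<^bsub>N\<^esub>"
    by (intro N.emb_eqI) (auto simp: N.add_closed N.zero_closed N.emb_add N.emb_zero)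
  ultimately show ?thesis using T.Rel_minus by fastforce
qed

text \<open>\<open>b\<close> is known only through its sequence, so one summand is split off at a
  time and injectivity of the embedding identifies what is left.\<close>

lemma lincomb_Rel:
  assumes "a \<in> carrier M" "b \<in> carrier N" "\<And>j. j < (d::nat) \<Longrightarrow> e j \<in> carrier N"
    and "\<Psi> b = (\<Sum>j<d. seq_source (c j) \<star> \<Psi> (e j))"
  shows "frag_of (a, b) - (\<Sum>j<d. frag_of (rsmult M a (c j), e j)) \<in> T.Rel"
  using assms
proof (induction d arbitrary: b)
  case 0
  then have "b = \<zero>\<^bsub>N\<^esub>" by (intro N.emb_eqI) (auto simp: N.zero_closed N.emb_zero)
  with 0 show ?case by (simp add: zero_right_Rel)
next
  case (Suc d)
  let ?t = "c d \<odot>\<^bsub>N\<^esub> e d"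
  obtain b' where b': "b' \<in> carrier N" "\<Psi> b' = (\<Sum>j<d. seq_source (c j) \<star> \<Psi> (e j))"
    using N.lincomb_exists[of d e c] Suc.prems by auto
  have t: "?t \<in> carrier N" using Suc.prems by (auto intro: N.smult_closed)
  have b: "b = b' \<oplus>\<^bsub>N\<^esub> ?t"
    using b' t Suc.prems by (intro N.emb_eqI) (auto simp: N.add_closed N.emb_add N.emb_smult)
  have r1: "frag_of (a, b' \<oplus>\<^bsub>N\<^esub> ?t) - frag_of (a, b') - frag_of (a, ?t) \<in> T.Rel"
    using Suc.prems b' t by (intro rel_right) auto
  have r2: "frag_of (rsmult M a (c d), e d) - frag_of (a, ?t) \<in> T.Rel"
    using Suc.prems b' t by (intro rel_balanced) auto
  have r3: "frag_of (a, b') - (\<Sum>j<d. frag_of (rsmult M a (c j), e j)) \<in> T.Rel"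
    using Suc.prems b' by (intro Suc.IH) auto
  have "(frag_of (a, b' \<oplus>\<^bsub>N\<^esub> ?t) - frag_of (a, b') - frag_of (a, ?t))
      - (frag_of (rsmult M a (c d), e d) - frag_of (a, ?t))
      + (frag_of (a, b') - (\<Sum>j<d. frag_of (rsmult M a (c j), e j))) \<in> T.Rel"
    by (rule T.Rel_add[OF T.Rel_diff[OF r1 r2] r3])
  then show ?case by (simp add: b algebra_simps)
qed

lemma diff_left_Rel:
  assumes "a \<in> carrier M" "a' \<in> carrier M" "b \<in> carrier N"
  shows "frag_of (a \<oplus>\<^bsub>M\<^esub> \<ominus>\<^bsub>M\<^esub> a', b) - (frag_of (a, b) - frag_of (a', b)) \<in> T.Rel"
proof -
  have n: "\<ominus>\<^bsub>M\<^esub> a' \<in> carrier M" by (rule M.neg_closed[OF assms(2)])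
  have z: "a' \<oplus>\<^bsub>M\<^esub> \<ominus>\<^bsub>M\<^esub> a' = \<zero>\<^bsub>M\<^esub>"
    using assms n by (intro M.emb_eqI) (auto simp: M.add_closed M.zero_closed M.emb_add M.emb_zero M.emb_neg)
  have r1: "frag_of (a \<oplus>\<^bsub>M\<^esub> \<ominus>\<^bsub>M\<^esub> a', b) - frag_of (a, b) - frag_of (\<ominus>\<^bsub>M\<^esub> a', b) \<in> T.Rel"
    using assms n by (intro rel_left)
  have r2: "frag_of (a' \<oplus>\<^bsub>M\<^esub> \<ominus>\<^bsub>M\<^esub> a', b) - frag_of (a', b) - frag_of (\<ominus>\<^bsub>M\<^esub> a', b) \<in> T.Rel"
    using assms n by (intro rel_left)
  have r3: "frag_of (a' \<oplus>\<^bsub>M\<^esub> \<ominus>\<^bsub>M\<^esub> a', b) \<in> T.Rel"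
    using assms unfolding z by (intro zero_left_Rel)
  have "(frag_of (a \<oplus>\<^bsub>M\<^esub> \<ominus>\<^bsub>M\<^esub> a', b) - frag_of (a, b) - frag_of (\<ominus>\<^bsub>M\<^esub> a', b))
     - (frag_of (a' \<oplus>\<^bsub>M\<^esub> \<ominus>\<^bsub>M\<^esub> a', b) - frag_of (a', b) - frag_of (\<ominus>\<^bsub>M\<^esub> a', b))
     + frag_of (a' \<oplus>\<^bsub>M\<^esub> \<ominus>\<^bsub>M\<^esub> a', b) \<in> T.Rel"
    by (rule T.Rel_add[OF T.Rel_diff[OF r1 r2] r3])
  then show ?thesis by (simp add: algebra_simps)
qed

text \<open>
  Interpolating the second factors at finitely many points writes a tensor as a sum of
  \<open>A\<^sub>j \<otimes> e\<^sub>j\<close>, where \<open>A\<^sub>j\<close> is the value of \<open>tensor_eval\<close> at the \<open>j\<close>-th point.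
\<close>

lemma separation:
  assumes u: "Poly_Mapping.keys u \<subseteq> carrier M \<times> carrier N" and 0: "\<And>m. tensor_eval \<Phi> \<Psi> u m = 0"
  shows "u \<in> T.Rel"
proof -
  define F where "F = snd ` Poly_Mapping.keys u"
  have F: "finite F" "F \<subseteq> carrier N" "Poly_Mapping.keys u \<subseteq> carrier M \<times> F"
    using u by (force simp: F_def)+
  obtain d :: nat and p e where e: "\<forall>j<d. e j \<in> carrier N"
    and ip: "\<forall>b\<in>F. \<Psi> b = (\<Sum>j<d. seq_source (\<Psi> b (p j)) \<star> \<Psi> (e j))"
    using N.interpolation[OF F(1,2)] by blast
  \<comment> \<open>The induction proves a formula for the evaluations instead of their vanishing,
    since the pieces of \<open>u\<close> need not evaluate to zero.\<close>
  have "\<exists>A. (\<forall>j<d. A j \<in> carrier M \<and> \<Phi> (A j) = tensor_eval \<Phi> \<Psi> u (p j)) \<and>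
      u - (\<Sum>j<d. frag_of (A j, e j)) \<in> T.Rel"
    using F(3)
  proof (induction u rule: frag_induction)
    case zero
    have "0 - (\<Sum>j<d. frag_of (\<zero>\<^bsub>M\<^esub>, e j)) \<in> T.Rel"
      by (rule T.Rel_diff[OF T.Rel_0 T.Rel_sum[OF zero_left_Rel]]) (use e in auto)
    then show ?case
      by (intro exI[of _ "\<lambda>_. \<zero>\<^bsub>M\<^esub>"]) (auto simp: M.zero_closed M.emb_zero tensor_eval_def)
  next
    case (one x)
    then obtain a b where x: "x = (a, b)" "a \<in> carrier M" "b \<in> F" by auto
    have "frag_of (a, b) - (\<Sum>j<d. frag_of (rsmult M a (\<Psi> b (p j)), e j)) \<in> T.Rel"
      using x e F(2) ip by (intro lincomb_Rel) auto
    then show ?case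
      using x by (intro exI[of _ "\<lambda>j. rsmult M a (\<Psi> b (p j))"]) (auto simp: M.rsmult_closed M.emb_rsmult)
  next
    case (diff v w)
    then obtain A B where A: "\<forall>j<d. A j \<in> carrier M \<and> \<Phi> (A j) = tensor_eval \<Phi> \<Psi> v (p j)"
      "v - (\<Sum>j<d. frag_of (A j, e j)) \<in> T.Rel"
      and B: "\<forall>j<d. B j \<in> carrier M \<and> \<Phi> (B j) = tensor_eval \<Phi> \<Psi> w (p j)"
      "w - (\<Sum>j<d. frag_of (B j, e j)) \<in> T.Rel"
      by blast
    let ?C = "\<lambda>j. A j \<oplus>\<^bsub>M\<^esub> \<ominus>\<^bsub>M\<^esub> B j"
    have "(\<Sum>j<d. frag_of (?C j, e j) - (frag_of (A j, e j) - frag_of (B j, e j))) \<in> T.Rel"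
      using A B e by (intro T.Rel_sum diff_left_Rel) auto
    from T.Rel_diff[OF T.Rel_diff[OF A(2) B(2)] this] have "(v - (\<Sum>j<d. frag_of (A j, e j))) - (w - (\<Sum>j<d. frag_of (B j, e j)))
       - (\<Sum>j<d. frag_of (?C j, e j) - (frag_of (A j, e j) - frag_of (B j, e j))) \<in> T.Rel"
      .
    then have "v - w - (\<Sum>j<d. frag_of (?C j, e j)) \<in> T.Rel"
      by (simp add: sum_subtractf sum.distrib algebra_simps)
    then show ?case
      using A B by (intro exI[of _ ?C])
        (auto simp: M.add_closed M.neg_closed M.emb_add M.emb_neg tensor_eval_diff)
  qed
  then obtain A where A: "\<forall>j<d. A j \<in> carrier M \<and> \<Phi> (A j) = 0"
    and uA: "u - (\<Sum>j<d. frag_of (A j, e j)) \<in> T.Rel"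
    using 0 by auto
  have "A j = \<zero>\<^bsub>M\<^esub>" if "j < d" for j
    using A that by (intro M.emb_eqI) (auto simp: M.zero_closed M.emb_zero)
  then have "(\<Sum>j<d. frag_of (A j, e j)) \<in> T.Rel"
    using e by (intro T.Rel_sum) (auto simp: zero_left_Rel)
  from T.Rel_add[OF uA this] show ?thesis by simp
qed

lemma class_eqI:
  assumes "Poly_Mapping.keys u \<subseteq> carrier M \<times> carrier N" "Poly_Mapping.keys v \<subseteq> carrier M \<times> carrier N"
    and "\<And>m. tensor_eval \<Phi> \<Psi> u m = tensor_eval \<Phi> \<Psi> v m"
  shows "tensor_class M N u = tensor_class M N v"
  unfolding class_eq T.cls_eq_iff
  by (rule separation) (use assms in \<open>simp_all add: keys_diff_subset tensor_eval_diff\<close>)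

lemma tensor_rep_keys: "X \<in> carrier (tensor M N) \<Longrightarrow> Poly_Mapping.keys (rep X) \<subseteq> carrier M \<times> carrier N"
  unfolding group_eq by (rule T.rep_keys)

lemma tensor_rep_class: "X \<in> carrier (tensor M N) \<Longrightarrow> tensor_class M N (rep X) = X"
  unfolding group_eq class_eq by (rule T.cls_rep)

lemma tensor_mult_class:
  "tensor_class M N (u + v) = tensor_class M N u \<otimes>\<^bsub>tensor M N\<^esub> tensor_class M N v"
  by (simp add: group_eq class_eq T.mult_Grp)

lemma tensor_class_closed:
  "Poly_Mapping.keys u \<subseteq> carrier M \<times> carrier N \<Longrightarrow> tensor_class M N u \<in> carrier (tensor M N)"
  unfolding group_eq class_eq by (rule T.cls_in_carrier)

lemma tensor_eqI:
  assumes "X \<in> carrier (tensor M N)" "Poly_Mapping.keys u \<subseteq> carrier M \<times> carrier N"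
    and "\<And>m. tensor_eval \<Phi> \<Psi> (rep X) m = tensor_eval \<Phi> \<Psi> u m"
  shows "X = tensor_class M N u"
  using class_eqI[OF tensor_rep_keys[OF assms(1)] assms(2,3)] tensor_rep_class[OF assms(1)] by simp

lemma tensor_map_closed:
  assumes "\<And>a b. (a, b) \<in> Poly_Mapping.keys (rep X) \<Longrightarrow> f a \<in> carrier M \<and> g b \<in> carrier N"
  shows "tensor_map M N f g X \<in> carrier (tensor M N)"
    and "tensor_eval \<Phi> \<Psi> (rep (tensor_map M N f g X)) m =
      fsum (\<lambda>(a, b). \<Phi> (f a) \<star> seq_target (\<Psi> (g b) m)) (rep X)"
proof -
  show "tensor_map M N f g X \<in> carrier (tensor M N)"
    unfolding tensor_map_def
    by (rule tensor_class_closed, rule keys_frag_extend_subset) (use assms in auto)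
  show "tensor_eval \<Phi> \<Psi> (rep (tensor_map M N f g X)) m =
      fsum (\<lambda>(a, b). \<Phi> (f a) \<star> seq_target (\<Psi> (g b) m)) (rep X)"
    unfolding tensor_map_def eval_rep
    by (simp add: tensor_eval_def fsum_frag_extend case_prod_unfold)
qed

lemma tensor_map_eqI:
  assumes "\<And>a b. (a, b) \<in> Poly_Mapping.keys (rep X) \<Longrightarrow> f a \<in> carrier M \<and> g b \<in> carrier N"
    and "Y \<in> carrier (tensor M N)"
    and "\<And>m. tensor_eval \<Phi> \<Psi> (rep Y) m = fsum (\<lambda>(a, b). \<Phi> (f a) \<star> seq_target (\<Psi> (g b) m)) (rep X)"
  shows "Y = tensor_map M N f g X"
proof -
  note c = tensor_map_closed[where X = X and f = f and g = g, OF assms(1)]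
  have "Y = tensor_class M N (rep (tensor_map M N f g X))"
    by (rule tensor_eqI[OF assms(2) tensor_rep_keys[OF c(1)]]) (simp_all add: c(2) assms(3))
  then show ?thesis using tensor_rep_class[OF c(1)] by simp
qed

sublocale T3: presentation "carrier M \<times> carrier M \<times> carrier N" "tensor3_relations M M N"
proof
  fix r assume "r \<in> tensor3_relations M M N"
  then show "Poly_Mapping.keys r \<subseteq> carrier M \<times> carrier M \<times> carrier N"
    by (auto simp only: tensor3_relations_def Un_iff mem_Collect_eq)
      (auto dest!: subsetD[OF keys_diff] simp: M.add_closed N.add_closed N.smult_closed M.rsmult_closed
        M.smult_closed split: if_splits)
qed

end

context seq_pair begin

interpretation MM: seq_pair M \<Phi> M \<Phi> ..

lemma append_Rel:
  assumes "y \<in> MM.T.Rel" "e \<in> carrier N"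
  shows "frag_extend (\<lambda>(a, b). frag_of (a, b, e)) y \<in> T3.Rel"
proof (rule MM.T.frag_extend_Rel[OF assms(1) T3.presentation_axioms])
  fix r assume "r \<in> tensor_relations M M"
  then show "frag_extend (\<lambda>(a, b). frag_of (a, b, e)) r \<in> T3.Rel"
    by (intro T3.Rel_relator, cases rule: tensor_relations_cases)
      (simp_all add: frag_extend_diff tensor3_relations_intros assms(2))
qed

lemma lincomb3_Rel:
  assumes "a \<in> carrier M" "b \<in> carrier M" "c \<in> carrier N" "\<And>j. j < (d::nat) \<Longrightarrow> e j \<in> carrier N"
    and "\<Psi> c = (\<Sum>j<d. seq_source (k j) \<star> \<Psi> (e j))"
  shows "frag_of (a, b, c) - (\<Sum>j<d. frag_of (a, rsmult M b (k j), e j)) \<in> T3.Rel"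
proof -
  have "frag_extend (\<lambda>(b, c). frag_of (a, b, c)) (frag_of (b, c) - (\<Sum>j<d. frag_of (rsmult M b (k j), e j)))
      \<in> T3.Rel"
  proof (rule T.frag_extend_Rel[OF lincomb_Rel T3.presentation_axioms])
    fix r assume "r \<in> tensor_relations M N"
    then show "frag_extend (\<lambda>(b, c). frag_of (a, b, c)) r \<in> T3.Rel"
      by (intro T3.Rel_relator, cases rule: tensor_relations_cases)
        (simp_all add: frag_extend_diff tensor3_relations_intros assms(1))
  qed (use assms in auto)
  then show ?thesis by (simp add: frag_extend_diff frag_extend_sum)
qed

text \<open>Interpolation in the third factor writes \<open>u\<close> as a sum of \<open>Y j\<close>
  (x) \<open>e j\<close> with \<open>Y j\<close> a formal sum of pairs. The hypothesis at the j-th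
  place says that all evaluations of \<open>Y j\<close> vanish, so \<open>separation\<close> for two
  factors disposes of each \<open>Y j\<close>.\<close>

lemma separation3:
  assumes u: "Poly_Mapping.keys u \<subseteq> carrier M \<times> carrier M \<times> carrier N"
    and 0: "\<And>m l. tensor3_eval \<Phi> \<Psi> u m l = 0"
  shows "u \<in> T3.Rel"
proof -
  define F where "F = (snd \<circ> snd) ` Poly_Mapping.keys u"
  have F: "finite F" "F \<subseteq> carrier N" "Poly_Mapping.keys u \<subseteq> carrier M \<times> carrier M \<times> F"
    using u by (force simp: F_def)+
  obtain d :: nat and p e where e: "\<forall>j<d. e j \<in> carrier N"
    and ip: "\<forall>b\<in>F. \<Psi> b = (\<Sum>j<d. seq_source (\<Psi> b (p j)) \<star> \<Psi> (e j))"
    using N.interpolation[OF F(1,2)] by blast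
  let ?E = "\<lambda>j. frag_extend (\<lambda>(a, b). frag_of (a, b, e j))"
  have "\<exists>Y. (\<forall>j<d. Poly_Mapping.keys (Y j) \<subseteq> carrier M \<times> carrier M \<and>
        (\<forall>l. tensor_eval \<Phi> \<Phi> (Y j) l = tensor3_eval \<Phi> \<Psi> u (p j) l)) \<and>
      u - (\<Sum>j<d. ?E j (Y j)) \<in> T3.Rel"
    using F(3)
  proof (induction u rule: frag_induction)
    case zero
    show ?case by (intro exI[of _ "\<lambda>_. 0"]) (auto simp: tensor_eval_def tensor3_eval_def)
  next
    case (one x)
    then obtain a b c where x: "x = (a, b, c)" "a \<in> carrier M" "b \<in> carrier M" "c \<in> F" by auto
    have "frag_of (a, b, c) - (\<Sum>j<d. frag_of (a, rsmult M b (\<Psi> c (p j)), e j)) \<in> T3.Rel"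
      using x e F(2) ip by (intro lincomb3_Rel) auto
    then show ?case
      using x by (intro exI[of _ "\<lambda>j. frag_of (a, rsmult M b (\<Psi> c (p j)))"])
        (auto simp: M.rsmult_closed M.emb_rsmult tensor3_eval_def)
  next
    case (diff v w)
    then obtain A B where A: "\<forall>j<d. Poly_Mapping.keys (A j) \<subseteq> carrier M \<times> carrier M \<and>
        (\<forall>l. tensor_eval \<Phi> \<Phi> (A j) l = tensor3_eval \<Phi> \<Psi> v (p j) l)"
      "v - (\<Sum>j<d. ?E j (A j)) \<in> T3.Rel"
      and B: "\<forall>j<d. Poly_Mapping.keys (B j) \<subseteq> carrier M \<times> carrier M \<and>
        (\<forall>l. tensor_eval \<Phi> \<Phi> (B j) l = tensor3_eval \<Phi> \<Psi> w (p j) l)"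
      "w - (\<Sum>j<d. ?E j (B j)) \<in> T3.Rel"
      by blast
    have "(v - (\<Sum>j<d. ?E j (A j))) - (w - (\<Sum>j<d. ?E j (B j))) \<in> T3.Rel"
      by (rule T3.Rel_diff[OF A(2) B(2)])
    then have "v - w - (\<Sum>j<d. ?E j (A j - B j)) \<in> T3.Rel"
      by (simp add: frag_extend_diff sum_subtractf algebra_simps)
    then show ?case
      using A B by (intro exI[of _ "\<lambda>j. A j - B j"])
        (simp add: keys_diff_subset tensor_eval_diff tensor3_eval_diff)
  qed
  then obtain Y where Y: "\<forall>j<d. Poly_Mapping.keys (Y j) \<subseteq> carrier M \<times> carrier M \<and>
        (\<forall>l. tensor_eval \<Phi> \<Phi> (Y j) l = 0)"
    and uY: "u - (\<Sum>j<d. ?E j (Y j)) \<in> T3.Rel"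
    using 0 by auto
  have "(\<Sum>j<d. ?E j (Y j)) \<in> T3.Rel"
    using Y e by (intro T3.Rel_sum append_Rel MM.separation) auto
  from T3.Rel_add[OF uY this] show ?thesis by simp
qed

lemma class3_eqI:
  assumes "Poly_Mapping.keys u \<subseteq> carrier M \<times> carrier M \<times> carrier N"
    and "Poly_Mapping.keys v \<subseteq> carrier M \<times> carrier M \<times> carrier N"
    and "\<And>m l. tensor3_eval \<Phi> \<Psi> u m l = tensor3_eval \<Phi> \<Psi> v m l"
  shows "tensor3_class M M N u = tensor3_class M M N v"
  unfolding tensor3_class_def T3.cls_eq_iff
  by (rule separation3) (use assms in \<open>simp_all add: keys_diff_subset tensor3_eval_diff\<close>)

end

section \<open>Coring, comodule and Hopf algebroid axioms as identities between sequences\<close>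

section \<open>Corings, comodules and Hopf algebroids of sequences\<close>

lemma seq_shift_pow_add: "(seq_shift ^^ m) (\<alpha> + \<beta>) = (seq_shift ^^ m) \<alpha> + (seq_shift ^^ m) \<beta>"
  by (auto simp: seq_shift_funpow fun_apply)

lemma seq_shift_pow_source_mult: "(seq_shift ^^ m) (seq_source x \<star> \<alpha>) = seq_source x \<star> (seq_shift ^^ m) \<alpha>"
  by (auto simp: seq_shift_funpow seq_source_mult)

lemma seq_shift_pow_pow: "(seq_shift ^^ l) ((seq_shift ^^ m) \<alpha>) = (seq_shift ^^ (m + l)) \<alpha>"
  by (simp add: add.commute funpow_add)

lemma seq_shift_pow_target: "(seq_shift ^^ i) (seq_target x) = seq_target (seq_target x i)"
  by (induction i) (auto simp: seq_target_shift, simp add: seq_target_def)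

text \<open>Tensors whose evaluations are the shifts of \<gamma> and of \<delta> multiply factorwise
  to a tensor whose evaluations are the shifts of the product: this is the Leibniz rule, with the
  binomial sum arising from the entry at \<open>l\<close> of the product of right factors.\<close>

lemma tensor_eval_mult:
  fixes \<gamma> \<delta> :: "nat \<Rightarrow> 'k::differential_field"
  assumes u: "\<And>j. tensor_eval \<Phi> \<Psi> u j = (seq_shift ^^ j) \<gamma>"
    and v: "\<And>j. tensor_eval \<Phi>' \<Psi>' v j = (seq_shift ^^ j) \<delta>"
  shows "fsum (\<lambda>(a, b). fsum (\<lambda>(c, d). (\<Phi> a \<star> \<Phi>' c) \<star> seq_target ((\<Psi> b \<star> \<Psi>' d) l)) v) u =
    (seq_shift ^^ l) (\<gamma> \<star> \<delta>)"
proof -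
  have nat: "seq_target (of_nat n) \<star> \<beta> = of_nat n * \<beta>" for n and \<beta> :: "nat \<Rightarrow> 'k"
    by (induction n) (auto simp: algebra_simps seq_target_add hurwitz_add_left)
  have nat': "\<alpha> \<star> (of_nat n * \<beta>) = of_nat n * (\<alpha> \<star> \<beta>)" for n and \<alpha> \<beta> :: "nat \<Rightarrow> 'k"
    by (induction n) (auto simp: algebra_simps hurwitz_add_right)
  have 1: "(\<Phi> a \<star> \<Phi>' c) \<star> seq_target ((\<Psi> b \<star> \<Psi>' d) l) =
      (\<Sum>j\<le>l. of_nat (l choose j) * ((\<Phi> a \<star> seq_target (\<Psi> b j)) \<star> (\<Phi>' c \<star> seq_target (\<Psi>' d (l - j)))))"
    for a b c d
  proof -
    have "seq_target ((\<Psi> b \<star> \<Psi>' d) l) =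
        (\<Sum>j\<le>l. of_nat (l choose j) * (seq_target (\<Psi> b j) \<star> seq_target (\<Psi>' d (l - j))))"
      by (simp add: hurwitz_mult_def[of "\<Psi> b"] seq_target_sum mult.assoc nat seq_target_mult)
    then show ?thesis
      by (simp add: hurwitz_sum_right nat' hurwitz_ac)
  qed
  have 2: "fsum (\<lambda>p. of_nat n * (\<alpha> \<star> (\<Phi>' (fst p) \<star> seq_target (\<Psi>' (snd p) j)))) v =
      of_nat n * (\<alpha> \<star> tensor_eval \<Phi>' \<Psi>' v j)" for j n \<alpha>
    unfolding tensor_eval_def case_prod_unfold
    by (rule fsum_hom[of "\<lambda>\<beta>. of_nat n * (\<alpha> \<star> \<beta>)", symmetric])
      (simp add: hurwitz_diff_right right_diff_distrib)
  have 3: "fsum (\<lambda>p. of_nat n * ((\<Phi> (fst p) \<star> seq_target (\<Psi> (snd p) j)) \<star> \<beta>)) u =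
      of_nat n * (tensor_eval \<Phi> \<Psi> u j \<star> \<beta>)" for j n \<beta>
    unfolding tensor_eval_def case_prod_unfold
    by (rule fsum_hom[of "\<lambda>\<alpha>. of_nat n * (\<alpha> \<star> \<beta>)", symmetric])
      (simp add: hurwitz_diff_left right_diff_distrib)
  show ?thesis
    unfolding case_prod_unfold by (simp only: 1 fsum_sum_fun 2 3 u v shift_mult_pow)
qed

text \<open>The second tensor is taken to be 1 (x) t(x), whose evaluations are the shifts of
  t(x).\<close>

lemma tensor_eval_mult_target:
  assumes u: "\<And>j. tensor_eval \<Phi> \<Psi> u j = (seq_shift ^^ j) \<gamma>"
  shows "fsum (\<lambda>(a, b). \<Phi> a \<star> seq_target ((\<Psi> b \<star> seq_target x) l)) u = (seq_shift ^^ l) (\<gamma> \<star> seq_target x)"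
  using tensor_eval_mult[OF u, of "\<lambda>x. x" "\<lambda>x. x" "frag_of (seq_source 1, seq_target x)" "seq_target x"]
  by (simp add: seq_shift_pow_target hurwitz_commute[of _ "seq_source 1"])

text \<open>Linearity of the comultiplication for both actions, coassociativity and the counit laws
  are consequences of \<open>comult_eval\<close> and of the embedding; they are derived
  below.\<close>

locale seq_coring = seq_bimodule C \<Phi> for C :: "('k::differential_field, 'a, 'z) coring_scheme" and \<Phi> +
  assumes comult_closed: "c \<in> carrier C \<Longrightarrow> comult C c \<in> carrier (tensor C C)"
    and comult_eval: "c \<in> carrier C \<Longrightarrow>
      tensor_eval \<Phi> \<Phi> (rep (comult C c)) m = (seq_shift ^^ m) (\<Phi> c)"
    and counit_eq: "c \<in> carrier C \<Longrightarrow> counit C c = \<Phi> c 0"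

text \<open>One locale for comultiplications and for coactions: a coring coacts on itself, and
  \<rho> is then its comultiplication.\<close>

locale seq_coaction = seq_coring C \<Phi> + X: seq_module X \<Psi>
  for C :: "('k::differential_field, 'a, 'z) coring_scheme" and \<Phi>
    and X :: "('k, 'b, 'w) module_scheme" and \<Psi> +
  fixes \<rho> :: "'b \<Rightarrow> ('a \<times> 'b \<Rightarrow>\<^sub>0 int) set"
  assumes coact_closed: "x \<in> carrier X \<Longrightarrow> \<rho> x \<in> carrier (tensor C X)"
    and coact_eval: "x \<in> carrier X \<Longrightarrow> tensor_eval \<Phi> \<Psi> (rep (\<rho> x)) m = (seq_shift ^^ m) (\<Psi> x)"
begin

sublocale P: seq_pair C \<Phi> X \<Psi> ..

interpretation CC: seq_pair C \<Phi> C \<Phi> ..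

lemma coact_hom: "\<rho> \<in> hom (add_monoid X) (tensor C X)"
proof (rule homI)
  fix x y assume xy: "x \<in> carrier (add_monoid X)" "y \<in> carrier (add_monoid X)"
  have "\<rho> (x \<oplus>\<^bsub>X\<^esub> y) = tensor_class C X (rep (\<rho> x) + rep (\<rho> y))"
    using xy X.add_closed[of x y]
    by (intro P.tensor_eqI keys_add_subset P.tensor_rep_keys coact_closed)
      (auto simp: coact_eval tensor_eval_def fsum_add X.emb_add seq_shift_pow_add
        coact_eval[unfolded tensor_eval_def])
  also have "\<dots> = \<rho> x \<otimes>\<^bsub>tensor C X\<^esub> \<rho> y"
    using P.tensor_mult_class[of "rep (\<rho> x)" "rep (\<rho> y)"] xy
    by (simp add: P.tensor_rep_class coact_closed)
  finally show "\<rho> (x \<otimes>\<^bsub>add_monoid X\<^esub> y) = \<rho> x \<otimes>\<^bsub>tensor C X\<^esub> \<rho> y" by simp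
qed (simp add: coact_closed)

lemma coact_keys:
  "x \<in> carrier X \<Longrightarrow> (a, b) \<in> Poly_Mapping.keys (rep (\<rho> x)) \<Longrightarrow> a \<in> carrier C \<and> b \<in> carrier X"
  using P.tensor_rep_keys[OF coact_closed] by blast

lemma coact_smult:
  assumes x: "x \<in> carrier X"
  shows "\<rho> (k \<odot>\<^bsub>X\<^esub> x) = tensor_map C X (\<lambda>a. k \<odot>\<^bsub>C\<^esub> a) id (\<rho> x)"
proof (rule P.tensor_map_eqI)
  fix m
  have "fsum (\<lambda>(a, b). \<Phi> (k \<odot>\<^bsub>C\<^esub> a) \<star> seq_target (\<Psi> (id b) m)) (rep (\<rho> x))
     = fsum (\<lambda>p. seq_source k \<star> (case p of (a, b) \<Rightarrow> \<Phi> a \<star> seq_target (\<Psi> b m))) (rep (\<rho> x))"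
    using coact_keys[OF x] by (intro fsum_cong) (auto simp: emb_smult hurwitz_assoc)
  also have "\<dots> = seq_source k \<star> tensor_eval \<Phi> \<Psi> (rep (\<rho> x)) m"
    unfolding tensor_eval_def by (rule fsum_hom[of "\<lambda>\<alpha>. seq_source k \<star> \<alpha>", symmetric]) (simp add: hurwitz_diff_right)
  finally show "tensor_eval \<Phi> \<Psi> (rep (\<rho> (k \<odot>\<^bsub>X\<^esub> x))) m =
      fsum (\<lambda>(a, b). \<Phi> (k \<odot>\<^bsub>C\<^esub> a) \<star> seq_target (\<Psi> (id b) m)) (rep (\<rho> x))"
    using x by (simp add: coact_eval X.smult_closed X.emb_smult seq_shift_pow_source_mult)
qed (use x coact_keys in \<open>auto simp: coact_closed X.smult_closed smult_closed\<close>)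

text \<open>Both sides evaluate at \<open>m\<close> and \<open>l\<close> to the shift of order m +
  l: on the left as an l-fold shift of the m-fold one, on the right because the two places are added
  inside the second factor.\<close>

lemma coact_coassoc:
  assumes x: "x \<in> carrier X"
  shows "comult_tensor C X (\<rho> x) = tensor_coact C X \<rho> (\<rho> x)"
  unfolding comult_tensor_def tensor_coact_def
proof (rule P.class3_eqI)
  have comult_keys: "(a, b) \<in> Poly_Mapping.keys (rep (comult C c)) \<Longrightarrow> a \<in> carrier C \<and> b \<in> carrier C"
    if "c \<in> carrier C" for a b c
    using CC.tensor_rep_keys[OF comult_closed[OF that]] by blast
  show "Poly_Mapping.keys (frag_extend (\<lambda>(c, n). frag_extend (\<lambda>(c', c''). frag_of (c', c'', n))
      (rep (comult C c))) (rep (\<rho> x))) \<subseteq> carrier C \<times> carrier C \<times> carrier X"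
    by (rule keys_frag_extend_subset, simp only: split_paired_all prod.case,
        rule keys_frag_extend_subset, simp only: split_paired_all prod.case, rule keys_frag_of_subset)
      (use coact_keys[OF x] comult_keys in blast)
  show "Poly_Mapping.keys (frag_extend (\<lambda>(c, n). frag_extend (\<lambda>(c', n'). frag_of (c, c', n'))
      (rep (\<rho> n))) (rep (\<rho> x))) \<subseteq> carrier C \<times> carrier C \<times> carrier X"
    by (rule keys_frag_extend_subset, simp only: split_paired_all prod.case,
        rule keys_frag_extend_subset, simp only: split_paired_all prod.case, rule keys_frag_of_subset)
      (use coact_keys[OF x] coact_keys in blast)
  fix m l
  have "tensor3_eval \<Phi> \<Psi> (frag_extend (\<lambda>(c, n). frag_extend (\<lambda>(c', c''). frag_of (c', c'', n))
      (rep (comult C c))) (rep (\<rho> x))) m l =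
    fsum (\<lambda>(c, n). fsum (\<lambda>(a, b). \<Phi> a \<star> seq_target ((\<Phi> b \<star> seq_target (\<Psi> n m)) l)) (rep (comult C c))) (rep (\<rho> x))"
    by (simp add: tensor3_eval_def fsum_frag_extend case_prod_unfold)
  also have "\<dots> = fsum (\<lambda>(c, n). (seq_shift ^^ l) (\<Phi> c \<star> seq_target (\<Psi> n m))) (rep (\<rho> x))"
  proof (rule fsum_cong)
    fix p assume p: "p \<in> Poly_Mapping.keys (rep (\<rho> x))"
    obtain c n where cn: "p = (c, n)" by fastforce
    have c: "c \<in> carrier C" and n: "n \<in> carrier X" using coact_keys[OF x] p cn by auto
    let ?k = "\<Psi> n m"
    have "fsum (\<lambda>(a, b). \<Phi> a \<star> seq_target ((\<Phi> b \<star> seq_target ?k) l)) (rep (comult C c))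
      = (seq_shift ^^ l) (\<Phi> c \<star> seq_target ?k)"
      by (rule tensor_eval_mult_target) (rule comult_eval[OF c])
    then show "(case p of (c, n) \<Rightarrow> fsum (\<lambda>(a, b). \<Phi> a \<star> seq_target ((\<Phi> b \<star> seq_target (\<Psi> n m)) l))
        (rep (comult C c))) = (case p of (c, n) \<Rightarrow> (seq_shift ^^ l) (\<Phi> c \<star> seq_target (\<Psi> n m)))"
      by (simp add: cn)
  qed
  also have "\<dots> = (seq_shift ^^ l) (tensor_eval \<Phi> \<Psi> (rep (\<rho> x)) m)"
    unfolding tensor_eval_def case_prod_unfold
    by (rule fsum_hom[of "seq_shift ^^ l", symmetric]) (auto simp: seq_shift_funpow fun_apply)
  also have "\<dots> = (seq_shift ^^ (m + l)) (\<Psi> x)"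
    by (simp add: coact_eval[OF x] seq_shift_pow_pow)
  also have "\<dots> = tensor_eval \<Phi> \<Psi> (rep (\<rho> x)) (m + l)"
    by (simp add: coact_eval[OF x])
  \<comment> \<open>Entry m + l of the sequence of \<open>n\<close> is entry \<open>l\<close> of its
    m-fold shift, which is the evaluation of its coaction at \<open>m\<close>.\<close>
  also have "\<dots> = fsum (\<lambda>(c, n). \<Phi> c \<star> seq_target (tensor_eval \<Phi> \<Psi> (rep (\<rho> n)) m l)) (rep (\<rho> x))"
    unfolding tensor_eval_def[of _ _ "rep (\<rho> x)"]
    using coact_keys[OF x] by (intro fsum_cong) (auto simp: coact_eval seq_shift_funpow)
  also have "\<dots> = tensor3_eval \<Phi> \<Psi> (frag_extend (\<lambda>(c, n). frag_extend (\<lambda>(c', n'). frag_of (c, c', n'))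
      (rep (\<rho> n))) (rep (\<rho> x))) m l"
  proof -
    have "\<Phi> c \<star> seq_target (tensor_eval \<Phi> \<Psi> u m l) =
        fsum (\<lambda>p. \<Phi> c \<star> seq_target ((\<Phi> (fst p) \<star> seq_target (\<Psi> (snd p) m)) l)) u" for c u
      unfolding tensor_eval_def case_prod_unfold
      by (rule fsum_hom[of "\<lambda>\<alpha>. \<Phi> c \<star> seq_target (\<alpha> l)"])
        (simp add: fun_apply seq_target_diff hurwitz_diff_right)
    then show ?thesis
      by (simp add: tensor3_eval_def fsum_frag_extend case_prod_unfold)
  qed
  finally show "tensor3_eval \<Phi> \<Psi> (frag_extend (\<lambda>(c, n). frag_extend (\<lambda>(c', c''). frag_of (c', c'', n))
      (rep (comult C c))) (rep (\<rho> x))) m l = tensor3_eval \<Phi> \<Psi> (frag_extend (\<lambda>(c, n). frag_extend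
      (\<lambda>(c', n'). frag_of (c, c', n')) (rep (\<rho> n))) (rep (\<rho> x))) m l" .
qed

text \<open>The counit reads place 0 of the left factor, and place 0 of the m-fold shift is entry
  m.\<close>

lemma coact_counit:
  assumes x: "x \<in> carrier X"
  shows "additive_extension X (\<lambda>(c, n). counit C c \<odot>\<^bsub>X\<^esub> n) (\<rho> x) = x"
proof -
  have cl: "(\<lambda>(c, n). counit C c \<odot>\<^bsub>X\<^esub> n) p \<in> carrier X" if "p \<in> Poly_Mapping.keys (rep (\<rho> x))" for p
    using that by (cases p) (auto simp: X.smult_closed dest: coact_keys[OF x])
  show ?thesis
  proof (rule X.emb_eqI[OF X.emb_additive_extension(1)[OF cl] x])
    have "fsum (\<lambda>p. \<Psi> (case p of (c, n) \<Rightarrow> counit C c \<odot>\<^bsub>X\<^esub> n)) (rep (\<rho> x)) m = \<Psi> x m" for m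
    proof -
      have "fsum (\<lambda>p. \<Psi> (case p of (c, n) \<Rightarrow> counit C c \<odot>\<^bsub>X\<^esub> n)) (rep (\<rho> x)) m =
          fsum (\<lambda>p. (case p of (a, b) \<Rightarrow> \<Phi> a \<star> seq_target (\<Psi> b m)) 0) (rep (\<rho> x))"
        unfolding fsum_at using coact_keys[OF x]
        by (intro fsum_cong) (auto simp: X.emb_smult counit_eq hurwitz_0 seq_source_mult)
      also have "\<dots> = tensor_eval \<Phi> \<Psi> (rep (\<rho> x)) m 0"
        unfolding tensor_eval_def fsum_at ..
      finally show ?thesis by (simp add: coact_eval[OF x] seq_shift_funpow)
    qed
    then show "\<Psi> (additive_extension X (\<lambda>(c, n). counit C c \<odot>\<^bsub>X\<^esub> n) (\<rho> x)) = \<Psi> x"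
      by (simp add: X.emb_additive_extension(2)[OF cl] fun_eq_iff)
  qed
qed

end

lemma seq_source_at_0 [simp]: "seq_source x 0 = x"
  by (simp add: seq_source_def)

lemma hurwitz_source_1_right [simp]: "\<alpha> \<star> seq_source 1 = \<alpha>"
  by (subst hurwitz_commute) simp

lemma base_module_simps [simp]:
  "carrier base_module = UNIV" "x \<oplus>\<^bsub>base_module\<^esub> y = x + y" "x \<odot>\<^bsub>base_module\<^esub> y = x * y"
  "\<zero>\<^bsub>base_module\<^esub> = 0"
  by (auto simp: base_module_def)

lemma linear_maps_iff:
  "f \<in> linear_maps M N \<longleftrightarrow> (\<forall>m\<in>carrier M. f m \<in> carrier N) \<and>
    (\<forall>m\<in>carrier M. \<forall>m'\<in>carrier M. f (m \<oplus>\<^bsub>M\<^esub> m') = f m \<oplus>\<^bsub>N\<^esub> f m') \<and>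
    (\<forall>x. \<forall>m\<in>carrier M. f (x \<odot>\<^bsub>M\<^esub> m) = x \<odot>\<^bsub>N\<^esub> f m)"
  by (auto simp: linear_maps_def hom_def)

context seq_coring begin

sublocale CC: seq_pair C \<Phi> C \<Phi> ..

sublocale self: seq_coaction C \<Phi> C \<Phi> "comult C"
  by unfold_locales (simp_all add: comult_closed comult_eval)

lemma is_coring: "is_coring C"
proof -
  have "comult C (rsmult C c x) = tensor_map C C id (\<lambda>b. rsmult C b x) (comult C c)"
    if c: "c \<in> carrier C" for c x
  proof (rule CC.tensor_map_eqI)
    fix m
    have "fsum (\<lambda>(a, b). \<Phi> (id a) \<star> seq_target (\<Phi> (rsmult C b x) m)) (rep (comult C c)) =
        fsum (\<lambda>(a, b). \<Phi> a \<star> seq_target ((\<Phi> b \<star> seq_target x) m)) (rep (comult C c))"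
      using self.coact_keys[OF c] by (intro fsum_cong) (auto simp: emb_rsmult)
    also have "\<dots> = (seq_shift ^^ m) (\<Phi> c \<star> seq_target x)"
      by (rule tensor_eval_mult_target) (rule comult_eval[OF c])
    finally show "tensor_eval \<Phi> \<Phi> (rep (comult C (rsmult C c x))) m =
        fsum (\<lambda>(a, b). \<Phi> (id a) \<star> seq_target (\<Phi> (rsmult C b x) m)) (rep (comult C c))"
      using c by (simp add: comult_eval rsmult_closed emb_rsmult)
  qed (use c self.coact_keys[OF c] in \<open>auto simp: comult_closed rsmult_closed\<close>)
  moreover have "additive_extension C (\<lambda>(a, b). rsmult C a (counit C b)) (comult C c) = c"
    if c: "c \<in> carrier C" for c
  proof -
    have cl: "(\<lambda>(a, b). rsmult C a (counit C b)) p \<in> carrier C" if "p \<in> Poly_Mapping.keys (rep (comult C c))" for p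
      using that by (cases p) (auto simp: rsmult_closed dest: self.coact_keys[OF c])
    have "fsum (\<lambda>p. \<Phi> (case p of (a, b) \<Rightarrow> rsmult C a (counit C b))) (rep (comult C c)) =
        tensor_eval \<Phi> \<Phi> (rep (comult C c)) 0"
      unfolding tensor_eval_def using self.coact_keys[OF c]
      by (intro fsum_cong) (auto simp: emb_rsmult counit_eq)
    then show ?thesis
      using emb_additive_extension[where X = "comult C c" and g = "\<lambda>(a, b). rsmult C a (counit C b)", OF cl] c by (intro emb_eqI) (simp_all add: comult_eval)
  qed
  ultimately show ?thesis
    unfolding is_coring_def
    using is_bimodule self.coact_hom self.coact_smult self.coact_coassoc self.coact_counit
    by (auto simp: linear_maps_iff counit_eq add_closed smult_closed rsmult_closed emb_add emb_smult
        emb_rsmult seq_source_mult hurwitz_0 fun_apply)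
qed

text \<open>Only the codomain is embedded in sequences. The test corings of the universal property
  require this generality, because their maps to sequences need not be injective.\<close>

lemma coring_homsI:
  fixes B :: "('k, 'c, 'v) coring_scheme"
  assumes lin: "g \<in> linear_maps B C"
    and rs: "\<And>b x. b \<in> carrier B \<Longrightarrow> g (rsmult B b x) = rsmult C (g b) x"
    and counit: "\<And>b. b \<in> carrier B \<Longrightarrow> \<Phi> (g b) 0 = counit B b"
    and keys: "\<And>b. b \<in> carrier B \<Longrightarrow> Poly_Mapping.keys (rep (comult B b)) \<subseteq> carrier B \<times> carrier B"
    and comult: "\<And>b m. b \<in> carrier B \<Longrightarrow>
      fsum (\<lambda>(x, y). \<Phi> (g x) \<star> seq_target (\<Phi> (g y) m)) (rep (comult B b)) = (seq_shift ^^ m) (\<Phi> (g b))"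
  shows "g \<in> coring_homs B C"
proof -
  have g: "g b \<in> carrier C" if "b \<in> carrier B" for b
    using lin that by (auto simp: linear_maps_iff)
  have "comult C (g b) = tensor_map C C g g (comult B b)" if b: "b \<in> carrier B" for b
  proof (rule CC.tensor_map_eqI)
    fix x y assume "(x, y) \<in> Poly_Mapping.keys (rep (comult B b))"
    with keys[OF b] show "g x \<in> carrier C \<and> g y \<in> carrier C" by (auto intro: g)
  qed (simp_all add: comult_closed comult_eval comult b g)
  then show ?thesis
    using lin rs counit g by (auto simp: coring_homs_def counit_eq)
qed

end

locale seq_comodule = seq_coaction C \<Phi> X \<Psi> "coact X"
  for C :: "('k::differential_field, 'a, 'z) coring_scheme" and \<Phi>
    and X :: "('k, 'a, 'b, 'w) comodule_scheme" and \<Psi>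
begin

lemma is_left_comodule: "left_comodule C X"
  unfolding left_comodule_def
  using X.is_module coact_hom coact_smult coact_coassoc coact_counit by auto

end

text \<open>A tensor is determined by its evaluations, and those of a coaction are the shifts of the
  sequence; preserving sequences therefore already forces linearity and colinearity.\<close>

lemma comodule_homsI:
  assumes X: "seq_comodule C \<Phi> X \<Psi>" and Y: "seq_comodule C \<Phi> Y \<Psi>'"
    and f: "\<And>x. x \<in> carrier X \<Longrightarrow> f x \<in> carrier Y" "\<And>x. x \<in> carrier X \<Longrightarrow> \<Psi>' (f x) = \<Psi> x"
  shows "f \<in> comodule_homs C X Y"
proof -
  interpret X: seq_comodule C \<Phi> X \<Psi> by fact
  interpret Y: seq_comodule C \<Phi> Y \<Psi>' by fact
  have "f \<in> linear_maps X Y"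
    by (auto simp: linear_maps_iff f X.X.add_closed X.X.smult_closed Y.X.add_closed Y.X.smult_closed
        X.X.emb_add X.X.emb_smult Y.X.emb_add Y.X.emb_smult intro!: Y.X.emb_eqI)
  moreover have "coact Y (f x) = tensor_map C Y id f (coact X x)" if x: "x \<in> carrier X" for x
  proof (rule Y.P.tensor_map_eqI)
    fix m
    have "fsum (\<lambda>(a, b). \<Phi> (id a) \<star> seq_target (\<Psi>' (f b) m)) (rep (coact X x)) =
        tensor_eval \<Phi> \<Psi> (rep (coact X x)) m"
      unfolding tensor_eval_def using X.coact_keys[OF x] by (intro fsum_cong) (auto simp: f)
    then show "tensor_eval \<Phi> \<Psi>' (rep (coact Y (f x))) m =
        fsum (\<lambda>(a, b). \<Phi> (id a) \<star> seq_target (\<Psi>' (f b) m)) (rep (coact X x))"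
      using x by (simp add: Y.coact_eval X.coact_eval f)
  qed (use x X.coact_keys[OF x] in \<open>auto simp: f Y.coact_closed\<close>)
  ultimately show ?thesis by (auto simp: comodule_homs_def)
qed

text \<open>At place n the l-th evaluation enters through its entry n - l, which is \<gamma>(n) for
  every l; what remains is the alternating sum of binomial coefficients, zero unless n = 0. The
  second identity is the image of the first under the antipode, an involutive ring map.\<close>

lemma tensor_eval_antipode:
  fixes \<gamma> :: "nat \<Rightarrow> 'k::differential_field"
  assumes u: "\<And>j. tensor_eval \<Phi> \<Psi> u j = (seq_shift ^^ j) \<gamma>"
  shows "fsum (\<lambda>(a, b). \<Phi> a \<star> dlin_antipode (\<Psi> b)) u = seq_source (\<gamma> 0)"
    and "fsum (\<lambda>(a, b). dlin_antipode (\<Phi> a) \<star> \<Psi> b) u = seq_target (\<gamma> 0)"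
proof -
  show 1: "fsum (\<lambda>(a, b). \<Phi> a \<star> dlin_antipode (\<Psi> b)) u = seq_source (\<gamma> 0)"
  proof
    fix n
    have 2: "fsum (\<lambda>p. of_nat k * (c * (\<Phi> (fst p) \<star> seq_target (\<Psi> (snd p) l)) j)) u =
        of_nat k * (c * \<gamma> (l + j))" for k c l j
    proof -
      have "fsum (\<lambda>p. of_nat k * (c * (\<Phi> (fst p) \<star> seq_target (\<Psi> (snd p) l)) j)) u =
          of_nat k * (c * tensor_eval \<Phi> \<Psi> u l j)"
        unfolding tensor_eval_def case_prod_unfold
        by (rule fsum_hom[of "\<lambda>\<alpha>. of_nat k * (c * \<alpha> j)", symmetric]) (simp add: fun_apply algebra_simps)
      then show ?thesis by (simp add: u seq_shift_funpow)
    qed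
    have "fsum (\<lambda>(a, b). \<Phi> a \<star> dlin_antipode (\<Psi> b)) u n =
        (\<Sum>l\<le>n. of_nat (n choose l) * ((- 1) ^ l * \<gamma> (l + (n - l))))"
      unfolding fsum_at case_prod_unfold mult_antipode_expand fsum_sum_fun 2 ..
    also have "\<dots> = (\<Sum>l\<le>n. (- 1) ^ l * of_nat (n choose l)) * \<gamma> n"
      unfolding sum_distrib_right by (intro sum.cong) auto
    also have "\<dots> = seq_source (\<gamma> 0) n"
      using choose_alternating_sum[of n, where ?'a = 'k] by (cases "n = 0") (auto simp: seq_source_def)
    finally show "fsum (\<lambda>(a, b). \<Phi> a \<star> dlin_antipode (\<Psi> b)) u n = seq_source (\<gamma> 0) n" .
  qed
  have "fsum (\<lambda>(a, b). dlin_antipode (\<Phi> a) \<star> \<Psi> b) u =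
      dlin_antipode (fsum (\<lambda>(a, b). \<Phi> a \<star> dlin_antipode (\<Psi> b)) u)"
    by (subst fsum_hom[of dlin_antipode]) (simp_all add: antipode_diff case_prod_unfold antipode_mult antipode_antipode)
  then show "fsum (\<lambda>(a, b). dlin_antipode (\<Phi> a) \<star> \<Psi> b) u = seq_target (\<gamma> 0)"
    by (simp add: 1 antipode_source)
qed

locale seq_hopf = seq_coring H \<Phi> for H :: "('k::differential_field, 'a, 'z) hopf_algebroid_scheme" and \<Phi> +
  assumes mult_closed: "\<lbrakk>a \<in> carrier H; b \<in> carrier H\<rbrakk> \<Longrightarrow> a \<otimes>\<^bsub>H\<^esub> b \<in> carrier H"
    and emb_mult: "\<lbrakk>a \<in> carrier H; b \<in> carrier H\<rbrakk> \<Longrightarrow> \<Phi> (a \<otimes>\<^bsub>H\<^esub> b) = \<Phi> a \<star> \<Phi> b"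
    and one_closed: "\<one>\<^bsub>H\<^esub> \<in> carrier H" and emb_one: "\<Phi> \<one>\<^bsub>H\<^esub> = seq_source 1"
    and source_closed: "source H x \<in> carrier H" and emb_source: "\<Phi> (source H x) = seq_source x"
    and target_closed: "target H x \<in> carrier H" and emb_target: "\<Phi> (target H x) = seq_target x"
    and antipode_closed: "a \<in> carrier H \<Longrightarrow> antipode H a \<in> carrier H"
    and emb_antipode: "a \<in> carrier H \<Longrightarrow> \<Phi> (antipode H a) = dlin_antipode (\<Phi> a)"
begin

lemma is_cring: "cring H"
proof (rule cringI)
  show "Group.comm_monoid H"
    by (rule comm_monoidI)
      (auto intro!: emb_eqI simp: mult_closed one_closed emb_mult emb_one hurwitz_ac)
qed (auto intro!: emb_eqI simp: is_abelian_group mult_closed add_closed emb_mult emb_add hurwitz_add_left)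

lemma additive_extension_antipode:
  assumes h: "h \<in> carrier H"
  shows "additive_extension H (\<lambda>(a, b). a \<otimes>\<^bsub>H\<^esub> antipode H b) (comult H h) = source H (counit H h)"
    and "additive_extension H (\<lambda>(a, b). antipode H a \<otimes>\<^bsub>H\<^esub> b) (comult H h) = target H (counit H h)"
proof -
  note k = self.coact_keys[OF h]
  have cl: "(\<lambda>(a, b). a \<otimes>\<^bsub>H\<^esub> antipode H b) p \<in> carrier H" "(\<lambda>(a, b). antipode H a \<otimes>\<^bsub>H\<^esub> b) p \<in> carrier H"
    if "p \<in> Poly_Mapping.keys (rep (comult H h))" for p
    using that by (cases p; auto simp: mult_closed antipode_closed dest: k)+
  have "fsum (\<lambda>p. \<Phi> (case p of (a, b) \<Rightarrow> a \<otimes>\<^bsub>H\<^esub> antipode H b)) (rep (comult H h)) =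
      fsum (\<lambda>(a, b). \<Phi> a \<star> dlin_antipode (\<Phi> b)) (rep (comult H h))"
    using k by (intro fsum_cong) (auto simp: emb_mult emb_antipode antipode_closed)
  then show "additive_extension H (\<lambda>(a, b). a \<otimes>\<^bsub>H\<^esub> antipode H b) (comult H h) = source H (counit H h)"
    using emb_additive_extension[where X = "comult H h" and g = "\<lambda>(a, b). a \<otimes>\<^bsub>H\<^esub> antipode H b", OF cl(1)]
      tensor_eval_antipode(1)[OF comult_eval[OF h]]
    by (intro emb_eqI) (auto simp: source_closed emb_source counit_eq[OF h])
  have "fsum (\<lambda>p. \<Phi> (case p of (a, b) \<Rightarrow> antipode H a \<otimes>\<^bsub>H\<^esub> b)) (rep (comult H h)) =
      fsum (\<lambda>(a, b). dlin_antipode (\<Phi> a) \<star> \<Phi> b) (rep (comult H h))"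
    using k by (intro fsum_cong) (auto simp: emb_mult emb_antipode antipode_closed)
  then show "additive_extension H (\<lambda>(a, b). antipode H a \<otimes>\<^bsub>H\<^esub> b) (comult H h) = target H (counit H h)"
    using emb_additive_extension[where X = "comult H h" and g = "\<lambda>(a, b). antipode H a \<otimes>\<^bsub>H\<^esub> b", OF cl(2)]
      tensor_eval_antipode(2)[OF comult_eval[OF h]]
    by (intro emb_eqI) (auto simp: target_closed emb_target counit_eq[OF h])
qed

lemma comult_mult:
  assumes g: "g \<in> carrier H" and h: "h \<in> carrier H"
  shows "comult H (g \<otimes>\<^bsub>H\<^esub> h) = tensor_mult H (comult H g) (comult H h)"
  unfolding tensor_mult_def
proof (rule CC.tensor_eqI)
  show "comult H (g \<otimes>\<^bsub>H\<^esub> h) \<in> carrier (tensor H H)"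
    by (simp add: comult_closed mult_closed g h)
  show "Poly_Mapping.keys (frag_extend (\<lambda>(a, b). frag_extend (\<lambda>(c, d). frag_of (a \<otimes>\<^bsub>H\<^esub> c, b \<otimes>\<^bsub>H\<^esub> d))
      (rep (comult H h))) (rep (comult H g))) \<subseteq> carrier H \<times> carrier H"
    by (rule keys_frag_extend_subset, simp only: split_paired_all prod.case,
        rule keys_frag_extend_subset, simp only: split_paired_all prod.case, rule keys_frag_of_subset)
      (use self.coact_keys[OF g] self.coact_keys[OF h] mult_closed in blast)
  fix m
  have "tensor_eval \<Phi> \<Phi> (frag_extend (\<lambda>(a, b). frag_extend (\<lambda>(c, d). frag_of (a \<otimes>\<^bsub>H\<^esub> c, b \<otimes>\<^bsub>H\<^esub> d))
      (rep (comult H h))) (rep (comult H g))) m =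
    fsum (\<lambda>(a, b). fsum (\<lambda>(c, d). \<Phi> (a \<otimes>\<^bsub>H\<^esub> c) \<star> seq_target (\<Phi> (b \<otimes>\<^bsub>H\<^esub> d) m)) (rep (comult H h)))
      (rep (comult H g))"
    by (simp add: tensor_eval_def fsum_frag_extend case_prod_unfold)
  also have "\<dots> = fsum (\<lambda>(a, b). fsum (\<lambda>(c, d). (\<Phi> a \<star> \<Phi> c) \<star> seq_target ((\<Phi> b \<star> \<Phi> d) m))
      (rep (comult H h))) (rep (comult H g))"
    by (rule fsum_cong, simp only: split_paired_all prod.case, rule fsum_cong,
        simp only: split_paired_all prod.case)
      (use self.coact_keys[OF g] self.coact_keys[OF h] emb_mult in force)
  also have "\<dots> = (seq_shift ^^ m) (\<Phi> g \<star> \<Phi> h)"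
    by (rule tensor_eval_mult) (simp_all add: comult_eval g h)
  finally show "tensor_eval \<Phi> \<Phi> (rep (comult H (g \<otimes>\<^bsub>H\<^esub> h))) m =
      tensor_eval \<Phi> \<Phi> (frag_extend (\<lambda>(a, b). frag_extend (\<lambda>(c, d). frag_of (a \<otimes>\<^bsub>H\<^esub> c, b \<otimes>\<^bsub>H\<^esub> d))
      (rep (comult H h))) (rep (comult H g))) m"
    by (simp add: comult_eval mult_closed g h emb_mult)
qed

lemma comult_source: "comult H (source H x) = pure_tensor H H (source H x) \<one>\<^bsub>H\<^esub>"
  unfolding pure_tensor_def
proof (rule CC.tensor_eqI)
  fix m
  show "tensor_eval \<Phi> \<Phi> (rep (comult H (source H x))) m = tensor_eval \<Phi> \<Phi> (frag_of (source H x, \<one>\<^bsub>H\<^esub>)) m"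
  proof (cases m)
    case 0
    then show ?thesis
      by (simp add: comult_eval source_closed emb_source emb_one)
  next
    case (Suc n)
    have "(seq_shift ^^ Suc n) (seq_source x) = (seq_shift ^^ n) 0"
      by (simp add: funpow_swap1 seq_source_shift)
    also have "\<dots> = 0" by (induction n) auto
    finally show ?thesis
      using Suc by (simp add: comult_eval source_closed emb_source emb_one del: funpow.simps)
        (simp add: seq_source_def)
  qed
qed (auto simp: comult_closed source_closed one_closed)

lemma comult_target: "comult H (target H x) = pure_tensor H H \<one>\<^bsub>H\<^esub> (target H x)"
  unfolding pure_tensor_def
  by (rule CC.tensor_eqI)
    (auto simp: comult_closed comult_eval target_closed one_closed emb_one emb_target seq_shift_pow_target)

theorem is_commutative_hopf_algebroid:
  assumes smult: "\<And>x h. h \<in> carrier H \<Longrightarrow> x \<odot>\<^bsub>H\<^esub> h = source H x \<otimes>\<^bsub>H\<^esub> h"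
    and rsmult: "\<And>x h. h \<in> carrier H \<Longrightarrow> rsmult H h x = h \<otimes>\<^bsub>H\<^esub> target H x"
  shows "commutative_hopf_algebroid H"
proof -
  have source_1: "source H 1 = \<one>\<^bsub>H\<^esub>"
    by (intro emb_eqI) (auto simp: source_closed one_closed emb_source emb_one)
  have "source H \<in> ring_hom \<bbbK> H"
    by (rule ring_hom_memI) (auto intro!: emb_eqI simp: source_closed mult_closed add_closed one_closed
        emb_source emb_mult emb_add emb_one seq_source_hom)
  moreover have "target H \<in> ring_hom \<bbbK> H"
    by (rule ring_hom_memI) (auto intro!: emb_eqI simp: target_closed mult_closed add_closed one_closed
        emb_target emb_mult emb_add emb_one seq_target_add seq_target_mult)
  moreover have "source H c = target H c" if "c \<in> constants" for c
    using that by (intro emb_eqI)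
      (auto simp: source_closed target_closed emb_source emb_target constants_def seq_target_constant)
  moreover have "counit H \<in> ring_hom H \<bbbK>"
    by (rule ring_hom_memI) (auto simp: counit_eq mult_closed add_closed one_closed emb_mult emb_add
        emb_one fun_apply hurwitz_0 seq_source_def)
  moreover have "counit H (source H x) = x" "counit H (target H x) = x" for x
    by (simp_all add: counit_eq source_closed target_closed emb_source emb_target seq_source_def)
  moreover have "antipode H \<in> ring_hom H H"
    by (rule ring_hom_memI) (auto intro!: emb_eqI simp: antipode_closed mult_closed add_closed one_closed
        emb_antipode emb_mult emb_add emb_one antipode_mult antipode_add antipode_source)
  moreover have "antipode H (source H x) = target H x" "antipode H (target H x) = source H x" for x
    by (auto intro!: emb_eqI simp: antipode_closed source_closed target_closed emb_antipode emb_source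
        emb_target antipode_source antipode_target)
  ultimately show ?thesis
    unfolding commutative_hopf_algebroid_def
    using is_cring is_coring smult rsmult comult_mult comult_source[of 1] comult_source comult_target
      additive_extension_antipode
    by (simp add: source_1)
qed

end

text \<open>Every structure map is pinned down by its effect on sequences, so a bijection that
  preserves sequences respects all of them.\<close>

lemma hopf_algebroid_isosI:
  assumes H: "seq_hopf H \<Phi>" and H': "seq_hopf H' \<Phi>'"
    and f: "bij_betw f (carrier H) (carrier H')" "\<And>h. h \<in> carrier H \<Longrightarrow> \<Phi>' (f h) = \<Phi> h"
  shows "f \<in> hopf_algebroid_isos H H'"
proof -
  interpret H: seq_hopf H \<Phi> by fact
  interpret H': seq_hopf H' \<Phi>' by fact
  have cl: "f h \<in> carrier H'" if "h \<in> carrier H" for h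
    using f(1) that by (auto simp: bij_betw_def)
  have "f \<in> ring_hom H H'"
    by (rule ring_hom_memI) (auto intro!: H'.emb_eqI simp: cl f(2) H.mult_closed H.add_closed H.one_closed
        H'.mult_closed H'.add_closed H'.one_closed H.emb_mult H.emb_add H.emb_one H'.emb_mult H'.emb_add
        H'.emb_one)
  moreover have "f \<in> coring_homs H H'"
  proof (rule H'.coring_homsI)
    show "f \<in> linear_maps H H'"
      by (auto simp: linear_maps_iff cl f(2) H.add_closed H.smult_closed H'.add_closed H'.smult_closed
          H.emb_add H.emb_smult H'.emb_add H'.emb_smult intro!: H'.emb_eqI)
    fix b x assume b: "b \<in> carrier H"
    show "f (rsmult H b x) = rsmult H' (f b) x"
      using b by (intro H'.emb_eqI) (auto simp: cl f(2) H.rsmult_closed H'.rsmult_closed H.emb_rsmult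
          H'.emb_rsmult)
    show "\<Phi>' (f b) 0 = counit H b" using b by (simp add: f(2) H.counit_eq)
    show "Poly_Mapping.keys (rep (comult H b)) \<subseteq> carrier H \<times> carrier H"
      by (rule H.CC.tensor_rep_keys[OF H.comult_closed[OF b]])
    fix m
    have "fsum (\<lambda>(x, y). \<Phi>' (f x) \<star> seq_target (\<Phi>' (f y) m)) (rep (comult H b)) =
        tensor_eval \<Phi> \<Phi> (rep (comult H b)) m"
      unfolding tensor_eval_def using H.self.coact_keys[OF b] by (intro fsum_cong) (auto simp: f(2))
    then show "fsum (\<lambda>(x, y). \<Phi>' (f x) \<star> seq_target (\<Phi>' (f y) m)) (rep (comult H b)) =
        (seq_shift ^^ m) (\<Phi>' (f b))"
      using b by (simp add: H.comult_eval f(2))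
  qed
  moreover have "f (source H x) = source H' x" "f (target H x) = target H' x" for x
    by (auto intro!: H'.emb_eqI simp: cl f(2) H.source_closed H'.source_closed H.target_closed
        H'.target_closed H.emb_source H'.emb_source H.emb_target H'.emb_target)
  moreover have "f (antipode H h) = antipode H' (f h)" if "h \<in> carrier H" for h
    using that by (intro H'.emb_eqI) (auto simp: cl f(2) H.antipode_closed H'.antipode_closed
        H.emb_antipode H'.emb_antipode)
  ultimately show ?thesis using f(1) by (auto simp: hopf_algebroid_isos_def)
qed

section \<open>Recursive sequences as sequences of finite rank over the target action\<close>

section \<open>Differentially recursive sequences\<close>

interpretation tsp: vector_space "\<lambda>x \<alpha>. \<alpha> \<star> seq_target x"
  by unfold_locales
    (simp_all add: hurwitz_add_left hurwitz_add_right seq_target_add hurwitz_assoc seq_target_mult[symmetric]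
      mult.commute)

lemma tspan_lincomb:
  "(\<And>i. i \<in> I \<Longrightarrow> f i \<in> B) \<Longrightarrow> (\<Sum>i\<in>I. f i \<star> seq_target (c i)) \<in> tsp.span B"
  by (rule tsp.span_sum, rule tsp.span_scale, rule tsp.span_base)

lemma tspan_image_lessThan:
  "\<alpha> \<in> tsp.span (f ` {..<d::nat}) \<longleftrightarrow> (\<exists>c. \<alpha> = (\<Sum>i<d. f i \<star> seq_target (c i)))"
proof
  show "\<alpha> \<in> tsp.span (f ` {..<d}) \<Longrightarrow> \<exists>c. \<alpha> = (\<Sum>i<d. f i \<star> seq_target (c i))"
  proof (induction d arbitrary: \<alpha>)
    case 0
    then show ?case by simp
  next
    case (Suc d)
    then have "\<alpha> \<in> tsp.span (insert (f d) (f ` {..<d}))" by (simp add: lessThan_Suc)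
    then obtain k where "\<alpha> - f d \<star> seq_target k \<in> tsp.span (f ` {..<d})"
      by (auto simp: tsp.span_breakdown_eq)
    then obtain c where c: "\<alpha> - f d \<star> seq_target k = (\<Sum>i<d. f i \<star> seq_target (c i))"
      using Suc.IH by blast
    have "\<alpha> = (\<Sum>i<Suc d. f i \<star> seq_target ((c(d := k)) i))"
      using c by (simp add: diff_eq_eq)
    then show ?case by blast
  qed
  show "\<exists>c. \<alpha> = (\<Sum>i<d. f i \<star> seq_target (c i)) \<Longrightarrow> \<alpha> \<in> tsp.span (f ` {..<d})"
    by (auto intro!: tspan_lincomb)
qed

text \<open>The shift is additive but not linear for the action through t: N(\<alpha> t(x)) =
  N(\<alpha>) t(x) + \<alpha> t(\<partial> x). The induction over the span therefore carries
  membership of \<alpha> itself along.\<close>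

lemma shift_tspan:
  assumes "\<alpha> \<in> tsp.span B" "\<And>b. b \<in> B \<Longrightarrow> seq_shift b \<in> tsp.span B"
  shows "seq_shift \<alpha> \<in> tsp.span B"
proof -
  have "\<alpha> \<in> tsp.span B \<and> seq_shift \<alpha> \<in> tsp.span B"
    using assms(1)
  proof (rule tsp.span_induct)
    show "tsp.subspace {\<beta>. \<beta> \<in> tsp.span B \<and> seq_shift \<beta> \<in> tsp.span B}"
      by (rule tsp.subspaceI)
        (auto simp: hurwitz_shift seq_target_shift tsp.span_zero tsp.span_add tsp.span_scale)
  qed (use assms(2) in \<open>auto intro: tsp.span_base\<close>)
  then show ?thesis by simp
qed

lemma annihilated_in_degree_iff:
  "annihilated_in_degree \<alpha> d \<longleftrightarrow>
    (\<exists>c. c d \<noteq> 0 \<and> (\<Sum>i\<le>d. (seq_shift ^^ i) \<alpha> \<star> seq_target (c i)) = 0)"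
  by (auto simp: annihilated_in_degree_def fun_eq_iff fun_apply sum_fun_apply hurwitz_commute)

text \<open>Nothing ties \<open>B\<close> to \<alpha>: the spanning sequences are arbitrary, which
  makes closure under products and under the antipode easy to prove.\<close>

definition finite_rank :: "(nat \<Rightarrow> 'k::differential_field) \<Rightarrow> bool" where
  "finite_rank \<alpha> \<longleftrightarrow> (\<exists>B. finite B \<and> (\<forall>m. (seq_shift ^^ m) \<alpha> \<in> tsp.span B))"

text \<open>Multiplying the relation by t(1/c_d) expresses the d-th shift through the earlier ones;
  their span is then stable under the shift and contains all shifts.\<close>

lemma dlin_imp_finite_rank:
  assumes "\<alpha> \<in> dlin"
  shows "finite_rank \<alpha>"
proof -
  from assms obtain d c where c: "c d \<noteq> 0" "(\<Sum>i\<le>d. (seq_shift ^^ i) \<alpha> \<star> seq_target (c i)) = 0"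
    by (auto simp: dlin_def annihilated_in_degree_iff)
  define B where "B = (\<lambda>i. (seq_shift ^^ i) \<alpha>) ` {..<d}"
  have "(\<Sum>i<d. (seq_shift ^^ i) \<alpha> \<star> seq_target (c i / c d)) + (seq_shift ^^ d) \<alpha> =
      (\<Sum>i\<le>d. (seq_shift ^^ i) \<alpha> \<star> seq_target (c i)) \<star> seq_target (1 / c d)"
    using c(1) by (simp add: hurwitz_sum_left hurwitz_add_left hurwitz_assoc seq_target_mult[symmetric]
        lessThan_Suc_atMost[symmetric] del: c(2))
  also have "\<dots> = 0"
    by (simp only: c(2) hurwitz_zero_left)
  finally have "(\<Sum>i<d. (seq_shift ^^ i) \<alpha> \<star> seq_target (c i / c d)) + (seq_shift ^^ d) \<alpha> = 0" .
  then have "(seq_shift ^^ d) \<alpha> = - (\<Sum>i<d. (seq_shift ^^ i) \<alpha> \<star> seq_target (c i / c d))"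
    by (simp add: eq_neg_iff_add_eq_0 add.commute)
  then have d: "(seq_shift ^^ d) \<alpha> \<in> tsp.span B"
    by (auto simp: B_def intro!: tsp.span_neg tspan_lincomb)
  have shift: "seq_shift b \<in> tsp.span B" if b: "b \<in> B" for b
  proof -
    obtain i where i: "i < d" "b = (seq_shift ^^ i) \<alpha>" using b by (auto simp: B_def)
    then have "seq_shift b = (seq_shift ^^ Suc i) \<alpha>" by simp
    then show ?thesis
      using i d by (cases "Suc i = d") (auto simp: B_def simp del: funpow.simps intro!: tsp.span_base)
  qed
  have "(seq_shift ^^ m) \<alpha> \<in> tsp.span B" for m
  proof (induction m)
    case 0
    \<comment> \<open>For \<open>d = 0\<close> the set \<open>B\<close> is empty and the relation
      itself says that \<alpha> is zero.\<close>
    show ?case using d by (cases "d = 0") (auto simp: B_def intro!: tsp.span_base image_eqI[of _ _ 0])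
  next
    case (Suc m)
    then show ?case using shift_tspan[OF Suc shift] by simp
  qed
  then show ?thesis by (auto simp: finite_rank_def B_def intro!: exI[of _ B])
qed

text \<open>If no shift lay in the span of the preceding ones, the first \<open>Suc (card B)\<close>
  shifts would be independent inside the span of \<open>B\<close>. A shift that does lie there gives
  a recursion.\<close>

lemma finite_rank_imp_dlin:
  assumes "finite_rank \<alpha>"
  shows "\<alpha> \<in> dlin"
proof -
  let ?f = "\<lambda>i. (seq_shift ^^ i) \<alpha>"
  obtain B where B: "finite B" "\<And>m. ?f m \<in> tsp.span B"
    using assms by (auto simp: finite_rank_def)
  have "\<exists>d. ?f d \<in> tsp.span (?f ` {..<d})"
  proof (rule ccontr)
    assume neg: "\<nexists>d. ?f d \<in> tsp.span (?f ` {..<d})"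
    have "tsp.independent (?f ` {..<n}) \<and> card (?f ` {..<n}) = n" for n
    proof (induction n)
      case (Suc n)
      have "?f n \<notin> tsp.span (?f ` {..<n})" using neg by blast
      moreover from this have "?f n \<notin> ?f ` {..<n}" by (rule contrapos_nn) (rule tsp.span_base)
      ultimately show ?case
        using Suc by (simp add: lessThan_Suc tsp.independent_insert)
    qed (simp add: tsp.independent_empty)
    then have "tsp.independent (?f ` {..<Suc (card B)})" "card (?f ` {..<Suc (card B)}) = Suc (card B)"
      by blast+
    moreover have "?f ` {..<Suc (card B)} \<subseteq> tsp.span B" using B(2) by blast
    ultimately show False
      using tsp.independent_span_bound[OF B(1), of "?f ` {..<Suc (card B)}"] by simp
  qed
  then obtain d c where "?f d = (\<Sum>i<d. ?f i \<star> seq_target (c i))"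
    by (auto simp: tspan_image_lessThan)
  \<comment> \<open>The value -1 at \<open>d\<close> brings the d-th shift to the other side and is
    the non-zero leading coefficient of the recursion.\<close>
  then have "(\<Sum>i\<le>d. ?f i \<star> seq_target ((c(d := - 1)) i)) = 0"
    by (simp add: lessThan_Suc_atMost[symmetric] tsp.scale_minus_left)
  then show ?thesis
    by (auto simp: dlin_def annihilated_in_degree_iff intro!: exI[of _ d] exI[of _ "c(d := - 1)"])
qed

lemma dlin_iff: "\<alpha> \<in> dlin \<longleftrightarrow> finite_rank \<alpha>"
  using dlin_imp_finite_rank finite_rank_imp_dlin by blast

lemma of_nat_mult_tspan: "\<alpha> \<in> tsp.span B \<Longrightarrow> of_nat n * \<alpha> \<in> tsp.span B"
  by (induction n) (auto simp: algebra_simps tsp.span_zero tsp.span_add)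

lemma dlin_0: "0 \<in> dlin"
proof -
  have "(seq_shift ^^ m) 0 = 0" for m by (induction m) auto
  then show ?thesis by (auto simp: dlin_iff finite_rank_def intro!: exI[of _ "{}"])
qed

lemma dlin_add: "\<alpha> \<in> dlin \<Longrightarrow> \<beta> \<in> dlin \<Longrightarrow> \<alpha> + \<beta> \<in> dlin"
proof -
  assume "\<alpha> \<in> dlin" "\<beta> \<in> dlin"
  then obtain A B where "finite A" "finite B" "\<forall>m. (seq_shift ^^ m) \<alpha> \<in> tsp.span A"
    "\<forall>m. (seq_shift ^^ m) \<beta> \<in> tsp.span B"
    by (auto simp: dlin_iff finite_rank_def)
  then show ?thesis
    unfolding dlin_iff finite_rank_def seq_shift_pow_add
    by (intro exI[of _ "A \<union> B"] conjI allI tsp.span_add)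
      (auto intro: subsetD[OF tsp.span_mono[of A "A \<union> B"]] subsetD[OF tsp.span_mono[of B "A \<union> B"]])
qed

lemma dlin_shift: "\<alpha> \<in> dlin \<Longrightarrow> seq_shift \<alpha> \<in> dlin"
  by (auto simp: dlin_iff finite_rank_def) (metis funpow_simps_right(2) comp_apply)

lemma dlin_shift_pow: "\<alpha> \<in> dlin \<Longrightarrow> (seq_shift ^^ i) \<alpha> \<in> dlin"
  by (induction i) (auto simp: dlin_shift)

text \<open>By the Leibniz rule the shifts of the product are combinations of products of shifts.
  The span of the products of spanning sequences absorbs these, since t(x) can be moved past either
  factor.\<close>

lemma dlin_mult: "\<alpha> \<in> dlin \<Longrightarrow> \<beta> \<in> dlin \<Longrightarrow> \<alpha> \<star> \<beta> \<in> dlin"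
proof -
  assume "\<alpha> \<in> dlin" "\<beta> \<in> dlin"
  then obtain A B where AB: "finite A" "finite B" "\<And>m. (seq_shift ^^ m) \<alpha> \<in> tsp.span A"
    "\<And>m. (seq_shift ^^ m) \<beta> \<in> tsp.span B"
    by (auto simp: dlin_iff finite_rank_def)
  let ?C = "(\<lambda>(a, b). a \<star> b) ` (A \<times> B)"
  have 1: "a \<star> \<gamma> \<in> tsp.span ?C" if "a \<in> A" "\<gamma> \<in> tsp.span B" for a \<gamma>
    using that(2)
  proof (rule tsp.span_induct)
    show "tsp.subspace {\<gamma>. a \<star> \<gamma> \<in> tsp.span ?C}"
      by (rule tsp.subspaceI)
        (auto simp: hurwitz_add_right tsp.span_zero tsp.span_add hurwitz_assoc[symmetric] tsp.span_scale)
  qed (use that(1) in \<open>auto intro!: tsp.span_base\<close>)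
  have 2: "\<delta> \<star> \<gamma> \<in> tsp.span ?C" if "\<delta> \<in> tsp.span A" "\<gamma> \<in> tsp.span B" for \<delta> \<gamma>
    using that(1)
  proof (rule tsp.span_induct)
    show "tsp.subspace {\<delta>. \<delta> \<star> \<gamma> \<in> tsp.span ?C}"
    proof (rule tsp.subspaceI)
      fix k \<delta> assume "\<delta> \<in> {\<delta>. \<delta> \<star> \<gamma> \<in> tsp.span ?C}"
      then have "(\<delta> \<star> \<gamma>) \<star> seq_target k \<in> tsp.span ?C" by (intro tsp.span_scale) simp
      then show "\<delta> \<star> seq_target k \<in> {\<delta>. \<delta> \<star> \<gamma> \<in> tsp.span ?C}" by (simp add: hurwitz_ac)
    qed (auto simp: hurwitz_add_left tsp.span_zero tsp.span_add)
  qed (use 1 that(2) in auto)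
  have "(seq_shift ^^ m) (\<alpha> \<star> \<beta>) \<in> tsp.span ?C" for m
    unfolding shift_mult_pow by (intro tsp.span_sum of_nat_mult_tspan 2 AB)
  then show ?thesis
    unfolding dlin_iff finite_rank_def using AB(1,2) by (intro exI[of _ ?C]) auto
qed

lemma dlin_source: "seq_source x \<in> dlin"
proof -
  have "(seq_shift ^^ Suc m) (seq_source x) = 0" for m
  proof -
    have "(seq_shift ^^ m) 0 = (0 :: nat \<Rightarrow> 'a)" by (induction m) auto
    then show ?thesis by (simp add: funpow_Suc_right seq_source_shift del: funpow.simps)
  qed
  then have "(seq_shift ^^ m) (seq_source x) \<in> tsp.span {seq_source x}" for m
    by (cases m) (auto simp: tsp.span_base tsp.span_zero simp del: funpow.simps(2))
  then show ?thesis unfolding dlin_iff finite_rank_def by (intro exI[of _ "{seq_source x}"]) auto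
qed

lemma dlin_target: "seq_target x \<in> dlin"
proof -
  have "(seq_shift ^^ m) (seq_target x) \<in> tsp.span {seq_source 1}" for m
    using tsp.span_scale[OF tsp.span_base[of "seq_source 1" "{seq_source 1}"], of "seq_target x m"]
    by (simp add: seq_shift_pow_target)
  then show ?thesis unfolding dlin_iff finite_rank_def by (intro exI[of _ "{seq_source 1}"]) auto
qed

lemma seq_shift_pow_diff_op: "seq_diff ((seq_shift ^^ j) \<alpha>) = (seq_shift ^^ j) (seq_diff \<alpha>)"
proof (induction j)
  case (Suc j)
  have "seq_diff (seq_shift \<beta>) = seq_shift (seq_diff \<beta>)" for \<beta> :: "nat \<Rightarrow> 'a"
    by (simp add: seq_diff_def seq_deriv_shift)
  with Suc show ?case by simp
qed simp

text \<open>If \<open>\<Sum> a\<^sub>i \<otimes> b\<^sub>i\<close> represents \<open>\<Delta> \<alpha>\<close>, then \<open>\<Sum> S b\<^sub>i \<otimes> S a\<^sub>i\<close> represents \<open>\<Delta> (S \<alpha>)\<close>.\<close>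

lemma antipode_shift_pow:
  fixes \<alpha> :: "nat \<Rightarrow> 'k::differential_field"
  assumes "\<And>j. tensor_eval \<Phi> \<Psi> u j = (seq_shift ^^ j) \<alpha>"
  shows "(seq_shift ^^ m) (dlin_antipode \<alpha>) =
    fsum (\<lambda>(a, b). dlin_antipode (\<Psi> b) \<star> seq_target (dlin_antipode (\<Phi> a) m)) u"
  using assms
proof (induction m arbitrary: \<alpha> \<Phi>)
  case 0
  have "\<alpha> = fsum (\<lambda>(a, b). seq_source (\<Phi> a 0) \<star> \<Psi> b) u"
  proof
    fix j
    have "\<alpha> j = tensor_eval \<Phi> \<Psi> u j 0" by (simp add: 0 seq_shift_funpow)
    also have "\<dots> = fsum (\<lambda>(a, b). seq_source (\<Phi> a 0) \<star> \<Psi> b) u j"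
      unfolding tensor_eval_def fsum_at by (intro fsum_cong) (auto simp: hurwitz_0 seq_source_mult)
    finally show "\<alpha> j = fsum (\<lambda>(a, b). seq_source (\<Phi> a 0) \<star> \<Psi> b) u j" .
  qed
  then have "dlin_antipode \<alpha> = fsum (\<lambda>p. dlin_antipode (case p of (a, b) \<Rightarrow> seq_source (\<Phi> a 0) \<star> \<Psi> b)) u"
    using fsum_hom[of dlin_antipode, OF antipode_diff] by metis
  also have "\<dots> = fsum (\<lambda>(a, b). dlin_antipode (\<Psi> b) \<star> seq_target (dlin_antipode (\<Phi> a) 0)) u"
    by (intro fsum_cong) (auto simp: antipode_mult antipode_source hurwitz_commute)
  finally show ?case by simp
next
  case (Suc m)
  \<comment> \<open>\<open>seq_diff\<close> kills target sequences, so applying it to the left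
    factors alone turns a tensor for \<alpha> into one for \<open>seq_diff \<alpha>\<close>; by
    \<open>antipode_shift\<close> that is what one more shift of the antipode requires.\<close>
  have "tensor_eval (\<lambda>a. seq_diff (\<Phi> a)) \<Psi> u j = (seq_shift ^^ j) (seq_diff \<alpha>)" for j
  proof -
    have "seq_diff (fsum (\<lambda>(a, b). \<Phi> a \<star> seq_target (\<Psi> b j)) u) =
        fsum (\<lambda>p. seq_diff (case p of (a, b) \<Rightarrow> \<Phi> a \<star> seq_target (\<Psi> b j))) u"
      by (rule fsum_hom[of seq_diff]) (simp add: seq_diff_def seq_deriv_diff)
    also have "\<dots> = tensor_eval (\<lambda>a. seq_diff (\<Phi> a)) \<Psi> u j"
      unfolding tensor_eval_def by (intro fsum_cong) (auto simp: seq_diff_mult seq_diff_target)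
    finally show ?thesis
      using Suc.prems[of j] by (simp add: tensor_eval_def seq_shift_pow_diff_op)
  qed
  from Suc.IH[OF this] have "(seq_shift ^^ Suc m) (dlin_antipode \<alpha>) =
      fsum (\<lambda>(a, b). dlin_antipode (\<Psi> b) \<star> seq_target (dlin_antipode (seq_diff (\<Phi> a)) m)) u"
    by (simp add: funpow_Suc_right antipode_shift del: funpow.simps)
  then show ?case
    by (simp add: antipode_shift[symmetric]) (simp add: seq_shift_def)
qed

text \<open>The coefficients of the shifts over \<open>B\<close>, read as sequences in the index of
  the shift, are the right factors of a tensor that represents \<alpha>. By
  \<open>antipode_shift_pow\<close> their antipodes, finite in number, span all shifts of the
  antipode.\<close>

lemma dlin_antipode_closed: "\<alpha> \<in> dlin \<Longrightarrow> dlin_antipode \<alpha> \<in> dlin"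
proof -
  assume "\<alpha> \<in> dlin"
  then obtain B where B: "finite B" "\<And>m. (seq_shift ^^ m) \<alpha> \<in> tsp.span B"
    by (auto simp: dlin_iff finite_rank_def)
  then have "\<exists>c. (seq_shift ^^ m) \<alpha> = (\<Sum>b\<in>B. b \<star> seq_target (c b))" for m
    using tsp.span_finite[OF B(1)] by auto
  then obtain c where c: "\<And>m. (seq_shift ^^ m) \<alpha> = (\<Sum>b\<in>B. b \<star> seq_target (c m b))" by metis
  define u where "u = (\<Sum>b\<in>B. frag_of (b, \<lambda>m. c m b))"
  have "tensor_eval (\<lambda>a. a) (\<lambda>b. b) u j = (seq_shift ^^ j) \<alpha>" for j
    by (simp add: tensor_eval_def u_def fsum_sum c)
  from antipode_shift_pow[of "\<lambda>a. a" "\<lambda>b. b", OF this]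
  have "(seq_shift ^^ m) (dlin_antipode \<alpha>) \<in> tsp.span ((\<lambda>b. dlin_antipode (\<lambda>m. c m b)) ` B)" for m
    by (auto simp: u_def fsum_sum intro!: tspan_lincomb)
  then show ?thesis
    unfolding dlin_iff finite_rank_def using B(1)
    by (intro exI[of _ "(\<lambda>b. dlin_antipode (\<lambda>m. c m b)) ` B"]) auto
qed

section \<open>Operators acting on sequences, and division with remainder\<close>

section \<open>The action of differential operators on sequences\<close>

lemma seq_act_eq: "seq_act \<alpha> P = (\<Sum>i\<le>degree P. (seq_shift ^^ i) \<alpha> \<star> seq_target (coeff P i))"
  by (auto simp: seq_act_def sum_fun_apply hurwitz_commute)

lemma seq_act_eq_sum:
  assumes "\<And>i. i > n \<Longrightarrow> coeff P i = 0"
  shows "seq_act \<alpha> P = (\<Sum>i\<le>n. (seq_shift ^^ i) \<alpha> \<star> seq_target (coeff P i))"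
proof -
  let ?m = "max n (degree P)"
  have "(\<Sum>i\<le>n. (seq_shift ^^ i) \<alpha> \<star> seq_target (coeff P i)) =
      (\<Sum>i\<le>?m. (seq_shift ^^ i) \<alpha> \<star> seq_target (coeff P i))"
    by (rule sum.mono_neutral_left) (auto simp: assms)
  moreover have "seq_act \<alpha> P = (\<Sum>i\<le>?m. (seq_shift ^^ i) \<alpha> \<star> seq_target (coeff P i))"
    unfolding seq_act_eq by (rule sum.mono_neutral_left) (auto simp: coeff_eq_0)
  ultimately show ?thesis by simp
qed

lemma seq_act_add: "seq_act \<alpha> (P + Q) = seq_act \<alpha> P + seq_act \<alpha> Q"
proof -
  let ?m = "max (degree P) (degree Q)"
  have "seq_act \<alpha> (P + Q) = (\<Sum>i\<le>?m. (seq_shift ^^ i) \<alpha> \<star> seq_target (coeff (P + Q) i))"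
    by (rule seq_act_eq_sum) (auto simp: coeff_eq_0)
  moreover have "seq_act \<alpha> P = (\<Sum>i\<le>?m. (seq_shift ^^ i) \<alpha> \<star> seq_target (coeff P i))"
    "seq_act \<alpha> Q = (\<Sum>i\<le>?m. (seq_shift ^^ i) \<alpha> \<star> seq_target (coeff Q i))"
    by (rule seq_act_eq_sum; auto simp: coeff_eq_0)+
  ultimately show ?thesis by (simp add: seq_target_add hurwitz_add_right sum.distrib)
qed

lemma seq_act_0_right [simp]: "seq_act \<alpha> 0 = 0"
  by (simp add: seq_act_eq)

lemma seq_act_0_left [simp]: "seq_act 0 P = 0"
proof -
  have "(seq_shift ^^ m) 0 = (0 :: nat \<Rightarrow> 'a)" for m by (induction m) auto
  then show ?thesis by (simp add: seq_act_eq)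
qed

lemma seq_act_diff: "seq_act \<alpha> (P - Q) = seq_act \<alpha> P - seq_act \<alpha> Q"
  using seq_act_add[of \<alpha> "P - Q" Q] by simp

lemma seq_act_sum: "seq_act \<alpha> (\<Sum>i\<in>I. P i) = (\<Sum>i\<in>I. seq_act \<alpha> (P i))"
  by (induction I rule: infinite_finite_induct) (auto simp: seq_act_add)

lemma seq_act_monom: "seq_act \<alpha> (monom c i) = (seq_shift ^^ i) \<alpha> \<star> seq_target c"
proof (cases "c = 0")
  case False
  have "seq_act \<alpha> (monom c i) = (\<Sum>j\<le>i. if j = i then (seq_shift ^^ i) \<alpha> \<star> seq_target c else 0)"
    unfolding seq_act_eq degree_monom_eq[OF False] by (rule sum.cong) auto
  then show ?thesis by simp
qed simp

lemma seq_act_smult: "seq_act \<alpha> (Polynomial.smult x P) = seq_act \<alpha> P \<star> seq_target x"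
proof -
  have "seq_act \<alpha> (Polynomial.smult x P) =
      (\<Sum>i\<le>degree P. (seq_shift ^^ i) \<alpha> \<star> seq_target (coeff (Polynomial.smult x P) i))"
    by (rule seq_act_eq_sum) (auto simp: coeff_eq_0)
  also have "\<dots> = (\<Sum>i\<le>degree P. ((seq_shift ^^ i) \<alpha> \<star> seq_target (coeff P i)) \<star> seq_target x)"
    by (simp add: seq_target_mult hurwitz_ac)
  also have "\<dots> = seq_act \<alpha> P \<star> seq_target x"
    by (simp add: seq_act_eq hurwitz_sum_left)
  finally show ?thesis .
qed

text \<open>The Leibniz expansion of the j-fold shift of N^i(\<alpha>) t(c) is the commutation
  formula built into \<open>op_mult\<close>; what is left is an exchange of sums.\<close>

lemma seq_act_op_mult: "seq_act \<alpha> (op_mult P Q) = seq_act (seq_act \<alpha> P) Q"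
proof -
  have nat: "seq_target (of_nat n) \<star> \<beta> = of_nat n * \<beta>" for n and \<beta> :: "nat \<Rightarrow> 'a"
    by (induction n) (auto simp: algebra_simps seq_target_add hurwitz_add_left)
  have pow_sum: "(seq_shift ^^ j) (\<Sum>i\<in>I. f i) = (\<Sum>i\<in>I. (seq_shift ^^ j) (f i))"
    for j and f :: "nat \<Rightarrow> nat \<Rightarrow> 'a" and I
    by (induction j) (simp_all add: seq_shift_sum)
  have "(seq_shift ^^ j) ((seq_shift ^^ i) \<alpha> \<star> seq_target (coeff P i)) \<star> seq_target (coeff Q j) =
     (\<Sum>k\<le>j. seq_act \<alpha> (monom (of_nat (j choose k) * (\<partial> ^^ k) (coeff P i) * coeff Q j) (i + (j - k))))"
    for i j
  proof -
    have tk: "(seq_shift ^^ k) (seq_target x) = seq_target ((\<partial> ^^ k) x)" for k and x :: 'a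
      unfolding seq_shift_pow_target by (simp add: seq_target_def[of x])
    have "(seq_shift ^^ j) ((seq_shift ^^ i) \<alpha> \<star> seq_target (coeff P i)) =
        (\<Sum>k\<le>j. of_nat (j choose k) * (seq_target ((\<partial> ^^ k) (coeff P i)) \<star> (seq_shift ^^ (i + (j - k))) \<alpha>))"
      by (subst hurwitz_commute)
        (simp add: shift_mult_pow tk seq_shift_pow_pow)
    then show ?thesis
      by (simp add: hurwitz_sum_left seq_act_monom seq_target_mult hurwitz_assoc nat[symmetric])
        (simp add: hurwitz_ac)
  qed
  then show ?thesis
    unfolding op_mult_def seq_act_sum seq_act_eq[of "seq_act \<alpha> P"]
    by (simp add: seq_act_eq[of \<alpha> P] pow_sum hurwitz_sum_left) (rule sum.swap)
qed

text \<open>The value of a functional on \<open>P\<close> is entry 0 of its sequence acted on by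
  \<open>P\<close>. Linearity in \<open>P\<close> and the rule for products are thereby inherited
  from the action.\<close>

lemma functional_eq_act: "functional_of_seq \<alpha> P = seq_act \<alpha> P 0"
  by (simp add: functional_of_seq_def seq_act_def hurwitz_0 seq_shift_funpow mult.commute)

lemma functional_add: "functional_of_seq \<alpha> (P + Q) = functional_of_seq \<alpha> P + functional_of_seq \<alpha> Q"
  by (simp add: functional_eq_act seq_act_add fun_apply)

lemma functional_diff: "functional_of_seq \<alpha> (P - Q) = functional_of_seq \<alpha> P - functional_of_seq \<alpha> Q"
  by (simp add: functional_eq_act seq_act_diff fun_apply)

lemma functional_smult: "functional_of_seq \<alpha> (Polynomial.smult x P) = x * functional_of_seq \<alpha> P"
  by (simp add: functional_eq_act seq_act_smult hurwitz_0)

lemma functional_monom: "functional_of_seq \<alpha> (monom 1 n) = \<alpha> n"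
  by (simp add: functional_eq_act seq_act_monom seq_shift_funpow)

lemma functional_op_mult: "functional_of_seq \<alpha> (op_mult P Q) = functional_of_seq (seq_act \<alpha> P) Q"
  by (simp add: functional_eq_act seq_act_op_mult)

lemma functional_0 [simp]: "functional_of_seq 0 P = 0" "functional_of_seq \<alpha> 0 = 0"
  by (simp_all add: functional_eq_act fun_apply)

lemma functional_coeff: "functional_of_seq (\<lambda>n. of_bool (n = i)) P = coeff P i"
proof -
  have "functional_of_seq (\<lambda>n. of_bool (n = i)) P = (\<Sum>n\<le>degree P. if n = i then coeff P i else 0)"
    unfolding functional_of_seq_def by (rule sum.cong) auto
  then show ?thesis by (auto simp: coeff_eq_0)
qed

text \<open>U acts faithfully, since indicator sequences read off coefficients. The ring laws of
  \<open>op_mult\<close> then come from the module law, without manipulating its triple sum.\<close>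

lemma op_eqI: "(\<And>\<alpha>. seq_act \<alpha> P = seq_act \<alpha> Q) \<Longrightarrow> P = Q"
  by (rule poly_eqI) (simp add: functional_coeff[symmetric] functional_eq_act)

lemma op_mult_simps:
  "op_mult P (A + B) = op_mult P A + op_mult P B"
  "op_mult P (A - B) = op_mult P A - op_mult P B"
  "op_mult P (Polynomial.smult x A) = Polynomial.smult x (op_mult P A)"
  "op_mult P 0 = 0" "op_mult P 1 = P" "op_mult 1 P = P"
  "op_mult (op_mult P Q) A = op_mult P (op_mult Q A)"
  "op_mult P [:x:] = Polynomial.smult x P"
proof -
  have 1: "seq_act \<alpha> 1 = \<alpha>" for \<alpha> :: "nat \<Rightarrow> 'a"
    by (simp add: seq_act_eq)
  have c: "seq_act \<alpha> [:x:] = \<alpha> \<star> seq_target x" for \<alpha> :: "nat \<Rightarrow> 'a" and x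
    by (simp add: seq_act_eq)
  show
    "op_mult P (A + B) = op_mult P A + op_mult P B"
    "op_mult P (A - B) = op_mult P A - op_mult P B"
    "op_mult P (Polynomial.smult x A) = Polynomial.smult x (op_mult P A)"
    "op_mult P 0 = 0" "op_mult P 1 = P" "op_mult 1 P = P"
    "op_mult (op_mult P Q) A = op_mult P (op_mult Q A)"
    "op_mult P [:x:] = Polynomial.smult x P"
    by (rule op_eqI; simp add: seq_act_op_mult seq_act_add seq_act_diff seq_act_smult 1 c)+
qed

lemma coeff_op_mult_high:
  assumes "n > degree P + degree A"
  shows "coeff (op_mult P A) n = 0"
  unfolding op_mult_def coeff_sum using assms by (intro sum.neutral ballI) auto

text \<open>Each derivation applied to a coefficient of \<open>P\<close> costs one degree, so only
  maximal i and j with k = 0 reach the top. Hence degrees add and there are no zero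
  divisors.\<close>

lemma coeff_op_mult_top: "coeff (op_mult P A) (degree P + degree A) = lead_coeff P * lead_coeff A"
proof -
  let ?g = "\<lambda>i j k. coeff (monom (of_nat (j choose k) * (\<partial> ^^ k) (coeff P i) * coeff A j) (i + (j - k)))
    (degree P + degree A)"
  have g: "?g i j k = (if i = degree P then if j = degree A then if k = 0 then
      lead_coeff P * lead_coeff A else 0 else 0 else 0)"
    if "i \<le> degree P" "j \<le> degree A" "k \<le> j" for i j k
    using that by auto
  have "coeff (op_mult P A) (degree P + degree A) =
      (\<Sum>i\<le>degree P. \<Sum>j\<le>degree A. \<Sum>k\<le>j. ?g i j k)"
    by (simp add: op_mult_def coeff_sum)
  also have "\<dots> = (\<Sum>i\<le>degree P. \<Sum>j\<le>degree A. \<Sum>k\<le>j. if i = degree P then if j = degree A then if k = 0 then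
      lead_coeff P * lead_coeff A else 0 else 0 else 0)"
    by (intro sum.cong refl g) auto
  also have "\<dots> = (\<Sum>i\<le>degree P. if i = degree P then lead_coeff P * lead_coeff A else 0)"
  proof (rule sum.cong)
    fix i
    have "(\<Sum>k\<le>j. if i = degree P then if j = degree A then if k = 0 then lead_coeff P * lead_coeff A
        else 0 else 0 else 0) = (if j = degree A then if i = degree P then lead_coeff P * lead_coeff A
        else 0 else 0)" for j :: nat
      by (cases "i = degree P"; cases "j = degree A") auto
    then show "(\<Sum>j\<le>degree A. \<Sum>k\<le>j. if i = degree P then if j = degree A then if k = 0 then
        lead_coeff P * lead_coeff A else 0 else 0 else 0) =
        (if i = degree P then lead_coeff P * lead_coeff A else 0)"
      by (simp only: sum.delta finite_atMost) simp
  qed simp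
  also have "\<dots> = lead_coeff P * lead_coeff A" by simp
  finally show ?thesis .
qed

lemma degree_op_mult:
  assumes "P \<noteq> 0" "A \<noteq> 0"
  shows "op_mult P A \<noteq> 0" "degree (op_mult P A) = degree P + degree A"
proof -
  have top: "coeff (op_mult P A) (degree P + degree A) \<noteq> 0"
    using assms by (simp add: coeff_op_mult_top)
  then show "op_mult P A \<noteq> 0" by auto
  show "degree (op_mult P A) = degree P + degree A"
    by (rule antisym[OF degree_le le_degree[OF top]]) (auto simp: coeff_op_mult_high)
qed

lemma right_ideal_iff: "u \<in> right_ideal P \<longleftrightarrow> (\<exists>A. u = op_mult P A)"
  by (auto simp: right_ideal_def)

lemma right_ideal_0: "0 \<in> right_ideal P"
  by (metis op_mult_simps(4) right_ideal_iff)

lemma right_ideal_add: "u \<in> right_ideal P \<Longrightarrow> v \<in> right_ideal P \<Longrightarrow> u + v \<in> right_ideal P"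
  by (metis op_mult_simps(1) right_ideal_iff)

lemma right_ideal_diff: "u \<in> right_ideal P \<Longrightarrow> v \<in> right_ideal P \<Longrightarrow> u - v \<in> right_ideal P"
  by (metis op_mult_simps(2) right_ideal_iff)

lemma right_ideal_smult: "u \<in> right_ideal P \<Longrightarrow> Polynomial.smult x u \<in> right_ideal P"
  by (metis op_mult_simps(3) right_ideal_iff)

lemma right_ideal_mult: "u \<in> right_ideal P \<Longrightarrow> op_mult u v \<in> right_ideal P"
  by (metis op_mult_simps(7) right_ideal_iff)

lemma right_ideal_self: "P \<in> right_ideal P"
  by (metis op_mult_simps(5) right_ideal_iff)

text \<open>Leading terms are removed one by one by right multiples of \<open>P\<close>. Remainders
  are bounded through their coefficients and not through \<open>degree\<close>, so that a constant
  \<open>P\<close> forces the remainder 0.\<close>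

lemma right_division_exists:
  assumes P: "P \<noteq> 0" and u: "\<forall>i\<ge>n. coeff u i = 0"
  shows "\<exists>R. (\<forall>i\<ge>degree P. coeff R i = 0) \<and> u - R \<in> right_ideal P"
  using u
proof (induction n arbitrary: u)
  case 0
  then show ?case by (intro exI[of _ u]) (auto simp: right_ideal_0)
next
  case (Suc n)
  show ?case
  proof (cases "Suc n \<le> degree P")
    case True
    with Suc.prems show ?thesis by (intro exI[of _ u]) (auto simp: right_ideal_0)
  next
    case False
    show ?thesis
    proof (cases "coeff u n = 0")
      case True
      have "\<forall>i\<ge>n. coeff u i = 0"
        using True Suc.prems by (metis Suc_leI le_eq_less_or_eq)
      then show ?thesis by (rule Suc.IH)
    next
      case nz: False
      \<comment> \<open>Multiplying \<open>P\<close> on the right by this monomial reproduces the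
        coefficient of \<open>u\<close> at \<open>n\<close>, so the difference falls under the
        induction hypothesis.\<close>
      define A where "A = monom (coeff u n / lead_coeff P) (n - degree P)"
      have A: "degree A = n - degree P" "lead_coeff A = coeff u n / lead_coeff P"
        using P nz by (auto simp: A_def degree_monom_eq)
      have "degree P + degree A = n" using A False by simp
      then have top: "coeff (op_mult P A) n = coeff u n"
        using coeff_op_mult_top[of P A] A P by simp
      have high: "coeff (op_mult P A) i = 0" if "i > n" for i
        using coeff_op_mult_high[of P A i] that A False by simp
      have "coeff (u - op_mult P A) i = 0" if "n \<le> i" for i
        using that top high[of i] Suc.prems by (cases "i = n") auto
      then have "\<forall>i\<ge>n. coeff (u - op_mult P A) i = 0" by blast
      from Suc.IH[OF this] obtain R where R: "\<forall>i\<ge>degree P. coeff R i = 0"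
        "u - op_mult P A - R \<in> right_ideal P" by blast
      have "u - R = (u - op_mult P A - R) + op_mult P A" by simp
      moreover have "op_mult P A \<in> right_ideal P" by (auto simp: right_ideal_iff)
      ultimately have "u - R \<in> right_ideal P" using R(2) right_ideal_add by metis
      with R show ?thesis by blast
    qed
  qed
qed

lemma right_ideal_low_degree:
  assumes "P \<noteq> 0" "u \<in> right_ideal P" "\<forall>i\<ge>degree P. coeff u i = 0"
  shows "u = 0"
proof (rule ccontr)
  assume "u \<noteq> 0"
  with assms(2) obtain A where A: "u = op_mult P A" "A \<noteq> 0"
    using op_mult_simps(4)[of P] by (auto simp: right_ideal_iff)
  with assms(1) have "degree u = degree P + degree A" by (simp add: degree_op_mult)
  with assms(3) have "lead_coeff u = 0" by simp
  with \<open>u \<noteq> 0\<close> show False by simp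
qed

definition op_rem :: "'k::differential_field poly \<Rightarrow> 'k poly \<Rightarrow> 'k poly" where
  "op_rem P u = (SOME R. (\<forall>i\<ge>degree P. coeff R i = 0) \<and> u - R \<in> right_ideal P)"

lemma op_rem:
  assumes "P \<noteq> 0"
  shows "\<forall>i\<ge>degree P. coeff (op_rem P u) i = 0" "u - op_rem P u \<in> right_ideal P"
proof -
  have "\<forall>i\<ge>Suc (degree u). coeff u i = 0" by (simp add: coeff_eq_0)
  from someI_ex[OF right_division_exists[OF assms this]]
  show "\<forall>i\<ge>degree P. coeff (op_rem P u) i = 0" "u - op_rem P u \<in> right_ideal P"
    by (simp_all add: op_rem_def)
qed

lemma op_rem_eqI:
  assumes P: "P \<noteq> 0" and R: "\<forall>i\<ge>degree P. coeff R i = 0" "u - R \<in> right_ideal P"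
  shows "op_rem P u = R"
proof -
  have "R - op_rem P u = (u - op_rem P u) - (u - R)" by simp
  then have "R - op_rem P u \<in> right_ideal P"
    using right_ideal_diff[OF op_rem(2)[OF P, of u] R(2)] by simp
  from right_ideal_low_degree[OF P this] show ?thesis using R(1) op_rem(1)[OF P] by simp
qed

lemma op_rem_linear:
  assumes P: "P \<noteq> 0"
  shows "op_rem P (u + v) = op_rem P u + op_rem P v"
    and "op_rem P (Polynomial.smult x u) = Polynomial.smult x (op_rem P u)"
    and "u - v \<in> right_ideal P \<Longrightarrow> op_rem P u = op_rem P v"
proof -
  have 1: "u + v - (op_rem P u + op_rem P v) = (u - op_rem P u) + (v - op_rem P v)" by simp
  show "op_rem P (u + v) = op_rem P u + op_rem P v"
  proof (rule op_rem_eqI[OF P])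
    show "u + v - (op_rem P u + op_rem P v) \<in> right_ideal P"
      unfolding 1 by (intro right_ideal_add op_rem(2) P)
  qed (use op_rem(1)[OF P] in simp)
  have 2: "Polynomial.smult x u - Polynomial.smult x (op_rem P u) = Polynomial.smult x (u - op_rem P u)"
    by (simp add: smult_diff_right)
  show "op_rem P (Polynomial.smult x u) = Polynomial.smult x (op_rem P u)"
  proof (rule op_rem_eqI[OF P])
    show "Polynomial.smult x u - Polynomial.smult x (op_rem P u) \<in> right_ideal P"
      unfolding 2 by (intro right_ideal_smult op_rem(2) P)
  qed (use op_rem(1)[OF P] in simp)
  assume uv: "u - v \<in> right_ideal P"
  have 3: "u - op_rem P v = (u - v) + (v - op_rem P v)" by simp
  show "op_rem P u = op_rem P v"
  proof (rule op_rem_eqI[OF P])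
    show "u - op_rem P v \<in> right_ideal P"
      unfolding 3 by (intro right_ideal_add op_rem(2) P uv)
  qed (use op_rem(1)[OF P] in simp)
qed

lemma op_rem_monom: "P \<noteq> 0 \<Longrightarrow> j < degree P \<Longrightarrow> op_rem P (monom 1 j) = monom 1 j"
  by (rule op_rem_eqI) (auto simp: right_ideal_0)

section \<open>Linear forms on U/PU as formal solutions, the minimal operator, and the Hopf
  algebroid of recursive sequences\<close>

section \<open>Quotients of the ring of operators and formal solutions\<close>

lemma quotient_class_eq: "quotient_class P u = {h + u | h. h \<in> right_ideal P}"
  by (auto simp: quotient_class_def a_r_coset_def r_coset_def op_ring_def)

lemma quotient_class_eq_iff: "quotient_class P u = quotient_class P v \<longleftrightarrow> u - v \<in> right_ideal P"
proof
  assume "quotient_class P u = quotient_class P v"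
  moreover have "0 + u \<in> quotient_class P u"
    unfolding quotient_class_eq using right_ideal_0 by blast
  ultimately obtain h where "h \<in> right_ideal P" "u = h + v"
    by (auto simp: quotient_class_eq)
  then show "u - v \<in> right_ideal P" by simp
next
  assume uv: "u - v \<in> right_ideal P"
  have "h + u \<in> quotient_class P v" if "h \<in> right_ideal P" for h
    using right_ideal_add[OF that uv]
    unfolding quotient_class_eq by (intro CollectI exI[of _ "h + (u - v)"]) simp
  moreover have "h + v \<in> quotient_class P u" if "h \<in> right_ideal P" for h
    using right_ideal_diff[OF that uv]
    unfolding quotient_class_eq by (intro CollectI exI[of _ "h - (u - v)"]) simp
  ultimately show "quotient_class P u = quotient_class P v"
    by (auto simp: quotient_class_eq[of P u] quotient_class_eq[of P v])
qed

lemma quotient_rep: "rep (quotient_class P u) - u \<in> right_ideal P"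
proof -
  have "0 + u \<in> quotient_class P u"
    unfolding quotient_class_eq using right_ideal_0 by blast
  then have "rep (quotient_class P u) \<in> quotient_class P u"
    unfolding rep_def by (rule someI)
  then show ?thesis by (auto simp: quotient_class_eq)
qed

lemma quotient_space_simps:
  "carrier (quotient_space P) = range (quotient_class P)"
  "\<zero>\<^bsub>quotient_space P\<^esub> = quotient_class P 0"
  "quotient_class P u \<oplus>\<^bsub>quotient_space P\<^esub> quotient_class P v = quotient_class P (u + v)"
  "x \<odot>\<^bsub>quotient_space P\<^esub> quotient_class P u = quotient_class P (Polynomial.smult x u)"
proof -
  have "rep (quotient_class P u) + rep (quotient_class P v) - (u + v) =
     (rep (quotient_class P u) - u) + (rep (quotient_class P v) - v)" by simp
  then show "quotient_class P u \<oplus>\<^bsub>quotient_space P\<^esub> quotient_class P v = quotient_class P (u + v)"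
    by (simp only: quotient_space_def module.simps ring.simps quotient_class_eq_iff)
      (simp add: quotient_class_eq_iff right_ideal_add quotient_rep)
  have "Polynomial.smult x (rep (quotient_class P u)) - Polynomial.smult x u =
     Polynomial.smult x (rep (quotient_class P u) - u)" by (simp add: smult_diff_right)
  then show "x \<odot>\<^bsub>quotient_space P\<^esub> quotient_class P u = quotient_class P (Polynomial.smult x u)"
    by (simp add: quotient_space_def quotient_class_eq_iff right_ideal_smult quotient_rep op_mult_simps)
qed (simp_all add: quotient_space_def)

lemma dual_simps:
  "f \<in> carrier (dual M) \<longleftrightarrow> f \<in> linear_maps M base_module \<and> f \<in> extensional (carrier M)"
  "\<zero>\<^bsub>dual M\<^esub> = (\<lambda>m\<in>carrier M. 0)"
  "f \<oplus>\<^bsub>dual M\<^esub> g = (\<lambda>m\<in>carrier M. f m + g m)"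
  "x \<odot>\<^bsub>dual M\<^esub> f = (\<lambda>m\<in>carrier M. x * f m)"
  by (simp_all add: dual_def)

definition form_seq :: "'k::differential_field poly \<Rightarrow> ('k poly set \<Rightarrow> 'k) \<Rightarrow> nat \<Rightarrow> 'k" where
  "form_seq P f = (\<lambda>n. f (quotient_power P n))"

definition solutions :: "'k::differential_field poly \<Rightarrow> (nat \<Rightarrow> 'k) set" where
  "solutions P = {\<alpha>. seq_act \<alpha> P = 0}"

definition seq_form :: "'k::differential_field poly \<Rightarrow> (nat \<Rightarrow> 'k) \<Rightarrow> 'k poly set \<Rightarrow> 'k" where
  "seq_form P \<alpha> = (\<lambda>X\<in>carrier (quotient_space P). functional_of_seq \<alpha> (rep X))"

lemma dual_quotient_iff:
  "f \<in> carrier (dual (quotient_space P)) \<longleftrightarrow>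
    (\<forall>u v. f (quotient_class P (u + v)) = f (quotient_class P u) + f (quotient_class P v)) \<and>
    (\<forall>x u. f (quotient_class P (Polynomial.smult x u)) = x * f (quotient_class P u)) \<and>
    f \<in> extensional (carrier (quotient_space P))"
  by (auto simp: dual_simps linear_maps_iff quotient_space_simps)

lemma form_functional:
  assumes f: "f \<in> carrier (dual (quotient_space P))"
  shows "f (quotient_class P u) = functional_of_seq (form_seq P f) u"
proof -
  have add: "f (quotient_class P (u + v)) = f (quotient_class P u) + f (quotient_class P v)"
    and sm: "f (quotient_class P (Polynomial.smult x u)) = x * f (quotient_class P u)" for u v x
    using f by (auto simp: dual_quotient_iff)
  have "f (quotient_class P (Polynomial.smult 0 0)) = 0" unfolding sm by simp
  then have z: "f (quotient_class P 0) = 0" by simp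
  have s: "f (quotient_class P (\<Sum>i\<in>I. w i)) = (\<Sum>i\<in>I. f (quotient_class P (w i)))"
    for I and w :: "nat \<Rightarrow> 'a poly"
    by (induction I rule: infinite_finite_induct) (simp_all add: z add)
  have m: "monom c i = Polynomial.smult c (monom 1 i)" for c :: 'a and i
    by (simp add: smult_monom)
  have "f (quotient_class P u) = f (quotient_class P (\<Sum>i\<le>degree u. monom (coeff u i) i))"
    by (simp add: poly_as_sum_of_monoms)
  also have "\<dots> = (\<Sum>i\<le>degree u. coeff u i * form_seq P f i)"
    unfolding s m[of "coeff u _"] sm by (simp add: form_seq_def quotient_power_def)
  finally show ?thesis by (simp add: functional_of_seq_def mult.commute)
qed

text \<open>Entry n of the sequence acted on by \<open>P\<close> is the value of the form on the
  class of P Y^n, which is the zero class.\<close>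

lemma form_seq_solution:
  assumes f: "f \<in> carrier (dual (quotient_space P))"
  shows "form_seq P f \<in> solutions P"
proof -
  have "seq_act (form_seq P f) P n = 0" for n
  proof -
    have "op_mult P (monom 1 n) - 0 \<in> right_ideal P" by (auto simp: right_ideal_iff)
    then have "f (quotient_class P (op_mult P (monom 1 n))) = f (quotient_class P 0)"
      by (simp only: quotient_class_eq_iff[symmetric])
    then show ?thesis
      by (simp add: form_functional[OF f] functional_op_mult functional_monom)
  qed
  then show ?thesis by (auto simp: solutions_def fun_eq_iff fun_apply)
qed

lemma solution_functional_eq:
  assumes "\<alpha> \<in> solutions P" "u - v \<in> right_ideal P"
  shows "functional_of_seq \<alpha> u = functional_of_seq \<alpha> v"
proof -
  obtain A where "u - v = op_mult P A" using assms(2) by (auto simp: right_ideal_iff)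
  then have "functional_of_seq \<alpha> (u - v) = 0"
    using assms(1) by (simp add: functional_op_mult solutions_def)
  then show ?thesis by (simp add: functional_diff)
qed

lemma seq_form_class:
  assumes "\<alpha> \<in> solutions P"
  shows "seq_form P \<alpha> (quotient_class P u) = functional_of_seq \<alpha> u"
  using solution_functional_eq[OF assms quotient_rep]
  by (simp add: seq_form_def quotient_space_simps)

lemma seq_form_dual: "\<alpha> \<in> solutions P \<Longrightarrow> seq_form P \<alpha> \<in> carrier (dual (quotient_space P))"
  unfolding dual_quotient_iff
  by (simp add: seq_form_class functional_add functional_smult) (simp add: seq_form_def)

lemma form_seq_seq_form: "\<alpha> \<in> solutions P \<Longrightarrow> form_seq P (seq_form P \<alpha>) = \<alpha>"
  by (simp add: form_seq_def quotient_power_def seq_form_class functional_monom)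

lemma form_eqI:
  assumes "f \<in> carrier (dual (quotient_space P))" "g \<in> carrier (dual (quotient_space P))"
    and "\<And>u. f (quotient_class P u) = g (quotient_class P u)"
  shows "f = g"
proof (rule extensionalityI[of _ "carrier (quotient_space P)"])
  show "f \<in> extensional (carrier (quotient_space P))" "g \<in> extensional (carrier (quotient_space P))"
    using assms by (auto simp: dual_quotient_iff)
qed (use assms(3) in \<open>auto simp: quotient_space_simps\<close>)

lemma solution_seq_module: "seq_module (dual (quotient_space P)) (form_seq P)"
proof
  let ?D = "dual (quotient_space P)"
  have pw: "quotient_power P n \<in> carrier (quotient_space P)" for n
    by (simp add: quotient_space_simps quotient_power_def)
  have c: "quotient_class P u \<in> carrier (quotient_space P)" for u
    by (simp add: quotient_space_simps)
  show "\<zero>\<^bsub>?D\<^esub> \<in> carrier ?D"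
    unfolding dual_quotient_iff by (simp add: dual_simps c)
  show "form_seq P \<zero>\<^bsub>?D\<^esub> = 0"
    by (auto simp: form_seq_def dual_simps pw fun_apply)
  fix f g x assume f: "f \<in> carrier ?D"
  show "x \<odot>\<^bsub>?D\<^esub> f \<in> carrier ?D"
    using f unfolding dual_quotient_iff by (simp add: dual_simps c algebra_simps)
  show "form_seq P (x \<odot>\<^bsub>?D\<^esub> f) = seq_source x \<star> form_seq P f"
    by (auto simp: form_seq_def dual_simps pw seq_source_mult)
  assume g: "g \<in> carrier ?D"
  show "f \<oplus>\<^bsub>?D\<^esub> g \<in> carrier ?D"
    using f g unfolding dual_quotient_iff by (simp add: dual_simps c algebra_simps)
  show "form_seq P (f \<oplus>\<^bsub>?D\<^esub> g) = form_seq P f + form_seq P g"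
    by (auto simp: form_seq_def dual_simps pw fun_apply)
next
  show "inj_on (form_seq P) (carrier (dual (quotient_space P)))"
  proof (intro inj_onI form_eqI)
    fix f g u assume "f \<in> carrier (dual (quotient_space P))" "g \<in> carrier (dual (quotient_space P))"
      "form_seq P f = form_seq P g"
    then show "f (quotient_class P u) = g (quotient_class P u)"
      using form_functional[of f P u] form_functional[of g P u] by simp
  qed
qed

text \<open>The witness for the description is the coefficient at Y^i of the remainder. It is unique
  because every class is the class of its remainder, a combination of the first
  \<open>degree P\<close> powers; for \<open>i\<close> beyond these the form is zero.\<close>

lemma dual_power:
  assumes P: "P \<noteq> 0"
  shows "dual_power P i \<in> carrier (dual (quotient_space P))"
    and "dual_power P i (quotient_class P u) = (if i < degree P then coeff (op_rem P u) i else 0)"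
proof -
  let ?D = "dual (quotient_space P)"
  define f where "f = (\<lambda>X\<in>carrier (quotient_space P). if i < degree P then coeff (op_rem P (rep X)) i else 0)"
  have fc: "f (quotient_class P u) = (if i < degree P then coeff (op_rem P u) i else 0)" for u
    using op_rem_linear(3)[OF P quotient_rep] by (simp add: f_def quotient_space_simps)
  have f: "f \<in> carrier ?D"
    unfolding dual_quotient_iff by (simp add: fc op_rem_linear[OF P]) (simp add: f_def)
  have fj: "\<forall>j<degree P. f (quotient_power P j) = of_bool (i = j)"
    using P by (auto simp: quotient_power_def fc op_rem_monom)
  have uniq: "g = f" if g: "g \<in> carrier ?D" "\<forall>j<degree P. g (quotient_power P j) = of_bool (i = j)" for g
  proof (rule form_eqI[OF g(1) f])
    fix u
    have R: "quotient_class P u = quotient_class P (op_rem P u)"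
      unfolding quotient_class_eq_iff by (rule op_rem(2)[OF P])
    have "functional_of_seq (form_seq P g) (op_rem P u) = functional_of_seq (form_seq P f) (op_rem P u)"
      unfolding functional_of_seq_def
    proof (rule sum.cong)
      fix n
      show "form_seq P g n * coeff (op_rem P u) n = form_seq P f n * coeff (op_rem P u) n"
        using g(2) fj op_rem(1)[OF P, of u] by (cases "n < degree P") (auto simp: form_seq_def)
    qed simp
    then show "g (quotient_class P u) = f (quotient_class P u)"
      by (simp only: R form_functional[OF f] form_functional[OF g(1)])
  qed
  have "dual_power P i = f"
    unfolding dual_power_def by (intro the_equality conjI f fj, elim conjE) (rule uniq)
  with f fc show "dual_power P i \<in> carrier ?D"
    "dual_power P i (quotient_class P u) = (if i < degree P then coeff (op_rem P u) i else 0)"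
    by simp_all
qed

text \<open>Y^m and its remainder modulo \<open>P\<close> act alike on a solution, and the numbers
  y_i^*(y_m) are the coefficients of the remainder. The evaluations of the comultiplication and of
  the coactions come from here.\<close>

lemma solution_expansion:
  assumes P: "P \<noteq> 0" and \<alpha>: "\<alpha> \<in> solutions P"
  shows "(\<Sum>i<degree P. (seq_shift ^^ i) \<alpha> \<star> seq_target (dual_power P i (quotient_power P m))) =
    (seq_shift ^^ m) \<alpha>"
proof -
  let ?R = "op_rem P (monom 1 m)"
  obtain A where A: "monom 1 m - ?R = op_mult P A"
    using op_rem(2)[OF P, of "monom 1 m"] by (auto simp: right_ideal_iff)
  have "seq_act \<alpha> (monom 1 m - ?R) = 0"
    using \<alpha> by (simp add: A seq_act_op_mult solutions_def)
  then have "(seq_shift ^^ m) \<alpha> = seq_act \<alpha> ?R"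
    by (simp add: seq_act_diff seq_act_monom)
  also have "\<dots> = (\<Sum>i\<le>degree P. (seq_shift ^^ i) \<alpha> \<star> seq_target (coeff ?R i))"
    by (rule seq_act_eq_sum) (use op_rem(1)[OF P] in auto)
  also have "\<dots> = (\<Sum>i<degree P. (seq_shift ^^ i) \<alpha> \<star> seq_target (coeff ?R i))"
    using op_rem(1)[OF P, of "monom 1 m"] by (simp add: lessThan_Suc_atMost[symmetric])
  also have "\<dots> = (\<Sum>i<degree P. (seq_shift ^^ i) \<alpha> \<star> seq_target (dual_power P i (quotient_power P m)))"
    by (rule sum.cong) (auto simp: quotient_power_def dual_power[OF P])
  finally show ?thesis by simp
qed

lemma annihilated_in_degree_solution:
  "annihilated_in_degree \<alpha> d \<longleftrightarrow> (\<exists>P. P \<noteq> 0 \<and> degree P = d \<and> \<alpha> \<in> solutions P)"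
proof
  assume "annihilated_in_degree \<alpha> d"
  then obtain c where c: "c d \<noteq> 0" "(\<Sum>i\<le>d. (seq_shift ^^ i) \<alpha> \<star> seq_target (c i)) = 0"
    by (auto simp: annihilated_in_degree_iff)
  define P where "P = (\<Sum>i\<le>d. monom (c i) i)"
  have coeff: "coeff P i = (if i \<le> d then c i else 0)" for i
    by (simp add: P_def coeff_sum)
  have "degree P = d"
    by (rule antisym[OF degree_le le_degree]) (use c(1) in \<open>auto simp: coeff\<close>)
  moreover have "P \<noteq> 0" using coeff[of d] c(1) by auto
  moreover have "seq_act \<alpha> P = 0"
    using c(2) by (simp add: P_def seq_act_sum seq_act_monom)
  ultimately show "\<exists>P. P \<noteq> 0 \<and> degree P = d \<and> \<alpha> \<in> solutions P" by (auto simp: solutions_def)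
next
  assume "\<exists>P. P \<noteq> 0 \<and> degree P = d \<and> \<alpha> \<in> solutions P"
  then obtain P where "P \<noteq> 0" "degree P = d" "seq_act \<alpha> P = 0" by (auto simp: solutions_def)
  then show "annihilated_in_degree \<alpha> d"
    unfolding annihilated_in_degree_iff seq_act_eq by (intro exI[of _ "coeff P"]) auto
qed

lemma dlin_solution: "\<alpha> \<in> dlin \<longleftrightarrow> (\<exists>P. P \<noteq> 0 \<and> \<alpha> \<in> solutions P)"
  by (auto simp: dlin_def annihilated_in_degree_solution)

lemma seq_annihilator_iff: "Q \<in> seq_annihilator \<alpha> \<longleftrightarrow> \<alpha> \<in> solutions Q"
  by (auto simp: seq_annihilator_def solutions_def fun_eq_iff fun_apply)

text \<open>An annihilating operator of least degree, made monic, generates: the remainder of any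
  other annihilator annihilates \<alpha> as well and would have smaller degree. Two monic generators
  are right multiples of each other, so their quotient is a constant with leading coefficient
  1.\<close>

lemma minimal_operator:
  assumes "\<alpha> \<in> dlin"
  shows "lead_coeff (minimal_operator \<alpha>) = 1" "seq_annihilator \<alpha> = right_ideal (minimal_operator \<alpha>)"
    and "seq_order \<alpha> = degree (minimal_operator \<alpha>)"
proof -
  let ?d = "seq_order \<alpha>"
  have "annihilated_in_degree \<alpha> ?d"
    using assms unfolding seq_order_def by (auto simp: dlin_def intro: LeastI)
  then obtain Q where Q: "Q \<noteq> 0" "degree Q = ?d" "\<alpha> \<in> solutions Q"
    by (auto simp: annihilated_in_degree_solution)
  define P where "P = Polynomial.smult (1 / lead_coeff Q) Q"
  have P: "P \<noteq> 0" "degree P = ?d" "lead_coeff P = 1" "\<alpha> \<in> solutions P"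
    using Q(1,3) unfolding P_def Q(2)[symmetric] by (auto simp: solutions_def seq_act_smult)
  have ann: "seq_annihilator \<alpha> = right_ideal P"
  proof (intro equalityI subsetI)
    fix u assume "u \<in> right_ideal P"
    then show "u \<in> seq_annihilator \<alpha>"
      using P(4) by (auto simp: right_ideal_iff seq_annihilator_iff solutions_def seq_act_op_mult)
  next
    fix u assume u: "u \<in> seq_annihilator \<alpha>"
    let ?R = "op_rem P u"
    obtain A where A: "u - ?R = op_mult P A"
      using op_rem(2)[OF P(1), of u] by (auto simp: right_ideal_iff)
    have "seq_act \<alpha> (u - ?R) = 0"
      using P(4) by (simp add: A seq_act_op_mult solutions_def)
    then have R: "\<alpha> \<in> solutions ?R"
      using u by (simp add: seq_annihilator_iff solutions_def seq_act_diff)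
    have "?R = 0"
    proof (rule ccontr)
      assume nz: "?R \<noteq> 0"
      then have "annihilated_in_degree \<alpha> (degree ?R)"
        using R by (auto simp: annihilated_in_degree_solution)
      then have "degree P \<le> degree ?R"
        unfolding P(2) seq_order_def by (rule Least_le)
      \<comment> \<open>The remainder has no coefficients from \<open>degree P\<close> on, while
        minimality places its degree there.\<close>
      then have "lead_coeff ?R = 0" using op_rem(1)[OF P(1), of u] by blast
      with nz show False by simp
    qed
    then show "u \<in> right_ideal P" using op_rem(2)[OF P(1), of u] by simp
  qed
  have "minimal_operator \<alpha> = P"
    unfolding minimal_operator_def
  proof (rule the_equality)
    fix P' assume P': "lead_coeff P' = 1 \<and> seq_annihilator \<alpha> = right_ideal P'"
    then have "P' \<noteq> 0" by auto
    have "P' \<in> right_ideal P" "P \<in> right_ideal P'"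
      using P' ann right_ideal_self by blast+
    then obtain A B where A: "P' = op_mult P A" and B: "P = op_mult P' B"
      by (auto simp: right_ideal_iff)
    have A0: "A \<noteq> 0"
      using A \<open>P' \<noteq> 0\<close> op_mult_simps(4)[of P] by (intro notI) simp
    have B0: "B \<noteq> 0"
      using B P(1) op_mult_simps(4)[of P'] by (intro notI) simp
    have "degree P' = degree P + degree A" "degree P = degree P' + degree B"
      using degree_op_mult(2)[OF P(1) A0, folded A] degree_op_mult(2)[OF \<open>P' \<noteq> 0\<close> B0, folded B] by blast+
    then have dA: "degree A = 0" "degree P' = degree P" by simp_all
    then have "lead_coeff P * lead_coeff A = lead_coeff P'"
      using coeff_op_mult_top[of P A] A by simp
    then have "lead_coeff A = 1" using P' P(3) by simp
    with dA(1) have "A = [:1:]"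
      by (elim degree_eq_zeroE) simp
    then show "P' = P" using A by (simp add: op_mult_simps(8))
  qed (use P ann in auto)
  then show "lead_coeff (minimal_operator \<alpha>) = 1"
    "seq_annihilator \<alpha> = right_ideal (minimal_operator \<alpha>)"
    "seq_order \<alpha> = degree (minimal_operator \<alpha>)"
    using P ann by auto
qed

lemma minimal_operator_solution:
  assumes "\<alpha> \<in> dlin"
  shows "minimal_operator \<alpha> \<noteq> 0" "\<alpha> \<in> solutions (minimal_operator \<alpha>)"
proof -
  show "minimal_operator \<alpha> \<noteq> 0" using minimal_operator(1)[OF assms] by auto
  show "\<alpha> \<in> solutions (minimal_operator \<alpha>)"
    using minimal_operator(2)[OF assms] right_ideal_self by (auto simp: seq_annihilator_iff[symmetric])
qed

lemma Dlin_simps: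
  "carrier Dlin = dlin" "monoid.mult Dlin = hurwitz_mult" "one Dlin = seq_source 1"
  "ring.zero Dlin = 0" "\<alpha> \<oplus>\<^bsub>Dlin\<^esub> \<beta> = \<alpha> + \<beta>" "x \<odot>\<^bsub>Dlin\<^esub> \<alpha> = seq_source x \<star> \<alpha>"
  "rsmult Dlin \<alpha> x = \<alpha> \<star> seq_target x" "comult Dlin = dlin_comult" "counit Dlin \<alpha> = \<alpha> 0"
  "source Dlin = seq_source" "target Dlin = seq_target" "antipode Dlin = dlin_antipode"
  by (auto simp: Dlin_def make_hopf_algebroid_def algebra_bimodule_def dlin_ring_def fun_eq_iff fun_apply)

text \<open>The relations only look at the fields listed, so records agreeing in them have literally
  the same tensor product; \<open>Dlin\<close> may thus replace
  \<open>dlin_bimodule\<close>.\<close>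

lemma tensor_class_cong:
  assumes "carrier M = carrier M'" "carrier N = carrier N'" "add M = add M'" "add N = add N'"
    "rsmult M = rsmult M'" "smult N = smult N'"
  shows "tensor_class M N = tensor_class M' N'" "tensor M N = tensor M' N'"
  by (simp_all add: fun_eq_iff tensor_class_def tensor_def tensor_relations_def assms)

lemma dlin_comult_eq:
  fixes \<alpha> :: "nat \<Rightarrow> 'k::differential_field"
  shows "dlin_comult \<alpha> = tensor_class Dlin Dlin (\<Sum>i<seq_order \<alpha>. frag_of ((seq_shift ^^ i) \<alpha>,
     form_seq (minimal_operator \<alpha>) (dual_power (minimal_operator \<alpha>) i)))"
proof -
  have "tensor_class (dlin_bimodule :: ('k, nat \<Rightarrow> 'k) bimodule) (dlin_bimodule :: ('k, nat \<Rightarrow> 'k) bimodule) =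
      tensor_class Dlin Dlin"
    by (rule tensor_class_cong)
      (auto simp: dlin_bimodule_def Dlin_def make_hopf_algebroid_def algebra_bimodule_def)
  then show ?thesis by (simp add: dlin_comult_def Let_def form_seq_def)
qed

interpretation Dlin_bimodule: seq_bimodule Dlin "\<lambda>\<alpha>. \<alpha>"
  by unfold_locales
    (simp_all add: Dlin_simps dlin_add dlin_0 dlin_mult dlin_source dlin_target)

interpretation Dlin_pair: seq_pair Dlin "\<lambda>\<alpha>. \<alpha>" Dlin "\<lambda>\<alpha>. \<alpha>" ..

text \<open>One computation for the comultiplication and for the coactions on formal solutions: the
  right factors may live in any sequence space in which the dual powers are represented.\<close>

lemma Dlin_coaction:
  assumes "P \<noteq> 0" "\<alpha> \<in> solutions P" "seq_module N \<Psi>"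
    and e: "\<And>i. i < degree P \<Longrightarrow> e i \<in> carrier N \<and> \<Psi> (e i) = form_seq P (dual_power P i)"
  shows "tensor_class Dlin N (\<Sum>i<degree P. frag_of ((seq_shift ^^ i) \<alpha>, e i)) \<in> carrier (tensor Dlin N)"
    and "tensor_eval (\<lambda>\<alpha>. \<alpha>) \<Psi> (rep (tensor_class Dlin N (\<Sum>i<degree P. frag_of ((seq_shift ^^ i) \<alpha>, e i)))) m =
      (seq_shift ^^ m) \<alpha>"
proof -
  interpret N: seq_module N \<Psi> by fact
  interpret P: seq_pair Dlin "\<lambda>\<alpha>. \<alpha>" N \<Psi> ..
  have "\<alpha> \<in> dlin" using assms by (auto simp: dlin_solution)
  then show "tensor_class Dlin N (\<Sum>i<degree P. frag_of ((seq_shift ^^ i) \<alpha>, e i)) \<in> carrier (tensor Dlin N)"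
    using e by (intro P.tensor_class_closed keys_sum_subset keys_frag_of_subset)
      (auto simp: Dlin_simps dlin_shift_pow)
  have "tensor_eval (\<lambda>\<alpha>. \<alpha>) \<Psi> (\<Sum>i<degree P. frag_of ((seq_shift ^^ i) \<alpha>, e i)) m =
      (\<Sum>i<degree P. (seq_shift ^^ i) \<alpha> \<star> seq_target (dual_power P i (quotient_power P m)))"
    using e by (auto simp: tensor_eval_def fsum_sum form_seq_def intro!: sum.cong)
  then show "tensor_eval (\<lambda>\<alpha>. \<alpha>) \<Psi> (rep (tensor_class Dlin N (\<Sum>i<degree P. frag_of ((seq_shift ^^ i) \<alpha>, e i)))) m =
      (seq_shift ^^ m) \<alpha>"
    by (simp add: P.eval_rep solution_expansion[OF assms(1,2)])
qed

lemma form_seq_dual_power_dlin: "P \<noteq> 0 \<Longrightarrow> form_seq P (dual_power P i) \<in> dlin"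
  unfolding dlin_solution using form_seq_solution[OF dual_power(1)] by blast

interpretation Dlin_hopf: seq_hopf Dlin "\<lambda>\<alpha>. \<alpha>"
proof
  fix \<alpha> m assume "\<alpha> \<in> carrier Dlin"
  then have \<alpha>: "\<alpha> \<in> dlin" by (simp add: Dlin_simps)
  note c = Dlin_coaction[OF minimal_operator_solution[OF \<alpha>] Dlin_bimodule.seq_module_axioms,
      of "\<lambda>i. form_seq (minimal_operator \<alpha>) (dual_power (minimal_operator \<alpha>) i)"]
  show "comult Dlin \<alpha> \<in> carrier (tensor Dlin Dlin)"
    "tensor_eval (\<lambda>\<alpha>. \<alpha>) (\<lambda>\<alpha>. \<alpha>) (rep (comult Dlin \<alpha>)) m = (seq_shift ^^ m) \<alpha>"
    using c by (simp_all add: Dlin_simps dlin_comult_eq minimal_operator(3)[OF \<alpha>]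
        form_seq_dual_power_dlin minimal_operator_solution[OF \<alpha>])
qed (simp_all add: Dlin_simps dlin_mult dlin_source dlin_target dlin_antipode_closed)

lemma Dlin_commutative_hopf_algebroid:
  "commutative_hopf_algebroid (Dlin :: ('k::differential_field, nat \<Rightarrow> 'k) hopf_algebroid)"
  by (rule Dlin_hopf.is_commutative_hopf_algebroid) (simp_all add: Dlin_simps)

section \<open>The directed system of formal solutions and its limit\<close>

section \<open>The comodules of formal solutions\<close>

lemma Dlin_comodule_simps:
  "carrier Dlin_comodule = dlin" "\<zero>\<^bsub>Dlin_comodule\<^esub> = 0" "\<alpha> \<oplus>\<^bsub>Dlin_comodule\<^esub> \<beta> = \<alpha> + \<beta>"
  "x \<odot>\<^bsub>Dlin_comodule\<^esub> \<alpha> = seq_source x \<star> \<alpha>" "coact Dlin_comodule = dlin_comult"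
  by (auto simp: Dlin_comodule_def Dlin_simps)

interpretation Dlin_comod: seq_comodule Dlin "\<lambda>\<alpha>. \<alpha>" Dlin_comodule "\<lambda>\<alpha>. \<alpha>"
proof -
  interpret seq_module Dlin_comodule "\<lambda>\<alpha>. \<alpha>"
    by unfold_locales (simp_all add: Dlin_comodule_simps dlin_add dlin_0 dlin_mult dlin_source)
  show "seq_comodule Dlin (\<lambda>\<alpha>. \<alpha>) Dlin_comodule (\<lambda>\<alpha>. \<alpha>)"
  proof
    have t: "tensor Dlin Dlin_comodule = tensor Dlin Dlin"
      by (rule tensor_class_cong) (auto simp: Dlin_comodule_def)
    fix \<alpha> m assume "\<alpha> \<in> carrier Dlin_comodule"
    then show "coact Dlin_comodule \<alpha> \<in> carrier (tensor Dlin Dlin_comodule)"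
      "tensor_eval (\<lambda>\<alpha>. \<alpha>) (\<lambda>\<alpha>. \<alpha>) (rep (coact Dlin_comodule \<alpha>)) m = (seq_shift ^^ m) \<alpha>"
      using Dlin_hopf.comult_closed[of \<alpha>] Dlin_hopf.comult_eval[of \<alpha> m]
      by (simp_all add: Dlin_comodule_simps Dlin_simps t)
  qed
qed

lemma solution_comodule_simps:
  "carrier (solution_comodule P) = carrier (dual (quotient_space P))"
  "ring.zero (solution_comodule P) = ring.zero (dual (quotient_space P))"
  "add (solution_comodule P) = add (dual (quotient_space P))"
  "smult (solution_comodule P) = smult (dual (quotient_space P))"
  "coact (solution_comodule P) f = tensor_class Dlin (dual (quotient_space P))
     (\<Sum>i<degree P. frag_of (\<lambda>n. f (quotient_power P (n + i)), dual_power P i))"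
  by (simp_all add: solution_comodule_def module.defs comodule.defs)

lemma solution_seq_comodule:
  assumes P: "P \<noteq> 0"
  shows "seq_comodule Dlin (\<lambda>\<alpha>. \<alpha>) (solution_comodule P) (form_seq P)"
proof -
  interpret D: seq_module "dual (quotient_space P)" "form_seq P"
    by (rule solution_seq_module)
  interpret seq_module "solution_comodule P" "form_seq P"
    by unfold_locales (simp_all add: solution_comodule_simps D.add_closed D.zero_closed D.smult_closed
        D.emb_add D.emb_zero D.emb_smult D.emb_inj)
  show ?thesis
  proof
    fix f m assume "f \<in> carrier (solution_comodule P)"
    then have f: "f \<in> carrier (dual (quotient_space P))" by (simp add: solution_comodule_simps)
    have t: "tensor Dlin (solution_comodule P) = tensor Dlin (dual (quotient_space P))"
      by (rule tensor_class_cong) (auto simp: solution_comodule_simps)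
    have s: "(\<lambda>n. f (quotient_power P (n + i))) = (seq_shift ^^ i) (form_seq P f)" for i
      by (auto simp: seq_shift_funpow form_seq_def add.commute)
    note c = Dlin_coaction[OF P form_seq_solution[OF f] D.seq_module_axioms, of "dual_power P"]
    show "coact (solution_comodule P) f \<in> carrier (tensor Dlin (solution_comodule P))"
      "tensor_eval (\<lambda>\<alpha>. \<alpha>) (form_seq P) (rep (coact (solution_comodule P) f)) m =
        (seq_shift ^^ m) (form_seq P f)"
      using c by (simp_all add: solution_comodule_simps t s dual_power(1)[OF P])
  qed
qed

text \<open>On sequences the transition map is the inclusion of the solutions of \<open>P\<close>
  among those of a right multiple \<open>P'\<close>. Functoriality and colinearity of the system
  follow from this.\<close>

lemma solution_transition:
  assumes le: "operator_le P P'" and f: "f \<in> carrier (dual (quotient_space P))"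
  shows "solution_transition P P' f \<in> carrier (dual (quotient_space P'))"
    and "form_seq P' (solution_transition P P' f) = form_seq P f"
proof -
  have sub: "u \<in> right_ideal P" if "u \<in> right_ideal P'" for u
    using le that right_ideal_mult by (auto simp: operator_le_def right_ideal_iff[of u P'])
  have c: "solution_transition P P' f (quotient_class P' u) = f (quotient_class P u)" for u
  proof -
    have "quotient_class P (rep (quotient_class P' u)) = quotient_class P u"
      unfolding quotient_class_eq_iff by (rule sub[OF quotient_rep])
    then show ?thesis by (simp add: solution_transition_def quotient_space_simps)
  qed
  show "solution_transition P P' f \<in> carrier (dual (quotient_space P'))"
    using f unfolding dual_quotient_iff by (simp add: c) (simp add: solution_transition_def)
  show "form_seq P' (solution_transition P P' f) = form_seq P f"
    by (simp add: form_seq_def quotient_power_def c)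
qed

text \<open>A |-> Q A followed by the remainder modulo \<open>P\<close> is linear from an
  infinite-dimensional space to one of dimension \<open>degree P\<close>, so it has a kernel. This
  is the right Ore condition, which makes the system directed.\<close>

lemma operator_upper_bound:
  assumes P: "P \<noteq> 0" and Q: "(Q::'k::differential_field poly) \<noteq> 0"
  shows "\<exists>R. R \<noteq> 0 \<and> operator_le P R \<and> operator_le Q R"
proof -
  text \<open>The remainders of the \<open>Q Y\<^sup>n\<close> modulo \<open>P\<close> are linearly dependent.\<close>
  have "vector_space (Polynomial.smult :: 'k \<Rightarrow> _)"
    by unfold_locales (simp_all add: smult_add_right smult_add_left)
  then interpret vs: vector_space "Polynomial.smult :: 'k \<Rightarrow> _" .
  define r where "r n = op_rem P (op_mult Q (monom 1 n))" for n
  let ?B = "(\<lambda>i. monom (1::'k) i) ` {..<degree P}"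
  have r: "r n \<in> vs.span ?B" for n
  proof -
    have low: "coeff (r n) i = 0" if "i \<ge> degree P" for i
      using op_rem(1)[OF P] that by (simp add: r_def)
    then have "r n = (\<Sum>i<degree P. Polynomial.smult (coeff (r n) i) (monom 1 i))"
    proof (intro poly_eqI)
      fix k
      have "coeff (\<Sum>i<degree P. Polynomial.smult (coeff (r n) i) (monom 1 i)) k =
          (\<Sum>i<degree P. if i = k then coeff (r n) k else 0)"
        unfolding coeff_sum by (rule sum.cong) auto
      then show "coeff (r n) k = coeff (\<Sum>i<degree P. Polynomial.smult (coeff (r n) i) (monom 1 i)) k"
        using low[of k] by auto
    qed
    also have "\<dots> \<in> vs.span ?B"
      by (intro vs.span_sum vs.span_scale vs.span_base) auto
    finally show ?thesis .
  qed
  have "\<exists>A. A \<noteq> 0 \<and> op_rem P (op_mult Q A) = 0"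
  proof (rule ccontr)
    assume neg: "\<nexists>A. A \<noteq> 0 \<and> op_rem P (op_mult Q A) = 0"
    have lin: "op_rem P (op_mult Q (A - B)) = op_rem P (op_mult Q A) - op_rem P (op_mult Q B)" for A B
      using op_rem_linear(1)[OF P, of "op_mult Q (A - B)" "op_mult Q B"]
      by (simp add: op_mult_simps)
    have inj: "A = B" if "op_rem P (op_mult Q A) = op_rem P (op_mult Q B)" for A B
      using neg lin[of A B] that by (metis eq_iff_diff_eq_0)
    \<comment> \<open>Were the remainder map injective, a dependence of \<open>r n\<close> on
      earlier remainders would make Y^n equal to an operator without a coefficient at n.\<close>
    have "r n \<notin> vs.span (r ` {..<n})" for n
    proof
      assume "r n \<in> vs.span (r ` {..<n})"
      then have "\<exists>A. r n = op_rem P (op_mult Q A) \<and> (\<forall>i\<ge>n. coeff A i = 0)"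
      proof (rule vs.span_induct)
        show "vs.subspace {u. \<exists>A. u = op_rem P (op_mult Q A) \<and> (\<forall>i\<ge>n. coeff A i = 0)}"
        proof (rule vs.subspaceI)
          have "op_rem P 0 = 0" by (rule op_rem_eqI[OF P]) (auto simp: right_ideal_0)
          then show "0 \<in> {u. \<exists>A. u = op_rem P (op_mult Q A) \<and> (\<forall>i\<ge>n. coeff A i = 0)}"
            by (intro CollectI exI[of _ 0]) (simp add: op_mult_simps)
        next
          fix u v assume "u \<in> {u. \<exists>A. u = op_rem P (op_mult Q A) \<and> (\<forall>i\<ge>n. coeff A i = 0)}"
            "v \<in> {u. \<exists>A. u = op_rem P (op_mult Q A) \<and> (\<forall>i\<ge>n. coeff A i = 0)}"
          then obtain A B where "u = op_rem P (op_mult Q A)" "\<forall>i\<ge>n. coeff A i = 0"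
            "v = op_rem P (op_mult Q B)" "\<forall>i\<ge>n. coeff B i = 0" by auto
          then show "u + v \<in> {u. \<exists>A. u = op_rem P (op_mult Q A) \<and> (\<forall>i\<ge>n. coeff A i = 0)}"
            by (intro CollectI exI[of _ "A + B"]) (simp add: op_mult_simps op_rem_linear[OF P])
        next
          fix c u assume "u \<in> {u. \<exists>A. u = op_rem P (op_mult Q A) \<and> (\<forall>i\<ge>n. coeff A i = 0)}"
          then obtain A where "u = op_rem P (op_mult Q A)" "\<forall>i\<ge>n. coeff A i = 0" by auto
          then show "Polynomial.smult c u \<in> {u. \<exists>A. u = op_rem P (op_mult Q A) \<and> (\<forall>i\<ge>n. coeff A i = 0)}"
            by (intro CollectI exI[of _ "Polynomial.smult c A"])
              (simp add: op_mult_simps op_rem_linear[OF P])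
        qed
      next
        fix u assume "u \<in> r ` {..<n}"
        then obtain i where "i < n" "u = r i" by auto
        then show "\<exists>A. u = op_rem P (op_mult Q A) \<and> (\<forall>i\<ge>n. coeff A i = 0)"
          by (intro exI[of _ "monom 1 i"]) (auto simp: r_def)
      qed
      then obtain A where "r n = op_rem P (op_mult Q A)" "\<forall>i\<ge>n. coeff A i = 0" by blast
      with inj[of "monom 1 n" A] have "coeff (monom (1::'k) n) n = 0" by (simp add: r_def)
      then show False by simp
    qed
    then have ind: "vs.independent (r ` {..<n}) \<and> card (r ` {..<n}) = n" for n
    proof (induction n)
      case (Suc n)
      have nin: "r n \<notin> vs.span (r ` {..<n})" by (rule Suc.prems)
      then have "r n \<notin> r ` {..<n}" by (rule contrapos_nn) (rule vs.span_base)
      then show ?case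
        using Suc nin by (simp add: lessThan_Suc vs.independent_insert)
    qed (simp add: vs.independent_empty)
    have "card (r ` {..<Suc (card ?B)}) \<le> card ?B"
      using vs.independent_span_bound[of ?B "r ` {..<Suc (card ?B)}"] ind[of "Suc (card ?B)"] r by blast
    then show False using ind[of "Suc (card ?B)"] by simp
  qed
  then obtain A where A: "A \<noteq> 0" "op_rem P (op_mult Q A) = 0" by blast
  have "op_mult Q A \<noteq> 0" by (rule degree_op_mult(1)[OF Q A(1)])
  moreover have "op_mult Q A \<in> right_ideal P"
    using op_rem(2)[OF P, of "op_mult Q A"] A(2) by simp
  moreover have "op_mult Q A \<in> right_ideal Q" by (auto simp: right_ideal_iff)
  ultimately show ?thesis by (auto simp: operator_le_def)
qed

lemma operator_le_refl: "operator_le P P"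
  by (simp add: operator_le_def right_ideal_self)

lemma operator_le_trans: "operator_le P Q \<Longrightarrow> operator_le Q R \<Longrightarrow> operator_le P R"
  using right_ideal_mult by (auto simp: operator_le_def right_ideal_iff[of R Q])

lemma solution_form_eqI:
  "\<lbrakk>f \<in> carrier (dual (quotient_space P)); g \<in> carrier (dual (quotient_space P));
    form_seq P f = form_seq P g\<rbrakk> \<Longrightarrow> f = g"
  using seq_module.emb_eqI[OF solution_seq_module] by blast

lemma solution_directed_system:
  "directed_system (Dlin :: ('k::differential_field, nat \<Rightarrow> 'k) hopf_algebroid)
     operator_index operator_le solution_comodule solution_transition"
  unfolding directed_system_def
proof (intro conjI ballI impI)
  show "operator_index \<noteq> ({} :: 'k poly set)"
    by (auto simp: operator_index_def intro!: exI[of _ 1])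
  fix P :: "'k poly" assume "P \<in> operator_index"
  then have P: "P \<noteq> 0" by (simp add: operator_index_def)
  show "operator_le P P" by (rule operator_le_refl)
  show "left_comodule Dlin (solution_comodule P)"
    using solution_seq_comodule[OF P] by (rule seq_comodule.is_left_comodule)
  {
    fix m assume "m \<in> carrier (solution_comodule P)"
    then show "solution_transition P P m = m"
      by (intro solution_form_eqI[of _ P])
        (simp_all add: solution_comodule_simps solution_transition operator_le_refl)
  }
  fix Q :: "'k poly" assume "Q \<in> operator_index"
  then have Q: "Q \<noteq> 0" by (simp add: operator_index_def)
  show "\<exists>R\<in>operator_index. operator_le P R \<and> operator_le Q R"
    using operator_upper_bound[OF P Q] by (auto simp: operator_index_def)
  {
    assume "operator_le P Q"
    then show "solution_transition P Q \<in> comodule_homs Dlin (solution_comodule P) (solution_comodule Q)"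
      by (intro comodule_homsI[OF solution_seq_comodule[OF P] solution_seq_comodule[OF Q]])
        (simp_all add: solution_comodule_simps solution_transition)
  }
  fix R :: "'k poly" assume PQ: "operator_le P Q" and QR: "operator_le Q R"
  show PR: "operator_le P R" by (rule operator_le_trans[OF PQ QR])
  fix m assume "m \<in> carrier (solution_comodule P)"
  then show "solution_transition Q R (solution_transition P Q m) = solution_transition P R m"
    using PQ QR PR by (intro solution_form_eqI[of _ R])
      (simp_all add: solution_comodule_simps solution_transition)
qed

abbreviation solution_limit_class ::
    "'k::differential_field poly \<Rightarrow> ('k poly set \<Rightarrow> 'k) \<Rightarrow> ('k poly \<times> ('k poly set \<Rightarrow> 'k)) set" where
  "solution_limit_class \<equiv> limit_class operator_index operator_le solution_comodule solution_transition"

definition limit_seq :: "('k::differential_field poly \<times> ('k poly set \<Rightarrow> 'k)) set \<Rightarrow> nat \<Rightarrow> 'k" where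
  "limit_seq A = (case rep A of (P, f) \<Rightarrow> form_seq P f)"

text \<open>Transition maps preserve sequences and sequences determine forms, so two forms agree at
  a common upper bound exactly when their sequences agree. The limit is the union of the solution
  spaces inside all sequences.\<close>

lemma solution_limit_class_eq:
  assumes P: "P \<noteq> 0" and f: "f \<in> carrier (dual (quotient_space P))"
  shows "solution_limit_class P f =
    {(Q, g). Q \<noteq> 0 \<and> g \<in> carrier (dual (quotient_space Q)) \<and> form_seq Q g = form_seq P f}"
proof -
  have "(\<exists>R\<in>operator_index. operator_le P R \<and> operator_le Q R \<and>
      solution_transition P R f = solution_transition Q R g) \<longleftrightarrow> form_seq Q g = form_seq P f"
    if Q: "Q \<noteq> 0" and g: "g \<in> carrier (dual (quotient_space Q))" for Q g
  proof
    assume "\<exists>R\<in>operator_index. operator_le P R \<and> operator_le Q R \<and>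
      solution_transition P R f = solution_transition Q R g"
    then show "form_seq Q g = form_seq P f"
      using solution_transition(2)[of P _ f] solution_transition(2)[of Q _ g] f g by metis
  next
    assume eq: "form_seq Q g = form_seq P f"
    obtain R where R: "R \<noteq> 0" "operator_le P R" "operator_le Q R"
      using operator_upper_bound[OF P Q] by blast
    have "solution_transition P R f = solution_transition Q R g"
      by (rule solution_form_eqI[of _ R])
        (simp_all add: solution_transition[OF R(2) f] solution_transition[OF R(3) g] eq)
    with R show "\<exists>R\<in>operator_index. operator_le P R \<and> operator_le Q R \<and>
      solution_transition P R f = solution_transition Q R g"
      by (auto simp: operator_index_def)
  qed
  then show ?thesis
    unfolding limit_class_def by (auto simp: operator_index_def solution_comodule_simps)
qed

lemma limit_seq_class:
  assumes P: "P \<noteq> 0" and f: "f \<in> carrier (dual (quotient_space P))"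
  shows "limit_seq (solution_limit_class P f) = form_seq P f"
proof -
  have "(P, f) \<in> solution_limit_class P f"
    unfolding solution_limit_class_eq[OF assms] using assms by simp
  then have "rep (solution_limit_class P f) \<in> solution_limit_class P f"
    unfolding rep_def by (rule someI)
  then show ?thesis
    unfolding solution_limit_class_eq[OF assms] by (auto simp: limit_seq_def)
qed

lemma solution_limit_simps:
  "carrier solution_limit = {solution_limit_class P f | P f. P \<noteq> 0 \<and> f \<in> carrier (dual (quotient_space P))}"
  "\<zero>\<^bsub>solution_limit\<^esub> = (let P = rep operator_index in solution_limit_class P \<zero>\<^bsub>dual (quotient_space P)\<^esub>)"
  "A \<oplus>\<^bsub>solution_limit\<^esub> B = (let (P, f) = rep A; (Q, g) = rep B;
      R = rep {R \<in> operator_index. operator_le P R \<and> operator_le Q R}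
    in solution_limit_class R (solution_transition P R f \<oplus>\<^bsub>dual (quotient_space R)\<^esub> solution_transition Q R g))"
  "x \<odot>\<^bsub>solution_limit\<^esub> A = (let (P, f) = rep A in solution_limit_class P (x \<odot>\<^bsub>dual (quotient_space P)\<^esub> f))"
  "coact solution_limit A = (let (P, f) = rep A in
     tensor_map Dlin (limit_module operator_index operator_le solution_comodule solution_transition) id
       (solution_limit_class P) (coact (solution_comodule P) f))"
  by (simp_all add: solution_limit_def limit_comodule_def limit_module_def module.defs comodule.defs
      solution_comodule_simps operator_index_def)

lemma solution_limit_cases:
  assumes "A \<in> carrier solution_limit"
  obtains P f where "rep A = (P, f)" "P \<noteq> 0" "f \<in> carrier (dual (quotient_space P))"
    "A = solution_limit_class P f" "limit_seq A = form_seq P f"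
proof -
  obtain Q g where Q: "Q \<noteq> 0" "g \<in> carrier (dual (quotient_space Q))" and A: "A = solution_limit_class Q g"
    using assms by (auto simp: solution_limit_simps)
  have "(Q, g) \<in> A" unfolding A solution_limit_class_eq[OF Q] using Q by simp
  then have "rep A \<in> A" unfolding rep_def by (rule someI)
  then obtain P f where r: "rep A = (P, f)" and P: "P \<noteq> 0" "f \<in> carrier (dual (quotient_space P))"
    and eq: "form_seq P f = form_seq Q g"
    unfolding A solution_limit_class_eq[OF Q] by auto
  have "A = solution_limit_class P f"
    unfolding A solution_limit_class_eq[OF Q] solution_limit_class_eq[OF P] eq ..
  with r P show ?thesis by (intro that[of P f]) (auto simp: limit_seq_def)
qed

lemma solution_limit_classI:
  "P \<noteq> 0 \<Longrightarrow> f \<in> carrier (dual (quotient_space P)) \<Longrightarrow> solution_limit_class P f \<in> carrier solution_limit"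
  by (auto simp: solution_limit_simps)

lemma solution_limit_zero:
  fixes S :: "('k::differential_field, nat \<Rightarrow> 'k, ('k poly \<times> ('k poly set \<Rightarrow> 'k)) set) comodule"
  assumes S: "S = solution_limit"
  shows "\<zero>\<^bsub>S\<^esub> \<in> carrier S" "limit_seq \<zero>\<^bsub>S\<^esub> = 0"
proof -
  define P where "P = rep (operator_index :: 'k poly set)"
  have "(1::'k poly) \<in> operator_index" by (simp add: operator_index_def)
  then have "P \<in> operator_index"
    unfolding P_def rep_def by (rule someI)
  then have P: "P \<noteq> 0" by (simp add: operator_index_def)
  interpret D: seq_module "dual (quotient_space P)" "form_seq P"
    by (rule solution_seq_module)
  have z: "\<zero>\<^bsub>S\<^esub> = solution_limit_class P \<zero>\<^bsub>dual (quotient_space P)\<^esub>"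
    unfolding S solution_limit_simps(2) Let_def P_def ..
  show "\<zero>\<^bsub>S\<^esub> \<in> carrier S"
    unfolding z unfolding S by (rule solution_limit_classI[OF P D.zero_closed])
  show "limit_seq \<zero>\<^bsub>S\<^esub> = 0"
    unfolding z by (simp add: limit_seq_class[OF P D.zero_closed] D.emb_zero)
qed

interpretation limit_mod: seq_module
  "solution_limit :: ('a::differential_field, nat \<Rightarrow> 'a, ('a poly \<times> ('a poly set \<Rightarrow> 'a)) set) comodule" limit_seq
proof
  fix A B :: "('a poly \<times> ('a poly set \<Rightarrow> 'a)) set" and x
  assume "A \<in> carrier solution_limit"
  then obtain P f where A: "rep A = (P, f)" "P \<noteq> 0" "f \<in> carrier (dual (quotient_space P))"
    "limit_seq A = form_seq P f" by (elim solution_limit_cases)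
  interpret D: seq_module "dual (quotient_space P)" "form_seq P" by (rule solution_seq_module)
  show "x \<odot>\<^bsub>solution_limit\<^esub> A \<in> carrier solution_limit"
    "limit_seq (x \<odot>\<^bsub>solution_limit\<^esub> A) = seq_source x \<star> limit_seq A"
    using A by (simp_all add: solution_limit_simps(4) solution_limit_classI limit_seq_class D.smult_closed
        D.emb_smult)
  assume "B \<in> carrier solution_limit"
  then obtain Q g where B: "rep B = (Q, g)" "Q \<noteq> 0" "g \<in> carrier (dual (quotient_space Q))"
    "limit_seq B = form_seq Q g" by (elim solution_limit_cases)
  define R where "R = rep {R \<in> operator_index. operator_le P R \<and> operator_le Q R}"
  have "\<exists>R. R \<in> {R \<in> operator_index. operator_le P R \<and> operator_le Q R}"
    using operator_upper_bound[OF A(2) B(2)] by (auto simp: operator_index_def)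
  then have "R \<in> {R \<in> operator_index. operator_le P R \<and> operator_le Q R}"
    unfolding R_def rep_def by (rule someI_ex)
  then have R: "R \<noteq> 0" "operator_le P R" "operator_le Q R" by (auto simp: operator_index_def)
  interpret E: seq_module "dual (quotient_space R)" "form_seq R" by (rule solution_seq_module)
  show "A \<oplus>\<^bsub>solution_limit\<^esub> B \<in> carrier solution_limit"
    "limit_seq (A \<oplus>\<^bsub>solution_limit\<^esub> B) = limit_seq A + limit_seq B"
    using A B R by (simp_all add: solution_limit_simps(3) R_def[symmetric] solution_limit_classI
        limit_seq_class E.add_closed E.emb_add solution_transition)
next
  show "inj_on limit_seq (carrier (solution_limit ::
      ('a, nat \<Rightarrow> 'a, ('a poly \<times> ('a poly set \<Rightarrow> 'a)) set) comodule))"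
  proof (rule inj_onI)
    fix A B :: "('a poly \<times> ('a poly set \<Rightarrow> 'a)) set"
    assume "A \<in> carrier solution_limit" "B \<in> carrier solution_limit" and eq: "limit_seq A = limit_seq B"
    then obtain P f Q g where A: "P \<noteq> 0" "f \<in> carrier (dual (quotient_space P))"
      "A = solution_limit_class P f" "limit_seq A = form_seq P f"
      and B: "Q \<noteq> 0" "g \<in> carrier (dual (quotient_space Q))"
      "B = solution_limit_class Q g" "limit_seq B = form_seq Q g"
      by (elim solution_limit_cases)
    then show "A = B" using eq by (simp add: solution_limit_class_eq)
  qed
qed (simp_all add: solution_limit_zero)

interpretation limit_comod: seq_comodule Dlin "\<lambda>\<alpha>. \<alpha>" solution_limit limit_seq
proof
  fix A :: "('a poly \<times> ('a poly set \<Rightarrow> 'a)) set" and m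
  assume "A \<in> carrier solution_limit"
  then obtain P f where A: "rep A = (P, f)" "P \<noteq> 0" "f \<in> carrier (dual (quotient_space P))"
    "limit_seq A = form_seq P f" by (elim solution_limit_cases)
  interpret S: seq_comodule Dlin "\<lambda>\<alpha>. \<alpha>" "solution_comodule P" "form_seq P"
    by (rule solution_seq_comodule[OF A(2)])
  interpret L: seq_pair Dlin "\<lambda>\<alpha>. \<alpha>" "solution_limit :: ('a, nat \<Rightarrow> 'a, _) comodule" limit_seq ..
  let ?X = "coact (solution_comodule P) f"
  have f: "f \<in> carrier (solution_comodule P)" using A by (simp add: solution_comodule_simps)
  have "tensor_class Dlin (limit_module operator_index operator_le solution_comodule solution_transition)
      = tensor_class Dlin (solution_limit :: ('a, nat \<Rightarrow> 'a, _) comodule)"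
    by (rule tensor_class_cong) (simp_all add: solution_limit_def limit_comodule_def module.defs comodule.defs)
  then have c: "coact solution_limit A = tensor_map Dlin solution_limit id (solution_limit_class P) ?X"
    by (simp add: solution_limit_simps(5) A(1) tensor_map_def)
  have k: "id a \<in> carrier Dlin \<and> solution_limit_class P b \<in> carrier solution_limit"
    and k': "b \<in> carrier (dual (quotient_space P))"
    if "(a, b) \<in> Poly_Mapping.keys (rep ?X)" for a b
    using S.coact_keys[OF f that] A(2) by (simp_all add: solution_comodule_simps solution_limit_classI)
  show "coact solution_limit A \<in> carrier (tensor Dlin solution_limit)"
    unfolding c by (rule L.tensor_map_closed(1)) (rule k)
  have "fsum (\<lambda>(a, b). id a \<star> seq_target (limit_seq (solution_limit_class P b) m)) (rep ?X) =
      tensor_eval (\<lambda>\<alpha>. \<alpha>) (form_seq P) (rep ?X) m"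
    unfolding tensor_eval_def by (rule fsum_cong) (auto dest!: k' simp: limit_seq_class A(2))
  also have "\<dots> = (seq_shift ^^ m) (limit_seq A)"
    by (simp add: S.coact_eval[OF f] A(4))
  finally show "tensor_eval (\<lambda>\<alpha>. \<alpha>) limit_seq (rep (coact solution_limit A)) m = (seq_shift ^^ m) (limit_seq A)"
    unfolding c by (subst L.tensor_map_closed(2)) (use k in auto)
qed

text \<open>Surjective because every recursive sequence solves some non-zero operator and
  \<open>seq_form\<close> turns it into a form on the corresponding quotient.\<close>

lemma limit_seq_bij: "bij_betw limit_seq (carrier solution_limit) (carrier Dlin_comodule)"
  unfolding bij_betw_def
proof (intro conjI limit_mod.emb_inj equalityI subsetI)
  fix \<alpha> :: "nat \<Rightarrow> 'a" assume "\<alpha> \<in> limit_seq ` carrier solution_limit"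
  then obtain A where "A \<in> carrier solution_limit" "\<alpha> = limit_seq A" by blast
  then obtain P f where "P \<noteq> 0" "f \<in> carrier (dual (quotient_space P))" "\<alpha> = form_seq P f"
    by (elim solution_limit_cases) simp
  then show "\<alpha> \<in> carrier Dlin_comodule"
    using form_seq_solution by (auto simp: Dlin_comodule_simps dlin_solution)
next
  fix \<alpha> :: "nat \<Rightarrow> 'a" assume "\<alpha> \<in> carrier Dlin_comodule"
  then obtain P where P: "P \<noteq> 0" "\<alpha> \<in> solutions P"
    by (auto simp: Dlin_comodule_simps dlin_solution)
  then have "limit_seq (solution_limit_class P (seq_form P \<alpha>)) = \<alpha>"
    by (simp add: limit_seq_class seq_form_dual form_seq_seq_form)
  then show "\<alpha> \<in> limit_seq ` carrier solution_limit"
    using solution_limit_classI[OF P(1) seq_form_dual[OF P(2)]] by (metis imageI)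
qed

lemma limit_isomorphic_Dlin:
  "\<exists>f \<in> comodule_homs (Dlin :: ('k::differential_field, nat \<Rightarrow> 'k) hopf_algebroid) solution_limit Dlin_comodule.
     bij_betw f (carrier solution_limit) (carrier Dlin_comodule)"
proof (intro bexI[of _ limit_seq] limit_seq_bij)
  show "limit_seq \<in> comodule_homs (Dlin :: ('k, nat \<Rightarrow> 'k) hopf_algebroid) solution_limit Dlin_comodule"
    using limit_seq_bij
    by (intro comodule_homsI[OF limit_comod.seq_comodule_axioms Dlin_comod.seq_comodule_axioms])
      (auto simp: bij_betw_def)
qed

section \<open>The pairing with U, universality of recursive sequences, and uniqueness of the
  universal dual\<close>

section \<open>The universal property\<close>

lemma presentation_tensor:
  assumes "\<And>a b. \<lbrakk>a \<in> carrier M; b \<in> carrier M\<rbrakk> \<Longrightarrow> a \<oplus>\<^bsub>M\<^esub> b \<in> carrier M"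
    and "\<And>a b. \<lbrakk>a \<in> carrier N; b \<in> carrier N\<rbrakk> \<Longrightarrow> a \<oplus>\<^bsub>N\<^esub> b \<in> carrier N"
    and "\<And>x a. a \<in> carrier N \<Longrightarrow> x \<odot>\<^bsub>N\<^esub> a \<in> carrier N"
    and "\<And>x a. a \<in> carrier M \<Longrightarrow> rsmult M a x \<in> carrier M"
  shows "presentation (carrier M \<times> carrier N) (tensor_relations M N)"
proof
  fix r assume "r \<in> tensor_relations M N"
  then show "Poly_Mapping.keys r \<subseteq> carrier M \<times> carrier N"
    by (cases rule: tensor_relations_cases) (simp_all add: assms keys_subset_intros)
qed

lemma is_bimoduleD:
  fixes C :: "('k::differential_field, 'a, 'z) bimodule_scheme"
  assumes "is_bimodule C"
  shows "module \<bbbK> C" "module \<bbbK> (C\<lparr>smult := \<lambda>x m. rsmult C m x\<rparr>)"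
    "c \<in> carrier C \<Longrightarrow> rsmult C c x \<in> carrier C" "c \<in> carrier C \<Longrightarrow> rsmult C c 1 = c"
    "c \<in> carrier C \<Longrightarrow> x \<odot>\<^bsub>C\<^esub> c \<in> carrier C" "c \<in> carrier C \<Longrightarrow> 1 \<odot>\<^bsub>C\<^esub> c = c"
proof -
  show m: "module \<bbbK> C" and m': "module \<bbbK> (C\<lparr>smult := \<lambda>x m. rsmult C m x\<rparr>)"
    using assms by (auto simp: is_bimodule_def)
  show "c \<in> carrier C \<Longrightarrow> rsmult C c x \<in> carrier C" "c \<in> carrier C \<Longrightarrow> rsmult C c 1 = c"
    "c \<in> carrier C \<Longrightarrow> x \<odot>\<^bsub>C\<^esub> c \<in> carrier C" "c \<in> carrier C \<Longrightarrow> 1 \<odot>\<^bsub>C\<^esub> c = c"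
    using module.smult_closed[OF m', of x c] module.smult_one[OF m', of c]
      module.smult_closed[OF m, of x c] module.smult_one[OF m, of c] by simp_all
qed

lemma bimodule_presentation:
  fixes C :: "('k::differential_field, 'a, 'z) bimodule_scheme"
  assumes "is_bimodule C"
  shows "presentation (carrier C \<times> carrier C) (tensor_relations C C)"
proof -
  interpret module \<bbbK> C by (rule is_bimoduleD(1)[OF assms])
  show ?thesis by (rule presentation_tensor) (auto intro: is_bimoduleD[OF assms])
qed

lemma coring_comult_keys:
  assumes C: "is_coring C" and c: "c \<in> carrier C"
  shows "Poly_Mapping.keys (rep (comult C c)) \<subseteq> carrier C \<times> carrier C"
    and "tensor_class C C (rep (comult C c)) = comult C c"
proof -
  have b: "is_bimodule C" using C by (simp add: is_coring_def)
  have "comult C c \<in> carrier (presented_group (carrier C \<times> carrier C) (tensor_relations C C))"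
    using C c by (auto simp: is_coring_def hom_def tensor_def)
  then show "Poly_Mapping.keys (rep (comult C c)) \<subseteq> carrier C \<times> carrier C"
    "tensor_class C C (rep (comult C c)) = comult C c"
    using presentation.rep_keys[OF bimodule_presentation[OF b]]
      presentation.cls_rep[OF bimodule_presentation[OF b]] by (auto simp: tensor_class_def)
qed

lemma op_functional_eq:
  assumes f: "f \<in> op_functionals"
  shows "f u = functional_of_seq (\<lambda>n. f (monom 1 n)) u"
proof -
  have add: "f (u + v) = f u + f v" and sm: "f (Polynomial.smult x u) = f u * x" for u v x
    using f by (auto simp: op_functionals_def op_mult_simps)
  have "f (Polynomial.smult 0 0) = 0" unfolding sm by simp
  then have z: "f 0 = 0" by simp
  have s: "f (\<Sum>i\<in>I. w i) = (\<Sum>i\<in>I. f (w i))" for I and w :: "nat \<Rightarrow> 'a poly"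
    by (induction I rule: infinite_finite_induct) (simp_all add: z add)
  have m: "monom c i = Polynomial.smult c (monom 1 i)" for c :: 'a and i
    by (simp add: smult_monom)
  have "f u = f (\<Sum>i\<le>degree u. monom (coeff u i) i)"
    by (simp add: poly_as_sum_of_monoms)
  also have "\<dots> = (\<Sum>i\<le>degree u. f (monom 1 i) * coeff u i)"
    unfolding s m[of "coeff u _"] sm ..
  finally show ?thesis by (simp add: functional_of_seq_def)
qed

lemma functional_linear:
  "functional_of_seq (\<alpha> + \<beta>) u = functional_of_seq \<alpha> u + functional_of_seq \<beta> u"
  "functional_of_seq (\<alpha> - \<beta>) u = functional_of_seq \<alpha> u - functional_of_seq \<beta> u"
  "functional_of_seq (seq_source x \<star> \<alpha>) u = x * functional_of_seq \<alpha> u"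
  by (simp_all add: functional_of_seq_def fun_apply seq_source_mult algebra_simps sum.distrib
      sum_subtractf sum_distrib_left)

lemma functional_const_mult:
  "functional_of_seq \<alpha> (op_mult [:x:] v) = functional_of_seq (\<alpha> \<star> seq_target x) v"
  by (simp add: functional_op_mult seq_act_eq)

lemma functional_inj: "functional_of_seq \<alpha> = functional_of_seq \<beta> \<Longrightarrow> \<alpha> = \<beta>"
  using functional_monom by (metis ext)

lemma op_mult_monom_1: "op_mult (monom 1 m) (monom 1 n) = monom (1::'k::differential_field) (m + n)"
  by (rule op_eqI) (simp add: seq_act_op_mult seq_act_monom seq_shift_pow_pow)

lemma Dlin_dual_pairing: "dual_pairing (Dlin :: ('k::differential_field, nat \<Rightarrow> 'k) hopf_algebroid) functional_of_seq"
proof -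
  have main: "functional_of_seq z (op_mult u v) = additive_extension \<bbbK>
      (\<lambda>(a, b). functional_of_seq a (op_mult [:functional_of_seq b u:] v)) (dlin_comult z)"
    if z: "z \<in> dlin" for z :: "nat \<Rightarrow> 'k" and u v
  proof -
    let ?u = "rep (dlin_comult z)"
    have ev: "tensor_eval (\<lambda>\<alpha>. \<alpha>) (\<lambda>\<alpha>. \<alpha>) ?u m = (seq_shift ^^ m) z" for m
      using Dlin_hopf.comult_eval[of z m] z by (simp add: Dlin_simps)
    \<comment> \<open>The functional of \<open>b\<close> at \<open>u\<close> combines the entries of
      \<open>b\<close> with the coefficients of \<open>u\<close>, and the n-th evaluation is the
      n-fold shift of \<open>z\<close>. The sum is therefore \<open>z\<close> acted on by
      \<open>u\<close>, and the pairing identity becomes the module law.\<close>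
    have "fsum (\<lambda>(a, b). a \<star> seq_target (functional_of_seq b u)) ?u =
        fsum (\<lambda>p. \<Sum>n\<le>degree u. (fst p \<star> seq_target (snd p n)) \<star> seq_target (coeff u n)) ?u"
      by (intro fsum_cong) (auto simp: functional_of_seq_def seq_target_sum seq_target_mult
          hurwitz_sum_right hurwitz_assoc)
    also have "\<dots> = (\<Sum>n\<le>degree u. tensor_eval (\<lambda>\<alpha>. \<alpha>) (\<lambda>\<alpha>. \<alpha>) ?u n \<star> seq_target (coeff u n))"
    proof -
      have "fsum (\<lambda>p. (fst p \<star> seq_target (snd p n)) \<star> \<beta>) ?u = tensor_eval (\<lambda>\<alpha>. \<alpha>) (\<lambda>\<alpha>. \<alpha>) ?u n \<star> \<beta>" for n \<beta>
        unfolding tensor_eval_def case_prod_unfold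
        by (rule fsum_hom[of "\<lambda>\<alpha>. \<alpha> \<star> \<beta>", symmetric]) (simp add: hurwitz_diff_left)
      then show ?thesis by (simp only: fsum_sum_fun)
    qed
    also have "\<dots> = seq_act z u" by (simp add: ev seq_act_eq)
    finally have 1: "fsum (\<lambda>(a, b). a \<star> seq_target (functional_of_seq b u)) ?u = seq_act z u" .
    have "fsum (\<lambda>(a, b). functional_of_seq a (op_mult [:functional_of_seq b u:] v)) ?u =
        fsum (\<lambda>p. functional_of_seq (case p of (a, b) \<Rightarrow> a \<star> seq_target (functional_of_seq b u)) v) ?u"
      by (intro fsum_cong) (auto simp: functional_const_mult)
    also have "\<dots> = functional_of_seq (seq_act z u) v"
      unfolding 1[symmetric]
      by (rule fsum_hom[of "\<lambda>\<alpha>. functional_of_seq \<alpha> v", symmetric]) (simp add: functional_linear)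
    finally show ?thesis
      by (simp add: additive_extension_base_ring functional_op_mult)
  qed
  have 1: "functional_of_seq z 1 = z 0" for z :: "nat \<Rightarrow> 'k"
    using functional_monom[of z 0] by simp
  have 2: "functional_of_seq (seq_source x \<star> z \<star> seq_target y) u =
      x * functional_of_seq z (op_mult [:y:] u)" for z :: "nat \<Rightarrow> 'k" and x y u
    by (simp add: functional_const_mult hurwitz_assoc functional_linear)
  show ?thesis
    unfolding dual_pairing_def
    using main 1 2 by (simp add: Dlin_simps functional_linear op_functionals_def functional_add op_mult_simps
        functional_smult mult.commute)
qed

lemma of_int_mult_tspan: "\<alpha> \<in> tsp.span B \<Longrightarrow> of_int c * \<alpha> \<in> tsp.span B"
  by (cases c rule: int_cases2) (simp_all add: of_nat_mult_tspan tsp.span_neg)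

definition pairing_seq :: "('c \<Rightarrow> 'k::differential_field poly \<Rightarrow> 'k) \<Rightarrow> 'c \<Rightarrow> nat \<Rightarrow> 'k" where
  "pairing_seq f c = (\<lambda>n. f c (monom 1 n))"

lemma dual_pairingD:
  assumes "dual_pairing C f" and c: "c \<in> carrier C"
  shows "f c \<in> op_functionals"
    and "d \<in> carrier C \<Longrightarrow> f (c \<oplus>\<^bsub>C\<^esub> d) u = f c u + f d u"
    and "f c (op_mult u v) = fsum (\<lambda>(a, b). f a (op_mult [:f b u:] v)) (rep (comult C c))"
    and "f c 1 = counit C c"
    and "f (rsmult C (x \<odot>\<^bsub>C\<^esub> c) y) u = x * f c (op_mult [:y:] u)"
  using assms unfolding dual_pairing_def additive_extension_base_ring by blast+

locale paired_coring =
  fixes C :: "('k::differential_field, 'c, 'z) coring_scheme" and f :: "'c \<Rightarrow> 'k poly \<Rightarrow> 'k"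
  assumes coring: "is_coring C" and pairing: "dual_pairing C f"
begin

lemma bimodule: "is_bimodule C"
  using coring by (simp add: is_coring_def)

lemma pairing_functional: "c \<in> carrier C \<Longrightarrow> functional_of_seq (pairing_seq f c) = f c"
  unfolding pairing_seq_def by (rule ext, rule op_functional_eq[symmetric], rule dual_pairingD(1)[OF pairing])

lemma comult_keys: "c \<in> carrier C \<Longrightarrow> (a, b) \<in> Poly_Mapping.keys (rep (comult C c)) \<Longrightarrow> a \<in> carrier C \<and> b \<in> carrier C"
  using coring_comult_keys(1)[OF coring] by blast

text \<open>The rule for \<open>f c (op_mult u v)\<close> at u = Y^m and v = Y^n, whose product is
  Y^(m+n), is entry n of this formula.\<close>

lemma pairing_eval:
  assumes c: "c \<in> carrier C"
  shows "tensor_eval (pairing_seq f) (pairing_seq f) (rep (comult C c)) m = (seq_shift ^^ m) (pairing_seq f c)"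
proof
  fix n
  have "(seq_shift ^^ m) (pairing_seq f c) n = f c (op_mult (monom 1 m) (monom 1 n))"
    by (simp add: seq_shift_funpow pairing_seq_def op_mult_monom_1)
  also have "\<dots> = fsum (\<lambda>(a, b). f a (op_mult [:f b (monom 1 m):] (monom 1 n))) (rep (comult C c))"
    by (rule dual_pairingD(3)[OF pairing c])
  also have "\<dots> = fsum (\<lambda>(a, b). (pairing_seq f a \<star> seq_target (pairing_seq f b m)) n) (rep (comult C c))"
  proof (rule fsum_cong)
    fix p assume p: "p \<in> Poly_Mapping.keys (rep (comult C c))"
    obtain a b where ab: "p = (a, b)" by fastforce
    then have "a \<in> carrier C" using comult_keys[OF c] p by blast
    then have "f a (op_mult [:f b (monom 1 m):] (monom 1 n)) =
        functional_of_seq (pairing_seq f a) (op_mult [:f b (monom 1 m):] (monom 1 n))"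
      by (simp add: pairing_functional)
    then show "(case p of (a, b) \<Rightarrow> f a (op_mult [:f b (monom 1 m):] (monom 1 n))) =
        (case p of (a, b) \<Rightarrow> (pairing_seq f a \<star> seq_target (pairing_seq f b m)) n)"
      by (simp add: ab functional_const_mult functional_monom pairing_seq_def)
  qed
  also have "\<dots> = tensor_eval (pairing_seq f) (pairing_seq f) (rep (comult C c)) m n"
    by (simp add: tensor_eval_def fsum_at case_prod_unfold)
  finally show "tensor_eval (pairing_seq f) (pairing_seq f) (rep (comult C c)) m n =
      (seq_shift ^^ m) (pairing_seq f c) n" ..
qed

text \<open>All shifts are combinations, with coefficients acting through t, of the sequences of the
  finitely many left factors in one representative of the comultiplication.\<close>

lemma pairing_dlin: "c \<in> carrier C \<Longrightarrow> pairing_seq f c \<in> dlin"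
proof -
  assume c: "c \<in> carrier C"
  let ?u = "rep (comult C c)"
  let ?B = "(\<lambda>p. pairing_seq f (fst p)) ` Poly_Mapping.keys ?u"
  have "(seq_shift ^^ m) (pairing_seq f c) \<in> tsp.span ?B" for m
    unfolding pairing_eval[OF c, symmetric] tensor_eval_def fsum_def case_prod_unfold
    by (rule tsp.span_sum, rule of_int_mult_tspan, rule tsp.span_scale, rule tsp.span_base) blast
  then show ?thesis
    unfolding dlin_iff finite_rank_def by (intro exI[of _ ?B]) auto
qed

lemma pairing_linear:
  assumes c: "c \<in> carrier C"
  shows "d \<in> carrier C \<Longrightarrow> pairing_seq f (c \<oplus>\<^bsub>C\<^esub> d) = pairing_seq f c + pairing_seq f d"
    and "pairing_seq f (x \<odot>\<^bsub>C\<^esub> c) = seq_source x \<star> pairing_seq f c"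
    and "pairing_seq f (rsmult C c x) = pairing_seq f c \<star> seq_target x"
    and "pairing_seq f c 0 = counit C c"
proof -
  have act: "f (rsmult C (x \<odot>\<^bsub>C\<^esub> z) y) u = x * f z (op_mult [:y:] u)" if "z \<in> carrier C" for x y z u
    using that by (rule dual_pairingD(5)[OF pairing])
  show "d \<in> carrier C \<Longrightarrow> pairing_seq f (c \<oplus>\<^bsub>C\<^esub> d) = pairing_seq f c + pairing_seq f d"
    using dual_pairingD(2)[OF pairing c] by (auto simp: pairing_seq_def fun_apply)
  have 1: "[:1:] = (1 :: 'k poly)" by (rule one_pCons[symmetric])
  show "pairing_seq f (x \<odot>\<^bsub>C\<^esub> c) = seq_source x \<star> pairing_seq f c"
    using act[OF c, of x 1] is_bimoduleD(4)[OF bimodule is_bimoduleD(5)[OF bimodule c]]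
    by (auto simp: pairing_seq_def seq_source_mult 1 op_mult_simps)
  have "functional_of_seq (pairing_seq f (rsmult C c x)) = functional_of_seq (pairing_seq f c \<star> seq_target x)"
    using act[OF c, of 1 x] c is_bimoduleD[OF bimodule]
    by (auto simp: fun_eq_iff functional_const_mult[symmetric] pairing_functional)
  then show "pairing_seq f (rsmult C c x) = pairing_seq f c \<star> seq_target x"
    by (rule functional_inj)
  show "pairing_seq f c 0 = counit C c"
    using dual_pairingD(4)[OF pairing c] by (simp add: pairing_seq_def)
qed

lemma pairing_coring_hom: "pairing_seq f \<in> coring_homs C Dlin"
proof (rule Dlin_hopf.coring_homsI)
  show "pairing_seq f \<in> linear_maps C Dlin"
    by (auto simp: linear_maps_iff Dlin_simps pairing_dlin pairing_linear)
qed (auto simp: Dlin_simps pairing_linear coring_comult_keys(1)[OF coring] pairing_eval[unfolded tensor_eval_def])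

end

text \<open>Existence is \<open>pairing_coring_hom\<close>; uniqueness is immediate because a
  functional determines its sequence.\<close>

lemma Dlin_universal_pairing:
  "universal_pairing TYPE('c) (Dlin :: ('k::differential_field, nat \<Rightarrow> 'k) hopf_algebroid) functional_of_seq"
  unfolding universal_pairing_def
proof (intro allI impI)
  fix C :: "('k, 'c) coring" and f assume "is_coring C" "dual_pairing C f"
  then interpret paired_coring C f by unfold_locales
  show "\<exists>g\<in>coring_homs C Dlin. (\<forall>c\<in>carrier C. functional_of_seq (g c) = f c) \<and>
      (\<forall>g'\<in>coring_homs C Dlin. (\<forall>c\<in>carrier C. functional_of_seq (g' c) = f c) \<longrightarrow> (\<forall>c\<in>carrier C. g' c = g c))"
  proof (intro bexI[OF _ pairing_coring_hom] conjI ballI impI)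
    fix g' c assume "\<forall>c\<in>carrier C. functional_of_seq (g' c) = f c" "c \<in> carrier C"
    then show "g' c = pairing_seq f c"
      by (intro functional_inj) (simp add: pairing_functional)
  qed (rule pairing_functional)
qed

lemma convolution_functional:
  "convolution (functional_of_seq \<alpha>) (functional_of_seq \<beta>) = functional_of_seq (\<alpha> \<star> \<beta>)"
  by (simp add: convolution_def functional_monom hurwitz_mult_def)

lemma op_counit_functional: "op_counit = functional_of_seq (seq_source 1)"
  by (simp add: op_counit_def seq_source_def of_bool_def)

lemma convolution_unit:
  "convolution (\<lambda>u. x * op_counit u) (op_mu y) = functional_of_seq (seq_source x \<star> seq_target y)"
proof -
  have "(\<lambda>u. x * op_counit u) = functional_of_seq (seq_source x)"
    using functional_linear(3)[of x "seq_source 1"] by (simp add: op_counit_functional fun_eq_iff)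
  moreover have "op_mu y = functional_of_seq (seq_target y)"
    by (simp add: op_mu_def seq_target_def)
  ultimately show ?thesis by (simp add: convolution_functional)
qed

lemma Dlin_universal_dual:
  "is_universal_dual TYPE('c) (Dlin :: ('k::differential_field, nat \<Rightarrow> 'k) hopf_algebroid) functional_of_seq"
  unfolding is_universal_dual_def
  by (simp add: Dlin_commutative_hopf_algebroid Dlin_dual_pairing Dlin_universal_pairing Dlin_simps
      op_counit_functional[symmetric] convolution_functional convolution_unit)

lemma presentation_tensor3:
  fixes C :: "('k::differential_field, 'a, 'z) bimodule_scheme"
  assumes "is_bimodule C"
  shows "presentation (carrier C \<times> carrier C \<times> carrier C) (tensor3_relations C C C)"
proof -
  interpret module \<bbbK> C by (rule is_bimoduleD(1)[OF assms])
  note cl = is_bimoduleD(3,5)[OF assms]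
  show ?thesis
  proof
    fix r assume "r \<in> tensor3_relations C C C"
    then show "Poly_Mapping.keys r \<subseteq> carrier C \<times> carrier C \<times> carrier C"
      by (auto simp only: tensor3_relations_def Un_iff mem_Collect_eq)
        (auto dest!: subsetD[OF keys_diff] simp: cl split: if_splits)
  qed
qed

lemma module_cong:
  assumes "carrier M = carrier N" "add M = add N" "ring.zero M = ring.zero N" "smult M = smult N"
  shows "module R M = module R N"
  by (simp add: module_def abelian_group_def abelian_monoid_def abelian_group_axioms_def
      module_axioms_def comm_group_def group_def group_axioms_def comm_monoid_def Group.monoid_def
      comm_monoid_axioms_def Units_def assms)

lemma additive_extension_cong:
  assumes "carrier A = carrier B" "add A = add B" "ring.zero A = ring.zero B"
  shows "additive_extension A = additive_extension B"
  by (simp add: fun_eq_iff additive_extension_def finsum_def finprod_def add_pow_def int_pow_def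
      nat_pow_def m_inv_def Let_def assms cong: if_cong)

text \<open>The test objects of the universal property are records of exact type
  \<open>coring\<close>; a Hopf algebroid becomes one only after its extra fields are
  dropped.\<close>

lemma coring_truncate:
  fixes C :: "('k::differential_field, 'a, 'z) coring_scheme"
  shows "is_coring (coring.truncate C) = is_coring C"
    and "dual_pairing (coring.truncate C) f = dual_pairing C f"
    and "coring_homs (coring.truncate C) D = coring_homs C D"
proof -
  let ?C = "coring.truncate C"
  have sel: "carrier ?C = carrier C" "add ?C = add C" "ring.zero ?C = ring.zero C" "smult ?C = smult C"
    "rsmult ?C = rsmult C" "comult ?C = comult C" "counit ?C = counit C"
    by (simp_all add: coring.truncate_def)
  have m: "module \<bbbK> ?C = module \<bbbK> C"
    "module \<bbbK> (?C\<lparr>smult := \<lambda>x m. rsmult C m x\<rparr>) = module \<bbbK> (C\<lparr>smult := \<lambda>x m. rsmult C m x\<rparr>)"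
    by (rule module_cong; simp add: sel)+
  have t: "tensor ?C ?C = tensor C C" "tensor_class ?C ?C = tensor_class C C"
    by (rule tensor_class_cong; simp add: sel)+
  have t3: "tensor3_class ?C ?C ?C = tensor3_class C C C"
    by (simp add: fun_eq_iff tensor3_class_def tensor3_relations_def sel)
  have a: "additive_extension ?C = additive_extension C"
    by (rule additive_extension_cong) (simp_all add: sel)
  have bi: "is_bimodule ?C = is_bimodule C"
    unfolding is_bimodule_def sel m ..
  have hm: "hom (add_monoid ?C) G = hom (add_monoid C) G" for G :: "('x, 'y) monoid_scheme"
    by (simp add: hom_def sel)
  have lin: "linear_maps ?C base_module = linear_maps C base_module"
    by (simp add: set_eq_iff linear_maps_iff sel)
  have tm: "tensor_map ?C ?C = tensor_map C C"
    by (simp add: fun_eq_iff tensor_map_def t)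
  have ct: "comult_tensor ?C ?C = comult_tensor C C" "tensor_coact ?C ?C = tensor_coact C C"
    by (simp_all add: fun_eq_iff comult_tensor_def tensor_coact_def t3 sel)
  show "is_coring ?C = is_coring C"
    unfolding is_coring_def hm unfolding bi lin tm ct a sel t ..
  show "dual_pairing ?C f = dual_pairing C f"
    unfolding dual_pairing_def by (simp add: sel)
  show "coring_homs ?C D = coring_homs C D"
    unfolding coring_homs_def by (simp add: sel linear_maps_iff)
qed

lemma coring_hom_id:
  assumes C: "is_coring C"
  shows "(\<lambda>c. c) \<in> coring_homs C C"
proof -
  have "tensor_map C C (\<lambda>c. c) (\<lambda>c. c) (comult C c) = comult C c" if c: "c \<in> carrier C" for c
    using coring_comult_keys(2)[OF C c]
    by (simp add: tensor_map_def case_prod_unfold frag_expansion[symmetric])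
  then show ?thesis by (simp add: coring_homs_def linear_maps_def hom_def)
qed

lemma coring_homsD:
  assumes "g \<in> coring_homs C D" and c: "c \<in> carrier C"
  shows "g c \<in> carrier D" "d \<in> carrier C \<Longrightarrow> g (c \<oplus>\<^bsub>C\<^esub> d) = g c \<oplus>\<^bsub>D\<^esub> g d"
    and "g (x \<odot>\<^bsub>C\<^esub> c) = x \<odot>\<^bsub>D\<^esub> g c" "g (rsmult C c x) = rsmult D (g c) x"
    and "counit D (g c) = counit C c" "comult D (g c) = tensor_map D D g g (comult C c)"
  using assms unfolding coring_homs_def mem_Collect_eq linear_maps_iff by blast+

text \<open>After the first map a new representative has been chosen. It may be replaced by the
  image of the old one since g (x) g sends relations to relations.\<close>

lemma coring_hom_comp:
  assumes B: "is_coring B" and C: "is_coring C" and D: "is_coring D"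
    and h: "h \<in> coring_homs B C" and g: "g \<in> coring_homs C D"
  shows "(\<lambda>b. g (h b)) \<in> coring_homs B D"
proof -
  have bi: "is_bimodule B" "is_bimodule C" "is_bimodule D"
    using B C D by (simp_all add: is_coring_def)
  interpret P: presentation "carrier C \<times> carrier C" "tensor_relations C C"
    by (rule bimodule_presentation[OF bi(2)])
  interpret Q: presentation "carrier D \<times> carrier D" "tensor_relations D D"
    by (rule bimodule_presentation[OF bi(3)])
  let ?g = "frag_extend (\<lambda>(a, b). frag_of (g a, g b))"
  let ?h = "frag_extend (\<lambda>(a, b). frag_of (h a, h b))"
  have "comult D (g (h b)) = tensor_map D D (\<lambda>b. g (h b)) (\<lambda>b. g (h b)) (comult B b)"
    if b: "b \<in> carrier B" for b
  proof -
    let ?u = "rep (comult B b)"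
    have rel: "?g r \<in> Q.Rel" if "r \<in> tensor_relations C C" for r
      using that
    proof (cases rule: tensor_relations_cases)
      case (left a a' b)
      then show ?thesis
        by (simp add: frag_extend_diff coring_homsD[OF g])
          (rule Q.Rel_relator, unfold tensor_relations_def, rule UnI1, rule UnI1,
            use coring_homsD(1)[OF g] in blast)
    next
      case (right a b b')
      then show ?thesis
        by (simp add: frag_extend_diff coring_homsD[OF g])
          (rule Q.Rel_relator, unfold tensor_relations_def, rule UnI1, rule UnI2,
            use coring_homsD(1)[OF g] in blast)
    next
      case (balanced a b x)
      then show ?thesis
        by (simp add: frag_extend_diff coring_homsD[OF g])
          (rule Q.Rel_relator, unfold tensor_relations_def, rule UnI2,
            use coring_homsD(1)[OF g] in blast)
    qed
    have "comult D (g (h b)) = tensor_map D D g g (tensor_map C C h h (comult B b))"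
      using b by (simp add: coring_homsD(6)[OF g] coring_homsD(1,6)[OF h])
    also have "\<dots> = Q.cls (?g (rep (P.cls (?h ?u))))"
      by (simp add: tensor_map_def tensor_class_def)
    also have "\<dots> = Q.cls (?g (?h ?u))"
      unfolding Q.cls_eq_iff frag_extend_diff[symmetric]
      by (rule P.frag_extend_Rel[OF P.rep_cls Q.presentation_axioms]) (rule rel)
    also have "?g (?h ?u) = frag_extend (\<lambda>(a, b). frag_of (g (h a), g (h b))) ?u"
      by (rule frag_induction[of ?u UNIV]) (auto simp: frag_extend_diff)
    finally show ?thesis by (simp add: tensor_map_def tensor_class_def)
  qed
  then show ?thesis
    unfolding coring_homs_def mem_Collect_eq linear_maps_iff
    by (simp add: coring_homsD[OF h] coring_homsD[OF g])
qed

text \<open>A bialgebroid map into \<open>Dlin\<close> commutes with the antipodes: evaluate \<open>S a \<sqdot> b \<sqdot> S c\<close> on \<open>\<Delta>\<^sup>2 z\<close>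
  in both orders.\<close>

lemma hom_to_Dlin_antipode:
  fixes V :: "('k::differential_field, 'v, 'z) hopf_algebroid_scheme"
  assumes V: "commutative_hopf_algebroid V"
    and h: "h \<in> coring_homs V Dlin"
    and mult: "\<And>a b. \<lbrakk>a \<in> carrier V; b \<in> carrier V\<rbrakk> \<Longrightarrow> h (a \<otimes>\<^bsub>V\<^esub> b) = h a \<star> h b"
    and st: "\<And>x. h (source V x) = seq_source x" "\<And>x. h (target V x) = seq_target x"
    and ev: "\<And>z m. z \<in> carrier V \<Longrightarrow> tensor_eval h h (rep (comult V z)) m = (seq_shift ^^ m) (h z)"
    and z: "z \<in> carrier V"
  shows "h (antipode V z) = dlin_antipode (h z)"
proof -
  interpret V: cring V using V by (simp add: commutative_hopf_algebroid_def)
  let ?S = "antipode V"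
  have coring: "is_coring V" and S: "?S \<in> ring_hom V V"
    and src: "source V \<in> ring_hom \<bbbK> V" and tgt: "target V \<in> ring_hom \<bbbK> V"
    using V unfolding commutative_hopf_algebroid_def by blast+
  have bi: "is_bimodule V" using coring unfolding is_coring_def by blast
  have act: "x \<odot>\<^bsub>V\<^esub> a = source V x \<otimes>\<^bsub>V\<^esub> a" "rsmult V a x = a \<otimes>\<^bsub>V\<^esub> target V x" if "a \<in> carrier V" for a x
    using V that by (simp_all add: commutative_hopf_algebroid_def)
  have Sst: "?S (source V x) = target V x" "?S (target V x) = source V x" for x
    using V by (simp_all add: commutative_hopf_algebroid_def)
  have Santi: "additive_extension V (\<lambda>(a, b). ?S a \<otimes>\<^bsub>V\<^esub> b) (comult V c) = target V (counit V c)"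
    if "c \<in> carrier V" for c
    using V that by (simp add: commutative_hopf_algebroid_def)
  have coassoc: "comult_tensor V V (comult V z) = tensor_coact V V (comult V) (comult V z)"
    and cu1: "additive_extension V (\<lambda>(a, b). counit V a \<odot>\<^bsub>V\<^esub> b) (comult V z) = z"
    and cu2: "additive_extension V (\<lambda>(a, b). rsmult V a (counit V b)) (comult V z) = z"
    using coring z by (simp_all add: is_coring_def)
  have cl: "source V x \<in> carrier V" "target V x \<in> carrier V" "a \<in> carrier V \<Longrightarrow> ?S a \<in> carrier V" for x a
    using ring_hom_closed[OF src, of x] ring_hom_closed[OF tgt, of x] ring_hom_closed[OF S, of a] by simp_all
  note cl' = is_bimoduleD(3,5)[OF bi]
  have hadd: "h (a \<oplus>\<^bsub>V\<^esub> b) = h a + h b" if "a \<in> carrier V" "b \<in> carrier V" for a b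
    using coring_homsD(2)[OF h that(1) that(2)] by (simp add: Dlin_simps)
  have hS: "h (?S (a \<oplus>\<^bsub>V\<^esub> b)) = h (?S a) + h (?S b)" "h (?S (a \<otimes>\<^bsub>V\<^esub> b)) = h (?S a) \<star> h (?S b)"
    if "a \<in> carrier V" "b \<in> carrier V" for a b
    using that S by (simp_all add: ring_hom_add[OF S] ring_hom_mult[OF S] hadd mult cl)
  have keys: "a \<in> carrier V \<and> b \<in> carrier V"
    if "c \<in> carrier V" "(a, b) \<in> Poly_Mapping.keys (rep (comult V c))" for a b c
    using coring_comult_keys(1)[OF coring that(1)] that(2) by blast
  \<comment> \<open>\<open>L\<close> has to respect the balancing in both places: antipodes exchange
    s and t, so a right scalar of an outer or middle factor matches the left scalar of its
    neighbour.\<close>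
  define L where "L = (\<lambda>(a, b, c). h (?S a) \<star> (h b \<star> dlin_antipode (h c)))"
  interpret T3: presentation "carrier V \<times> carrier V \<times> carrier V" "tensor3_relations V V V"
    by (rule presentation_tensor3[OF bi])
  have L0: "fsum L r = 0" if "r \<in> tensor3_relations V V V" for r
    using that
    by (auto simp: tensor3_relations_def L_def fsum_diff hadd hS mult act cl Sst st antipode_add antipode_mult
        antipode_source hurwitz_add_left hurwitz_add_right hurwitz_ac)
  let ?u = "rep (comult V z)"
  let ?l = "frag_extend (\<lambda>(c, n). frag_extend (\<lambda>(c', c''). frag_of (c', c'', n)) (rep (comult V c))) ?u"
  let ?r = "frag_extend (\<lambda>(c, n). frag_extend (\<lambda>(c', n'). frag_of (c, c', n')) (rep (comult V n))) ?u"
  have "T3.cls ?l = T3.cls ?r"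
    using coassoc by (simp add: comult_tensor_def tensor_coact_def tensor3_class_def)
  then have "?l - ?r \<in> T3.Rel" by (simp only: T3.cls_eq_iff)
  from T3.fsum_Rel[OF this L0] have "fsum L ?l = fsum L ?r" by (simp add: fsum_diff)
  \<comment> \<open>Left bracketing: the antipode axiom of \<open>V\<close> collapses the first two
    factors to t of the counit, and the counit law leaves the sequence antipode of
    \<open>h z\<close>.\<close>
  moreover have "fsum L ?l = dlin_antipode (h z)"
  proof -
    have inner: "fsum (\<lambda>(c', c''). h (?S c') \<star> (h c'' \<star> \<beta>)) (rep (comult V c)) =
        seq_target (counit V c) \<star> \<beta>" if c: "c \<in> carrier V" for c \<beta>
    proof -
      have "h (additive_extension V (\<lambda>(a, b). ?S a \<otimes>\<^bsub>V\<^esub> b) (comult V c)) =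
          fsum (\<lambda>p. h (case p of (a, b) \<Rightarrow> ?S a \<otimes>\<^bsub>V\<^esub> b)) (rep (comult V c))"
        by (rule additive_extension_fsum(2)[OF V.abelian_group_axioms]) (use keys[OF c] in \<open>auto simp: hadd cl\<close>)
      also have "\<dots> = fsum (\<lambda>(a, b). h (?S a) \<star> h b) (rep (comult V c))"
        using keys[OF c] by (intro fsum_cong) (auto simp: mult cl)
      finally have "seq_target (counit V c) = fsum (\<lambda>(a, b). h (?S a) \<star> h b) (rep (comult V c))"
        by (simp add: Santi[OF c] st)
      then have "seq_target (counit V c) \<star> \<beta> =
          fsum (\<lambda>p. (case p of (a, b) \<Rightarrow> h (?S a) \<star> h b) \<star> \<beta>) (rep (comult V c))"
        using fsum_hom[of "\<lambda>\<alpha>. \<alpha> \<star> \<beta>" "\<lambda>(a, b). h (?S a) \<star> h b"] by (simp add: hurwitz_diff_left)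
      then show ?thesis by (simp add: case_prod_unfold hurwitz_assoc)
    qed
    have "fsum L ?l = fsum (\<lambda>(c, n). fsum (\<lambda>(c', c''). h (?S c') \<star> (h c'' \<star> dlin_antipode (h n)))
        (rep (comult V c))) ?u"
      by (simp add: fsum_frag_extend case_prod_unfold L_def)
    also have "\<dots> = fsum (\<lambda>p. dlin_antipode (h (case p of (a, b) \<Rightarrow> counit V a \<odot>\<^bsub>V\<^esub> b))) ?u"
      by (rule fsum_cong) (auto dest!: keys[OF z] simp: inner act mult cl st antipode_mult antipode_source)
    also have "\<dots> = dlin_antipode (fsum (\<lambda>p. h (case p of (a, b) \<Rightarrow> counit V a \<odot>\<^bsub>V\<^esub> b)) ?u)"
      by (rule fsum_hom[of dlin_antipode, symmetric]) (rule antipode_diff)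
    also have "fsum (\<lambda>p. h (case p of (a, b) \<Rightarrow> counit V a \<odot>\<^bsub>V\<^esub> b)) ?u =
        h (additive_extension V (\<lambda>(a, b). counit V a \<odot>\<^bsub>V\<^esub> b) (comult V z))"
      by (rule additive_extension_fsum(2)[OF V.abelian_group_axioms, symmetric])
        (use keys[OF z] in \<open>auto simp: hadd cl'\<close>)
    finally show ?thesis by (simp add: cu1)
  qed
  \<comment> \<open>Right bracketing: here the antipode identity for sequences collapses the last
    two factors to s of the counit, and the antipode of \<open>V\<close> survives.\<close>
  moreover have "fsum L ?r = h (?S z)"
  proof -
    have inner: "fsum (\<lambda>(c', n'). \<beta> \<star> (h c' \<star> dlin_antipode (h n'))) (rep (comult V n)) =
        \<beta> \<star> seq_source (counit V n)" if n: "n \<in> carrier V" for n \<beta>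
    proof -
      have "h n 0 = counit V n"
        using coring_homsD(5)[OF h n] by (simp add: Dlin_simps)
      then have "fsum (\<lambda>(a, b). h a \<star> dlin_antipode (h b)) (rep (comult V n)) = seq_source (counit V n)"
        using tensor_eval_antipode(1)[OF ev[OF n]] by simp
      then have "\<beta> \<star> seq_source (counit V n) =
          fsum (\<lambda>p. \<beta> \<star> (case p of (a, b) \<Rightarrow> h a \<star> dlin_antipode (h b))) (rep (comult V n))"
        using fsum_hom[of "\<lambda>\<alpha>. \<beta> \<star> \<alpha>" "\<lambda>(a, b). h a \<star> dlin_antipode (h b)" "rep (comult V n)",
          OF hurwitz_diff_right] by simp
      then show ?thesis by (simp add: case_prod_unfold)
    qed
    have "fsum L ?r = fsum (\<lambda>(c, n). fsum (\<lambda>(c', n'). h (?S c) \<star> (h c' \<star> dlin_antipode (h n')))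
        (rep (comult V n))) ?u"
      by (simp add: fsum_frag_extend case_prod_unfold L_def)
    also have "\<dots> = fsum (\<lambda>p. h (?S (case p of (a, b) \<Rightarrow> rsmult V a (counit V b)))) ?u"
      by (rule fsum_cong) (auto dest!: keys[OF z] simp: inner act hS cl Sst st)
    also have "\<dots> = h (?S (additive_extension V (\<lambda>(a, b). rsmult V a (counit V b)) (comult V z)))"
      by (rule additive_extension_fsum(2)[OF V.abelian_group_axioms, of "\<lambda>a. h (?S a)", symmetric])
        (use keys[OF z] in \<open>auto simp: hS cl'\<close>)
    finally show ?thesis by (simp add: cu2)
  qed
  ultimately show ?thesis by simp
qed

text \<open>\<open>pairing_seq \<xi>\<close> maps \<open>V\<close> to \<open>Dlin\<close>, and
  universality for test corings on sequences gives a map g back. Universality on the type of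
  \<open>V\<close> itself makes the pairing map injective; from then on every identity in
  \<open>V\<close> is checked on sequences.\<close>

lemma universal_dual_unique:
  fixes V :: "('k::differential_field, 'v) hopf_algebroid"
  assumes U1: "is_universal_dual TYPE('v) V \<xi>" and U2: "is_universal_dual TYPE(nat \<Rightarrow> 'k) V \<xi>"
  shows "hopf_algebroid_isomorphic (Dlin :: ('k, nat \<Rightarrow> 'k) hopf_algebroid) V"
proof -
  let ?D = "Dlin :: ('k, nat \<Rightarrow> 'k) hopf_algebroid"
  have V: "commutative_hopf_algebroid V" and pair: "dual_pairing V \<xi>"
    and univ: "universal_pairing TYPE('v) V \<xi>" "universal_pairing TYPE(nat \<Rightarrow> 'k) V \<xi>"
    and xi_one: "\<xi> \<one>\<^bsub>V\<^esub> = op_counit"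
    and xi_mult: "\<And>z w. z \<in> carrier V \<Longrightarrow> w \<in> carrier V \<Longrightarrow> \<xi> (z \<otimes>\<^bsub>V\<^esub> w) = convolution (\<xi> z) (\<xi> w)"
    and xi_st: "\<And>x y. \<xi> (source V x \<otimes>\<^bsub>V\<^esub> target V y) = convolution (\<lambda>u. x * op_counit u) (op_mu y)"
    using U1 U2 by (simp_all add: is_universal_dual_def)
  have coring: "is_coring V" and src: "source V \<in> ring_hom \<bbbK> V" and tgt: "target V \<in> ring_hom \<bbbK> V"
    using V by (simp_all add: commutative_hopf_algebroid_def)
  interpret V: cring V using V by (simp add: commutative_hopf_algebroid_def)
  interpret P: paired_coring V \<xi> by unfold_locales (rule coring, rule pair)
  let ?h = "pairing_seq \<xi>"
  have h: "?h \<in> coring_homs V ?D" by (rule P.pairing_coring_hom)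
  have cl: "source V x \<in> carrier V" "target V x \<in> carrier V" for x
    using ring_hom_closed[OF src, of x] ring_hom_closed[OF tgt, of x] by simp_all
  have one: "source V 1 = \<one>\<^bsub>V\<^esub>" "target V 1 = \<one>\<^bsub>V\<^esub>"
    using ring_hom_one[OF src] ring_hom_one[OF tgt] by simp_all
  have mult: "?h (a \<otimes>\<^bsub>V\<^esub> b) = ?h a \<star> ?h b" if "a \<in> carrier V" "b \<in> carrier V" for a b
    by (rule functional_inj) (simp add: P.pairing_functional that xi_mult convolution_functional[symmetric])
  have hst: "?h (source V x) = seq_source x" "?h (target V x) = seq_target x" for x
  proof -
    have "functional_of_seq (?h (source V x \<otimes>\<^bsub>V\<^esub> target V y)) = functional_of_seq (seq_source x \<star> seq_target y)" for y
      by (simp add: P.pairing_functional cl xi_st convolution_unit)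
    from functional_inj[OF this[of 1]] show "?h (source V x) = seq_source x" by (simp add: one cl)
    have "functional_of_seq (?h (source V 1 \<otimes>\<^bsub>V\<^esub> target V x)) = functional_of_seq (seq_source 1 \<star> seq_target x)"
      by (simp only: P.pairing_functional[OF V.m_closed[OF cl]] xi_st convolution_unit)
    from functional_inj[OF this] show "?h (target V x) = seq_target x" by (simp add: one cl)
  qed
  obtain g where g: "g \<in> coring_homs ?D V" "\<And>\<alpha>. \<alpha> \<in> dlin \<Longrightarrow> \<xi> (g \<alpha>) = functional_of_seq \<alpha>"
  proof -
    have "is_coring (coring.truncate ?D)" "dual_pairing (coring.truncate ?D) functional_of_seq"
      by (simp_all only: coring_truncate Dlin_hopf.is_coring Dlin_dual_pairing)
    with univ(2) obtain g where "g \<in> coring_homs (coring.truncate ?D) V"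
      "\<forall>c\<in>carrier (coring.truncate ?D). \<xi> (g c) = functional_of_seq c"
      unfolding universal_pairing_def by blast
    then show ?thesis
      by (intro that[of g]) (simp_all add: coring_truncate(3), simp add: coring.truncate_def Dlin_simps)
  qed
  have hg: "?h (g \<alpha>) = \<alpha>" if "\<alpha> \<in> dlin" for \<alpha>
    using that coring_homsD(1)[OF g(1), of \<alpha>]
    by (intro functional_inj) (simp add: P.pairing_functional g(2) Dlin_simps)
  \<comment> \<open>The composite and the identity are coring endomorphisms of \<open>V\<close> that
    both lie over \<open>\<xi>\<close>, so uniqueness in the universal property identifies
    them.\<close>
  have gh: "g (?h z) = z" if z: "z \<in> carrier V" for z
  proof -
    have "is_coring (coring.truncate V)" "dual_pairing (coring.truncate V) \<xi>"
      by (simp_all only: coring_truncate coring pair)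
    with univ(1) obtain k where k: "\<forall>g'\<in>coring_homs (coring.truncate V) V.
        (\<forall>c\<in>carrier (coring.truncate V). \<xi> (g' c) = \<xi> c) \<longrightarrow> (\<forall>c\<in>carrier (coring.truncate V). g' c = k c)"
      unfolding universal_pairing_def by blast
    have ct: "carrier (coring.truncate V) = carrier V" by (simp add: coring.truncate_def)
    have k': "g' z = k z" if "g' \<in> coring_homs V V" "\<And>c. c \<in> carrier V \<Longrightarrow> \<xi> (g' c) = \<xi> c" for g'
      using k[unfolded coring_truncate(3) ct] that z by blast
    have "(\<lambda>z. g (?h z)) \<in> coring_homs V V"
      by (rule coring_hom_comp[OF coring Dlin_hopf.is_coring coring h g(1)])
    then have "g (?h z) = k z"
      by (rule k'[of "\<lambda>z. g (?h z)"]) (simp add: g(2) P.pairing_dlin P.pairing_functional)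
    moreover have "z = k z" by (rule k'[OF coring_hom_id[OF coring]]) simp
    ultimately show ?thesis by simp
  qed
  have gcl: "g \<alpha> \<in> carrier V" if "\<alpha> \<in> dlin" for \<alpha>
    using coring_homsD(1)[OF g(1), of \<alpha>] that by (simp add: Dlin_simps)
  have eqI: "a = b" if "a \<in> carrier V" "b \<in> carrier V" "?h a = ?h b" for a b
    by (rule trans[OF gh[OF that(1), symmetric]], subst that(3), rule gh[OF that(2)])
  have anti: "?h (antipode V z) = dlin_antipode (?h z)" if "z \<in> carrier V" for z
    by (rule hom_to_Dlin_antipode[OF V h mult hst P.pairing_eval that])
  have anti_cl: "antipode V z \<in> carrier V" if "z \<in> carrier V" for z
    using V that by (auto simp: commutative_hopf_algebroid_def dest: ring_hom_closed)
  have "g \<in> ring_hom ?D V"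
    by (rule ring_hom_memI)
      (auto intro!: eqI simp: Dlin_simps gcl hg mult dlin_mult dlin_add dlin_source P.pairing_linear
        hst[of 1, unfolded one])
  moreover have "bij_betw g (carrier ?D) (carrier V)"
    by (rule bij_betw_byWitness[where f' = ?h]) (auto simp: Dlin_simps hg gh gcl P.pairing_dlin)
  moreover have "g (source ?D x) = source V x" "g (target ?D x) = target V x" for x
    by (auto intro!: eqI simp: Dlin_simps gcl hg dlin_source dlin_target cl hst)
  moreover have "g (antipode ?D \<alpha>) = antipode V (g \<alpha>)" if "\<alpha> \<in> carrier ?D" for \<alpha>
    using that by (auto intro!: eqI simp: Dlin_simps gcl hg dlin_antipode_closed anti anti_cl)
  ultimately have "g \<in> hopf_algebroid_isos ?D V"
    using g(1) by (simp add: hopf_algebroid_isos_def)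
  then show ?thesis
    using V Dlin_commutative_hopf_algebroid by (auto simp: hopf_algebroid_isomorphic_def)
qed

section \<open>Generators, dual bases and the sequences of matrix coefficients\<close>

section \<open>Finite-dimensional differential spaces\<close>

text \<open>Closure is asked for members of the carrier only, so \<open>T\<close> may be any set cut
  out by a property.\<close>

definition lin_closed :: "('k::differential_field, 'a, 'z) module_scheme \<Rightarrow> 'a set \<Rightarrow> bool" where
  "lin_closed M T \<longleftrightarrow> \<zero>\<^bsub>M\<^esub> \<in> T \<and>
    (\<forall>a\<in>carrier M. \<forall>b\<in>carrier M. a \<in> T \<longrightarrow> b \<in> T \<longrightarrow> a \<oplus>\<^bsub>M\<^esub> b \<in> T) \<and>
    (\<forall>x. \<forall>a\<in>carrier M. a \<in> T \<longrightarrow> x \<odot>\<^bsub>M\<^esub> a \<in> T)"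

text \<open>Spanning in the form of an induction principle: a property of all vectors is proved by
  showing that it is linearly closed and holds on \<open>B\<close>, without finite sums in the
  record.\<close>

definition generates :: "('k::differential_field, 'a, 'z) module_scheme \<Rightarrow> 'a set \<Rightarrow> bool" where
  "generates M B \<longleftrightarrow> finite B \<and> B \<subseteq> carrier M \<and>
    (\<forall>T. lin_closed M T \<longrightarrow> B \<subseteq> T \<longrightarrow> carrier M \<subseteq> T)"

lemma base_ring_minus: "\<ominus>\<^bsub>\<bbbK>\<^esub> x = - x"
  using cring_base_ring[where 'a = 'a]
  by (intro abelian_group.minus_equality) (auto intro: ring.is_abelian_group cring.axioms)

lemma finsum_lin_closed:
  fixes M :: "('k::differential_field, 'a, 'z) module_scheme"
  assumes "module \<bbbK> M" "lin_closed M T" "finite I" "\<And>i. i \<in> I \<Longrightarrow> b i \<in> carrier M \<and> b i \<in> T"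
  shows "(\<Oplus>\<^bsub>M\<^esub>i\<in>I. c i \<odot>\<^bsub>M\<^esub> b i) \<in> T \<and> (\<Oplus>\<^bsub>M\<^esub>i\<in>I. c i \<odot>\<^bsub>M\<^esub> b i) \<in> carrier M"
proof -
  interpret module \<bbbK> M by fact
  show ?thesis
    using assms(3,4)
  proof (induction I)
    case empty
    then show ?case using assms(2) by (simp add: lin_closed_def)
  next
    case (insert i I)
    have "(\<Oplus>\<^bsub>M\<^esub>j\<in>insert i I. c j \<odot>\<^bsub>M\<^esub> b j) = c i \<odot>\<^bsub>M\<^esub> b i \<oplus>\<^bsub>M\<^esub> (\<Oplus>\<^bsub>M\<^esub>j\<in>I. c j \<odot>\<^bsub>M\<^esub> b j)"
      using insert by (intro finsum_insert) (auto simp: smult_closed)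
    moreover have "(\<Oplus>\<^bsub>M\<^esub>j\<in>I. c j \<odot>\<^bsub>M\<^esub> b j) \<in> T" "(\<Oplus>\<^bsub>M\<^esub>j\<in>I. c j \<odot>\<^bsub>M\<^esub> b j) \<in> carrier M"
      using insert by auto
    moreover have "c i \<odot>\<^bsub>M\<^esub> b i \<in> T" "c i \<odot>\<^bsub>M\<^esub> b i \<in> carrier M"
      using insert assms(2) by (auto simp: lin_closed_def smult_closed)
    ultimately show ?case
      using assms(2) by (simp add: lin_closed_def)
  qed
qed

lemma generates_lincomb:
  fixes M :: "('k::differential_field, 'a, 'z) module_scheme"
  assumes M: "module \<bbbK> M" and B: "generates M B" and m: "m \<in> carrier M"
  shows "\<exists>c. m = (\<Oplus>\<^bsub>M\<^esub>b\<in>B. c b \<odot>\<^bsub>M\<^esub> b)"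
proof -
  interpret module \<bbbK> M by fact
  have fin: "finite B" and sub: "B \<subseteq> carrier M" using B by (auto simp: generates_def)
  let ?T = "{m. \<exists>c. m = (\<Oplus>\<^bsub>M\<^esub>b\<in>B. c b \<odot>\<^bsub>M\<^esub> b)}"
  have cl: "(\<lambda>b. c b \<odot>\<^bsub>M\<^esub> b) \<in> B \<rightarrow> carrier M" for c
    using sub by (auto intro: smult_closed)
  have "lin_closed M ?T"
    unfolding lin_closed_def
  proof (intro conjI ballI allI impI)
    have "(\<Oplus>\<^bsub>M\<^esub>b\<in>B. 0 \<odot>\<^bsub>M\<^esub> b) = (\<Oplus>\<^bsub>M\<^esub>b\<in>B. \<zero>\<^bsub>M\<^esub>)"
      by (rule finsum_cong') (use sub smult_l_null in auto)
    then show "\<zero>\<^bsub>M\<^esub> \<in> ?T" by (auto intro!: exI[of _ "\<lambda>_. 0"])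
  next
    fix a b assume "a \<in> ?T" "b \<in> ?T"
    then obtain c d where "a = (\<Oplus>\<^bsub>M\<^esub>b\<in>B. c b \<odot>\<^bsub>M\<^esub> b)" "b = (\<Oplus>\<^bsub>M\<^esub>b\<in>B. d b \<odot>\<^bsub>M\<^esub> b)" by auto
    then have "a \<oplus>\<^bsub>M\<^esub> b = (\<Oplus>\<^bsub>M\<^esub>b\<in>B. c b \<odot>\<^bsub>M\<^esub> b \<oplus>\<^bsub>M\<^esub> d b \<odot>\<^bsub>M\<^esub> b)"
      by (simp add: finsum_addf[OF cl cl])
    also have "\<dots> = (\<Oplus>\<^bsub>M\<^esub>b\<in>B. (c b + d b) \<odot>\<^bsub>M\<^esub> b)"
      by (rule finsum_cong') (use sub smult_l_distr in \<open>auto intro: smult_closed\<close>)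
    finally show "a \<oplus>\<^bsub>M\<^esub> b \<in> ?T" by (intro CollectI exI)
  next
    fix x a assume "a \<in> ?T"
    then obtain c where "a = (\<Oplus>\<^bsub>M\<^esub>b\<in>B. c b \<odot>\<^bsub>M\<^esub> b)" by auto
    then have "x \<odot>\<^bsub>M\<^esub> a = (\<Oplus>\<^bsub>M\<^esub>b\<in>B. x \<odot>\<^bsub>M\<^esub> (c b \<odot>\<^bsub>M\<^esub> b))"
      using finsum_smult_ldistr[OF fin _ cl, of x c] by simp
    also have "\<dots> = (\<Oplus>\<^bsub>M\<^esub>b\<in>B. (x * c b) \<odot>\<^bsub>M\<^esub> b)"
      by (rule finsum_cong') (use sub smult_assoc1 in \<open>auto intro: smult_closed\<close>)
    finally show "x \<odot>\<^bsub>M\<^esub> a \<in> ?T" by (intro CollectI exI)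
  qed
  moreover have "B \<subseteq> ?T"
  proof
    fix b assume b: "b \<in> B"
    have "(\<Oplus>\<^bsub>M\<^esub>a\<in>B. of_bool (b = a) \<odot>\<^bsub>M\<^esub> a) = (\<Oplus>\<^bsub>M\<^esub>a\<in>B. if b = a then a else \<zero>\<^bsub>M\<^esub>)"
      by (rule finsum_cong') (use sub smult_l_null smult_one in auto)
    also have "\<dots> = b"
      using finsum_singleton[OF b fin, of "\<lambda>a. a"] sub by auto
    finally show "b \<in> ?T" by (auto intro!: exI[of _ "\<lambda>a. of_bool (b = a)"])
  qed
  ultimately show ?thesis using B m unfolding generates_def by blast
qed

lemma finite_dimensional_iff:
  fixes M :: "('k::differential_field, 'a, 'z) module_scheme"
  assumes M: "module \<bbbK> M"
  shows "finite_dimensional M \<longleftrightarrow> (\<exists>B. generates M B)"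
proof
  assume "finite_dimensional M"
  then obtain B where B: "finite B" "B \<subseteq> carrier M" "\<forall>m\<in>carrier M. \<exists>c. m = (\<Oplus>\<^bsub>M\<^esub>b\<in>B. c b \<odot>\<^bsub>M\<^esub> b)"
    by (auto simp: finite_dimensional_def)
  have "carrier M \<subseteq> T" if "lin_closed M T" "B \<subseteq> T" for T
  proof
    fix m assume "m \<in> carrier M"
    then obtain c where "m = (\<Oplus>\<^bsub>M\<^esub>b\<in>B. c b \<odot>\<^bsub>M\<^esub> b)" using B(3) by blast
    then show "m \<in> T"
      using finsum_lin_closed[OF M that(1) B(1), of "\<lambda>b. b" c] B(2) that(2) by auto
  qed
  with B show "\<exists>B. generates M B" by (auto simp: generates_def)
next
  assume "\<exists>B. generates M B"
  then obtain B where B: "generates M B" by blast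
  then show "finite_dimensional M"
    using generates_lincomb[OF M B] unfolding finite_dimensional_def generates_def by blast
qed

lemma linear_form_finsum:
  fixes M :: "('k::differential_field, 'a, 'z) module_scheme"
  assumes M: "module \<bbbK> M" and f: "f \<in> linear_maps M base_module"
    and I: "finite I" "\<And>i. i \<in> I \<Longrightarrow> b i \<in> carrier M"
  shows "f (\<Oplus>\<^bsub>M\<^esub>i\<in>I. c i \<odot>\<^bsub>M\<^esub> b i) = (\<Sum>i\<in>I. c i * f (b i))"
proof -
  interpret module \<bbbK> M by fact
  have add: "f (a \<oplus>\<^bsub>M\<^esub> b) = f a + f b" if "a \<in> carrier M" "b \<in> carrier M" for a b
    using f that by (auto simp: linear_maps_iff)
  have sm: "f (x \<odot>\<^bsub>M\<^esub> a) = x * f a" if "a \<in> carrier M" for x a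
    using f that by (auto simp: linear_maps_iff)
  have z: "f \<zero>\<^bsub>M\<^esub> = 0" using sm[of "\<zero>\<^bsub>M\<^esub>" 0] smult_r_null[of 0] by simp
  show ?thesis
    using I
  proof (induction I)
    case (insert i I)
    have cl: "(\<lambda>j. c j \<odot>\<^bsub>M\<^esub> b j) \<in> I \<rightarrow> carrier M" using insert by (auto intro: smult_closed)
    then have "(\<Oplus>\<^bsub>M\<^esub>j\<in>insert i I. c j \<odot>\<^bsub>M\<^esub> b j) = c i \<odot>\<^bsub>M\<^esub> b i \<oplus>\<^bsub>M\<^esub> (\<Oplus>\<^bsub>M\<^esub>j\<in>I. c j \<odot>\<^bsub>M\<^esub> b j)"
      using insert by (intro finsum_insert) (auto intro: smult_closed)
    then show ?case
      using insert finsum_closed[OF cl] by (simp add: add sm smult_closed)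
  qed (simp add: z)
qed

lemma dual_basis_exists:
  fixes M :: "('k::differential_field, 'a, 'z) module_scheme"
  assumes M: "module \<bbbK> M" and fd: "finite_dimensional M"
  shows "\<exists>d e e'. is_dual_basis M d e e'"
proof -
  interpret module \<bbbK> M by fact
  obtain B where B: "generates M B" and min: "\<And>B'. generates M B' \<Longrightarrow> card B \<le> card B'"
    using fd finite_dimensional_iff[OF M] arg_min_nat_lemma[of "generates M" _ card] by metis
  have fin: "finite B" and sub: "B \<subseteq> carrier M" using B by (auto simp: generates_def)
  have cl: "(\<lambda>b. c b \<odot>\<^bsub>M\<^esub> b) \<in> A \<rightarrow> carrier M" if "A \<subseteq> B" for c A
    using sub that by (auto intro: smult_closed)
  have uniq0: "c b = 0" if c: "(\<Oplus>\<^bsub>M\<^esub>b\<in>B. c b \<odot>\<^bsub>M\<^esub> b) = \<zero>\<^bsub>M\<^esub>" and b: "b \<in> B" for c b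
  proof (rule ccontr)
    assume nz: "c b \<noteq> 0"
    let ?s = "\<Oplus>\<^bsub>M\<^esub>a\<in>B - {b}. (- c a / c b) \<odot>\<^bsub>M\<^esub> a"
    let ?r = "\<Oplus>\<^bsub>M\<^esub>a\<in>B - {b}. c a \<odot>\<^bsub>M\<^esub> a"
    have r: "?r \<in> carrier M" by (rule finsum_closed[OF cl]) auto
    have bc: "b \<in> carrier M" using b sub by auto
    have "c b \<odot>\<^bsub>M\<^esub> b \<oplus>\<^bsub>M\<^esub> ?r = \<zero>\<^bsub>M\<^esub>"
      using finsum_insert[of "B - {b}" b "\<lambda>a. c a \<odot>\<^bsub>M\<^esub> a"] fin cl[of "B - {b}" c] bc c b
      by (simp add: insert_absorb smult_closed)
    then have 1: "c b \<odot>\<^bsub>M\<^esub> b = \<ominus>\<^bsub>M\<^esub> ?r"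
      using r bc by (intro minus_equality[symmetric]) (auto simp: smult_closed)
    have "b = (1 / c b) \<odot>\<^bsub>M\<^esub> (c b \<odot>\<^bsub>M\<^esub> b)"
      using smult_assoc1[of "1 / c b" "c b" b] smult_one[of b] bc nz by simp
    also have "\<dots> = (- 1 / c b) \<odot>\<^bsub>M\<^esub> ?r"
      unfolding 1 using r smult_r_minus[of "1 / c b" ?r] smult_l_minus[of "1 / c b" ?r]
      by (simp add: base_ring_minus)
    also have "\<dots> = (\<Oplus>\<^bsub>M\<^esub>a\<in>B - {b}. (- 1 / c b) \<odot>\<^bsub>M\<^esub> (c a \<odot>\<^bsub>M\<^esub> a))"
      using finsum_smult_ldistr[of "B - {b}" "- 1 / c b" "\<lambda>a. c a \<odot>\<^bsub>M\<^esub> a"] fin cl[of "B - {b}" c] by simp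
    also have "\<dots> = ?s"
      by (rule finsum_cong') (use sub smult_assoc1[symmetric] in \<open>auto intro: smult_closed\<close>)
    finally have b_eq: "b = ?s" .
    have "generates M (B - {b})"
      unfolding generates_def
    proof (intro conjI allI impI)
      fix T assume T: "lin_closed M T" "B - {b} \<subseteq> T"
      have "b \<in> T"
        by (subst b_eq, rule finsum_lin_closed[OF M T(1), of "B - {b}" "\<lambda>a. a" "\<lambda>a. - c a / c b",
              THEN conjunct1])
          (use fin sub T(2) in auto)
      then show "carrier M \<subseteq> T" using B T unfolding generates_def by blast
    qed (use fin sub in auto)
    from min[OF this] show False using card_Diff1_less[OF fin b] by linarith
  qed
  have uniq: "c b = c' b" if eq: "(\<Oplus>\<^bsub>M\<^esub>b\<in>B. c b \<odot>\<^bsub>M\<^esub> b) = (\<Oplus>\<^bsub>M\<^esub>b\<in>B. c' b \<odot>\<^bsub>M\<^esub> b)" and b: "b \<in> B" for c c' b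
  proof -
    have m1: "(- 1) \<odot>\<^bsub>M\<^esub> a = \<ominus>\<^bsub>M\<^esub> a" if "a \<in> carrier M" for a
      using smult_l_minus[of 1 a] smult_one[of a] that by (simp add: base_ring_minus)
    have "(\<Oplus>\<^bsub>M\<^esub>b\<in>B. (c b - c' b) \<odot>\<^bsub>M\<^esub> b) = (\<Oplus>\<^bsub>M\<^esub>b\<in>B. c b \<odot>\<^bsub>M\<^esub> b \<oplus>\<^bsub>M\<^esub> (- 1) \<odot>\<^bsub>M\<^esub> (c' b \<odot>\<^bsub>M\<^esub> b))"
    proof (rule finsum_cong')
      fix a assume "a \<in> B"
      then have a: "a \<in> carrier M" using sub by auto
      show "(c a - c' a) \<odot>\<^bsub>M\<^esub> a = c a \<odot>\<^bsub>M\<^esub> a \<oplus>\<^bsub>M\<^esub> (- 1) \<odot>\<^bsub>M\<^esub> (c' a \<odot>\<^bsub>M\<^esub> a)"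
        using smult_l_distr[of "c a" "- c' a" a] smult_assoc1[of "- 1" "c' a" a] a by simp
    qed (use sub in \<open>auto intro: smult_closed\<close>)
    also have "\<dots> = (\<Oplus>\<^bsub>M\<^esub>b\<in>B. c b \<odot>\<^bsub>M\<^esub> b) \<oplus>\<^bsub>M\<^esub> (\<Oplus>\<^bsub>M\<^esub>b\<in>B. (- 1) \<odot>\<^bsub>M\<^esub> (c' b \<odot>\<^bsub>M\<^esub> b))"
      by (rule finsum_addf) (use sub in \<open>auto intro: smult_closed\<close>)
    also have "(\<Oplus>\<^bsub>M\<^esub>b\<in>B. (- 1) \<odot>\<^bsub>M\<^esub> (c' b \<odot>\<^bsub>M\<^esub> b)) = (- 1) \<odot>\<^bsub>M\<^esub> (\<Oplus>\<^bsub>M\<^esub>b\<in>B. c' b \<odot>\<^bsub>M\<^esub> b)"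
      using finsum_smult_ldistr[of B "- 1" "\<lambda>a. c' a \<odot>\<^bsub>M\<^esub> a"] fin cl[of B c'] by simp
    also have "(\<Oplus>\<^bsub>M\<^esub>b\<in>B. c b \<odot>\<^bsub>M\<^esub> b) \<oplus>\<^bsub>M\<^esub> \<dots> = \<zero>\<^bsub>M\<^esub>"
      unfolding eq using finsum_closed[OF cl[of B c']] by (simp add: m1 r_neg)
    finally show ?thesis using uniq0[of "\<lambda>b. c b - c' b" b] b by simp
  qed
  \<comment> \<open>Coordinates are picked by choice; uniqueness of the coefficients then makes them
    linear and dual to \<open>B\<close>.\<close>
  define co where "co m = (SOME c. m = (\<Oplus>\<^bsub>M\<^esub>b\<in>B. c b \<odot>\<^bsub>M\<^esub> b))" for m
  have co: "m = (\<Oplus>\<^bsub>M\<^esub>b\<in>B. co m b \<odot>\<^bsub>M\<^esub> b)" if "m \<in> carrier M" for m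
    unfolding co_def using generates_lincomb[OF M B that] by (rule someI_ex)
  have co_uniq: "co m b = c b" if "m = (\<Oplus>\<^bsub>M\<^esub>b\<in>B. c b \<odot>\<^bsub>M\<^esub> b)" "b \<in> B" for m c b
  proof (rule uniq[OF _ that(2)])
    have "m \<in> carrier M" unfolding that(1) by (rule finsum_closed[OF cl]) simp
    from co[OF this] that(1) show "(\<Oplus>\<^bsub>M\<^esub>b\<in>B. co m b \<odot>\<^bsub>M\<^esub> b) = (\<Oplus>\<^bsub>M\<^esub>b\<in>B. c b \<odot>\<^bsub>M\<^esub> b)" by simp
  qed
  have co_add: "co (m \<oplus>\<^bsub>M\<^esub> n) b = co m b + co n b" if "m \<in> carrier M" "n \<in> carrier M" "b \<in> B" for m n b
  proof (rule co_uniq[OF _ that(3)])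
    have "m \<oplus>\<^bsub>M\<^esub> n = (\<Oplus>\<^bsub>M\<^esub>b\<in>B. co m b \<odot>\<^bsub>M\<^esub> b) \<oplus>\<^bsub>M\<^esub> (\<Oplus>\<^bsub>M\<^esub>b\<in>B. co n b \<odot>\<^bsub>M\<^esub> b)"
      using co that(1,2) by metis
    also have "\<dots> = (\<Oplus>\<^bsub>M\<^esub>b\<in>B. co m b \<odot>\<^bsub>M\<^esub> b \<oplus>\<^bsub>M\<^esub> co n b \<odot>\<^bsub>M\<^esub> b)"
      by (rule finsum_addf[OF cl cl, symmetric]) auto
    also have "\<dots> = (\<Oplus>\<^bsub>M\<^esub>b\<in>B. (co m b + co n b) \<odot>\<^bsub>M\<^esub> b)"
      by (rule finsum_cong') (use sub smult_l_distr in \<open>auto intro: smult_closed\<close>)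
    finally show "m \<oplus>\<^bsub>M\<^esub> n = (\<Oplus>\<^bsub>M\<^esub>b\<in>B. (co m b + co n b) \<odot>\<^bsub>M\<^esub> b)" .
  qed
  have co_smult: "co (x \<odot>\<^bsub>M\<^esub> m) b = x * co m b" if "m \<in> carrier M" "b \<in> B" for m x b
  proof (rule co_uniq[OF _ that(2)])
    have "x \<odot>\<^bsub>M\<^esub> m = x \<odot>\<^bsub>M\<^esub> (\<Oplus>\<^bsub>M\<^esub>b\<in>B. co m b \<odot>\<^bsub>M\<^esub> b)" using co that(1) by metis
    also have "\<dots> = (\<Oplus>\<^bsub>M\<^esub>b\<in>B. x \<odot>\<^bsub>M\<^esub> (co m b \<odot>\<^bsub>M\<^esub> b))"
      using finsum_smult_ldistr[of B x "\<lambda>b. co m b \<odot>\<^bsub>M\<^esub> b"] fin cl[of B "co m"] by simp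
    also have "\<dots> = (\<Oplus>\<^bsub>M\<^esub>b\<in>B. (x * co m b) \<odot>\<^bsub>M\<^esub> b)"
      by (rule finsum_cong') (use sub smult_assoc1 in \<open>auto intro: smult_closed\<close>)
    finally show "x \<odot>\<^bsub>M\<^esub> m = (\<Oplus>\<^bsub>M\<^esub>b\<in>B. (x * co m b) \<odot>\<^bsub>M\<^esub> b)" .
  qed
  have co_basis: "co b a = of_bool (b = a)" if "a \<in> B" "b \<in> B" for a b
  proof (rule co_uniq[OF _ that(1)])
    have "(\<Oplus>\<^bsub>M\<^esub>a\<in>B. of_bool (b = a) \<odot>\<^bsub>M\<^esub> a) = (\<Oplus>\<^bsub>M\<^esub>a\<in>B. if b = a then a else \<zero>\<^bsub>M\<^esub>)"
      by (rule finsum_cong') (use sub smult_l_null smult_one in auto)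
    also have "\<dots> = b"
      using finsum_singleton[OF that(2) fin, of "\<lambda>a. a"] sub by auto
    finally show "b = (\<Oplus>\<^bsub>M\<^esub>a\<in>B. of_bool (b = a) \<odot>\<^bsub>M\<^esub> a)" by simp
  qed
  obtain e where e: "bij_betw e {..<card B} B"
    using ex_bij_betw_nat_finite[OF fin] by (auto simp: atLeast0LessThan)
  have eB: "e i \<in> B" if "i < card B" for i using e that by (auto simp: bij_betw_def)
  have e_inj: "e i = e j \<longleftrightarrow> i = j" if "i < card B" "j < card B" for i j
    using e that by (auto simp: bij_betw_def dest: inj_onD)
  let ?e' = "\<lambda>i. \<lambda>m\<in>carrier M. co m (e i)"
  have "is_dual_basis M (card B) e ?e'"
    unfolding is_dual_basis_def
  proof (intro conjI allI impI ballI)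
    fix i assume i: "i < card B"
    show "e i \<in> carrier M" using eB[OF i] sub by auto
    show "?e' i \<in> carrier (dual M)"
      using eB[OF i] by (simp add: dual_simps linear_maps_iff co_add co_smult a_closed smult_closed)
    fix j assume j: "j < card B"
    show "?e' i (e j) = of_bool (i = j)"
      using eB[OF i] eB[OF j] sub e_inj[OF i j] by (auto simp: co_basis)
  next
    fix m assume m: "m \<in> carrier M"
    have "m = (\<Oplus>\<^bsub>M\<^esub>b\<in>e ` {..<card B}. co m b \<odot>\<^bsub>M\<^esub> b)"
      using co[OF m] e by (simp add: bij_betw_def)
    also have "\<dots> = (\<Oplus>\<^bsub>M\<^esub>i\<in>{..<card B}. co m (e i) \<odot>\<^bsub>M\<^esub> e i)"
      by (rule finsum_reindex) (use e sub in \<open>auto simp: bij_betw_def intro!: smult_closed\<close>)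
    also have "\<dots> = (\<Oplus>\<^bsub>M\<^esub>i\<in>{..<card B}. ?e' i m \<odot>\<^bsub>M\<^esub> e i)"
      using m by simp
    finally show "m = (\<Oplus>\<^bsub>M\<^esub>i\<in>{..<card B}. ?e' i m \<odot>\<^bsub>M\<^esub> e i)" .
  qed
  then show ?thesis by blast
qed

locale fd_space =
  fixes M :: "('k::differential_field, 'a, 'z) diff_space_scheme"
  assumes fd: "fd_diff_space M"
begin

lemma is_module: "module \<bbbK> M"
  using fd by (simp add: fd_diff_space_def)

sublocale Mod: module \<bbbK> M by (rule is_module)

lemma has_dual_basis: "\<exists>d e e'. is_dual_basis M d e e'"
  using dual_basis_exists[OF is_module] fd by (simp add: fd_diff_space_def)

lemma has_generators: "\<exists>B. generates M B"
  using finite_dimensional_iff[OF is_module] fd by (simp add: fd_diff_space_def)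

lemma smult_closed [simp, intro]: "m \<in> carrier M \<Longrightarrow> x \<odot>\<^bsub>M\<^esub> m \<in> carrier M"
  by simp

lemma diff_closed [simp, intro]: "m \<in> carrier M \<Longrightarrow> differential M m \<in> carrier M"
  using fd by (auto simp: fd_diff_space_def hom_def)

lemma diff_add: "m \<in> carrier M \<Longrightarrow> n \<in> carrier M \<Longrightarrow>
    differential M (m \<oplus>\<^bsub>M\<^esub> n) = differential M m \<oplus>\<^bsub>M\<^esub> differential M n"
  using fd by (auto simp: fd_diff_space_def hom_def)

lemma diff_smult: "m \<in> carrier M \<Longrightarrow>
    differential M (x \<odot>\<^bsub>M\<^esub> m) = x \<odot>\<^bsub>M\<^esub> differential M m \<oplus>\<^bsub>M\<^esub> \<partial> x \<odot>\<^bsub>M\<^esub> m"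
  using fd by (auto simp: fd_diff_space_def)

lemma diff_pow_closed [simp]: "m \<in> carrier M \<Longrightarrow> (differential M ^^ n) m \<in> carrier M"
  by (induction n) auto

lemma diff_pow_add: "m \<in> carrier M \<Longrightarrow> m' \<in> carrier M \<Longrightarrow>
    (differential M ^^ n) (m \<oplus>\<^bsub>M\<^esub> m') = (differential M ^^ n) m \<oplus>\<^bsub>M\<^esub> (differential M ^^ n) m'"
  by (induction n) (auto simp: diff_add)

lemma zero_smult: "m \<in> carrier M \<Longrightarrow> 0 \<odot>\<^bsub>M\<^esub> m = \<zero>\<^bsub>M\<^esub>"
  using Mod.smult_l_null[of m] by simp

lemma one_smult: "m \<in> carrier M \<Longrightarrow> 1 \<odot>\<^bsub>M\<^esub> m = m"
  using Mod.smult_one[of m] by simp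

lemma add_smult: "m \<in> carrier M \<Longrightarrow> (x + y) \<odot>\<^bsub>M\<^esub> m = x \<odot>\<^bsub>M\<^esub> m \<oplus>\<^bsub>M\<^esub> y \<odot>\<^bsub>M\<^esub> m"
  using Mod.smult_l_distr[of x y m] by simp

lemma smult_smult: "m \<in> carrier M \<Longrightarrow> (x * y) \<odot>\<^bsub>M\<^esub> m = x \<odot>\<^bsub>M\<^esub> (y \<odot>\<^bsub>M\<^esub> m)"
  using Mod.smult_assoc1[of x y m] by simp

lemma smult_add: "m \<in> carrier M \<Longrightarrow> n \<in> carrier M \<Longrightarrow> x \<odot>\<^bsub>M\<^esub> (m \<oplus>\<^bsub>M\<^esub> n) = x \<odot>\<^bsub>M\<^esub> m \<oplus>\<^bsub>M\<^esub> x \<odot>\<^bsub>M\<^esub> n"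
  using Mod.smult_r_distr[of x m n] by simp

end

text \<open>The sequence of a matrix coefficient; the isomorphism with \<open>Dlin\<close> sends the
  class of \<phi> (x) m to it. Differentiating m shifts it.\<close>

definition coseq ::
    "('k::differential_field, 'a, 'z) diff_space_scheme \<Rightarrow> ('a \<Rightarrow> 'k) \<Rightarrow> 'a \<Rightarrow> nat \<Rightarrow> 'k" where
  "coseq M \<phi> m = (\<lambda>n. \<phi> ((differential M ^^ n) m))"

context fd_space begin

lemma dualD:
  assumes "\<phi> \<in> carrier (dual M)"
  shows "m \<in> carrier M \<Longrightarrow> n \<in> carrier M \<Longrightarrow> \<phi> (m \<oplus>\<^bsub>M\<^esub> n) = \<phi> m + \<phi> n"
    and "m \<in> carrier M \<Longrightarrow> \<phi> (x \<odot>\<^bsub>M\<^esub> m) = x * \<phi> m"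
    and "\<phi> \<in> extensional (carrier M)"
    and "\<phi> \<in> linear_maps M base_module"
  using assms by (auto simp: dual_simps linear_maps_iff)

lemma dualI:
  assumes "\<And>m n. m \<in> carrier M \<Longrightarrow> n \<in> carrier M \<Longrightarrow> \<phi> (m \<oplus>\<^bsub>M\<^esub> n) = \<phi> m + \<phi> n"
    and "\<And>x m. m \<in> carrier M \<Longrightarrow> \<phi> (x \<odot>\<^bsub>M\<^esub> m) = x * \<phi> m"
    and "\<phi> \<in> extensional (carrier M)"
  shows "\<phi> \<in> carrier (dual M)"
  using assms by (auto simp: dual_simps linear_maps_iff)

lemma dual_add_closed: "\<phi> \<in> carrier (dual M) \<Longrightarrow> \<psi> \<in> carrier (dual M) \<Longrightarrow> \<phi> \<oplus>\<^bsub>dual M\<^esub> \<psi> \<in> carrier (dual M)"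
  by (rule dualI) (simp_all add: dual_simps(3) dualD algebra_simps)

lemma dual_smult_closed: "\<phi> \<in> carrier (dual M) \<Longrightarrow> x \<odot>\<^bsub>dual M\<^esub> \<phi> \<in> carrier (dual M)"
  by (rule dualI) (simp_all add: dual_simps(4) dualD algebra_simps)

lemma dual_zero_closed: "\<zero>\<^bsub>dual M\<^esub> \<in> carrier (dual M)"
  by (rule dualI) (simp_all add: dual_simps(2))

lemma dual_eqI:
  assumes "\<phi> \<in> carrier (dual M)" "\<psi> \<in> carrier (dual M)" "\<And>m. m \<in> carrier M \<Longrightarrow> \<phi> m = \<psi> m"
  shows "\<phi> = \<psi>"
  using assms by (intro extensionalityI[of _ "carrier M"]) (auto dest: dualD(3))

lemma dual_module: "module \<bbbK> (dual M)"
proof (rule moduleI[OF cring_base_ring])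
  show "abelian_group (dual M)"
  proof (rule abelian_groupI)
    fix \<phi> assume \<phi>: "\<phi> \<in> carrier (dual M)"
    show "\<exists>y\<in>carrier (dual M). y \<oplus>\<^bsub>dual M\<^esub> \<phi> = \<zero>\<^bsub>dual M\<^esub>"
      using dual_smult_closed[OF \<phi>, of "- 1"]
      by (intro bexI[of _ "(- 1) \<odot>\<^bsub>dual M\<^esub> \<phi>"] dual_eqI)
        (auto simp: \<phi> dual_add_closed dual_zero_closed, auto simp: dual_simps)
  qed (auto intro!: dual_eqI simp: dual_add_closed dual_zero_closed; simp add: dual_simps)+
qed (auto intro!: dual_eqI simp: dual_add_closed dual_smult_closed; simp add: dual_simps algebra_simps)+

lemma coseq_at_0: "coseq M \<phi> m 0 = \<phi> m"
  by (simp add: coseq_def)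

lemma coseq_diff: "coseq M \<phi> (differential M m) = seq_shift (coseq M \<phi> m)"
  by (simp add: coseq_def seq_shift_def funpow_swap1)

lemma coseq_diff_pow: "coseq M \<phi> ((differential M ^^ k) m) = (seq_shift ^^ k) (coseq M \<phi> m)"
  by (induction k) (auto simp: coseq_diff)

lemma coseq_add:
  "\<phi> \<in> carrier (dual M) \<Longrightarrow> m \<in> carrier M \<Longrightarrow> n \<in> carrier M \<Longrightarrow>
    coseq M \<phi> (m \<oplus>\<^bsub>M\<^esub> n) = coseq M \<phi> m + coseq M \<phi> n"
  by (auto simp: coseq_def diff_pow_add dualD fun_apply)

lemma coseq_smult:
  assumes \<phi>: "\<phi> \<in> carrier (dual M)" and m: "m \<in> carrier M"
  shows "coseq M \<phi> (x \<odot>\<^bsub>M\<^esub> m) = coseq M \<phi> m \<star> seq_target x"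
proof -
  have "coseq M \<phi> (x \<odot>\<^bsub>M\<^esub> m) n = (coseq M \<phi> m \<star> seq_target x) n" for n
    using m
  proof (induction n arbitrary: x m)
    case 0
    then show ?case using \<phi> by (simp add: coseq_at_0 hurwitz_0 dualD)
  next
    case (Suc n)
    have "coseq M \<phi> (x \<odot>\<^bsub>M\<^esub> m) (Suc n) = coseq M \<phi> (differential M (x \<odot>\<^bsub>M\<^esub> m)) n"
      by (simp add: coseq_diff seq_shift_def)
    also have "\<dots> = coseq M \<phi> (x \<odot>\<^bsub>M\<^esub> differential M m) n + coseq M \<phi> (\<partial> x \<odot>\<^bsub>M\<^esub> m) n"
      using Suc.prems by (simp add: diff_smult coseq_add[OF \<phi>] fun_apply)
    also have "\<dots> = seq_shift (coseq M \<phi> m \<star> seq_target x) n"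
      using Suc.prems by (simp add: Suc.IH hurwitz_shift seq_target_shift coseq_diff fun_apply)
    finally show ?case by (simp add: seq_shift_def)
  qed
  then show ?thesis by blast
qed

lemma coseq_dual_add:
  "m \<in> carrier M \<Longrightarrow> coseq M (\<phi> \<oplus>\<^bsub>dual M\<^esub> \<psi>) m = coseq M \<phi> m + coseq M \<psi> m"
  by (auto simp: coseq_def dual_simps fun_apply)

lemma coseq_zero: "\<phi> \<in> carrier (dual M) \<Longrightarrow> coseq M \<phi> \<zero>\<^bsub>M\<^esub> = 0"
  using coseq_smult[of \<phi> "\<zero>\<^bsub>M\<^esub>" 0] zero_smult[of "\<zero>\<^bsub>M\<^esub>"] by simp

lemma coseq_tspan:
  assumes \<phi>: "\<phi> \<in> carrier (dual M)" and B: "generates M B" and m: "m \<in> carrier M"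
  shows "coseq M \<phi> m \<in> tsp.span (coseq M \<phi> ` B)"
proof -
  let ?T = "{m. coseq M \<phi> m \<in> tsp.span (coseq M \<phi> ` B)}"
  have "lin_closed M ?T"
    unfolding lin_closed_def
    using \<phi> by (auto simp: coseq_zero coseq_add coseq_smult tsp.span_zero tsp.span_add tsp.span_scale)
  moreover have "B \<subseteq> ?T" by (auto intro: tsp.span_base)
  ultimately have "carrier M \<subseteq> ?T" using B unfolding generates_def by blast
  with m show ?thesis by blast
qed

text \<open>The shifts are the sequences of the iterated derivatives of m, and all of these lie in
  the span of the sequences of finitely many generators.\<close>

lemma coseq_dlin:
  assumes \<phi>: "\<phi> \<in> carrier (dual M)" and m: "m \<in> carrier M"
  shows "coseq M \<phi> m \<in> dlin"
proof -
  obtain B where B: "generates M B" using has_generators by blast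
  have "(seq_shift ^^ k) (coseq M \<phi> m) \<in> tsp.span (coseq M \<phi> ` B)" for k
    using coseq_tspan[OF \<phi> B, of "(differential M ^^ k) m"] m by (simp add: coseq_diff_pow)
  moreover have "finite (coseq M \<phi> ` B)" using B by (simp add: generates_def)
  ultimately show ?thesis unfolding dlin_iff finite_rank_def by blast
qed

text \<open>The k-th derivative of m is expanded in the dual basis. Whichever basis is used, the
  comultiplication of the finite dual therefore evaluates to shifts.\<close>

lemma coseq_dual_basis:
  assumes \<phi>: "\<phi> \<in> carrier (dual M)" and m: "m \<in> carrier M" and e: "is_dual_basis M d e e'"
  shows "(\<Sum>i<d. coseq M \<phi> (e i) \<star> seq_target (coseq M (e' i) m k)) = (seq_shift ^^ k) (coseq M \<phi> m)"
proof -
  let ?m = "(differential M ^^ k) m"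
  have "(seq_shift ^^ k) (coseq M \<phi> m) = coseq M \<phi> (\<Oplus>\<^bsub>M\<^esub>i\<in>{..<d}. e' i ?m \<odot>\<^bsub>M\<^esub> e i)"
    using e m diff_pow_closed[OF m, of k] by (simp add: coseq_diff_pow[symmetric] is_dual_basis_def)
  moreover have "coseq M \<phi> (\<Oplus>\<^bsub>M\<^esub>i\<in>I. c i \<odot>\<^bsub>M\<^esub> e i) = (\<Sum>i\<in>I. coseq M \<phi> (e i) \<star> seq_target (c i))"
    if "finite I" "I \<subseteq> {..<d}" for I c
    using that
  proof (induction I)
    case empty
    then show ?case by (simp add: coseq_zero[OF \<phi>])
  next
    case (insert i I)
    have ec: "e j \<in> carrier M" if "j < d" for j using e that by (simp add: is_dual_basis_def)
    have cl: "(\<lambda>j. c j \<odot>\<^bsub>M\<^esub> e j) \<in> I \<rightarrow> carrier M" using insert.prems ec by auto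
    then have "(\<Oplus>\<^bsub>M\<^esub>j\<in>insert i I. c j \<odot>\<^bsub>M\<^esub> e j) = c i \<odot>\<^bsub>M\<^esub> e i \<oplus>\<^bsub>M\<^esub> (\<Oplus>\<^bsub>M\<^esub>j\<in>I. c j \<odot>\<^bsub>M\<^esub> e j)"
      using insert ec by (intro Mod.finsum_insert) auto
    then show ?case
      using insert ec Mod.finsum_closed[OF cl] by (simp add: coseq_add[OF \<phi>] coseq_smult[OF \<phi>])
  qed
  ultimately show ?thesis by (simp add: coseq_def)
qed

end

lemma diff_homsD:
  assumes "f \<in> diff_homs M N" and m: "m \<in> carrier M"
  shows "f m \<in> carrier N" "f (differential M m) = differential N (f m)"
    and "n \<in> carrier M \<Longrightarrow> f (m \<oplus>\<^bsub>M\<^esub> n) = f m \<oplus>\<^bsub>N\<^esub> f n" "f (x \<odot>\<^bsub>M\<^esub> m) = x \<odot>\<^bsub>N\<^esub> f m"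
  using assms by (auto simp: diff_homs_def linear_maps_iff)

text \<open>A map commuting with the differentials may act on the vector or, by pull-back, on the
  form, with the same sequence; this is why the relations between different spaces are
  respected.\<close>

lemma coseq_transport:
  assumes M: "fd_diff_space M" and f: "f \<in> diff_homs M N" and m: "m \<in> carrier M"
  shows "coseq M (compose (carrier M) \<psi> f) m = coseq N \<psi> (f m)"
proof -
  interpret fd_space M by unfold_locales (rule M)
  have "f ((differential M ^^ n) m) = (differential N ^^ n) (f m)" for n
    using m by (induction n) (auto simp: diff_homsD[OF f])
  then show ?thesis using m by (simp add: coseq_def compose_def)
qed

lemma compose_dual:
  assumes M: "fd_diff_space M" and N: "fd_diff_space N" and f: "f \<in> diff_homs M N"
    and \<psi>: "\<psi> \<in> carrier (dual N)"
  shows "compose (carrier M) \<psi> f \<in> carrier (dual M)"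
proof -
  interpret M: fd_space M by unfold_locales (rule M)
  interpret N: fd_space N by unfold_locales (rule N)
  show ?thesis
    by (rule M.dualI) (auto simp: compose_def diff_homsD[OF f] N.dualD[OF \<psi>])
qed

section \<open>Shift-stable spaces of sequences\<close>

section \<open>Spaces of sequences as differential spaces\<close>

text \<open>With scalars acting through t, the product rule of the shift is exactly the rule
  required of a differential.\<close>

definition seq_space :: "(nat \<Rightarrow> 'k) set \<Rightarrow> ('k::differential_field, nat \<Rightarrow> 'k) diff_space" where
  "seq_space W = \<lparr>carrier = W, monoid.mult = undefined, one = undefined, ring.zero = 0, add = (+),
     smult = (\<lambda>x \<alpha>. \<alpha> \<star> seq_target x), differential = seq_shift\<rparr>"

lemma seq_space_simps [simp]:
  "carrier (seq_space W) = W" "ring.zero (seq_space W) = 0" "add (seq_space W) = (+)"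
  "smult (seq_space W) x \<alpha> = \<alpha> \<star> seq_target x" "differential (seq_space W) = seq_shift"
  by (simp_all add: seq_space_def)

definition stable :: "(nat \<Rightarrow> 'k::differential_field) set \<Rightarrow> bool" where
  "stable B \<longleftrightarrow> finite B \<and> (\<forall>b\<in>B. seq_shift b \<in> tsp.span B)"

text \<open>Evaluation at 0 and a member \<alpha> of a shift-stable space have \<alpha> as their
  attached sequence, so these generators serve as normal forms.\<close>

definition seq_gen :: "(nat \<Rightarrow> 'k) set \<Rightarrow> (nat \<Rightarrow> 'k) \<Rightarrow> 'k::differential_field udeg_gen" where
  "seq_gen B \<alpha> = (seq_space (tsp.span B), (\<lambda>\<alpha>\<in>tsp.span B. \<alpha> 0), \<alpha>)"

lemma fd_seq_space:
  assumes "stable B"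
  shows "fd_diff_space (seq_space (tsp.span B))"
proof -
  let ?W = "seq_space (tsp.span B)"
  have ag: "abelian_group ?W"
  proof (rule abelian_groupI)
    fix \<alpha> assume "\<alpha> \<in> carrier ?W"
    then show "\<exists>y\<in>carrier ?W. y \<oplus>\<^bsub>?W\<^esub> \<alpha> = \<zero>\<^bsub>?W\<^esub>"
      by (intro bexI[of _ "- \<alpha>"]) (auto intro: tsp.span_neg)
  qed (auto simp: tsp.span_add tsp.span_zero)
  have m: "module \<bbbK> ?W"
    by (rule moduleI[OF cring_base_ring ag])
      (auto simp: tsp.span_scale seq_target_add hurwitz_add_right hurwitz_add_left seq_target_mult hurwitz_ac)
  have "generates ?W B"
    unfolding generates_def
  proof (intro conjI allI impI subsetI)
    fix T \<alpha> assume T: "lin_closed ?W T" "B \<subseteq> T" and \<alpha>: "\<alpha> \<in> carrier ?W"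
    have "\<alpha> \<in> tsp.span B" using \<alpha> by simp
    then have "\<alpha> \<in> tsp.span B \<and> \<alpha> \<in> T"
    proof (rule tsp.span_induct)
      show "tsp.subspace {\<alpha>. \<alpha> \<in> tsp.span B \<and> \<alpha> \<in> T}"
        using T(1) by (intro tsp.subspaceI) (auto simp: lin_closed_def tsp.span_zero tsp.span_add tsp.span_scale)
    qed (use T(2) in \<open>auto intro: tsp.span_base\<close>)
    then show "\<alpha> \<in> T" by simp
  qed (use assms in \<open>auto simp: stable_def intro: tsp.span_base\<close>)
  then have "finite_dimensional ?W" using finite_dimensional_iff[OF m] by blast
  moreover have "seq_shift \<alpha> \<in> tsp.span B" if "\<alpha> \<in> tsp.span B" for \<alpha>
    by (rule shift_tspan[OF that]) (use assms in \<open>simp add: stable_def\<close>)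
  ultimately show ?thesis
    using m by (auto simp: fd_diff_space_def hom_def hurwitz_shift seq_target_shift)
qed

lemma seq_space_ev: "stable B \<Longrightarrow> (\<lambda>\<alpha>\<in>tsp.span B. \<alpha> 0) \<in> carrier (dual (seq_space (tsp.span B)))"
  using fd_space.dualI[of "seq_space (tsp.span B)" "\<lambda>\<alpha>\<in>tsp.span B. \<alpha> 0"]
  by (simp add: fd_space_def fd_seq_space tsp.span_add tsp.span_scale fun_apply hurwitz_0 mult.commute)

lemma stable_union: "stable B \<Longrightarrow> stable C \<Longrightarrow> stable (B \<union> C)"
  unfolding stable_def
  by (auto intro: subsetD[OF tsp.span_mono[of B "B \<union> C"]] subsetD[OF tsp.span_mono[of C "B \<union> C"]])

section \<open>The finite dual embedded into sequences\<close>

section \<open>The finite dual\<close>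

definition gen_seq :: "'k::differential_field udeg_gen \<Rightarrow> nat \<Rightarrow> 'k" where
  "gen_seq = (\<lambda>(M, \<phi>, m). coseq M \<phi> m)"

definition udeg_seq :: "'k::differential_field udeg \<Rightarrow> nat \<Rightarrow> 'k" where
  "udeg_seq X = fsum gen_seq (rep X)"

lemma udeg_gens_iff: "(M, \<phi>, m) \<in> udeg_gens \<longleftrightarrow> fd_diff_space M \<and> \<phi> \<in> carrier (dual M) \<and> m \<in> carrier M"
  by (simp add: udeg_gens_def diff_universe_def)

lemma udeg_relations_cases [consumes 1, case_names form vector hom]:
  assumes "r \<in> udeg_relations"
  obtains M \<phi> \<phi>' m where "fd_diff_space M" "\<phi> \<in> carrier (dual M)" "\<phi>' \<in> carrier (dual M)" "m \<in> carrier M"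
      "r = frag_of (M, \<phi> \<oplus>\<^bsub>dual M\<^esub> \<phi>', m) - frag_of (M, \<phi>, m) - frag_of (M, \<phi>', m)"
  | M \<phi> m m' where "fd_diff_space M" "\<phi> \<in> carrier (dual M)" "m \<in> carrier M" "m' \<in> carrier M"
      "r = frag_of (M, \<phi>, m \<oplus>\<^bsub>M\<^esub> m') - frag_of (M, \<phi>, m) - frag_of (M, \<phi>, m')"
  | M N \<psi> f m where "fd_diff_space M" "fd_diff_space N" "\<psi> \<in> carrier (dual N)" "m \<in> carrier M"
      "f \<in> diff_homs M N" "r = frag_of (N, \<psi>, f m) - frag_of (M, compose (carrier M) \<psi> f, m)"
  using assms unfolding udeg_relations_def diff_universe_def by blast

interpretation U: presentation udeg_gens udeg_relations
proof
  fix r :: "'a udeg_gen \<Rightarrow>\<^sub>0 int" assume "r \<in> udeg_relations"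
  then show "Poly_Mapping.keys r \<subseteq> udeg_gens"
  proof (cases rule: udeg_relations_cases)
    case (form M \<phi> \<phi>' m)
    then interpret fd_space M by unfold_locales
    show ?thesis
      unfolding form(5) using form(1-4)
      by (intro keys_subset_intros) (simp_all add: udeg_gens_iff dual_add_closed)
  next
    case (vector M \<phi> m m')
    then interpret fd_space M by unfold_locales
    show ?thesis
      unfolding vector(5) using vector(1-4) by (intro keys_subset_intros) (simp_all add: udeg_gens_iff)
  next
    case (hom M N \<psi> f m)
    then show ?thesis
      unfolding hom(6) by (intro keys_subset_intros) (simp_all add: udeg_gens_iff compose_dual diff_homsD)
  qed
qed

lemma U_rel_vector:
  "\<lbrakk>fd_diff_space M; \<phi> \<in> carrier (dual M); m \<in> carrier M; m' \<in> carrier M\<rbrakk> \<Longrightarrow>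
    frag_of (M, \<phi>, m \<oplus>\<^bsub>M\<^esub> m') - frag_of (M, \<phi>, m) - frag_of (M, \<phi>, m') \<in> U.Rel"
  by (rule U.Rel_relator, unfold udeg_relations_def diff_universe_def, rule UnI1, rule UnI2) blast

lemma U_rel_hom:
  "\<lbrakk>fd_diff_space M; fd_diff_space N; \<psi> \<in> carrier (dual N); m \<in> carrier M; f \<in> diff_homs M N\<rbrakk> \<Longrightarrow>
    frag_of (N, \<psi>, f m) - frag_of (M, compose (carrier M) \<psi> f, m) \<in> U.Rel"
  by (rule U.Rel_relator, unfold udeg_relations_def diff_universe_def, rule UnI2) blast

lemma gen_seq_relator:
  assumes "r \<in> udeg_relations"
  shows "fsum gen_seq r = 0"
  using assms
proof (cases rule: udeg_relations_cases)
  case (form M \<phi> \<phi>' m)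
  then interpret fd_space M by unfold_locales
  show ?thesis using form by (simp add: fsum_diff gen_seq_def coseq_dual_add)
next
  case (vector M \<phi> m m')
  then interpret fd_space M by unfold_locales
  show ?thesis using vector by (simp add: fsum_diff gen_seq_def coseq_add)
next
  case (hom M N \<psi> f m)
  then show ?thesis by (simp add: fsum_diff gen_seq_def coseq_transport)
qed

text \<open>The inclusion of the smaller space commutes with the shift, and evaluation at 0 on the
  larger space restricts to evaluation at 0.\<close>

lemma seq_gen_mono:
  assumes B: "stable B" and C: "stable C" and BC: "B \<subseteq> C" and \<alpha>: "\<alpha> \<in> tsp.span B"
  shows "frag_of (seq_gen C \<alpha>) - frag_of (seq_gen B \<alpha>) \<in> U.Rel"
proof -
  have sub: "tsp.span B \<subseteq> tsp.span C" using BC by (rule tsp.span_mono)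
  then have "(\<lambda>\<alpha>. \<alpha>) \<in> diff_homs (seq_space (tsp.span B)) (seq_space (tsp.span C))"
    by (auto simp: diff_homs_def linear_maps_iff)
  from U_rel_hom[OF fd_seq_space[OF B] fd_seq_space[OF C] seq_space_ev[OF C] _ this, of \<alpha>] \<alpha>
  have "frag_of (seq_gen C \<alpha>) - frag_of (seq_space (tsp.span B), compose (tsp.span B) (\<lambda>\<alpha>\<in>tsp.span C. \<alpha> 0) (\<lambda>\<alpha>. \<alpha>), \<alpha>)
      \<in> U.Rel" by (simp add: seq_gen_def)
  moreover have "compose (tsp.span B) (\<lambda>\<alpha>\<in>tsp.span C. \<alpha> 0) (\<lambda>\<alpha>. \<alpha>) = (\<lambda>\<alpha>\<in>tsp.span B. \<alpha> 0)"
    using sub by (auto simp: compose_def restrict_def fun_eq_iff)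
  ultimately show ?thesis by (simp add: seq_gen_def)
qed

lemma seq_gen_add:
  assumes "stable B" "\<alpha> \<in> tsp.span B" "\<beta> \<in> tsp.span B"
  shows "frag_of (seq_gen B (\<alpha> + \<beta>)) - frag_of (seq_gen B \<alpha>) - frag_of (seq_gen B \<beta>) \<in> U.Rel"
  using U_rel_vector[OF fd_seq_space[OF assms(1)] seq_space_ev[OF assms(1)], of \<alpha> \<beta>] assms(2,3)
  by (simp add: seq_gen_def)

lemma seq_gen_zero: "stable B \<Longrightarrow> frag_of (seq_gen B 0) \<in> U.Rel"
  using U.Rel_minus[OF seq_gen_add[of B 0 0]] by (simp add: tsp.span_zero)

text \<open>
  Pushing \<open>\<phi> \<otimes> m\<close> forward along \<open>coseq\<close> turns every generator into the evaluation at \<open>0\<close> on a space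
  of sequences; adding up such spaces makes a single generator out of an arbitrary element.
\<close>

lemma gen_normal_form:
  assumes "(M, \<phi>, m) \<in> udeg_gens"
  shows "\<exists>B. stable B \<and> coseq M \<phi> m \<in> tsp.span B \<and>
    frag_of (M, \<phi>, m) - frag_of (seq_gen B (coseq M \<phi> m)) \<in> U.Rel"
proof -
  have M: "fd_diff_space M" and \<phi>: "\<phi> \<in> carrier (dual M)" and m: "m \<in> carrier M"
    using assms by (auto simp: udeg_gens_iff)
  interpret fd_space M by unfold_locales (rule M)
  obtain B0 where B0: "generates M B0" using has_generators by blast
  let ?B = "coseq M \<phi> ` B0"
  have span: "coseq M \<phi> n \<in> tsp.span ?B" if "n \<in> carrier M" for n
    by (rule coseq_tspan[OF \<phi> B0 that])
  have B: "stable ?B"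
    unfolding stable_def
  proof (intro conjI ballI)
    show "finite ?B" using B0 by (simp add: generates_def)
    fix b assume "b \<in> ?B"
    then obtain n where "n \<in> carrier M" "b = coseq M \<phi> n" using B0 by (auto simp: generates_def)
    then show "seq_shift b \<in> tsp.span ?B"
      using span[of "differential M n"] by (simp add: coseq_diff)
  qed
  have f: "coseq M \<phi> \<in> diff_homs M (seq_space (tsp.span ?B))"
    by (auto simp: diff_homs_def linear_maps_iff span coseq_add[OF \<phi>] coseq_smult[OF \<phi>] coseq_diff)
  have "compose (carrier M) (\<lambda>\<alpha>\<in>tsp.span ?B. \<alpha> 0) (coseq M \<phi>) = \<phi>"
  proof (rule dual_eqI[OF _ \<phi>])
    show "compose (carrier M) (\<lambda>\<alpha>\<in>tsp.span ?B. \<alpha> 0) (coseq M \<phi>) \<in> carrier (dual M)"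
      by (rule compose_dual[OF M fd_seq_space[OF B] f seq_space_ev[OF B]])
  qed (simp add: compose_def span coseq_at_0)
  then have "frag_of (seq_gen ?B (coseq M \<phi> m)) - frag_of (M, \<phi>, m) \<in> U.Rel"
    using U_rel_hom[OF M fd_seq_space[OF B] seq_space_ev[OF B] m f] by (simp add: seq_gen_def)
  from U.Rel_minus[OF this] B span[OF m] show ?thesis by (intro exI[of _ ?B]) simp
qed

lemma udeg_normal_form:
  fixes u :: "'k::differential_field udeg_gen \<Rightarrow>\<^sub>0 int"
  assumes "Poly_Mapping.keys u \<subseteq> udeg_gens"
  shows "\<exists>B. stable B \<and> fsum gen_seq u \<in> tsp.span B \<and> u - frag_of (seq_gen B (fsum gen_seq u)) \<in> U.Rel"
  using assms
proof (induction u rule: frag_induction)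
  case zero
  have "stable ({} :: (nat \<Rightarrow> 'k) set)" by (simp add: stable_def)
  then show ?case
    using U.Rel_minus[OF seq_gen_zero] by (intro exI[of _ "{}"]) simp
next
  case (one x)
  then show ?case using gen_normal_form by (cases x) (auto simp: gen_seq_def)
next
  case (diff u v)
  then obtain B C where B: "stable B" "fsum gen_seq u \<in> tsp.span B" "u - frag_of (seq_gen B (fsum gen_seq u)) \<in> U.Rel"
    and C: "stable C" "fsum gen_seq v \<in> tsp.span C" "v - frag_of (seq_gen C (fsum gen_seq v)) \<in> U.Rel"
    by blast
  let ?D = "B \<union> C" and ?a = "fsum gen_seq u" and ?b = "fsum gen_seq v"
  have D: "stable ?D" by (rule stable_union[OF B(1) C(1)])
  have a: "?a \<in> tsp.span ?D" and b: "?b \<in> tsp.span ?D"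
    using B(2) C(2) tsp.span_mono[of B ?D] tsp.span_mono[of C ?D] by auto
  have ab: "?a - ?b \<in> tsp.span ?D" by (rule tsp.span_diff[OF a b])
  have r1: "frag_of (seq_gen ?D ?a) - frag_of (seq_gen B ?a) \<in> U.Rel"
    by (rule seq_gen_mono[OF B(1) D _ B(2)]) simp
  have r2: "frag_of (seq_gen ?D ?b) - frag_of (seq_gen C ?b) \<in> U.Rel"
    by (rule seq_gen_mono[OF C(1) D _ C(2)]) simp
  \<comment> \<open>The relations express sums, so the difference is obtained from the decomposition
    of \<open>?a\<close> as \<open>?a - ?b + ?b\<close>.\<close>
  have r3: "frag_of (seq_gen ?D (?a - ?b + ?b)) - frag_of (seq_gen ?D (?a - ?b)) - frag_of (seq_gen ?D ?b) \<in> U.Rel"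
    by (rule seq_gen_add[OF D ab b])
  from U.Rel_add[OF U.Rel_add[OF U.Rel_diff[OF B(3) C(3)] U.Rel_diff[OF r2 r1]] r3]
  have "u - v - frag_of (seq_gen ?D (?a - ?b)) \<in> U.Rel"
    by (simp add: algebra_simps)
  with D ab show ?case by (intro exI[of _ ?D]) (simp add: fsum_diff)
qed

lemma udeg_separation:
  assumes "Poly_Mapping.keys u \<subseteq> udeg_gens" "fsum gen_seq u = 0"
  shows "u \<in> U.Rel"
proof -
  obtain B where B: "stable B" "u - frag_of (seq_gen B (fsum gen_seq u)) \<in> U.Rel"
    using udeg_normal_form[OF assms(1)] by blast
  from U.Rel_add[OF B(2) seq_gen_zero[OF B(1)]] show ?thesis by (simp add: assms(2))
qed

lemma udeg_class_cls: "udeg_class = U.cls" "udeg_group = U.Grp"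
  by (simp_all add: fun_eq_iff udeg_class_def udeg_group_def)

lemma udeg_seq_class: "udeg_seq (udeg_class u) = fsum gen_seq u"
  unfolding udeg_seq_def udeg_class_cls by (rule U.fsum_rep_cls) (rule gen_seq_relator)

lemma udeg_class_closed: "Poly_Mapping.keys u \<subseteq> udeg_gens \<Longrightarrow> udeg_class u \<in> carrier udeg_group"
  unfolding udeg_class_cls by (rule U.cls_in_carrier)

lemma udeg_rep_keys: "X \<in> carrier udeg_group \<Longrightarrow> Poly_Mapping.keys (rep X) \<subseteq> udeg_gens"
  unfolding udeg_class_cls by (rule U.rep_keys)

lemma udeg_class_rep: "X \<in> carrier udeg_group \<Longrightarrow> udeg_class (rep X) = X"
  unfolding udeg_class_cls by (rule U.cls_rep)

lemma udeg_seq_inj: "inj_on udeg_seq (carrier udeg_group)"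
proof (rule inj_onI)
  fix X Y :: "'a udeg" assume X: "X \<in> carrier udeg_group" and Y: "Y \<in> carrier udeg_group"
    and eq: "udeg_seq X = udeg_seq Y"
  have "rep X - rep Y \<in> U.Rel"
    by (rule udeg_separation[OF keys_diff_subset[OF udeg_rep_keys[OF X] udeg_rep_keys[OF Y]]])
      (use eq in \<open>simp add: fsum_diff udeg_seq_def\<close>)
  then have "udeg_class (rep X) = udeg_class (rep Y)"
    unfolding udeg_class_cls U.cls_eq_iff .
  then show "X = Y" by (simp add: udeg_class_rep X Y)
qed

lemma gen_seq_dlin: "g \<in> udeg_gens \<Longrightarrow> gen_seq g \<in> dlin"
  by (cases g) (auto simp: udeg_gens_iff gen_seq_def fd_space.coseq_dlin fd_space_def)

lemma of_int_dlin: "\<alpha> \<in> dlin \<Longrightarrow> of_int c * \<alpha> \<in> dlin"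
  using dlin_mult[OF dlin_source, of \<alpha> "of_int c"]
  by (simp add: seq_source_mult times_fun_def of_int_fun_apply)

lemma dlin_sum: "(\<And>i. i \<in> I \<Longrightarrow> f i \<in> dlin) \<Longrightarrow> (\<Sum>i\<in>I. f i) \<in> dlin"
  by (induction I rule: infinite_finite_induct) (auto simp: dlin_0 dlin_add)

lemma udeg_seq_dlin: "X \<in> carrier udeg_group \<Longrightarrow> udeg_seq X \<in> dlin"
  unfolding udeg_seq_def fsum_def
  by (intro dlin_sum of_int_dlin gen_seq_dlin) (use udeg_rep_keys in blast)

text \<open>The first \<open>degree P\<close> shifts of a solution of \<open>P\<close> span a
  shift-stable space, and there the normal form generator at \<alpha> has sequence \<alpha>.\<close>

lemma udeg_seq_surj:
  assumes "\<alpha> \<in> dlin"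
  shows "\<exists>X\<in>carrier udeg_group. udeg_seq X = \<alpha>"
proof -
  obtain P where P: "P \<noteq> 0" "\<alpha> \<in> solutions P" using assms by (auto simp: dlin_solution)
  let ?B = "(\<lambda>i. (seq_shift ^^ i) \<alpha>) ` {..<degree P}"
  have span: "(seq_shift ^^ m) \<alpha> \<in> tsp.span ?B" for m
    by (subst solution_expansion[OF P, of m, symmetric], rule tspan_lincomb) simp
  have B: "stable ?B"
    unfolding stable_def using span[of "Suc _"] by auto
  have k: "Poly_Mapping.keys (frag_of (seq_gen ?B \<alpha>)) \<subseteq> udeg_gens"
    using span[of 0] by (intro keys_frag_of_subset)
      (simp add: seq_gen_def udeg_gens_iff fd_seq_space[OF B] seq_space_ev[OF B])
  have "gen_seq (seq_gen ?B \<alpha>) = \<alpha>"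
    using span by (auto simp: gen_seq_def seq_gen_def coseq_def seq_shift_funpow)
  then have "udeg_seq (udeg_class (frag_of (seq_gen ?B \<alpha>))) = \<alpha>"
    by (simp add: udeg_seq_class)
  with udeg_class_closed[OF k] show ?thesis by blast
qed

text \<open>Coordinates in a dual basis, padded by zeros, carry all structure over to a set of
  sequences. This is the witness for the choice in \<open>udeg_gen\<close>.\<close>

lemma (in fd_space) isomorphic_sequence_space:
  "\<exists>N :: ('k, nat \<Rightarrow> 'k) diff_space. \<exists>\<theta>. fd_diff_space N \<and> \<theta> \<in> diff_isos N M"
proof -
  obtain d e e' where e: "is_dual_basis M d e e'" using has_dual_basis by blast
  define \<iota> where "\<iota> m = (\<lambda>i. if i < d then e' i m else 0)" for m
  define \<kappa> where "\<kappa> = inv_into (carrier M) \<iota>"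
  have inj: "inj_on \<iota> (carrier M)"
  proof (rule inj_onI)
    fix m n assume m: "m \<in> carrier M" and n: "n \<in> carrier M" and eq: "\<iota> m = \<iota> n"
    have ee: "e' i m = e' i n" if "i < d" for i
      using fun_cong[OF eq, of i] that by (simp add: \<iota>_def)
    have "m = (\<Oplus>\<^bsub>M\<^esub>i\<in>{..<d}. e' i m \<odot>\<^bsub>M\<^esub> e i)" using e m by (simp add: is_dual_basis_def)
    also have "\<dots> = (\<Oplus>\<^bsub>M\<^esub>i\<in>{..<d}. e' i n \<odot>\<^bsub>M\<^esub> e i)"
      by (rule Mod.finsum_cong') (use e ee in \<open>auto simp: is_dual_basis_def\<close>)
    also have "\<dots> = n" using e n by (simp add: is_dual_basis_def)
    finally show "m = n" .
  qed
  have \<kappa>: "\<kappa> (\<iota> m) = m" if "m \<in> carrier M" for m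
    using that inj by (simp add: \<kappa>_def)
  define N :: "('k, nat \<Rightarrow> 'k) diff_space" where
    "N = \<lparr>carrier = \<iota> ` carrier M, monoid.mult = undefined, one = undefined, ring.zero = \<iota> \<zero>\<^bsub>M\<^esub>,
      add = (\<lambda>a b. \<iota> (\<kappa> a \<oplus>\<^bsub>M\<^esub> \<kappa> b)), smult = (\<lambda>x a. \<iota> (x \<odot>\<^bsub>M\<^esub> \<kappa> a)), differential = (\<lambda>a. \<iota> (differential M (\<kappa> a)))\<rparr>"
  have sel: "carrier N = \<iota> ` carrier M" "\<zero>\<^bsub>N\<^esub> = \<iota> \<zero>\<^bsub>M\<^esub>"
    "a \<oplus>\<^bsub>N\<^esub> b = \<iota> (\<kappa> a \<oplus>\<^bsub>M\<^esub> \<kappa> b)" "x \<odot>\<^bsub>N\<^esub> a = \<iota> (x \<odot>\<^bsub>M\<^esub> \<kappa> a)" "differential N a = \<iota> (differential M (\<kappa> a))"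
    for a b x by (simp_all add: N_def)
  have ag: "abelian_group N"
  proof (rule abelian_groupI)
    fix a assume "a \<in> carrier N"
    then obtain m where "m \<in> carrier M" "a = \<iota> m" by (auto simp: sel)
    then show "\<exists>b\<in>carrier N. b \<oplus>\<^bsub>N\<^esub> a = \<zero>\<^bsub>N\<^esub>"
      by (intro bexI[of _ "\<iota> (\<ominus>\<^bsub>M\<^esub> m)"]) (auto simp: sel \<kappa> Mod.l_neg)
  qed (auto simp: sel \<kappa> Mod.a_ac)
  have m: "module \<bbbK> N"
    by (rule moduleI[OF cring_base_ring ag])
      (auto simp: sel \<kappa> add_smult smult_smult smult_add one_smult)
  obtain B where B: "generates M B" using has_generators by blast
  have "generates N (\<iota> ` B)"
    unfolding generates_def
  proof (intro conjI allI impI subsetI)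
    fix T a assume T: "lin_closed N T" "\<iota> ` B \<subseteq> T" and a: "a \<in> carrier N"
    have "lin_closed M {m. \<iota> m \<in> T}"
      using T(1) by (auto simp: lin_closed_def sel \<kappa>)
    moreover have "B \<subseteq> {m. \<iota> m \<in> T}" using T(2) by auto
    ultimately have "carrier M \<subseteq> {m. \<iota> m \<in> T}" using B unfolding generates_def by blast
    with a show "a \<in> T" by (auto simp: sel)
  qed (use B in \<open>auto simp: generates_def sel\<close>)
  then have "finite_dimensional N" using finite_dimensional_iff[OF m] by blast
  then have "fd_diff_space N"
    using m by (auto simp: fd_diff_space_def hom_def sel \<kappa> diff_add diff_smult)
  moreover have "\<kappa> \<in> diff_isos N M"
    by (auto simp: diff_isos_def diff_homs_def linear_maps_iff sel \<kappa> \<kappa>_def[symmetric]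
        intro!: bij_betwI[where g = \<iota>])
  ultimately show ?thesis by blast
qed

text \<open>Whatever space the choice returns, its isomorphism onto \<open>M\<close> preserves the
  attached sequence, so later computations do not see the choice.\<close>

lemma udeg_gen:
  fixes M :: "('k::differential_field, 'a) diff_space"
  assumes M: "fd_diff_space M" and \<phi>: "\<phi> \<in> carrier (dual M)" and m: "m \<in> carrier M"
  shows "udeg_gen M \<phi> m \<in> udeg_gens" "gen_seq (udeg_gen M \<phi> m) = coseq M \<phi> m"
proof -
  let ?P = "\<lambda>(N, \<psi>, n). N \<in> diff_universe \<and> n \<in> carrier N \<and>
     (\<exists>\<theta>\<in>diff_isos N M. \<psi> = compose (carrier N) \<phi> \<theta> \<and> \<theta> n = m)"
  obtain N :: "('k, nat \<Rightarrow> 'k) diff_space" and \<theta> where N: "fd_diff_space N" "\<theta> \<in> diff_isos N M"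
    using fd_space.isomorphic_sequence_space[of M] M by (auto simp: fd_space_def)
  then have "m \<in> \<theta> ` carrier N"
    using m by (simp add: diff_isos_def bij_betw_def)
  then obtain n where "n \<in> carrier N" "\<theta> n = m" by auto
  with N have "?P (N, compose (carrier N) \<phi> \<theta>, n)" by (auto simp: diff_universe_def)
  then have P: "?P (udeg_gen M \<phi> m)" unfolding udeg_gen_def by (rule someI)
  obtain N' \<psi>' n' where g: "udeg_gen M \<phi> m = (N', \<psi>', n')" by (cases "udeg_gen M \<phi> m")
  then obtain \<theta>' where N': "fd_diff_space N'" "n' \<in> carrier N'" "\<theta>' \<in> diff_isos N' M"
    "\<psi>' = compose (carrier N') \<phi> \<theta>'" "\<theta>' n' = m"
    using P by (auto simp: diff_universe_def)
  have \<theta>': "\<theta>' \<in> diff_homs N' M" using N'(3) by (simp add: diff_isos_def)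
  show "udeg_gen M \<phi> m \<in> udeg_gens"
    using N' compose_dual[OF N'(1) M \<theta>' \<phi>] by (simp add: g udeg_gens_iff)
  show "gen_seq (udeg_gen M \<phi> m) = coseq M \<phi> m"
    using coseq_transport[OF N'(1) \<theta>' N'(2), of \<phi>] N' by (simp add: g gen_seq_def)
qed

lemma diff_unit_simps [simp]:
  "carrier diff_unit = UNIV" "ring.zero diff_unit = 0" "x \<oplus>\<^bsub>diff_unit\<^esub> y = x + y"
  "x \<odot>\<^bsub>diff_unit\<^esub> y = x * y" "differential diff_unit = \<partial>"
  by (simp_all add: diff_unit_def base_module_def module.defs diff_space.defs)

lemma fd_diff_unit: "fd_diff_space (diff_unit :: ('k::differential_field, 'k) diff_space)"
proof -
  let ?M = "diff_unit :: ('k, 'k) diff_space"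
  have ag: "abelian_group ?M"
    by (rule abelian_groupI) (auto simp: algebra_simps intro!: exI[of _ "- _"])
  have m: "module \<bbbK> ?M"
    by (rule moduleI[OF cring_base_ring ag]) (auto simp: algebra_simps)
  have "generates ?M {1}"
    unfolding generates_def
  proof (intro conjI allI impI subsetI)
    fix T and x :: 'k assume "lin_closed ?M T" "{1} \<subseteq> T"
    then have "\<forall>x a. a \<in> T \<longrightarrow> x * a \<in> T" "1 \<in> T" by (auto simp: lin_closed_def)
    then have "x * 1 \<in> T" by blast
    then show "x \<in> T" by simp
  qed auto
  then have "finite_dimensional ?M" using finite_dimensional_iff[OF m] by blast
  with m show ?thesis
    by (auto simp: fd_diff_space_def hom_def derivation_add derivation_mult algebra_simps)
qed

lemma udeg_source: "udeg_source x \<in> carrier udeg_group" "udeg_seq (udeg_source x) = seq_source x"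
proof -
  have d: "(\<lambda>y. x * y) \<in> carrier (dual diff_unit)"
    by (auto simp: dual_simps linear_maps_iff algebra_simps)
  note g = udeg_gen[OF fd_diff_unit d, of 1]
  show "udeg_source x \<in> carrier udeg_group"
    unfolding udeg_source_def by (rule udeg_class_closed, rule keys_frag_of_subset) (simp add: g)
  have "coseq diff_unit (\<lambda>y. x * y) 1 n = seq_source x n" for n
    by (cases n) (simp_all add: coseq_def seq_source_def funpow_Suc_right del: funpow.simps)
  then show "udeg_seq (udeg_source x) = seq_source x"
    unfolding udeg_source_def udeg_seq_class by (simp add: g fun_eq_iff)
qed

lemma udeg_target: "udeg_target x \<in> carrier udeg_group" "udeg_seq (udeg_target x) = seq_target x"
proof -
  have d: "(\<lambda>y. y) \<in> carrier (dual diff_unit)"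
    by (auto simp: dual_simps linear_maps_iff)
  note g = udeg_gen[OF fd_diff_unit d, of x]
  show "udeg_target x \<in> carrier udeg_group"
    unfolding udeg_target_def by (rule udeg_class_closed, rule keys_frag_of_subset) (simp add: g)
  show "udeg_seq (udeg_target x) = seq_target x"
    unfolding udeg_target_def udeg_seq_class by (simp add: g coseq_def seq_target_def)
qed

lemma diff_dual_simps:
  "carrier (diff_dual M) = carrier (dual M)" "ring.zero (diff_dual M) = ring.zero (dual M)"
  "add (diff_dual M) = add (dual M)" "smult (diff_dual M) = smult (dual M)"
  "differential (diff_dual M) = (\<lambda>f. \<lambda>m\<in>carrier M. \<partial> (f m) - f (differential M m))"
  by (simp_all add: diff_dual_def module.defs diff_space.defs)

lemma fd_diff_dual:
  fixes M :: "('k::differential_field, 'a) diff_space"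
  assumes M: "fd_diff_space M"
  shows "fd_diff_space (diff_dual M)"
proof -
  interpret fd_space M by unfold_locales (rule M)
  let ?D = "diff_dual M"
  have m: "module \<bbbK> ?D"
    using dual_module module_cong[of ?D "dual M" \<bbbK>] by (simp add: diff_dual_simps)
  obtain d e e' where e: "is_dual_basis M d e e'" using has_dual_basis by blast
  have e': "e' i \<in> carrier (dual M)" "e i \<in> carrier M" if "i < d" for i
    using e that by (auto simp: is_dual_basis_def)
  have "generates ?D (e' ` {..<d})"
    unfolding generates_def
  proof (intro conjI allI impI subsetI)
    fix T \<phi> assume T: "lin_closed ?D T" "e' ` {..<d} \<subseteq> T" and "\<phi> \<in> carrier ?D"
    then have \<phi>: "\<phi> \<in> carrier (dual M)" by (simp add: diff_dual_simps)
    \<comment> \<open>\<open>lin_closed\<close> adds two vectors at a time, so the expansion of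
      \<phi> in the dual basis is built up through partial sums.\<close>
    have "(\<lambda>m\<in>carrier M. \<Sum>i<k. \<phi> (e i) * e' i m) \<in> T \<inter> carrier (dual M)" if "k \<le> d" for k
      using that
    proof (induction k)
      case 0
      have "(\<lambda>m\<in>carrier M. 0) \<in> T" using T(1) by (simp add: lin_closed_def diff_dual_simps dual_simps)
      moreover have "(\<lambda>m\<in>carrier M. \<Sum>i<0. \<phi> (e i) * e' i m) = (\<lambda>m\<in>carrier M. 0)"
        by (rule restrict_ext) simp
      ultimately show ?case using dual_zero_closed unfolding dual_simps(2) by (simp only: Int_iff)
    next
      case (Suc k)
      let ?f = "\<lambda>m\<in>carrier M. \<Sum>i<k. \<phi> (e i) * e' i m" and ?g = "\<phi> (e k) \<odot>\<^bsub>dual M\<^esub> e' k"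
      have k: "k < d" using Suc.prems by simp
      have g: "?g \<in> T" "?g \<in> carrier (dual M)"
        using T k e'(1)[OF k] dual_smult_closed by (auto simp: lin_closed_def diff_dual_simps)
      have f: "?f \<in> T" "?f \<in> carrier (dual M)"
        using Suc.IH[OF Suc_leD[OF Suc.prems]] by blast+
      have "?f \<oplus>\<^bsub>dual M\<^esub> ?g \<in> T \<inter> carrier (dual M)"
        using T(1) f g dual_add_closed by (simp add: lin_closed_def diff_dual_simps)
      moreover have eq: "?f \<oplus>\<^bsub>dual M\<^esub> ?g = (\<lambda>m\<in>carrier M. \<Sum>i<Suc k. \<phi> (e i) * e' i m)"
        by (auto simp: dual_simps fun_eq_iff)
      ultimately show ?case unfolding eq by blast
    qed
    from this[of d] have "(\<lambda>m\<in>carrier M. \<Sum>i<d. \<phi> (e i) * e' i m) \<in> T"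
      "(\<lambda>m\<in>carrier M. \<Sum>i<d. \<phi> (e i) * e' i m) \<in> carrier (dual M)" by auto
    moreover from this(2) have "(\<lambda>m\<in>carrier M. \<Sum>i<d. \<phi> (e i) * e' i m) = \<phi>"
    proof (rule dual_eqI[OF _ \<phi>])
      fix m assume m: "m \<in> carrier M"
      have "\<phi> m = \<phi> (\<Oplus>\<^bsub>M\<^esub>i\<in>{..<d}. e' i m \<odot>\<^bsub>M\<^esub> e i)" using e m by (simp add: is_dual_basis_def)
      also have "\<dots> = (\<Sum>i<d. e' i m * \<phi> (e i))"
        by (rule linear_form_finsum[OF is_module dualD(4)[OF \<phi>]]) (use e' in auto)
      finally show "(\<lambda>m\<in>carrier M. \<Sum>i<d. \<phi> (e i) * e' i m) m = \<phi> m" using m by (simp add: mult.commute)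
    qed
    ultimately show "\<phi> \<in> T" by simp
  qed (use e' in \<open>auto simp: diff_dual_simps\<close>)
  then have fin: "finite_dimensional ?D" using finite_dimensional_iff[OF m] by blast
  have cl: "differential ?D \<phi> \<in> carrier (dual M)" if \<phi>: "\<phi> \<in> carrier (dual M)" for \<phi>
  proof (rule dualI)
    fix m x assume m: "m \<in> carrier M"
    have "\<phi> (differential M (x \<odot>\<^bsub>M\<^esub> m)) = x * \<phi> (differential M m) + \<partial> x * \<phi> m"
      using m by (simp add: diff_smult dualD[OF \<phi>])
    then show "differential ?D \<phi> (x \<odot>\<^bsub>M\<^esub> m) = x * differential ?D \<phi> m"
      using m by (simp add: diff_dual_simps dualD[OF \<phi>] derivation_mult algebra_simps)
    fix n assume n: "n \<in> carrier M"
    show "differential ?D \<phi> (m \<oplus>\<^bsub>M\<^esub> n) = differential ?D \<phi> m + differential ?D \<phi> n"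
      using m n by (simp add: diff_dual_simps dualD[OF \<phi>] diff_add derivation_add algebra_simps)
  qed (simp add: diff_dual_simps)
  have "differential ?D (\<phi> \<oplus>\<^bsub>?D\<^esub> \<psi>) = differential ?D \<phi> \<oplus>\<^bsub>?D\<^esub> differential ?D \<psi>" for \<phi> \<psi>
    by (auto simp: diff_dual_simps dual_simps fun_eq_iff derivation_add algebra_simps)
  moreover have "differential ?D (x \<odot>\<^bsub>?D\<^esub> \<phi>) = x \<odot>\<^bsub>?D\<^esub> differential ?D \<phi> \<oplus>\<^bsub>?D\<^esub> \<partial> x \<odot>\<^bsub>?D\<^esub> \<phi>" for x \<phi>
    by (auto simp: diff_dual_simps dual_simps fun_eq_iff derivation_mult algebra_simps)
  ultimately show ?thesis
    using m fin cl by (auto simp: fd_diff_space_def hom_def diff_dual_simps(1))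
qed

text \<open>Differentiating \<phi> in the dual applies \<open>seq_diff\<close> to the sequence of
  \<phi> at m, and the antipode turns \<open>seq_diff\<close> into the shift; hence an induction on
  the place with \<phi> arbitrary.\<close>

lemma coseq_diff_dual:
  fixes M :: "('k::differential_field, 'a) diff_space"
  assumes M: "fd_diff_space M" and \<phi>: "\<phi> \<in> carrier (dual M)" and m: "m \<in> carrier M"
  shows "(\<lambda>f\<in>carrier (dual M). f m) \<in> carrier (dual (diff_dual M))"
    and "coseq (diff_dual M) (\<lambda>f\<in>carrier (dual M). f m) \<phi> = dlin_antipode (coseq M \<phi> m)"
proof -
  interpret fd_space M by unfold_locales (rule M)
  interpret D: fd_space "diff_dual M" by unfold_locales (rule fd_diff_dual[OF M])
  let ?e = "\<lambda>f\<in>carrier (dual M). f m"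
  show "?e \<in> carrier (dual (diff_dual M))"
  proof (rule D.dualI)
    fix f g x assume f: "f \<in> carrier (diff_dual M)"
    then show "?e (x \<odot>\<^bsub>diff_dual M\<^esub> f) = x * ?e f"
      using m dual_smult_closed[of f x] by (simp add: diff_dual_simps, simp add: dual_simps(4))
    assume "g \<in> carrier (diff_dual M)"
    with f show "?e (f \<oplus>\<^bsub>diff_dual M\<^esub> g) = ?e f + ?e g"
      using m dual_add_closed[of f g] by (simp add: diff_dual_simps, simp add: dual_simps(3))
  qed (simp add: diff_dual_simps)
  have "coseq (diff_dual M) ?e \<phi> n = dlin_antipode (coseq M \<phi> m) n" for n
    using \<phi>
  proof (induction n arbitrary: \<phi>)
    case 0
    then show ?case by (simp add: D.coseq_at_0 coseq_at_0)
  next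
    case (Suc n)
    let ?d = "differential (diff_dual M) \<phi>"
    have d: "?d \<in> carrier (dual M)"
      using D.diff_closed[of \<phi>] Suc.prems by (simp add: diff_dual_simps(1))
    have "coseq M ?d m = seq_diff (coseq M \<phi> m)"
      using m by (auto simp: coseq_def diff_dual_simps seq_diff_def seq_deriv_def seq_shift_def fun_apply)
    then have "dlin_antipode (coseq M \<phi> m) (Suc n) = dlin_antipode (coseq M ?d m) n"
      using fun_cong[OF antipode_shift[of "coseq M \<phi> m"], of n] by (simp add: seq_shift_def[of "dlin_antipode _"])
    also have "\<dots> = coseq (diff_dual M) ?e ?d n" by (rule Suc.IH[OF d, symmetric])
    also have "\<dots> = coseq (diff_dual M) ?e \<phi> (Suc n)"
      by (simp add: D.coseq_diff seq_shift_def)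
    finally show ?case ..
  qed
  then show "coseq (diff_dual M) ?e \<phi> = dlin_antipode (coseq M \<phi> m)" by blast
qed

section \<open>Tensor products of differential spaces and the product on the finite dual\<close>

subsection \<open>Tensor products of differential spaces\<close>

lemma symmetric_bimodule_simps [simp]:
  "carrier (symmetric_bimodule M) = carrier M" "add (symmetric_bimodule M) = add M"
  "ring.zero (symmetric_bimodule M) = ring.zero M" "smult (symmetric_bimodule M) = smult M"
  "rsmult (symmetric_bimodule M) m x = x \<odot>\<^bsub>M\<^esub> m"
  by (simp_all add: symmetric_bimodule_def)

locale fd_pair = N: fd_space N + M: fd_space M
  for N :: "('k::differential_field, 'a) diff_space" and M :: "('k, 'b) diff_space"
begin

sublocale T: presentation "carrier N \<times> carrier M" "tensor_relations (symmetric_bimodule N) M"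
  using presentation_tensor[of "symmetric_bimodule N" M] by simp

abbreviation "act x \<equiv> frag_extend (\<lambda>(n, m). frag_of (x \<odot>\<^bsub>N\<^esub> n, m))"
abbreviation "der \<equiv> frag_extend (\<lambda>(n, m). frag_of (differential N n, m) + frag_of (n, differential M m))"

lemma rel_left: "\<lbrakk>a \<in> carrier N; a' \<in> carrier N; b \<in> carrier M\<rbrakk> \<Longrightarrow>
    frag_of (a \<oplus>\<^bsub>N\<^esub> a', b) - frag_of (a, b) - frag_of (a', b) \<in> T.Rel"
  by (rule T.Rel_relator, unfold tensor_relations_def symmetric_bimodule_simps, rule UnI1, rule UnI1) blast

lemma rel_right: "\<lbrakk>a \<in> carrier N; b \<in> carrier M; b' \<in> carrier M\<rbrakk> \<Longrightarrow>
    frag_of (a, b \<oplus>\<^bsub>M\<^esub> b') - frag_of (a, b) - frag_of (a, b') \<in> T.Rel"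
  by (rule T.Rel_relator, unfold tensor_relations_def symmetric_bimodule_simps, rule UnI1, rule UnI2) blast

lemma rel_balanced: "\<lbrakk>a \<in> carrier N; b \<in> carrier M\<rbrakk> \<Longrightarrow>
    frag_of (x \<odot>\<^bsub>N\<^esub> a, b) - frag_of (a, x \<odot>\<^bsub>M\<^esub> b) \<in> T.Rel"
  by (rule T.Rel_relator, unfold tensor_relations_def symmetric_bimodule_simps, rule UnI2) blast

lemma act_Rel: "u \<in> T.Rel \<Longrightarrow> act x u \<in> T.Rel"
proof (rule T.frag_extend_Rel[OF _ T.presentation_axioms])
  fix r assume "r \<in> tensor_relations (symmetric_bimodule N) M"
  then show "act x r \<in> T.Rel"
  proof (cases rule: tensor_relations_cases)
    case (left a a' b)
    then show ?thesis
      using rel_left[of "x \<odot>\<^bsub>N\<^esub> a" "x \<odot>\<^bsub>N\<^esub> a'" b] by (simp add: frag_extend_diff N.smult_add)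
  next
    case (right a b b')
    then show ?thesis
      using rel_right[of "x \<odot>\<^bsub>N\<^esub> a" b b'] by (simp add: frag_extend_diff)
  next
    case (balanced a b y)
    then show ?thesis
      using rel_balanced[of "x \<odot>\<^bsub>N\<^esub> a" b y] N.smult_smult[of a x y] N.smult_smult[of a y x]
      by (simp add: frag_extend_diff mult.commute)
  qed
qed

text \<open>The delicate relator is the balancing one: both Leibniz rules produce a term with
  \<partial> x, and these cancel only after the scalars have been moved across. Its image is a
  combination of five relations.\<close>

lemma der_Rel: "u \<in> T.Rel \<Longrightarrow> der u \<in> T.Rel"
proof (rule T.frag_extend_Rel[OF _ T.presentation_axioms])
  fix r assume "r \<in> tensor_relations (symmetric_bimodule N) M"
  then show "der r \<in> T.Rel"
  proof (cases rule: tensor_relations_cases)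
    case (left a a' b)
    then have "(frag_of (differential N a \<oplus>\<^bsub>N\<^esub> differential N a', b) - frag_of (differential N a, b)
          - frag_of (differential N a', b)) +
        (frag_of (a \<oplus>\<^bsub>N\<^esub> a', differential M b) - frag_of (a, differential M b)
          - frag_of (a', differential M b)) \<in> T.Rel"
      by (intro T.Rel_add[OF rel_left rel_left]) auto
    then show ?thesis
      unfolding left(4) using left(1-3) by (simp add: frag_extend_diff frag_extend_add N.diff_add algebra_simps)
  next
    case (right a b b')
    then have "(frag_of (differential N a, b \<oplus>\<^bsub>M\<^esub> b') - frag_of (differential N a, b)
          - frag_of (differential N a, b')) +
        (frag_of (a, differential M b \<oplus>\<^bsub>M\<^esub> differential M b') - frag_of (a, differential M b)
          - frag_of (a, differential M b')) \<in> T.Rel"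
      by (intro T.Rel_add[OF rel_right rel_right]) auto
    then show ?thesis
      unfolding right(4) using right(1-3) by (simp add: frag_extend_diff frag_extend_add M.diff_add algebra_simps)
  next
    case (balanced a b x)
    then have a: "a \<in> carrier N" and b: "b \<in> carrier M" by simp_all
    have r1: "frag_of (x \<odot>\<^bsub>N\<^esub> differential N a \<oplus>\<^bsub>N\<^esub> \<partial> x \<odot>\<^bsub>N\<^esub> a, b) - frag_of (x \<odot>\<^bsub>N\<^esub> differential N a, b)
        - frag_of (\<partial> x \<odot>\<^bsub>N\<^esub> a, b) \<in> T.Rel"
      using a b by (intro rel_left) auto
    have r2: "frag_of (x \<odot>\<^bsub>N\<^esub> differential N a, b) - frag_of (differential N a, x \<odot>\<^bsub>M\<^esub> b) \<in> T.Rel"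
      using a b by (intro rel_balanced) auto
    have r3: "frag_of (\<partial> x \<odot>\<^bsub>N\<^esub> a, b) - frag_of (a, \<partial> x \<odot>\<^bsub>M\<^esub> b) \<in> T.Rel"
      using a b by (intro rel_balanced) auto
    have r4: "frag_of (x \<odot>\<^bsub>N\<^esub> a, differential M b) - frag_of (a, x \<odot>\<^bsub>M\<^esub> differential M b) \<in> T.Rel"
      using a b by (intro rel_balanced) auto
    have r5: "frag_of (a, x \<odot>\<^bsub>M\<^esub> differential M b \<oplus>\<^bsub>M\<^esub> \<partial> x \<odot>\<^bsub>M\<^esub> b) - frag_of (a, x \<odot>\<^bsub>M\<^esub> differential M b)
        - frag_of (a, \<partial> x \<odot>\<^bsub>M\<^esub> b) \<in> T.Rel"
      using a b by (intro rel_right) auto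
    from T.Rel_diff[OF T.Rel_add[OF T.Rel_add[OF T.Rel_add[OF r1 r2] r3] r4] r5]
    show ?thesis
      unfolding balanced(3) using a b by (simp add: frag_extend_diff frag_extend_add N.diff_smult M.diff_smult algebra_simps)
  qed
qed

abbreviation "TT \<equiv> diff_tensor N M"

text \<open>The operations of \<open>diff_tensor\<close> act on chosen representatives; as
  \<open>act\<close> and \<open>der\<close> preserve relations, they may be computed on any
  representative.\<close>

lemma TT_simps:
  "carrier TT = carrier T.Grp" "\<zero>\<^bsub>TT\<^esub> = T.cls 0" "T.cls u \<oplus>\<^bsub>TT\<^esub> T.cls v = T.cls (u + v)"
  "x \<odot>\<^bsub>TT\<^esub> T.cls u = T.cls (act x u)" "differential TT (T.cls u) = T.cls (der u)"
proof -
  have rep: "rep (T.cls u) - u \<in> T.Rel" by (rule T.rep_cls)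
  show "x \<odot>\<^bsub>TT\<^esub> T.cls u = T.cls (act x u)"
    using act_Rel[OF rep, of x]
    by (simp add: diff_tensor_def Let_def tensor_map_def tensor_class_def T.cls_eq_iff frag_extend_diff)
  show "differential TT (T.cls u) = T.cls (der u)"
    using der_Rel[OF rep]
    by (simp add: diff_tensor_def Let_def tensor_class_def T.cls_eq_iff frag_extend_diff)
qed (simp_all add: diff_tensor_def Let_def tensor_def T.one_Grp T.mult_Grp)

lemma TT_cases:
  assumes "X \<in> carrier TT"
  obtains u where "X = T.cls u" "Poly_Mapping.keys u \<subseteq> carrier N \<times> carrier M"
  using assms by (auto simp: TT_simps T.carrier_Grp)

lemma TT_closed: "Poly_Mapping.keys u \<subseteq> carrier N \<times> carrier M \<Longrightarrow> T.cls u \<in> carrier TT"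
  by (simp add: TT_simps T.cls_in_carrier)

lemma act_keys: "Poly_Mapping.keys u \<subseteq> carrier N \<times> carrier M \<Longrightarrow> Poly_Mapping.keys (act x u) \<subseteq> carrier N \<times> carrier M"
  by (rule keys_frag_extend_subset, simp only: split_paired_all prod.case, rule keys_frag_of_subset) auto

lemma der_keys: "Poly_Mapping.keys u \<subseteq> carrier N \<times> carrier M \<Longrightarrow> Poly_Mapping.keys (der u) \<subseteq> carrier N \<times> carrier M"
  by (rule keys_frag_extend_subset, simp only: split_paired_all prod.case,
      rule keys_add_subset; rule keys_frag_of_subset) auto

lemma TT_module: "module \<bbbK> TT"
proof (rule moduleI[OF cring_base_ring])
  show "abelian_group TT"
  proof (rule abelian_groupI)
    fix X assume "X \<in> carrier TT"
    then obtain u where u: "X = T.cls u" "Poly_Mapping.keys u \<subseteq> carrier N \<times> carrier M" by (rule TT_cases)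
    then show "\<exists>Y\<in>carrier TT. Y \<oplus>\<^bsub>TT\<^esub> X = \<zero>\<^bsub>TT\<^esub>"
      by (intro bexI[of _ "T.cls (- u)"] TT_closed) (simp_all add: TT_simps)
  qed ((elim TT_cases)?; simp add: TT_simps(2,3) TT_closed keys_add_subset algebra_simps)+
next
  fix x X assume "X \<in> carrier TT"
  then obtain u where u: "X = T.cls u" "Poly_Mapping.keys u \<subseteq> carrier N \<times> carrier M" by (rule TT_cases)
  show "x \<odot>\<^bsub>TT\<^esub> X \<in> carrier TT" using u by (simp add: TT_simps(4) TT_closed act_keys)
  have one: "act 1 u = u"
    using u(2) by (induction u rule: frag_induction) (auto simp: frag_extend_diff N.one_smult)
  show "\<one>\<^bsub>\<bbbK>\<^esub> \<odot>\<^bsub>TT\<^esub> X = X" by (simp add: u(1) TT_simps one)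
  fix y
  have assoc: "act (x * y) u = act x (act y u)"
    using u(2) by (induction u rule: frag_induction) (auto simp: frag_extend_diff N.smult_smult)
  show "(x \<otimes>\<^bsub>\<bbbK>\<^esub> y) \<odot>\<^bsub>TT\<^esub> X = x \<odot>\<^bsub>TT\<^esub> (y \<odot>\<^bsub>TT\<^esub> X)" by (simp add: u(1) TT_simps assoc)
  \<comment> \<open>Additivity in the scalar is the one module law that does not already hold on
    representatives.\<close>
  have "act (x + y) u - (act x u + act y u) \<in> T.Rel"
    using u(2)
  proof (induction u rule: frag_induction)
    case (one p)
    then show ?case
      using rel_left[of "x \<odot>\<^bsub>N\<^esub> fst p" "y \<odot>\<^bsub>N\<^esub> fst p" "snd p"]
      by (cases p) (simp add: N.add_smult algebra_simps)
  next
    case (diff a b)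
    from T.Rel_diff[OF diff] show ?case by (simp add: frag_extend_diff algebra_simps)
  qed simp
  then show "(x \<oplus>\<^bsub>\<bbbK>\<^esub> y) \<odot>\<^bsub>TT\<^esub> X = x \<odot>\<^bsub>TT\<^esub> X \<oplus>\<^bsub>TT\<^esub> y \<odot>\<^bsub>TT\<^esub> X"
    by (simp add: u(1) TT_simps T.cls_eq_iff)
  fix Y assume "Y \<in> carrier TT"
  then obtain v where "Y = T.cls v" by (rule TT_cases)
  then show "x \<odot>\<^bsub>TT\<^esub> (X \<oplus>\<^bsub>TT\<^esub> Y) = x \<odot>\<^bsub>TT\<^esub> X \<oplus>\<^bsub>TT\<^esub> x \<odot>\<^bsub>TT\<^esub> Y"
    by (simp add: u(1) TT_simps frag_extend_add)
qed

text \<open>Pure tensors of generators suffice, by applying the generation principle twice: a closed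
  set containing them contains n (x) c for all n with c fixed, and then n (x) m for all m with n
  fixed.\<close>

lemma TT_finite_dimensional: "finite_dimensional TT"
proof -
  interpret TM: module \<bbbK> TT by (rule TT_module)
  obtain B C where B: "generates N B" and C: "generates M C"
    using N.has_generators M.has_generators by blast
  let ?p = "\<lambda>(b, c). T.cls (frag_of (b, c))"
  have "generates TT (?p ` (B \<times> C))"
    unfolding generates_def
  proof (intro conjI allI impI subsetI)
    show "finite (?p ` (B \<times> C))" using B C by (simp add: generates_def)
    fix X assume "X \<in> ?p ` (B \<times> C)"
    then show "X \<in> carrier TT"
      using B C by (auto simp: generates_def intro!: TT_closed)
  next
    fix T X assume T: "lin_closed TT T" "?p ` (B \<times> C) \<subseteq> T" and X: "X \<in> carrier TT"
    have T0: "T.cls 0 \<in> T" and Tadd: "a \<in> carrier TT \<Longrightarrow> b \<in> carrier TT \<Longrightarrow> a \<in> T \<Longrightarrow> b \<in> T \<Longrightarrow> a \<oplus>\<^bsub>TT\<^esub> b \<in> T"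
      and Tsm: "a \<in> carrier TT \<Longrightarrow> a \<in> T \<Longrightarrow> x \<odot>\<^bsub>TT\<^esub> a \<in> T" for a b x
      using T(1) by (auto simp: lin_closed_def TT_simps(2))
    have pc: "T.cls (frag_of (n, m)) \<in> carrier TT" if "n \<in> carrier N" "m \<in> carrier M" for n m
      using that by (intro TT_closed) simp
    have l: "T.cls (frag_of (a \<oplus>\<^bsub>N\<^esub> a', b)) = T.cls (frag_of (a, b)) \<oplus>\<^bsub>TT\<^esub> T.cls (frag_of (a', b))"
      if "a \<in> carrier N" "a' \<in> carrier N" "b \<in> carrier M" for a a' b
      using rel_left[OF that] by (simp add: TT_simps T.cls_eq_iff diff_diff_add)
    have r: "T.cls (frag_of (a, b \<oplus>\<^bsub>M\<^esub> b')) = T.cls (frag_of (a, b)) \<oplus>\<^bsub>TT\<^esub> T.cls (frag_of (a, b'))"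
      if "a \<in> carrier N" "b \<in> carrier M" "b' \<in> carrier M" for a b b'
      using rel_right[OF that] by (simp add: TT_simps T.cls_eq_iff diff_diff_add)
    have s: "T.cls (frag_of (x \<odot>\<^bsub>N\<^esub> a, b)) = x \<odot>\<^bsub>TT\<^esub> T.cls (frag_of (a, b))" for a b x
      by (simp add: TT_simps)
    have s': "T.cls (frag_of (a, x \<odot>\<^bsub>M\<^esub> b)) = x \<odot>\<^bsub>TT\<^esub> T.cls (frag_of (a, b))"
      if "a \<in> carrier N" "b \<in> carrier M" for a b x
      using rel_balanced[OF that, of x] T.cls_eq_iff[of "frag_of (x \<odot>\<^bsub>N\<^esub> a, b)" "frag_of (a, x \<odot>\<^bsub>M\<^esub> b)"]
      by (simp add: TT_simps)
    have z: "T.cls (frag_of (\<zero>\<^bsub>N\<^esub>, b)) = T.cls 0" "T.cls (frag_of (a, \<zero>\<^bsub>M\<^esub>)) = T.cls 0"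
      if "a \<in> carrier N" "b \<in> carrier M" for a b
    proof -
      have "0 \<odot>\<^bsub>TT\<^esub> X = T.cls 0" if "X \<in> carrier TT" for X
        using TM.smult_l_null[OF that] by (simp add: TT_simps(2))
      then show "T.cls (frag_of (\<zero>\<^bsub>N\<^esub>, b)) = T.cls 0" "T.cls (frag_of (a, \<zero>\<^bsub>M\<^esub>)) = T.cls 0"
        using s[of 0 "\<zero>\<^bsub>N\<^esub>" b] s'[of a "\<zero>\<^bsub>M\<^esub>" 0] N.zero_smult[of "\<zero>\<^bsub>N\<^esub>"] M.zero_smult[of "\<zero>\<^bsub>M\<^esub>"] that pc
        by simp_all
    qed
    have 1: "T.cls (frag_of (n, c)) \<in> T" if n: "n \<in> carrier N" and c: "c \<in> C" for n c
    proof -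
      have cM: "c \<in> carrier M" using C c by (auto simp: generates_def)
      have "lin_closed N {n. T.cls (frag_of (n, c)) \<in> T}"
        unfolding lin_closed_def using cM z(1)[OF N.Mod.zero_closed cM] T0
        by (auto simp: l s intro!: Tadd Tsm pc)
      moreover have "B \<subseteq> {n. T.cls (frag_of (n, c)) \<in> T}" using T(2) c by auto
      ultimately show ?thesis using B n unfolding generates_def by blast
    qed
    have 2: "T.cls (frag_of (n, m)) \<in> T" if n: "n \<in> carrier N" and m: "m \<in> carrier M" for n m
    proof -
      have "lin_closed M {m. T.cls (frag_of (n, m)) \<in> T}"
        unfolding lin_closed_def using n z(2)[OF n M.Mod.zero_closed] T0
        by (auto simp: r s' intro!: Tadd Tsm pc)
      moreover have "C \<subseteq> {m. T.cls (frag_of (n, m)) \<in> T}" using 1[OF n] by auto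
      ultimately show ?thesis using C m unfolding generates_def by blast
    qed
    obtain u where u: "X = T.cls u" "Poly_Mapping.keys u \<subseteq> carrier N \<times> carrier M" using X by (rule TT_cases)
    have "T.cls u \<in> T \<and> Poly_Mapping.keys u \<subseteq> carrier N \<times> carrier M"
      using u(2)
    proof (induction u rule: frag_induction)
      case zero
      then show ?case using T0 by simp
    next
      case (one p)
      then show ?case using 2 by (cases p) auto
    next
      \<comment> \<open>Induction over the free group yields differences, whereas
        \<open>lin_closed\<close> offers sums and scalar multiples; the difference is rewritten with
        the scalar -1.\<close>
      case (diff a b)
      have a: "T.cls a \<in> carrier TT" and b: "T.cls b \<in> carrier TT" and ab: "T.cls (a - b) \<in> carrier TT"
        using diff by (simp_all add: TT_closed keys_diff_subset)
      have m1: "(- 1) \<odot>\<^bsub>TT\<^esub> T.cls b = \<ominus>\<^bsub>TT\<^esub> T.cls b"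
        using TM.smult_l_minus[of 1 "T.cls b"] TM.smult_one[of "T.cls b"] b by (simp add: base_ring_minus)
      have "T.cls a = T.cls (a - b) \<oplus>\<^bsub>TT\<^esub> T.cls b" by (simp add: TT_simps)
      then have "T.cls (a - b) = T.cls a \<oplus>\<^bsub>TT\<^esub> (- 1) \<odot>\<^bsub>TT\<^esub> T.cls b"
        unfolding m1 using ab b by (simp add: TM.a_assoc TM.r_neg)
      then have "T.cls (a - b) \<in> T"
        using diff Tadd[OF a _ _ Tsm[OF b]] TM.smult_closed[of "- 1" "T.cls b"] b by simp
      with diff show ?case by (simp add: keys_diff_subset)
    qed
    then show "X \<in> T" by (simp add: u(1))
  qed
  then show ?thesis using finite_dimensional_iff[OF TT_module] by blast
qed

lemma TT_fd: "fd_diff_space TT"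
proof -
  have "differential TT (x \<odot>\<^bsub>TT\<^esub> X) = x \<odot>\<^bsub>TT\<^esub> differential TT X \<oplus>\<^bsub>TT\<^esub> \<partial> x \<odot>\<^bsub>TT\<^esub> X"
    if X: "X \<in> carrier TT" for x X
  proof -
    obtain u where u: "X = T.cls u" "Poly_Mapping.keys u \<subseteq> carrier N \<times> carrier M" using X by (rule TT_cases)
    have "der (act x u) - (act x (der u) + act (\<partial> x) u) \<in> T.Rel"
      using u(2)
    proof (induction u rule: frag_induction)
      case (one p)
      then obtain n m where p: "p = (n, m)" "n \<in> carrier N" "m \<in> carrier M" by auto
      then have "frag_of (x \<odot>\<^bsub>N\<^esub> differential N n \<oplus>\<^bsub>N\<^esub> \<partial> x \<odot>\<^bsub>N\<^esub> n, m) - frag_of (x \<odot>\<^bsub>N\<^esub> differential N n, m)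
          - frag_of (\<partial> x \<odot>\<^bsub>N\<^esub> n, m) \<in> T.Rel"
        by (intro rel_left) auto
      with p show ?case by (simp add: N.diff_smult frag_extend_add algebra_simps)
    next
      case (diff a b)
      from T.Rel_diff[OF diff] show ?case by (simp add: frag_extend_diff algebra_simps)
    qed simp
    then show ?thesis by (simp add: u(1) TT_simps T.cls_eq_iff)
  qed
  moreover have "differential TT X \<in> carrier TT" if X: "X \<in> carrier TT" for X
    using X by (elim TT_cases) (simp add: TT_simps(5) TT_closed der_keys)
  moreover have "differential TT (X \<oplus>\<^bsub>TT\<^esub> Y) = differential TT X \<oplus>\<^bsub>TT\<^esub> differential TT Y"
    if "X \<in> carrier TT" "Y \<in> carrier TT" for X Y
    using that by (elim TT_cases) (simp add: TT_simps frag_extend_add)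
  ultimately show ?thesis
    using TT_module TT_finite_dimensional by (simp add: fd_diff_space_def hom_def)
qed

text \<open>The differential of a tensor product obeys the same product rule as the shift of a
  Hurwitz product, and at place 0 both give the product of the two values; the induction on the
  place leaves both vectors arbitrary.\<close>

lemma tensor_coseq:
  assumes \<phi>: "\<phi> \<in> carrier (dual M)" and \<psi>: "\<psi> \<in> carrier (dual N)"
  defines "\<chi> \<equiv> (\<lambda>X\<in>carrier TT. additive_extension \<bbbK> (\<lambda>(q, p). \<phi> (\<psi> q \<odot>\<^bsub>M\<^esub> p)) X)"
  shows "\<chi> \<in> carrier (dual TT)"
    and "q \<in> carrier N \<Longrightarrow> p \<in> carrier M \<Longrightarrow>
      coseq TT \<chi> (pure_tensor (symmetric_bimodule N) M q p) = coseq M \<phi> p \<star> coseq N \<psi> q"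
proof -
  interpret TT: fd_space TT by unfold_locales (rule TT_fd)
  let ?g = "\<lambda>(q, p). \<phi> (\<psi> q \<odot>\<^bsub>M\<^esub> p)"
  have g: "?g (q, p) = \<psi> q * \<phi> p" if "p \<in> carrier M" for q p
    using that by (simp add: M.dualD[OF \<phi>])
  have rel: "fsum ?g r = 0" if "r \<in> tensor_relations (symmetric_bimodule N) M" for r
    using that
  proof (cases rule: tensor_relations_cases)
    case (left a a' b)
    show ?thesis
      unfolding left(4) using left(1-3)
      by (simp add: fsum_diff g M.dualD[OF \<phi>] N.dualD[OF \<psi>] distrib_left distrib_right)
  next
    case (right a b b')
    show ?thesis
      unfolding right(4) using right(1-3)
      by (simp add: fsum_diff g M.dualD[OF \<phi>] N.dualD[OF \<psi>] distrib_left distrib_right)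
  next
    case (balanced a x b)
    show ?thesis
      unfolding balanced(3) using balanced(1,2)
      by (simp add: fsum_diff g M.dualD[OF \<phi>] N.dualD[OF \<psi>] distrib_left distrib_right)
  qed
  have \<chi>: "\<chi> (T.cls u) = fsum ?g u" if "Poly_Mapping.keys u \<subseteq> carrier N \<times> carrier M" for u
    using TT_closed[OF that] T.fsum_rep_cls[of ?g u, OF rel] by (simp add: \<chi>_def additive_extension_base_ring)
  show \<chi>d: "\<chi> \<in> carrier (dual TT)"
  proof (rule TT.dualI)
    fix X x assume "X \<in> carrier TT"
    then obtain u where u: "X = T.cls u" "Poly_Mapping.keys u \<subseteq> carrier N \<times> carrier M" by (rule TT_cases)
    have "fsum ?g (act x u) = x * fsum ?g u"
      using u(2)
    proof (induction u rule: frag_induction)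
      case (one p)
      then show ?case by (cases p) (simp add: M.dualD[OF \<phi>] N.dualD[OF \<psi>])
    qed (simp_all add: frag_extend_diff fsum_diff right_diff_distrib)
    then show "\<chi> (x \<odot>\<^bsub>TT\<^esub> X) = x * \<chi> X" using u by (simp add: TT_simps(4) \<chi> act_keys)
    fix Y assume "Y \<in> carrier TT"
    then obtain v where v: "Y = T.cls v" "Poly_Mapping.keys v \<subseteq> carrier N \<times> carrier M" by (rule TT_cases)
    show "\<chi> (X \<oplus>\<^bsub>TT\<^esub> Y) = \<chi> X + \<chi> Y"
      using u v by (simp add: TT_simps(3) \<chi> keys_add_subset fsum_add)
  qed (simp add: \<chi>_def)
  have "coseq TT \<chi> (T.cls (frag_of (q, p))) n = (coseq M \<phi> p \<star> coseq N \<psi> q) n"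
    if "q \<in> carrier N" "p \<in> carrier M" for q p n
    using that
  proof (induction n arbitrary: q p)
    case 0
    then show ?case
      by (simp add: TT.coseq_at_0 \<chi> hurwitz_0 M.coseq_at_0 N.coseq_at_0 M.dualD[OF \<phi>] mult.commute)
  next
    case (Suc n)
    have c: "T.cls (frag_of (a, b)) \<in> carrier TT" if "a \<in> carrier N" "b \<in> carrier M" for a b
      using that by (intro TT_closed) simp
    have "coseq TT \<chi> (T.cls (frag_of (q, p))) (Suc n) = coseq TT \<chi> (differential TT (T.cls (frag_of (q, p)))) n"
      by (simp add: TT.coseq_diff seq_shift_def)
    also have "differential TT (T.cls (frag_of (q, p))) =
        T.cls (frag_of (differential N q, p)) \<oplus>\<^bsub>TT\<^esub> T.cls (frag_of (q, differential M p))"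
      by (simp add: TT_simps)
    also have "coseq TT \<chi> \<dots> n = (coseq M \<phi> p \<star> coseq N \<psi> (differential N q)) n +
        (coseq M \<phi> (differential M p) \<star> coseq N \<psi> q) n"
      using Suc.prems by (simp add: TT.coseq_add[OF \<chi>d] c Suc.IH fun_apply)
    also have "\<dots> = seq_shift (coseq M \<phi> p \<star> coseq N \<psi> q) n"
      by (simp add: hurwitz_shift N.coseq_diff M.coseq_diff fun_apply)
    finally show ?case by (simp add: seq_shift_def)
  qed
  then show "q \<in> carrier N \<Longrightarrow> p \<in> carrier M \<Longrightarrow>
      coseq TT \<chi> (pure_tensor (symmetric_bimodule N) M q p) = coseq M \<phi> p \<star> coseq N \<psi> q"
    by (simp add: pure_tensor_def tensor_class_def fun_eq_iff)
qed

end

lemma udeg_gensE: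
  assumes "g \<in> udeg_gens"
  obtains M \<phi> m where "g = (M, \<phi>, m)" "fd_diff_space M" "\<phi> \<in> carrier (dual M)" "m \<in> carrier M"
  using assms by (cases g) (auto simp: udeg_gens_iff)

lemma udeg_gen_mult:
  assumes "g \<in> udeg_gens" "h \<in> udeg_gens"
  shows "udeg_gen_mult g h \<in> udeg_gens" "gen_seq (udeg_gen_mult g h) = gen_seq g \<star> gen_seq h"
proof -
  obtain M \<phi> p where g: "g = (M, \<phi>, p)" "fd_diff_space M" "\<phi> \<in> carrier (dual M)" "p \<in> carrier M"
    using assms(1) by (rule udeg_gensE)
  obtain N \<psi> q where h: "h = (N, \<psi>, q)" "fd_diff_space N" "\<psi> \<in> carrier (dual N)" "q \<in> carrier N"
    using assms(2) by (rule udeg_gensE)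
  interpret fd_pair N M by unfold_locales (fact h(2) g(2))+
  have t: "pure_tensor (symmetric_bimodule N) M q p \<in> carrier TT"
    using TT_closed[of "frag_of (q, p)"] g h by (simp add: pure_tensor_def tensor_class_def)
  note u = udeg_gen[OF TT_fd tensor_coseq(1)[OF g(3) h(3)] t]
  show "udeg_gen_mult g h \<in> udeg_gens"
    using u(1) by (simp add: g(1) h(1) udeg_gen_mult_def)
  show "gen_seq (udeg_gen_mult g h) = gen_seq g \<star> gen_seq h"
    using u(2) tensor_coseq(2)[OF g(3) h(3) h(4) g(4)]
    by (simp add: g(1) h(1) udeg_gen_mult_def gen_seq_def)
qed

lemma udeg_class_extend:
  assumes "X \<in> carrier udeg_group" "\<And>g. g \<in> udeg_gens \<Longrightarrow> Poly_Mapping.keys (F g) \<subseteq> udeg_gens"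
  shows "udeg_class (frag_extend F (rep X)) \<in> carrier udeg_group"
    and "udeg_seq (udeg_class (frag_extend F (rep X))) = fsum (\<lambda>g. fsum gen_seq (F g)) (rep X)"
  using subsetD[OF udeg_rep_keys[OF assms(1)]]
  by (simp_all only: udeg_seq_class fsum_frag_extend udeg_class_closed keys_frag_extend_subset assms(2))

lemma udeg_mult:
  assumes X: "X \<in> carrier udeg_group" and Z: "Z \<in> carrier udeg_group"
  shows "udeg_mult X Z \<in> carrier udeg_group" "udeg_seq (udeg_mult X Z) = udeg_seq X \<star> udeg_seq Z"
proof -
  let ?F = "\<lambda>g. frag_extend (\<lambda>h. frag_of (udeg_gen_mult g h)) (rep Z)"
  have F: "Poly_Mapping.keys (?F g) \<subseteq> udeg_gens" if "g \<in> udeg_gens" for g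
    using udeg_rep_keys[OF Z] udeg_gen_mult(1)[OF that]
    by (intro keys_frag_extend_subset keys_frag_of_subset) blast
  note c = udeg_class_extend[of X ?F, OF X F]
  show "udeg_mult X Z \<in> carrier udeg_group" unfolding udeg_mult_def by (rule c(1))
  have 1: "fsum gen_seq (?F g) = gen_seq g \<star> udeg_seq Z" if "g \<in> udeg_gens" for g
  proof -
    have "fsum gen_seq (?F g) = fsum (\<lambda>h. gen_seq (udeg_gen_mult g h)) (rep Z)"
      by (simp add: fsum_frag_extend)
    also have "\<dots> = fsum (\<lambda>h. gen_seq g \<star> gen_seq h) (rep Z)"
      using udeg_rep_keys[OF Z] by (intro fsum_cong udeg_gen_mult(2)[OF that]) blast
    also have "\<dots> = gen_seq g \<star> udeg_seq Z"
      unfolding udeg_seq_def by (rule fsum_hom[of "\<lambda>\<beta>. gen_seq g \<star> \<beta>", symmetric]) (rule hurwitz_diff_right)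
    finally show ?thesis .
  qed
  have "fsum (\<lambda>g. fsum gen_seq (?F g)) (rep X) = fsum (\<lambda>g. gen_seq g \<star> udeg_seq Z) (rep X)"
    using udeg_rep_keys[OF X] by (intro fsum_cong 1) blast
  also have "\<dots> = udeg_seq X \<star> udeg_seq Z"
    unfolding udeg_seq_def[of X] by (rule fsum_hom[of "\<lambda>\<beta>. \<beta> \<star> udeg_seq Z", symmetric]) (rule hurwitz_diff_left)
  finally show "udeg_seq (udeg_mult X Z) = udeg_seq X \<star> udeg_seq Z"
    by (simp only: udeg_mult_def c(2))
qed

lemma udeg_add:
  assumes X: "X \<in> carrier udeg_group" and Z: "Z \<in> carrier udeg_group"
  shows "X \<otimes>\<^bsub>udeg_group\<^esub> Z \<in> carrier udeg_group"
    and "udeg_seq (X \<otimes>\<^bsub>udeg_group\<^esub> Z) = udeg_seq X + udeg_seq Z"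
proof -
  have "X \<otimes>\<^bsub>udeg_group\<^esub> Z = udeg_class (rep X + rep Z)"
    using U.mult_Grp[of "rep X" "rep Z"] udeg_class_rep[OF X] udeg_class_rep[OF Z]
    by (simp add: udeg_class_cls)
  then show "X \<otimes>\<^bsub>udeg_group\<^esub> Z \<in> carrier udeg_group"
    "udeg_seq (X \<otimes>\<^bsub>udeg_group\<^esub> Z) = udeg_seq X + udeg_seq Z"
    using X Z
    by (simp_all add: udeg_class_closed keys_add_subset udeg_rep_keys udeg_seq_class fsum_add
        udeg_seq_def[of X] udeg_seq_def[of Z])
qed

lemma udeg_zero: "\<one>\<^bsub>udeg_group\<^esub> \<in> carrier udeg_group" "udeg_seq \<one>\<^bsub>udeg_group\<^esub> = 0"
  using udeg_class_closed[of 0] udeg_seq_class[of 0] by (simp_all add: udeg_class_cls U.one_Grp)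

lemma udeg_antipode:
  fixes X :: "'k::differential_field udeg"
  assumes X: "X \<in> carrier udeg_group"
  shows "udeg_antipode X \<in> carrier udeg_group" "udeg_seq (udeg_antipode X) = dlin_antipode (udeg_seq X)"
proof -
  let ?F = "\<lambda>(M, \<phi>, m). frag_of (udeg_gen (diff_dual M) (\<lambda>f\<in>carrier (dual M). f m) \<phi>)"
  have F: "Poly_Mapping.keys (?F g) \<subseteq> udeg_gens \<and> fsum gen_seq (?F g) = dlin_antipode (gen_seq g)"
    if gen: "g \<in> udeg_gens" for g :: "'k udeg_gen"
  proof -
    obtain M \<phi> m where g: "g = (M, \<phi>, m)" "fd_diff_space M" "\<phi> \<in> carrier (dual M)" "m \<in> carrier M"
      using gen by (rule udeg_gensE)
    note c = coseq_diff_dual[OF g(2-4)]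
    have "\<phi> \<in> carrier (diff_dual M)" using g by (simp add: diff_dual_simps(1))
    from udeg_gen[OF fd_diff_dual[OF g(2)] c(1) this] c(2) show ?thesis
      by (simp add: g(1) gen_seq_def)
  qed
  note c = udeg_class_extend[of X ?F, OF X F[THEN conjunct1]]
  show "udeg_antipode X \<in> carrier udeg_group" unfolding udeg_antipode_def by (rule c(1))
  have "fsum (\<lambda>g. fsum gen_seq (?F g)) (rep X) = fsum (\<lambda>g. dlin_antipode (gen_seq g)) (rep X)"
    using udeg_rep_keys[OF X] by (intro fsum_cong F[THEN conjunct2]) blast
  also have "\<dots> = dlin_antipode (udeg_seq X)"
    unfolding udeg_seq_def by (rule fsum_hom[of dlin_antipode, symmetric]) (rule antipode_diff)
  finally show "udeg_seq (udeg_antipode X) = dlin_antipode (udeg_seq X)"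
    by (simp only: udeg_antipode_def c(2))
qed

lemma udeg_counit:
  assumes X: "X \<in> carrier udeg_group"
  shows "udeg_counit X = udeg_seq X 0"
proof -
  have "udeg_counit X = fsum (\<lambda>(M, \<phi>, m). \<phi> m) (rep X)"
    by (simp add: udeg_counit_def additive_extension_base_ring)
  also have "\<dots> = fsum (\<lambda>g. gen_seq g 0) (rep X)"
    by (rule fsum_cong) (auto simp: gen_seq_def coseq_def)
  finally show ?thesis by (simp add: udeg_seq_def fsum_at)
qed

lemma finite_dual_simps:
  "carrier finite_dual = carrier udeg_group" "add finite_dual = monoid.mult udeg_group"
  "\<zero>\<^bsub>finite_dual\<^esub> = \<one>\<^bsub>udeg_group\<^esub>" "monoid.mult finite_dual = udeg_mult" "\<one>\<^bsub>finite_dual\<^esub> = udeg_source 1"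
  "x \<odot>\<^bsub>finite_dual\<^esub> X = udeg_mult (udeg_source x) X" "rsmult finite_dual X x = udeg_mult X (udeg_target x)"
  "comult finite_dual = udeg_comult" "counit finite_dual = udeg_counit"
  "source finite_dual = udeg_source" "target finite_dual = udeg_target" "antipode finite_dual = udeg_antipode"
  by (simp_all add: finite_dual_def make_hopf_algebroid_def algebra_bimodule_def udeg_ring_def)

interpretation udeg_module: seq_bimodule finite_dual udeg_seq
  by unfold_locales
    (simp_all add: finite_dual_simps udeg_add udeg_zero udeg_mult udeg_source udeg_target udeg_seq_inj)

interpretation udeg_pair: seq_pair finite_dual udeg_seq finite_dual udeg_seq ..

text \<open>For a single generator the evaluation is \<open>coseq_dual_basis\<close>, so the dual
  basis picked by choice leaves no trace; additivity extends this to all classes.\<close>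

lemma udeg_comult:
  fixes X :: "'k::differential_field udeg"
  assumes X: "X \<in> carrier udeg_group"
  shows "udeg_comult X \<in> carrier (tensor finite_dual finite_dual)"
    and "tensor_eval udeg_seq udeg_seq (rep (udeg_comult X)) k = (seq_shift ^^ k) (udeg_seq X)"
proof -
  let ?F = "\<lambda>(M, \<phi>, m). let (d, e, e') = (SOME (d, e, e'). is_dual_basis M d e e') in
    \<Sum>i<d. frag_of (udeg_class (frag_of (M, \<phi>, e i)), udeg_class (frag_of (M, e' i, m)))"
  have "tensor_class (udeg_bimodule :: ('k, 'k udeg) bimodule) (udeg_bimodule :: ('k, 'k udeg) bimodule) =
      tensor_class finite_dual finite_dual"
    by (rule tensor_class_cong)
      (auto simp: udeg_bimodule_def finite_dual_def make_hopf_algebroid_def algebra_bimodule_def)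
  then have comult: "udeg_comult X = tensor_class finite_dual finite_dual (frag_extend ?F (rep X))"
    by (simp add: udeg_comult_def)
  have F: "Poly_Mapping.keys (?F g) \<subseteq> carrier finite_dual \<times> carrier finite_dual \<and>
      fsum (\<lambda>(a, b). udeg_seq a \<star> seq_target (udeg_seq b k)) (?F g) = (seq_shift ^^ k) (gen_seq g)"
    if gen: "g \<in> udeg_gens" for g :: "'k udeg_gen"
  proof -
    obtain M \<phi> m where g: "g = (M, \<phi>, m)" "fd_diff_space M" "\<phi> \<in> carrier (dual M)" "m \<in> carrier M"
      using gen by (rule udeg_gensE)
    interpret fd_space M by unfold_locales (rule g(2))
    obtain d e e' where s: "(SOME (d, e, e'). is_dual_basis M d e e') = (d, e, e')"
      by (cases "SOME (d, e, e'). is_dual_basis M d e e'")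
    have "\<exists>p. (\<lambda>(d, e, e'). is_dual_basis M d e e') p" using has_dual_basis by auto
    from someI_ex[OF this] have e: "is_dual_basis M d e e'" by (simp add: s)
    then have ec: "e i \<in> carrier M" "e' i \<in> carrier (dual M)" if "i < d" for i
      using that by (auto simp: is_dual_basis_def)
    have "Poly_Mapping.keys (?F g) \<subseteq> carrier finite_dual \<times> carrier finite_dual"
      using g ec unfolding g(1) prod.case s Let_def
      by (intro keys_subset_intros) (simp add: finite_dual_simps udeg_class_closed udeg_gens_iff)
    moreover have "fsum (\<lambda>(a, b). udeg_seq a \<star> seq_target (udeg_seq b k)) (?F g) =
        (\<Sum>i<d. coseq M \<phi> (e i) \<star> seq_target (coseq M (e' i) m k))"
      unfolding g(1) prod.case s Let_def by (simp add: fsum_sum udeg_seq_class gen_seq_def)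
    ultimately show ?thesis
      using coseq_dual_basis[OF g(3,4) e] by (simp add: g(1) gen_seq_def)
  qed
  have k: "Poly_Mapping.keys (frag_extend ?F (rep X)) \<subseteq> carrier finite_dual \<times> carrier finite_dual"
    using udeg_rep_keys[OF X] F[THEN conjunct1] by (intro keys_frag_extend_subset) blast
  show "udeg_comult X \<in> carrier (tensor finite_dual finite_dual)"
    unfolding comult by (rule udeg_pair.tensor_class_closed[OF k])
  have "tensor_eval udeg_seq udeg_seq (rep (udeg_comult X)) k =
      fsum (\<lambda>g. fsum (\<lambda>(a, b). udeg_seq a \<star> seq_target (udeg_seq b k)) (?F g)) (rep X)"
    unfolding comult udeg_pair.eval_rep by (simp add: tensor_eval_def fsum_frag_extend)
  also have "\<dots> = fsum (\<lambda>g. (seq_shift ^^ k) (gen_seq g)) (rep X)"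
    using udeg_rep_keys[OF X] by (intro fsum_cong F[THEN conjunct2]) blast
  also have "\<dots> = (seq_shift ^^ k) (udeg_seq X)"
    unfolding udeg_seq_def
    by (rule fsum_hom[of "seq_shift ^^ k", symmetric]) (simp add: fun_eq_iff seq_shift_funpow fun_apply)
  finally show "tensor_eval udeg_seq udeg_seq (rep (udeg_comult X)) k = (seq_shift ^^ k) (udeg_seq X)" .
qed

interpretation udeg_hopf: seq_hopf finite_dual udeg_seq
  by unfold_locales
    (simp_all add: finite_dual_simps udeg_comult udeg_counit udeg_mult udeg_source udeg_target udeg_antipode)

lemma finite_dual_isomorphic_Dlin:
  "hopf_algebroid_isomorphic (finite_dual :: ('k::differential_field, 'k udeg) hopf_algebroid)
    (Dlin :: ('k, nat \<Rightarrow> 'k) hopf_algebroid)"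
proof -
  let ?U = "finite_dual :: ('k, 'k udeg) hopf_algebroid" and ?D = "Dlin :: ('k, nat \<Rightarrow> 'k) hopf_algebroid"
  have "commutative_hopf_algebroid ?U"
    by (rule udeg_hopf.is_commutative_hopf_algebroid) (simp_all add: finite_dual_simps)
  moreover have "bij_betw udeg_seq (carrier ?U) (carrier ?D)"
    using udeg_seq_inj udeg_seq_dlin udeg_seq_surj
    by (fastforce simp: bij_betw_def finite_dual_simps Dlin_simps image_iff)
  then have "udeg_seq \<in> hopf_algebroid_isos ?U ?D"
    by (rule hopf_algebroid_isosI[OF udeg_hopf.seq_hopf_axioms Dlin_hopf.seq_hopf_axioms]) simp
  ultimately show ?thesis
    using Dlin_commutative_hopf_algebroid by (auto simp: hopf_algebroid_isomorphic_def)
qed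

theorem mainTheorem1:
  shows "commutative_hopf_algebroid (Dlin :: ('k::differential_field, nat \<Rightarrow> 'k) hopf_algebroid)
    \<and> hopf_algebroid_isomorphic
        (finite_dual :: ('k, 'k udeg) hopf_algebroid) (Dlin :: ('k, nat \<Rightarrow> 'k) hopf_algebroid)
    \<and> is_universal_dual TYPE('c) (Dlin :: ('k, nat \<Rightarrow> 'k) hopf_algebroid) functional_of_seq
    \<and> (\<forall>(V :: ('k, 'v) hopf_algebroid) \<xi>.
         is_universal_dual TYPE('v) V \<xi> \<longrightarrow> is_universal_dual TYPE(nat \<Rightarrow> 'k) V \<xi> \<longrightarrow>
         hopf_algebroid_isomorphic (Dlin :: ('k, nat \<Rightarrow> 'k) hopf_algebroid) V)
    \<and> directed_system (Dlin :: ('k, nat \<Rightarrow> 'k) hopf_algebroid)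
        operator_index operator_le solution_comodule solution_transition
    \<and> left_comodule (Dlin :: ('k, nat \<Rightarrow> 'k) hopf_algebroid) solution_limit
    \<and> left_comodule (Dlin :: ('k, nat \<Rightarrow> 'k) hopf_algebroid) Dlin_comodule
    \<and> (\<exists>f \<in> comodule_homs (Dlin :: ('k, nat \<Rightarrow> 'k) hopf_algebroid) solution_limit Dlin_comodule.
         bij_betw f (carrier solution_limit) (carrier Dlin_comodule))"
proof (intro conjI allI impI)
  show "is_universal_dual TYPE('c) (Dlin :: ('k, nat \<Rightarrow> 'k) hopf_algebroid) functional_of_seq"
    by (rule Dlin_universal_dual)
  show "hopf_algebroid_isomorphic (Dlin :: ('k, nat \<Rightarrow> 'k) hopf_algebroid) V"
    if "is_universal_dual TYPE('v) V \<xi>" "is_universal_dual TYPE(nat \<Rightarrow> 'k) V \<xi>"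
    for V :: "('k, 'v) hopf_algebroid" and \<xi>
    using that by (rule universal_dual_unique)
qed (rule Dlin_commutative_hopf_algebroid finite_dual_isomorphic_Dlin solution_directed_system
    limit_comod.is_left_comodule Dlin_comod.is_left_comodule limit_isomorphic_Dlin)+

end
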